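(* Let $0<\alpha<2$ and $\lambda\in\mathbb{R}$ with $\lambda>0$. If $N$ is a positive integer with $$N>11+\frac4\alpha,$$ then for every $s\ge0$ the Cauchy problem $$u_t=\Delta u+\lambda|u|^\alpha u,\qquad u(0,\cdot)=u_0$$ in $\mathbb{R}^N$ is not locally well posed for small data in $H^s(\mathbb{R}^N)$.
   Context: All functions are complex-valued. $C_0(\mathbb{R}^N)$ is the space of continuous functions on $\mathbb{R}^N$ vanishing at infinity, with the sup norm. $C^\infty_c(\mathbb{R}^N)$ is the space of smooth compactly supported functions. $H^s(\mathbb{R}^N)$ is the usual $L^2$-based Sobolev space with norm $\|u\|_{H^s}=\|\mathcal{F}^{-1}[(1+|\xi|^2)^{s/2}\widehat u]\|_{L^2}$. The Cauchy problem is locally well posed in $C_0(\mathbb{R}^N)$: for every $u_0\in C_0(\mathbb{R}^N)$ there exist a maximal existence time $T_{\max}(u_0)\in(0,\infty]$ and a unique maximal solution $u\in C([0,T_{\max}(u_0)),C_0(\mathbb{R}^N))$, i.e. a solution of $u(t)=e^{t\Delta}u_0+\lambda\int_0^t e^{(t-\sigma)\Delta}(|u(\sigma)|^\alpha u(\sigma))\,d\sigma$, where $(e^{t\Delta})_{t\ge0}$ is the heat semigroup on $\mathbb{R}^N$. Definition. Let $s\ge0$. The Cauchy problem is called locally well posed for small data in $H^s(\mathbb{R}^N)$ if there exist $\delta,T>0$ such that if $u_0\in C^\infty_c(\mathbb{R}^N)$ and $\|u_0\|_{H^s}\le\delta$, then the corresponding maximal solution $u\in C([0,T_{\max}(u_0)),C_0(\mathbb{R}^N))$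 satisfies $T_{\max}(u_0)\ge T$ and $u(t)\in H^s(\mathbb{R}^N)$ for all $0\le t\le T$. *)

theory Defs
  imports "HOL-Analysis.Analysis"
begin

text \<open>
  The space dimension N is \<open>CARD('n)\<close>; functions on N-space have type
  \<open>(real^'n) \<Rightarrow> complex\<close>.
\<close>

subsection \<open>Function spaces\<close>

definition C0 :: "((real^'n) \<Rightarrow> complex) set" where
  "C0 = {f. continuous_on UNIV f \<and> (f \<longlongrightarrow> 0) at_infinity}"

primrec C_diff :: "nat \<Rightarrow> ((real^'n) \<Rightarrow> complex) \<Rightarrow> bool" where
  "C_diff 0 f \<longleftrightarrow> continuous_on UNIV f"
| "C_diff (Suc k) f \<longleftrightarrow> f differentiable_on UNIV \<and>
     (\<forall>i. C_diff k (\<lambda>x. frechet_derivative f (at x) (axis i 1)))"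

definition Cc_infty :: "((real^'n) \<Rightarrow> complex) set" where
  "Cc_infty = {f. (\<forall>k. C_diff k f) \<and> compact (closure {x. f x \<noteq> 0})}"

definition L2 :: "((real^'n) \<Rightarrow> complex) set" where
  "L2 = {f. f \<in> borel_measurable lborel \<and> integrable lborel (\<lambda>x. (cmod (f x))\<^sup>2)}"

definition L2_norm :: "((real^'n) \<Rightarrow> complex) \<Rightarrow> real" where
  "L2_norm f = sqrt (LINT x|lborel. (cmod (f x))\<^sup>2)"

text \<open>
  Convergence in square mean as \<open>R \<rightarrow> \<infinity>\<close>. The integral in \<open>ennreal\<close> is used so that a
  difference that is not square integrable counts as infinitely far away.
\<close>

definition L2_lim :: "(real \<Rightarrow> (real^'n) \<Rightarrow> complex) \<Rightarrow> ((real^'n) \<Rightarrow> complex) \<Rightarrow> bool" where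
  "L2_lim F g \<longleftrightarrow>
     ((\<lambda>R. \<integral>\<^sup>+x. ennreal ((cmod (F R x - g x))\<^sup>2) \<partial>lborel) \<longlongrightarrow> 0) at_top"

subsection \<open>Fourier transform and Sobolev spaces\<close>

text \<open>
  The Fourier transform on \<open>L2\<close> and its inverse, as limits in \<open>L2\<close> of the integrals
  over balls. Both are relations because the limits are only determined almost everywhere.
\<close>

definition is_fourier :: "((real^'n) \<Rightarrow> complex) \<Rightarrow> ((real^'n) \<Rightarrow> complex) \<Rightarrow> bool" where
  "is_fourier f g \<longleftrightarrow> f \<in> L2 \<and> g \<in> L2 \<and>
     L2_lim (\<lambda>R \<xi>. LINT x:cball 0 R|lborel. cis (- (x \<bullet> \<xi>)) * f x) g"

definition is_inverse_fourier ::
    "((real^'n) \<Rightarrow> complex) \<Rightarrow> ((real^'n) \<Rightarrow> complex) \<Rightarrow> bool" where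
  "is_inverse_fourier g f \<longleftrightarrow> g \<in> L2 \<and> f \<in> L2 \<and>
     L2_lim (\<lambda>R x. (1 / (2 * pi) ^ CARD('n)) *\<^sub>R
       (LINT \<xi>:cball 0 R|lborel. cis (x \<bullet> \<xi>) * g \<xi>)) f"

text \<open>
  \<open>bessel_potential s u v\<close>: \<open>v\<close> is the inverse Fourier transform of
  \<open>(1 + |\<xi>|\<^sup>2) powr (s/2)\<close> times the Fourier transform of \<open>u\<close>.
  For \<open>s \<ge> 0\<close> the Sobolev space of order \<open>s\<close> is contained in \<open>L2\<close>, so the
  Fourier transform on \<open>L2\<close> suffices to define it.
\<close>

definition bessel_potential ::
    "real \<Rightarrow> ((real^'n) \<Rightarrow> complex) \<Rightarrow> ((real^'n) \<Rightarrow> complex) \<Rightarrow> bool" where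
  "bessel_potential s u v \<longleftrightarrow> (\<exists>uh. is_fourier u uh \<and>
     is_inverse_fourier (\<lambda>\<xi>. of_real ((1 + (norm \<xi>)\<^sup>2) powr (s / 2)) * uh \<xi>) v)"

definition Hs :: "real \<Rightarrow> ((real^'n) \<Rightarrow> complex) set" where
  "Hs s = {u. \<exists>v. bessel_potential s u v}"

text \<open>The choice of \<open>v\<close> is immaterial: any two candidates agree almost everywhere.\<close>

definition Hs_norm :: "real \<Rightarrow> ((real^'n) \<Rightarrow> complex) \<Rightarrow> real" where
  "Hs_norm s u = L2_norm (SOME v. bessel_potential s u v)"

subsection \<open>The nonlinear heat equation\<close>

definition heat :: "real \<Rightarrow> ((real^'n) \<Rightarrow> complex) \<Rightarrow> (real^'n) \<Rightarrow> complex" where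
  "heat t f x = (if t = 0 then f x else
     LINT y|lborel. of_real ((4 * pi * t) powr (- real CARD('n) / 2) *
       exp (- (norm (x - y))\<^sup>2 / (4 * t))) * f y)"

definition nonlin :: "real \<Rightarrow> ((real^'n) \<Rightarrow> complex) \<Rightarrow> (real^'n) \<Rightarrow> complex" where
  "nonlin \<alpha> f x = of_real (cmod (f x) powr \<alpha>) * f x"

definition time_interval :: "ereal \<Rightarrow> real set" where
  "time_interval T = {t. 0 \<le> t \<and> ereal t < T}"

text \<open>
  A solution on \<open>[0,T)\<close>, with \<open>0 < T \<le> \<infinity>\<close>: continuous in time with values in \<open>C0\<close> for the
  sup norm (uniform convergence), satisfying Duhamel's formula. The time integral of the
  continuous \<open>C0\<close>-valued integrand is written pointwise in \<open>x\<close>, since evaluation at \<open>x\<close> is a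
  bounded linear functional on \<open>C0\<close>. Values of \<open>u\<close> outside \<open>[0,T)\<close> are irrelevant.
\<close>

definition is_solution :: "real \<Rightarrow> real \<Rightarrow> ((real^'n) \<Rightarrow> complex) \<Rightarrow> ereal \<Rightarrow>
    (real \<Rightarrow> (real^'n) \<Rightarrow> complex) \<Rightarrow> bool" where
  "is_solution \<alpha> lam u0 T u \<longleftrightarrow> 0 < T \<and>
     (\<forall>t\<in>time_interval T. u t \<in> C0) \<and>
     (\<forall>t\<in>time_interval T. uniform_limit UNIV u (u t) (at t within time_interval T)) \<and>
     (\<forall>t\<in>time_interval T. \<forall>x. u t x = heat t u0 x +
        of_real lam * (LINT \<sigma>:{0..t}|lborel. heat (t - \<sigma>) (nonlin \<alpha> (u \<sigma>)) x))"

definition is_maximal_solution :: "real \<Rightarrow> real \<Rightarrow> ((real^'n) \<Rightarrow> complex) \<Rightarrow> ereal \<Rightarrow>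
    (real \<Rightarrow> (real^'n) \<Rightarrow> complex) \<Rightarrow> bool" where
  "is_maximal_solution \<alpha> lam u0 T u \<longleftrightarrow> is_solution \<alpha> lam u0 T u \<and>
     (\<forall>T' v. is_solution \<alpha> lam u0 T' v \<and> T \<le> T' \<and> (\<forall>t\<in>time_interval T. v t = u t)
        \<longrightarrow> T' = T)"

text \<open>
  The maximal solution exists and is unique (on its interval) for every initial value in
  \<open>C0\<close>, so "the maximal solution satisfies" is rendered by an existential quantifier.
  If the maximal time equals \<open>T\<close>, the solution has no value at \<open>T\<close>, hence the
  restriction \<open>t < Tmax\<close>; it makes no difference to the notion, as \<open>T\<close> may be decreased.
\<close>

definition locally_well_posed_small_data ::
    "'n::finite itself \<Rightarrow> real \<Rightarrow> real \<Rightarrow> real \<Rightarrow> bool" where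
  "locally_well_posed_small_data _ \<alpha> lam s \<longleftrightarrow>
     (\<exists>\<delta>>0. \<exists>T>0. \<forall>u0 :: (real^'n) \<Rightarrow> complex.
        u0 \<in> Cc_infty \<and> Hs_norm s u0 \<le> \<delta> \<longrightarrow>
        (\<exists>Tmax u. is_maximal_solution \<alpha> lam u0 Tmax u \<and> ereal T \<le> Tmax \<and>
           (\<forall>t. 0 \<le> t \<and> t \<le> T \<and> ereal t < Tmax \<longrightarrow> u t \<in> Hs s)))"

end

theory Submission
  imports Defs "HOL-Probability.Characteristic_Functions" "HOL-Probability.Sinc_Integral"
begin

text \<open>
  Start from an odd bump in one coordinate \<open>x \<bullet> e\<close>, positive on \<open>x \<bullet> e > 0\<close>; the solution stays
  odd and positive there. If \<open>s < N / 2 - 2 / \<alpha>\<close>, rescaled bumps of critical height have small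
  \<open>Hs\<close> norm, but by Jensen's inequality (Weissler's argument) a solution on \<open>[0,t]\<close> satisfies
  \<open>\<alpha> lam t (e\<^sup>t\<^sup>\<Delta> u0)\<^sup>\<alpha> \<le> 1\<close> on the half-space, which they violate at arbitrarily small times.
  By \<open>N > 11 + 4 / \<alpha>\<close> the only other case is \<open>s > 11 / 2\<close>. There the obstruction is the finite
  smoothness of the nonlinearity: near \<open>x \<bullet> e = 0\<close> a positive odd solution is
  \<open>slope * (x \<bullet> e)\<close> with \<open>slope > 0\<close>, so \<open>\<bar>u\<bar>\<^sup>\<alpha> u\<close> has the singularity \<open>\<bar>x \<bullet> e\<bar>\<^sup>\<alpha> (x \<bullet> e)\<close>.
  Pairing \<open>u(t)\<close> with the fifth derivative of a Gaussian of variance \<open>2 * \<epsilon>\<close> in direction \<open>e\<close>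
  and using Duhamel's formula gives, for \<open>\<alpha> < 2\<close>, at least a multiple of the integral of
  \<open>1 / (\<epsilon> + t - \<rho>)\<close> over \<open>\<rho>\<close>, which grows like \<open>ln (1 / \<epsilon>)\<close>. For \<open>u(t)\<close> in \<open>Hs\<close> with
  \<open>s > 11 / 2\<close> these pairings are bounded, by duality.
\<close>

lemma measurable_cis [measurable (raw)]:
  "f \<in> borel_measurable M \<Longrightarrow> (\<lambda>x. cis (f x)) \<in> borel_measurable M"
  by (rule borel_measurable_continuous_on[of cis]) (auto intro!: continuous_intros)

lemma
  fixes f :: "'a::euclidean_space \<Rightarrow> real \<Rightarrow> 'b::{real_normed_field,banach,second_countable_topology}"
  assumes f: "\<And>b. b \<in> Basis \<Longrightarrow> integrable lborel (f b)"
  shows integrable_lborel_prod: "integrable lborel (\<lambda>x::'a. \<Prod>b\<in>Basis. f b (x \<bullet> b))"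
    and integral_lborel_prod: "(LINT x|lborel. (\<Prod>b\<in>Basis. f b (x \<bullet> b))) = (\<Prod>b\<in>Basis. (LINT x|lborel. f b x))"
proof -
  interpret product_sigma_finite "\<lambda>_::'a. lborel::real measure"
    by standard
  have [measurable]: "f b \<in> borel_measurable borel" if "b \<in> Basis" for b
    using borel_measurable_integrable[OF f[OF that]] by simp
  have eq: "(\<Prod>b\<in>Basis. f b ((\<Sum>c\<in>Basis. x c *\<^sub>R c) \<bullet> b)) = (\<Prod>b\<in>Basis. f b (x b))" for x :: "'a \<Rightarrow> real"
    by (intro prod.cong) auto
  show "integrable lborel (\<lambda>x::'a. \<Prod>b\<in>Basis. f b (x \<bullet> b))"
    by (subst lborel_eq, subst integrable_distr_eq)
       (auto simp: eq intro!: product_integrable_prod f)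
  show "(LINT x|lborel. (\<Prod>b\<in>Basis. f b (x \<bullet> b))) = (\<Prod>b\<in>Basis. (LINT x|lborel. f b x))"
    by (subst lborel_eq, subst integral_distr)
       (auto simp: eq intro!: product_integral_prod f)
qed

lemma integrable_pair_mult:
  fixes f :: "'a::euclidean_space \<Rightarrow> 'c::{real_normed_field,banach,second_countable_topology}" and g :: "'b::euclidean_space \<Rightarrow> 'c"
  assumes f: "integrable lborel f" and g: "integrable lborel g"
  shows "integrable (lborel \<Otimes>\<^sub>M lborel) (\<lambda>(x,y). f x * g y)"
proof -
  have [measurable]: "f \<in> borel_measurable borel" "g \<in> borel_measurable borel"
    using f g borel_measurable_integrable by auto
  show ?thesis
    by (rule lborel_pair.Fubini_integrable) (auto simp: norm_mult intro!: integrable_mult_right integrable_mult_left integrable_norm f g)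
qed

lemma lborel_integral_split_coordinate:
  fixes p q :: "real \<Rightarrow> real" and g :: "'a::euclidean_space \<Rightarrow> real"
  assumes e: "e \<in> Basis" and g: "\<And>x. g x = g (x - (x \<bullet> e) *\<^sub>R e)"
    and p: "integrable lborel (\<lambda>x. p (x \<bullet> e) * g x)" and q: "integrable lborel (\<lambda>x. q (x \<bullet> e) * g x)"
  shows "(LINT x|lborel. p (x \<bullet> e) * g x) * (LINT y|lborel. q y) =
    (LINT x|lborel. q (x \<bullet> e) * g x) * (LINT y|lborel. p y)"
proof -
  interpret product_sigma_finite "\<lambda>_::'a. lborel::real measure"
    by standard
  let ?B = "Basis - {e}" and ?V = "\<lambda>x::'a \<Rightarrow> real. \<Sum>b\<in>Basis. x b *\<^sub>R b"
  have B: "(Basis::'a set) = insert e ?B" using e by auto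
  have main: "(LINT x|lborel. p (x \<bullet> e) * g x) =
      (LINT y|lborel. p y) * (LINT x|PiM ?B (\<lambda>_. lborel). g (\<Sum>b\<in>?B. x b *\<^sub>R b))"
    if p: "integrable lborel (\<lambda>x. p (x \<bullet> e) * g x)" for p :: "real \<Rightarrow> real"
  proof -
    have V: "?V (x(e:=y)) \<bullet> e = y" for x y
      using e by simp
    have V2: "?V (x(e:=y)) - (?V (x(e:=y)) \<bullet> e) *\<^sub>R e = (\<Sum>b\<in>?B. x b *\<^sub>R b)" for x y
    proof -
      have "?V (x(e:=y)) = y *\<^sub>R e + (\<Sum>b\<in>?B. x b *\<^sub>R b)"
        by (subst B, subst sum.insert) (auto intro!: sum.cong)
      then show ?thesis using V[of x y] by simp
    qed
    have gV: "g (?V (x(e:=y))) = g (\<Sum>b\<in>?B. x b *\<^sub>R b)" for x y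
      using g[of "?V (x(e:=y))"] V2[of x y] by simp
    have pg: "(\<lambda>x. p (x \<bullet> e) * g x) \<in> borel_measurable borel"
      using borel_measurable_integrable[OF p] by simp
    have meas: "?V \<in> measurable (PiM Basis (\<lambda>_. lborel)) borel"
      by measurable
    have i2: "integrable (PiM (insert e ?B) (\<lambda>_. lborel)) (\<lambda>x. p (?V x \<bullet> e) * g (?V x))"
      using p meas pg by (subst B[symmetric], subst (asm) lborel_eq, subst (asm) integrable_distr_eq) auto
    have "(LINT x|lborel. p (x \<bullet> e) * g x) = (LINT x|PiM (insert e ?B) (\<lambda>_. lborel). p (?V x \<bullet> e) * g (?V x))"
      unfolding B[symmetric] using meas pg by (subst lborel_eq, subst integral_distr) auto
    also have "\<dots> = (LINT x|PiM ?B (\<lambda>_. lborel). (LINT y|lborel. p (?V (x(e:=y)) \<bullet> e) * g (?V (x(e:=y)))))"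
      by (rule product_integral_insert[OF _ _ i2]) auto
    also have "\<dots> = (LINT x|PiM ?B (\<lambda>_. lborel). (LINT y|lborel. p y * g (\<Sum>b\<in>?B. x b *\<^sub>R b)))"
      unfolding gV V ..
    finally show ?thesis by simp
  qed
  show ?thesis
    unfolding main[OF p] main[OF q] by simp
qed

subsection \<open>Gaussian integrals\<close>

lemma
  fixes r x :: real assumes r: "r > 0"
  shows gauss_cis_integrable: "integrable lborel (\<lambda>y. cis (- (x * y)) * of_real (exp (- r * y\<^sup>2)))" (is ?A)
    and gauss_cis_integral: "(LINT y|lborel. cis (- (x * y)) * of_real (exp (- r * y\<^sup>2))) =
      of_real (sqrt (pi / r) * exp (- x\<^sup>2 / (4 * r)))" (is ?B)
proof -
  let ?c = "1 / sqrt (2 * r)"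
  let ?g = "\<lambda>y. cis (- (x * y)) * of_real (exp (- r * y\<^sup>2))"
  have c: "?c \<noteq> 0" "?c > 0" using r by auto
  have gc: "?g (0 + ?c * y) = cis (- (x * ?c) * y) * of_real (sqrt (2 * pi) * std_normal_density y)" for y
    using r by (simp add: std_normal_density_def power_mult_distrib power_divide algebra_simps)
  have int0: "integrable lborel (\<lambda>y. sqrt (2 * pi) * std_normal_density y)"
    using integrable_normal_density[of 1 0] by (intro integrable_mult_right) auto
  have int: "integrable lborel (\<lambda>y. cis (- (x * ?c) * y) * of_real (sqrt (2 * pi) * std_normal_density y))"
    by (rule Bochner_Integration.integrable_bound[OF int0]) (auto simp: norm_mult)
  show ?A
    using int by (subst lborel_integrable_real_affine_iff[where c="?c" and t=0, symmetric, OF c(1)])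
      (simp only: gc)
  have "(LINT y|lborel. ?g y) = \<bar>?c\<bar> *\<^sub>R (LINT y|lborel. ?g (0 + ?c * y))"
    by (rule lborel_integral_real_affine) (rule c)
  also have "(LINT y|lborel. ?g (0 + ?c * y)) = (LINT y|lborel. sqrt (2 * pi) *\<^sub>R (std_normal_density y *\<^sub>R iexp (- (x * ?c) * y)))"
    unfolding gc by (intro Bochner_Integration.integral_cong) (auto simp: cis_conv_exp scaleR_conv_of_real mult_ac)
  also have "\<dots> = sqrt (2 * pi) *\<^sub>R (LINT y|lborel. (std_normal_density y *\<^sub>R iexp (- (x * ?c) * y)))"
    by (rule integral_scaleR_right)
  also have "(LINT y|lborel. (std_normal_density y *\<^sub>R iexp (- (x * ?c) * y))) = char std_normal_distribution (- (x * ?c))"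
    unfolding char_def by (subst integral_density) (auto simp: mult_ac)
  also have "\<dots> = of_real (exp (- (- (x * ?c))\<^sup>2 / 2))"
    by (simp add: char_std_normal_distribution)
  also have "exp (- (- (x * ?c))\<^sup>2 / 2) = exp (- x\<^sup>2 / (4 * r))"
    using r by (simp add: power_mult_distrib power_divide)
  also have "\<bar>?c\<bar> *\<^sub>R sqrt (2 * pi) *\<^sub>R complex_of_real (exp (- x\<^sup>2 / (4 * r))) =
      of_real (sqrt (pi / r) * exp (- x\<^sup>2 / (4 * r)))"
    using r by (simp add: scaleR_conv_of_real real_sqrt_mult real_sqrt_divide)
  finally show ?B .
qed

lemma
  fixes r :: real assumes r: "r > 0"
  shows gauss_integrable: "integrable lborel (\<lambda>y. exp (- r * y\<^sup>2))"
    and gauss_integral: "(LINT y|lborel. exp (- r * y\<^sup>2)) = sqrt (pi / r)"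
proof -
  show 1: "integrable lborel (\<lambda>y. exp (- r * y\<^sup>2))"
    using integrable_Re[OF gauss_cis_integrable[OF r, of 0]] by simp
  have "complex_of_real (LINT y|lborel. exp (- r * y\<^sup>2)) = of_real (sqrt (pi / r))"
    using gauss_cis_integral[OF r, of 0] by simp
  then show "(LINT y|lborel. exp (- r * y\<^sup>2)) = sqrt (pi / r)"
    using of_real_eq_iff by blast
qed

lemma norm_sq_basis: "(norm (x::'a::euclidean_space))\<^sup>2 = (\<Sum>b\<in>Basis. (x \<bullet> b)\<^sup>2)"
  unfolding power2_norm_eq_inner by (subst euclidean_inner) (simp add: power2_eq_square)

lemma cis_sum: "finite A \<Longrightarrow> cis (\<Sum>x\<in>A. f x) = (\<Prod>x\<in>A. cis (f x))"
  by (induction A rule: finite_induct) (auto simp flip: cis_mult)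

lemma cis_inner_prod: "cis (- (x \<bullet> \<xi>)) = (\<Prod>b\<in>Basis. cis (- ((x \<bullet> b) * (\<xi> \<bullet> b))))"
  for x :: "'a::euclidean_space"
  by (simp add: euclidean_inner[of x \<xi>] cis_sum flip: sum_negf)

lemma exp_norm_prod: "exp (- r * (norm x)\<^sup>2) = (\<Prod>b\<in>Basis. exp (- r * (x \<bullet> b)\<^sup>2))" for x :: "'a::euclidean_space"
  by (simp add: norm_sq_basis sum_distrib_left flip: exp_sum)

text \<open>The heat kernel, extended by zero to \<open>r \<le> 0\<close> so that Duhamel integrals run over the whole line.\<close>

definition hk :: "real \<Rightarrow> 'a::euclidean_space \<Rightarrow> real" where
  "hk r x = (if r > 0 then (4 * pi * r) powr (- real DIM('a) / 2) * exp (- (norm x)\<^sup>2 / (4 * r)) else 0)"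

lemma measurable_hk [measurable]: "case_prod hk \<in> borel_measurable borel"
  "hk r \<in> borel_measurable borel"
  unfolding hk_def case_prod_beta' borel_prod[symmetric] by measurable

lemma measurable_hk_comp [measurable (raw)]:
  "f \<in> borel_measurable M \<Longrightarrow> g \<in> borel_measurable M \<Longrightarrow> (\<lambda>x. hk (f x) (g x :: 'a::euclidean_space)) \<in> borel_measurable M"
  using measurable_compose[OF _ measurable_hk(1), of "\<lambda>x. (f x, g x)" M] 
  by (simp add: borel_prod[symmetric])

lemma hk_nonneg [simp]: "0 \<le> hk r x" and hk_pos: "r > 0 \<Longrightarrow> hk r x > 0"
  by (auto simp: hk_def)

lemma hk_minus [simp]: "hk r (- x) = hk r x"
  by (simp add: hk_def)

lemma hk_commute: "hk r (x - y) = hk r (y - x)"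
  by (simp add: hk_def norm_minus_commute)

lemma hk_nonpos [simp]: "r \<le> 0 \<Longrightarrow> hk r x = 0"
  by (simp add: hk_def)

lemma powr_half_power: "a > 0 \<Longrightarrow> a powr (real n / 2) = sqrt a ^ n"
  by (simp add: powr_half_sqrt_powr powr_realpow real_sqrt_power)

lemma
  fixes x :: "'a::euclidean_space" and r :: real assumes r: "r > 0"
  shows gauss_cis_integrable_nd: "integrable lborel (\<lambda>y. cis (- (x \<bullet> y)) * of_real (exp (- r * (norm y)\<^sup>2)))" (is ?A)
    and gauss_cis_integral_nd: "(LINT y|lborel. cis (- (x \<bullet> y)) * of_real (exp (- r * (norm y)\<^sup>2))) =
      of_real ((pi / r) powr (DIM('a) / 2) * exp (- (norm x)\<^sup>2 / (4 * r)))" (is ?B)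
proof -
  have eq: "cis (- (x \<bullet> y)) * of_real (exp (- r * (norm y)\<^sup>2)) =
    (\<Prod>b\<in>Basis. cis (- ((x \<bullet> b) * (y \<bullet> b))) * of_real (exp (- r * (y \<bullet> b)\<^sup>2)))" for y
    unfolding cis_inner_prod exp_norm_prod of_real_prod prod.distrib ..
  show ?A unfolding eq
    by (rule integrable_lborel_prod) (rule gauss_cis_integrable[OF r])
  have "(LINT y|lborel. cis (- (x \<bullet> y)) * of_real (exp (- r * (norm y)\<^sup>2))) =
     (\<Prod>b\<in>Basis. of_real (sqrt (pi / r) * exp (- (x \<bullet> b)\<^sup>2 / (4 * r))))"
    unfolding eq by (subst integral_lborel_prod)
     (simp_all only: gauss_cis_integral[OF r] gauss_cis_integrable[OF r])
  also have "\<dots> = of_real (\<Prod>b::'a\<in>Basis. (sqrt (pi / r) * exp (- (x \<bullet> b)\<^sup>2 / (4 * r))))"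
    by simp
  also have "(\<Prod>b::'a\<in>Basis. (sqrt (pi / r) * exp (- (x \<bullet> b)\<^sup>2 / (4 * r)))) = 
      sqrt (pi / r) ^ DIM('a) * exp (- (norm x)\<^sup>2 / (4 * r))"
    by (simp add: prod.distrib norm_sq_basis sum_divide_distrib flip: exp_sum sum_negf)
  also have "sqrt (pi / r) ^ DIM('a) = (pi / r) powr (DIM('a) / 2)"
    using r by (simp add: powr_half_power)
  finally show ?B .
qed

lemma
  fixes r :: real assumes r: "r > 0"
  shows gauss_integrable_nd: "integrable lborel (\<lambda>y::'a::euclidean_space. exp (- r * (norm y)\<^sup>2))"
    and gauss_integral_nd: "(LINT y|lborel. exp (- r * (norm (y::'a))\<^sup>2)) = (pi / r) powr (DIM('a) / 2)"
proof -
  show 1: "integrable lborel (\<lambda>y::'a. exp (- r * (norm y)\<^sup>2))"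
    using integrable_Re[OF gauss_cis_integrable_nd[OF r, of "0::'a"]] by simp
  have "complex_of_real (LINT y|lborel. exp (- r * (norm (y::'a))\<^sup>2)) = of_real ((pi / r) powr (DIM('a) / 2))"
    using gauss_cis_integral_nd[OF r, of "0::'a"] by simp
  then show "(LINT y|lborel. exp (- r * (norm (y::'a))\<^sup>2)) = (pi / r) powr (DIM('a) / 2)"
    using of_real_eq_iff by blast
qed

lemma hk_alt: "r > 0 \<Longrightarrow> hk r x = (4 * pi * r) powr (- real DIM('a) / 2) * exp (- (1 / (4 * r)) * (norm x)\<^sup>2)"
  for x :: "'a::euclidean_space"
  by (simp add: hk_def)

lemma hk_integrable: "integrable lborel (hk r :: 'a::euclidean_space \<Rightarrow> real)"
proof (cases "r > 0")
  case True
  then show ?thesis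
    using gauss_integrable_nd[of "1 / (4 * r)", where ?'a='a]
    by (simp add: hk_alt cong: Bochner_Integration.integrable_cong)
qed (simp add: hk_def[abs_def])

lemma hk_integral: "r > 0 \<Longrightarrow> (LINT x|lborel. hk r (x :: 'a::euclidean_space)) = 1"
  using gauss_integral_nd[of "1 / (4 * r)", where ?'a='a]
  by (simp add: hk_alt mult_ac flip: powr_add cong: Bochner_Integration.integral_cong)

lemma lborel_integrable_shift:
  fixes f :: "'a::euclidean_space \<Rightarrow> 'b::{banach,second_countable_topology}"
  assumes f: "integrable lborel f" shows "integrable lborel (\<lambda>y. f (x - y))"
proof -
  have [measurable]: "f \<in> borel_measurable borel" using borel_measurable_integrable[OF f] by simp
  have "lborel = distr lborel borel (\<lambda>y::'a. x - y)"
    using lborel_affine[of "-1" x] by (simp add: density_1 one_ennreal_def[symmetric])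
  then have "integrable (distr lborel borel (\<lambda>y::'a. x - y)) f" using f by metis
  then show ?thesis by (subst (asm) integrable_distr_eq) auto
qed

lemma lborel_integral_shift:
  fixes f :: "'a::euclidean_space \<Rightarrow> 'b::{banach,second_countable_topology}"
  assumes [measurable]: "f \<in> borel_measurable borel"
  shows "(LINT y|lborel. f (x - y)) = (LINT y|lborel. f y)"
proof -
  have "lborel = distr lborel borel (\<lambda>y::'a. x - y)"
    using lborel_affine[of "-1" x] by (simp add: density_1 one_ennreal_def[symmetric])
  then have "(LINT y|lborel. f y) = (LINT y|distr lborel borel (\<lambda>y::'a. x - y). f y)" by metis
  then show ?thesis by (subst (asm) integral_distr) auto
qed

lemma hk_shift_integrable: "integrable lborel (\<lambda>y. hk r (x - y :: 'a::euclidean_space))"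
  by (rule lborel_integrable_shift) (rule hk_integrable)

lemma hk_shift_integral: "r > 0 \<Longrightarrow> (LINT y|lborel. hk r (x - y :: 'a::euclidean_space)) = 1"
  by (subst lborel_integral_shift) (auto simp: hk_integral)

lemma hk_shift_nn_integral: "r > 0 \<Longrightarrow> (\<integral>\<^sup>+y. ennreal (hk r (x - y :: 'a::euclidean_space)) \<partial>lborel) = 1"
  by (subst nn_integral_eq_integral[OF hk_shift_integrable]) (auto simp: hk_shift_integral)

lemma hk_shift_nn_integral_le: "(\<integral>\<^sup>+y. ennreal (hk r (x - y :: 'a::euclidean_space)) \<partial>lborel) \<le> 1"
  by (cases "r > 0") (auto simp: hk_shift_nn_integral)

lemma hk_conv_cis:
  fixes x \<xi> :: "'a::euclidean_space"
  assumes r: "r > 0"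
  shows "(LINT y|lborel. of_real (hk r (x - y)) * cis (- (y \<bullet> \<xi>))) = cis (- (x \<bullet> \<xi>)) * of_real (exp (- r * (norm \<xi>)\<^sup>2))"
proof -
  let ?c = "(4 * pi * r) powr (- real DIM('a) / 2)"
  have "(LINT y|lborel. of_real (hk r (x - y)) * cis (- (y \<bullet> \<xi>))) =
      (LINT y|lborel. (\<lambda>z. of_real (hk r z) * cis (- ((x - z) \<bullet> \<xi>))) (x - y))"
    by simp
  also have "\<dots> = (LINT z|lborel. of_real (hk r z) * cis (- ((x - z) \<bullet> \<xi>)))"
    by (subst lborel_integral_shift) auto
  also have "\<dots> = (LINT z|lborel. cis (- (x \<bullet> \<xi>)) * of_real ?c * (cis (- ((- \<xi>) \<bullet> z)) * of_real (exp (- (1 / (4 * r)) * (norm z)\<^sup>2))))"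
    using r by (intro Bochner_Integration.integral_cong)
      (auto simp: hk_alt inner_diff_left inner_diff_right cis_mult inner_commute)
  also have "\<dots> = cis (- (x \<bullet> \<xi>)) * of_real ?c * of_real ((pi / (1 / (4 * r))) powr (DIM('a) / 2) * exp (- (norm (-\<xi>))\<^sup>2 / (4 * (1 / (4 * r)))))"
    using r by (subst integral_mult_right_zero, subst gauss_cis_integral_nd) auto
  also have "\<dots> = cis (- (x \<bullet> \<xi>)) * of_real (?c * (4 * pi * r) powr (DIM('a) / 2) * exp (- r * (norm \<xi>)\<^sup>2))"
    using r by (simp add: mult_ac)
  also have "?c * (4 * pi * r) powr (DIM('a) / 2) = 1"
    using r by (simp flip: powr_add)
  finally show ?thesis by simp
qed

lemma hk_conv_fourier:
  fixes h :: "'a::euclidean_space \<Rightarrow> complex"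
  assumes r: "r > 0" and h: "integrable lborel h"
  shows "(LINT z|lborel. of_real (hk r (x - z)) * (LINT \<xi>|lborel. cis (- (z \<bullet> \<xi>)) * h \<xi>)) =
    (LINT \<xi>|lborel. cis (- (x \<bullet> \<xi>)) * of_real (exp (- r * (norm \<xi>)\<^sup>2)) * h \<xi>)"
proof -
  have [measurable]: "h \<in> borel_measurable borel" using borel_measurable_integrable[OF h] by simp
  have int: "integrable (lborel \<Otimes>\<^sub>M lborel) (\<lambda>(z,\<xi>). of_real (hk r (x - z)) * (cis (- (z \<bullet> \<xi>)) * h \<xi>))"
  proof (rule Bochner_Integration.integrable_bound)
    show "integrable (lborel \<Otimes>\<^sub>M lborel) (\<lambda>(z,\<xi>). of_real (hk r (x - z)) * h \<xi>)"
      by (intro integrable_pair_mult integrable_of_real hk_shift_integrable h)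
  qed (auto simp: norm_mult)
  have "(LINT z|lborel. of_real (hk r (x - z)) * (LINT \<xi>|lborel. cis (- (z \<bullet> \<xi>)) * h \<xi>)) =
    (LINT z|lborel. (LINT \<xi>|lborel. of_real (hk r (x - z)) * (cis (- (z \<bullet> \<xi>)) * h \<xi>)))"
    by simp
  also have "\<dots> = (LINT \<xi>|lborel. (LINT z|lborel. of_real (hk r (x - z)) * (cis (- (z \<bullet> \<xi>)) * h \<xi>)))"
    using lborel_pair.Fubini_integral[OF int] by simp
  also have "\<dots> = (LINT \<xi>|lborel. cis (- (x \<bullet> \<xi>)) * of_real (exp (- r * (norm \<xi>)\<^sup>2)) * h \<xi>)"
    by (subst mult.assoc[symmetric], subst integral_mult_left_zero) (simp only: hk_conv_cis[OF r])
  finally show ?thesis .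
qed

lemma hk_semigroup:
  fixes x y :: "'a::euclidean_space"
  assumes r: "r > 0" and s: "s > 0"
  shows "(LINT z|lborel. hk r (x - z) * hk s (z - y)) = hk (r + s) (x - y)"
proof -
  let ?c = "complex_of_real ((4 * pi * s) powr (- real DIM('a) / 2) * (pi / (1 / (4 * s))) powr (- real DIM('a) / 2))"
  have four: "complex_of_real (hk s z) = of_real ((2 * pi) powr (- real DIM('a))) * (LINT \<xi>|lborel. cis (- (z \<bullet> \<xi>)) * of_real (exp (- s * (norm \<xi>)\<^sup>2)))"
    if s: "s > 0" for s and z :: 'a
  proof -
    have "(4 * pi * s) = (2 * pi)\<^sup>2 * (s / pi)" by (simp add: power2_eq_square)
    then have "(4 * pi * s) powr (- real DIM('a) / 2) = ((2 * pi)\<^sup>2) powr (- real DIM('a) / 2) * (s / pi) powr (- real DIM('a) / 2)"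
      using s powr_mult[of "(2 * pi)\<^sup>2" "s / pi"] by (metis less_eq_real_def pi_gt_zero zero_le_power2 divide_nonneg_pos)
    also have "((2 * pi)\<^sup>2) powr (- real DIM('a) / 2) = (2 * pi) powr (- real DIM('a))"
      by (subst powr_numeral[symmetric], simp) (simp only: powr_powr, simp)
    also have "(s / pi) powr (- real DIM('a) / 2) = (pi / s) powr (real DIM('a) / 2)"
      using s by (metis powr_minus divide_minus_left inverse_powr inverse_divide)
    finally have c: "(4 * pi * s) powr (- real DIM('a) / 2) = (2 * pi) powr (- real DIM('a)) * (pi / s) powr (real DIM('a) / 2)" .
    show ?thesis using s by (subst gauss_cis_integral_nd) (auto simp: hk_def c[simplified])
  qed
  have h: "integrable lborel (\<lambda>\<xi>::'a. cis (y \<bullet> \<xi>) * of_real (exp (- s * (norm \<xi>)\<^sup>2)))"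
    using gauss_cis_integrable_nd[OF s, of "-y"] by simp
  have "complex_of_real (LINT z|lborel. hk r (x - z) * hk s (z - y)) =
    (LINT z|lborel. of_real (hk r (x - z)) * of_real (hk s (z - y)))"
    by (simp flip: integral_complex_of_real)
  also have "\<dots> = (LINT z|lborel. of_real ((2 * pi) powr (- real DIM('a))) * 
     (of_real (hk r (x - z)) * (LINT \<xi>|lborel. cis (- (z \<bullet> \<xi>)) * (cis (y \<bullet> \<xi>) * of_real (exp (- s * (norm \<xi>)\<^sup>2))))))"
    unfolding four[OF s] by (intro Bochner_Integration.integral_cong refl)
     (auto simp: inner_diff_left cis_mult simp flip: mult.assoc)
  also have "\<dots> = of_real ((2 * pi) powr (- real DIM('a))) * 
     (LINT \<xi>|lborel. cis (- (x \<bullet> \<xi>)) * of_real (exp (- r * (norm \<xi>)\<^sup>2)) * (cis (y \<bullet> \<xi>) * of_real (exp (- s * (norm \<xi>)\<^sup>2))))"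
    by (subst integral_mult_right_zero, subst hk_conv_fourier[OF r h]) simp
  also have "(\<lambda>\<xi>. cis (- (x \<bullet> \<xi>)) * complex_of_real (exp (- r * (norm \<xi>)\<^sup>2)) * (cis (y \<bullet> \<xi>) * of_real (exp (- s * (norm \<xi>)\<^sup>2)))) =
      (\<lambda>\<xi>. cis (- ((x - y) \<bullet> \<xi>)) * of_real (exp (- (r + s) * (norm \<xi>)\<^sup>2)))"
  proof
    fix \<xi> :: 'a
    have "cis (- ((x - y) \<bullet> \<xi>)) = cis (- (x \<bullet> \<xi>)) * cis (y \<bullet> \<xi>)"
      by (simp add: cis_mult inner_diff_left)
    moreover have "exp (- (r + s) * (norm \<xi>)\<^sup>2) = exp (- r * (norm \<xi>)\<^sup>2) * exp (- s * (norm \<xi>)\<^sup>2)"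
      by (simp add: algebra_simps flip: exp_add)
    ultimately show "cis (- (x \<bullet> \<xi>)) * complex_of_real (exp (- r * (norm \<xi>)\<^sup>2)) * (cis (y \<bullet> \<xi>) * of_real (exp (- s * (norm \<xi>)\<^sup>2))) =
      cis (- ((x - y) \<bullet> \<xi>)) * of_real (exp (- (r + s) * (norm \<xi>)\<^sup>2))"
      by (simp only: of_real_mult mult_ac)
  qed
  also have "of_real ((2 * pi) powr (- real DIM('a))) * (LINT \<xi>|lborel. cis (- ((x - y) \<bullet> \<xi>)) * of_real (exp (- (r + s) * (norm \<xi>)\<^sup>2)))
      = complex_of_real (hk (r + s) (x - y))"
    using r s by (subst four) auto
  finally show ?thesis using of_real_eq_iff by blast
qed

subsection \<open>Plancherel's inequality\<close>

lemma measurable_cnj [measurable (raw)]: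
  "f \<in> borel_measurable M \<Longrightarrow> (\<lambda>x. cnj (f x)) \<in> borel_measurable M"
  by (rule borel_measurable_continuous_on[of cnj]) (auto intro!: continuous_intros)

lemma ennreal_norm_integral_le:
  fixes f :: "'a \<Rightarrow> 'b::{banach,second_countable_topology}"
  shows "ennreal (norm (integral\<^sup>L M f)) \<le> (\<integral>\<^sup>+x. ennreal (norm (f x)) \<partial>M)"
  by (cases "integrable M f") (auto simp: integral_norm_bound_ennreal not_integrable_integral_eq)

lemma power_half_cancel: "(4 * pi * r) powr (- real n / 2) * (2 * pi) ^ n = (pi / r) powr (real n / 2)" if "r > 0"
proof -
  have "(2 * pi) ^ n = (4 * pi\<^sup>2) powr (real n / 2)"
    by (subst powr_half_power) (auto simp: real_sqrt_mult)
  also have "4 * pi\<^sup>2 = (4 * pi * r) * (pi / r)"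
    using that by (simp add: power2_eq_square)
  also have "\<dots> powr (real n / 2) = (4 * pi * r) powr (real n / 2) * (pi / r) powr (real n / 2)"
    using that by (subst powr_mult) auto
  finally show ?thesis
    using that by (simp add: powr_minus)
qed

lemma gauss_cis_integral_hk:
  fixes z :: "'a::euclidean_space"
  assumes r: "r > 0"
  shows "(LINT x|lborel. cis (x \<bullet> z) * of_real (exp (- r * (norm x)\<^sup>2))) = of_real ((2 * pi) ^ DIM('a) * hk r z)"
proof -
  have "(pi / r) powr (DIM('a) / 2) * exp (- (norm (- z))\<^sup>2 / (4 * r)) = (2 * pi) ^ DIM('a) * hk r z"
    using r by (simp add: hk_def flip: power_half_cancel[OF r])
  then show ?thesis
    using gauss_cis_integral_nd[OF r, of "- z"] by (simp add: inner_commute)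
qed

lemma plancherel_gauss:
  fixes g :: "'a::euclidean_space \<Rightarrow> complex"
  assumes g: "integrable lborel g" and g2: "integrable lborel (\<lambda>\<xi>. (cmod (g \<xi>))\<^sup>2)" and r: "r > 0"
  shows "(\<integral>\<^sup>+x. ennreal ((cmod (LINT \<xi>|lborel. cis (x \<bullet> \<xi>) * g \<xi>))\<^sup>2 * exp (- r * (norm x)\<^sup>2)) \<partial>lborel)
    \<le> ennreal ((2 * pi) ^ DIM('a) * (LINT \<xi>|lborel. (cmod (g \<xi>))\<^sup>2))"
proof -
  have [measurable]: "g \<in> borel_measurable borel" using borel_measurable_integrable[OF g] by simp
  define G where "G x = (LINT \<xi>|lborel. cis (x \<bullet> \<xi>) * g \<xi>)" for x
  have Gmeas[measurable]: "G \<in> borel_measurable borel"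
    unfolding G_def by measurable
  let ?P = "lborel \<Otimes>\<^sub>M lborel :: ('a \<times> 'a) measure"
  have gx: "integrable lborel (\<lambda>\<xi>. cis (x \<bullet> \<xi>) * g \<xi>)" for x
    using integrable_norm[OF g] by (rule Bochner_Integration.integrable_bound) (auto simp: norm_mult)
  have gx': "integrable lborel (\<lambda>\<xi>. cnj (cis (x \<bullet> \<xi>) * g \<xi>))" for x
    by (rule integrable_cnj[OF gx])
  have GG: "of_real ((cmod (G x))\<^sup>2) = (LINT p|?P. (cis (x \<bullet> fst p) * g (fst p)) * cnj (cis (x \<bullet> snd p) * g (snd p)))" for x
  proof -
    have "(LINT p|?P. (cis (x \<bullet> fst p) * g (fst p)) * cnj (cis (x \<bullet> snd p) * g (snd p))) =
       (LINT \<xi>|lborel. (LINT \<zeta>|lborel. (cis (x \<bullet> \<xi>) * g \<xi>) * cnj (cis (x \<bullet> \<zeta>) * g \<zeta>)))"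
      using lborel_pair.integral_fst'[OF integrable_pair_mult[OF gx gx', of x x], symmetric] unfolding case_prod_beta fst_conv snd_conv .
    also have "\<dots> = G x * cnj (G x)"
      unfolding G_def by (simp add: integral_cnj[symmetric] del: integral_cnj complex_cnj_mult)
    also have "\<dots> = of_real ((cmod (G x))\<^sup>2)"
      using complex_norm_square[of "G x"] by simp
    finally show ?thesis ..
  qed
  have int: "integrable (lborel \<Otimes>\<^sub>M ?P) (\<lambda>(x, p). of_real (exp (- r * (norm x)\<^sup>2)) * ((cis (x \<bullet> fst p) * g (fst p)) * cnj (cis (x \<bullet> snd p) * g (snd p))))"
  proof (rule Bochner_Integration.integrable_bound)
    have "integrable lborel (\<lambda>p::'a\<times>'a. g (fst p) * cnj (g (snd p)))"
      using integrable_pair_mult[OF g integrable_cnj[OF g]] unfolding lborel_prod case_prod_beta .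
    from integrable_pair_mult[OF integrable_of_real[OF gauss_integrable_nd[OF r]] this]
    show "integrable (lborel \<Otimes>\<^sub>M ?P) (\<lambda>(x::'a, p). of_real (exp (- r * (norm x)\<^sup>2)) * (g (fst p) * cnj (g (snd p))))"
      by (simp add: lborel_prod)
  next
    show "(\<lambda>(x, p). of_real (exp (- r * (norm x)\<^sup>2)) * ((cis (x \<bullet> fst p) * g (fst p)) * cnj (cis (x \<bullet> snd p) * g (snd p))))
        \<in> borel_measurable (lborel \<Otimes>\<^sub>M ?P)"
      unfolding case_prod_beta by measurable
  qed (auto simp: norm_mult)
  have "integrable lborel (\<lambda>x. (cmod (G x))\<^sup>2 * exp (- r * (norm x)\<^sup>2))"
  proof (rule Bochner_Integration.integrable_bound)
    show "integrable lborel (\<lambda>x::'a. (LINT \<xi>|lborel. norm (g \<xi>))\<^sup>2 * exp (- r * (norm x)\<^sup>2))"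
      by (intro integrable_mult_right gauss_integrable_nd r)
    have "norm (G x) \<le> (LINT \<xi>|lborel. norm (g \<xi>))" for x
      unfolding G_def by (rule order_trans[OF integral_norm_bound]) (auto simp: norm_mult)
    then show "AE x in lborel. norm ((cmod (G x))\<^sup>2 * exp (- r * (norm x)\<^sup>2)) \<le> norm ((LINT \<xi>|lborel. norm (g \<xi>))\<^sup>2 * exp (- r * (norm x)\<^sup>2))"
      by (auto intro!: mult_right_mono power_mono)
  qed auto
  then have eq1: "(\<integral>\<^sup>+x. ennreal ((cmod (G x))\<^sup>2 * exp (- r * (norm x)\<^sup>2)) \<partial>lborel) = ennreal (LINT x|lborel. (cmod (G x))\<^sup>2 * exp (- r * (norm x)\<^sup>2))"
    by (intro nn_integral_eq_integral) auto
  have "complex_of_real (LINT x|lborel. (cmod (G x))\<^sup>2 * exp (- r * (norm x)\<^sup>2)) =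
     (LINT x|lborel. of_real (exp (- r * (norm x)\<^sup>2)) * of_real ((cmod (G x))\<^sup>2))"
    by (subst integral_complex_of_real[symmetric]) (simp add: mult_ac)
  also have "\<dots> = (LINT x|lborel. (LINT p|?P. of_real (exp (- r * (norm x)\<^sup>2)) * ((cis (x \<bullet> fst p) * g (fst p)) * cnj (cis (x \<bullet> snd p) * g (snd p)))))"
    unfolding GG by simp
  also have "\<dots> = (LINT p|?P. (LINT x|lborel. of_real (exp (- r * (norm x)\<^sup>2)) * ((cis (x \<bullet> fst p) * g (fst p)) * cnj (cis (x \<bullet> snd p) * g (snd p)))))"
  proof -
    interpret pair_sigma_finite lborel ?P
      by standard
    show ?thesis using Fubini_integral[OF int] by simp
  qed
  also have "\<dots> = (LINT p|?P. g (fst p) * cnj (g (snd p)) * of_real ((2 * pi) ^ DIM('a) * hk r (fst p - snd p)))"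
  proof (intro Bochner_Integration.integral_cong refl)
    fix p :: "'a \<times> 'a"
    have "(LINT x|lborel. of_real (exp (- r * (norm x)\<^sup>2)) * ((cis (x \<bullet> fst p) * g (fst p)) * cnj (cis (x \<bullet> snd p) * g (snd p)))) =
      (LINT x|lborel. g (fst p) * cnj (g (snd p)) * (cis (x \<bullet> (fst p - snd p)) * of_real (exp (- r * (norm x)\<^sup>2))))"
      by (intro Bochner_Integration.integral_cong) (auto simp: inner_diff_right cis_cnj simp flip: cis_divide cis_inverse simp: field_simps)
    then show "(LINT x|lborel. of_real (exp (- r * (norm x)\<^sup>2)) * ((cis (x \<bullet> fst p) * g (fst p)) * cnj (cis (x \<bullet> snd p) * g (snd p)))) =
      g (fst p) * cnj (g (snd p)) * of_real ((2 * pi) ^ DIM('a) * hk r (fst p - snd p))"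
      by (simp only: integral_mult_right_zero gauss_cis_integral_hk[OF r])
  qed
  finally have eq2: "complex_of_real (LINT x|lborel. (cmod (G x))\<^sup>2 * exp (- r * (norm x)\<^sup>2)) =
      (LINT p|?P. g (fst p) * cnj (g (snd p)) * of_real ((2 * pi) ^ DIM('a) * hk r (fst p - snd p)))" .
  have "ennreal (LINT x|lborel. (cmod (G x))\<^sup>2 * exp (- r * (norm x)\<^sup>2)) =
     ennreal (norm (complex_of_real (LINT x|lborel. (cmod (G x))\<^sup>2 * exp (- r * (norm x)\<^sup>2))))"
    by (simp add: integral_nonneg_AE del: of_real_mult)
  also have "\<dots> \<le> (\<integral>\<^sup>+p. ennreal (norm (g (fst p) * cnj (g (snd p)) * of_real ((2 * pi) ^ DIM('a) * hk r (fst p - snd p)))) \<partial>?P)"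
    unfolding eq2 by (rule ennreal_norm_integral_le)
  also have "\<dots> \<le> (\<integral>\<^sup>+p. ennreal ((2 * pi) ^ DIM('a) / 2 * (cmod (g (fst p)))\<^sup>2 * hk r (fst p - snd p)) + 
       ennreal ((2 * pi) ^ DIM('a) / 2 * (cmod (g (snd p)))\<^sup>2 * hk r (fst p - snd p)) \<partial>?P)"
  proof (rule nn_integral_mono)
    fix p :: "'a \<times> 'a"
    have "a * b * (c * k) \<le> c / 2 * a\<^sup>2 * k + c / 2 * b\<^sup>2 * k" if "0 \<le> c" "0 \<le> k" for a b c k :: real
    proof -
      have "a * b \<le> (a\<^sup>2 + b\<^sup>2) / 2" using sum_squares_bound[of a b] by simp
      then have "a * b * (c * k) \<le> (a\<^sup>2 + b\<^sup>2) / 2 * (c * k)"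
        by (rule mult_right_mono) (use that in auto)
      then show ?thesis by (simp add: field_simps)
    qed
    from this[of "(2 * pi) ^ DIM('a)" "hk r (fst p - snd p)" "cmod (g (fst p))" "cmod (g (snd p))"]
    show "ennreal (norm (g (fst p) * cnj (g (snd p)) * of_real ((2 * pi) ^ DIM('a) * hk r (fst p - snd p)))) \<le>
      ennreal ((2 * pi) ^ DIM('a) / 2 * (cmod (g (fst p)))\<^sup>2 * hk r (fst p - snd p)) + 
       ennreal ((2 * pi) ^ DIM('a) / 2 * (cmod (g (snd p)))\<^sup>2 * hk r (fst p - snd p))"
      by (simp add: norm_mult norm_power flip: ennreal_plus)
  qed
  also have "\<dots> = (\<integral>\<^sup>+p. ennreal ((2 * pi) ^ DIM('a) / 2 * (cmod (g (fst p)))\<^sup>2 * hk r (fst p - snd p)) \<partial>?P) +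
      (\<integral>\<^sup>+p. ennreal ((2 * pi) ^ DIM('a) / 2 * (cmod (g (snd p)))\<^sup>2 * hk r (fst p - snd p)) \<partial>?P)"
    by (rule nn_integral_add) auto
  also have "(\<integral>\<^sup>+p. ennreal ((2 * pi) ^ DIM('a) / 2 * (cmod (g (fst p)))\<^sup>2 * hk r (fst p - snd p)) \<partial>?P) =
     (\<integral>\<^sup>+\<xi>. \<integral>\<^sup>+\<zeta>. ennreal ((2 * pi) ^ DIM('a) / 2 * (cmod (g \<xi>))\<^sup>2) * ennreal (hk r (\<xi> - \<zeta>)) \<partial>lborel \<partial>lborel)"
    by (subst lborel.nn_integral_fst[symmetric]) (auto simp: mult_ac simp flip: ennreal_mult)
  also have "\<dots> = (\<integral>\<^sup>+\<xi>. ennreal ((2 * pi) ^ DIM('a) / 2 * (cmod (g \<xi>))\<^sup>2) \<partial>lborel)"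
    by (subst nn_integral_cmult) (auto simp: hk_shift_nn_integral[OF r])
  also have "(\<integral>\<^sup>+p. ennreal ((2 * pi) ^ DIM('a) / 2 * (cmod (g (snd p)))\<^sup>2 * hk r (fst p - snd p)) \<partial>?P) =
     (\<integral>\<^sup>+\<zeta>. \<integral>\<^sup>+\<xi>. ennreal ((2 * pi) ^ DIM('a) / 2 * (cmod (g \<zeta>))\<^sup>2) * ennreal (hk r (\<zeta> - \<xi>)) \<partial>lborel \<partial>lborel)"
    by (subst lborel_pair.nn_integral_snd[symmetric]) (auto simp: hk_commute mult_ac simp flip: ennreal_mult)
  also have "\<dots> = (\<integral>\<^sup>+\<xi>. ennreal ((2 * pi) ^ DIM('a) / 2 * (cmod (g \<xi>))\<^sup>2) \<partial>lborel)"
    by (subst nn_integral_cmult) (auto simp: hk_shift_nn_integral[OF r])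
  also have "(\<integral>\<^sup>+\<xi>. ennreal ((2 * pi) ^ DIM('a) / 2 * (cmod (g \<xi>))\<^sup>2) \<partial>lborel) = ennreal ((2 * pi) ^ DIM('a) / 2 * (LINT \<xi>|lborel. (cmod (g \<xi>))\<^sup>2))"
    using g2 by (subst nn_integral_eq_integral) auto
  also have "\<dots> + \<dots> = ennreal ((2 * pi) ^ DIM('a) * (LINT \<xi>|lborel. (cmod (g \<xi>))\<^sup>2))"
    by (subst ennreal_plus[symmetric]) (auto intro!: integral_nonneg_AE)
  finally show ?thesis
    unfolding eq1[unfolded G_def] G_def .
qed

lemma plancherel_le:
  fixes g :: "'a::euclidean_space \<Rightarrow> complex"
  assumes g: "integrable lborel g" and g2: "integrable lborel (\<lambda>\<xi>. (cmod (g \<xi>))\<^sup>2)"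
  shows "(\<integral>\<^sup>+x. ennreal ((cmod (LINT \<xi>|lborel. cis (x \<bullet> \<xi>) * g \<xi>))\<^sup>2) \<partial>lborel)
    \<le> ennreal ((2 * pi) ^ DIM('a) * (LINT \<xi>|lborel. (cmod (g \<xi>))\<^sup>2))"
proof -
  have [measurable]: "g \<in> borel_measurable borel" using borel_measurable_integrable[OF g] by simp
  define G where "G x = (LINT \<xi>|lborel. cis (x \<bullet> \<xi>) * g \<xi>)" for x
  have Gmeas[measurable]: "G \<in> borel_measurable borel"
    unfolding G_def by measurable
  define h where "h n x = ennreal ((cmod (G x))\<^sup>2 * exp (- inverse (real (Suc n)) * (norm x)\<^sup>2))" for n x
  have lim: "(\<lambda>n. h n x) \<longlonglongrightarrow> ennreal ((cmod (G x))\<^sup>2)" for x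
  proof -
    have "(\<lambda>n. inverse (real (Suc n))) \<longlonglongrightarrow> 0" by (rule LIMSEQ_inverse_real_of_nat)
    then have "(\<lambda>n. (cmod (G x))\<^sup>2 * exp (- inverse (real (Suc n)) * (norm x)\<^sup>2)) \<longlonglongrightarrow> (cmod (G x))\<^sup>2 * exp (- 0 * (norm x)\<^sup>2)"
      by (intro tendsto_intros)
    then show ?thesis unfolding h_def by (intro tendsto_ennrealI) simp
  qed
  have "(\<integral>\<^sup>+x. ennreal ((cmod (G x))\<^sup>2) \<partial>lborel) = (\<integral>\<^sup>+x. liminf (\<lambda>n. h n x) \<partial>lborel)"
    using lim_imp_Liminf[OF _ lim] by simp
  also have "\<dots> \<le> liminf (\<lambda>n. \<integral>\<^sup>+x. h n x \<partial>lborel)"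
    by (rule nn_integral_liminf) (auto simp: h_def)
  also have "\<dots> \<le> ennreal ((2 * pi) ^ DIM('a) * (LINT \<xi>|lborel. (cmod (g \<xi>))\<^sup>2))"
    using plancherel_gauss[OF g g2]
    by (intro Liminf_le) (auto simp: h_def G_def)
  finally show ?thesis unfolding G_def .
qed

subsection \<open>Bounds for the Sobolev norm\<close>

lemma ennreal_sq_add_le: "ennreal ((norm (a::'b::real_normed_vector))\<^sup>2) \<le> 2 * ennreal ((norm b)\<^sup>2) + 2 * ennreal ((norm (b - a))\<^sup>2)"
proof -
  have "norm a \<le> norm b + norm (b - a)"
    by (metis add_diff_cancel_left' norm_triangle_sub norm_minus_commute add.commute diff_add_cancel norm_triangle_ineq)
  then have "(norm a)\<^sup>2 \<le> (norm b + norm (b - a))\<^sup>2" by (rule power_mono) auto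
  also have "\<dots> \<le> 2 * (norm b)\<^sup>2 + 2 * (norm (b - a))\<^sup>2"
    using sum_squares_bound[of "norm b" "norm (b - a)"] by (simp add: power2_sum)
  finally have "ennreal ((norm a)\<^sup>2) \<le> ennreal (2 * (norm b)\<^sup>2 + 2 * (norm (b - a))\<^sup>2)"
    by (rule ennreal_leI)
  then show ?thesis by (simp add: ennreal_mult)
qed

lemma lint_cball_indicator:
  "(LINT x:cball 0 R|lborel. c x * g x) = (LINT x|lborel. c x * (indicator (cball 0 R) x * g x))"
  for c g :: "'a::euclidean_space \<Rightarrow> complex"
  unfolding set_lebesgue_integral_def
  by (intro Bochner_Integration.integral_cong) (auto simp: indicator_def)

lemma Hs_norm_le:
  fixes f fh :: "(real^'n) \<Rightarrow> complex"
  assumes f: "f \<in> L2" and supp: "\<And>x. norm x > R0 \<Longrightarrow> f x = 0"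
    and fh: "\<And>\<xi>. fh \<xi> = (LINT x|lborel. cis (- (x \<bullet> \<xi>)) * f x)" and fh2: "fh \<in> L2"
    and w_def: "w = (\<lambda>\<xi>. of_real ((1 + (norm \<xi>)\<^sup>2) powr (s / 2)) * fh \<xi>)"
    and w: "integrable lborel w" and w2: "integrable lborel (\<lambda>\<xi>. (cmod (w \<xi>))\<^sup>2)"
  shows "Hs_norm s f \<le> sqrt (2 / (2 * pi) ^ CARD('n) * (LINT \<xi>|lborel. (cmod (w \<xi>))\<^sup>2))"
proof -
  have [measurable]: "f \<in> borel_measurable borel" using f by (simp add: L2_def)
  have [measurable]: "fh \<in> borel_measurable borel" using fh2 by (simp add: L2_def)
  have [measurable]: "cball (0::real^'n) R \<in> sets borel" for R :: real by auto
  have [measurable]: "w \<in> borel_measurable borel" using borel_measurable_integrable[OF w] by simp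
  let ?c = "1 / (2 * pi) ^ CARD('n)"
  have c: "?c > 0" by simp
  define FR where "FR R \<xi> = (LINT x:cball 0 R|lborel. cis (- (x \<bullet> \<xi>)) * f x)" for R \<xi>
  have FR: "FR R = fh" if "R \<ge> R0" for R
    unfolding FR_def fh fun_eq_iff set_lebesgue_integral_def using that supp
    by (auto intro!: Bochner_Integration.integral_cong simp: indicator_def)
  have FRlim: "eventually (\<lambda>R. (\<integral>\<^sup>+x. ennreal ((cmod (FR R x - g x))\<^sup>2) \<partial>lborel) = (\<integral>\<^sup>+x. ennreal ((cmod (fh x - g x))\<^sup>2) \<partial>lborel)) at_top" for g
    using eventually_ge_at_top[of R0] by eventually_elim (simp add: FR)
  have four: "is_fourier f fh"
    unfolding is_fourier_def L2_lim_def FR_def[symmetric] using f fh2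
    by (auto intro!: tendsto_eventually eventually_mono[OF FRlim[of fh]])
  have four_uniq: "AE x in lborel. uh x = fh x" if uh: "is_fourier f uh" for uh
  proof -
    have [measurable]: "uh \<in> borel_measurable borel" using uh by (simp add: is_fourier_def L2_def)
    have "((\<lambda>R. \<integral>\<^sup>+x. ennreal ((cmod (FR R x - uh x))\<^sup>2) \<partial>lborel) \<longlongrightarrow> 0) at_top"
      using uh unfolding is_fourier_def L2_lim_def FR_def[symmetric] by auto
    then have "((\<lambda>R::real. \<integral>\<^sup>+x. ennreal ((cmod (fh x - uh x))\<^sup>2) \<partial>lborel) \<longlongrightarrow> 0) at_top"
      by (rule Lim_transform_eventually[OF _ FRlim])
    then have "(\<integral>\<^sup>+x. ennreal ((cmod (fh x - uh x))\<^sup>2) \<partial>lborel) = 0"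
      by (simp add: tendsto_const_iff)
    then have "AE x in lborel. ennreal ((cmod (fh x - uh x))\<^sup>2) = 0"
      by (subst (asm) nn_integral_0_iff_AE) auto
    then show ?thesis by eventually_elim auto
  qed
  define V where "V R x = ?c *\<^sub>R (LINT \<xi>:cball 0 R|lborel. cis (x \<bullet> \<xi>) * w \<xi>)" for R x
  have wR: "integrable lborel (\<lambda>\<xi>. indicator A \<xi> * w \<xi>)" "integrable lborel (\<lambda>\<xi>. (cmod (indicator A \<xi> * w \<xi>))\<^sup>2)" 
    if [measurable]: "A \<in> sets borel" for A
  proof -
    show "integrable lborel (\<lambda>\<xi>. indicator A \<xi> * w \<xi>)"
      by (rule Bochner_Integration.integrable_bound[OF w]) (auto simp: indicator_def)
    show "integrable lborel (\<lambda>\<xi>. (cmod (indicator A \<xi> * w \<xi>))\<^sup>2)"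
      by (rule Bochner_Integration.integrable_bound[OF w2]) (auto simp: indicator_def)
  qed
  have VA: "(\<integral>\<^sup>+x. ennreal ((cmod (?c *\<^sub>R (LINT \<xi>|lborel. cis (x \<bullet> \<xi>) * (indicator A \<xi> * w \<xi>))))\<^sup>2) \<partial>lborel)
      \<le> ennreal (?c * (LINT \<xi>|lborel. (cmod (indicator A \<xi> * w \<xi>))\<^sup>2))" (is "?L \<le> _")
    if A[measurable]: "A \<in> sets borel" for A
  proof -
    have "?L = (\<integral>\<^sup>+x. ennreal (?c\<^sup>2) * ennreal ((cmod (LINT \<xi>|lborel. cis (x \<bullet> \<xi>) * (indicator A \<xi> * w \<xi>)))\<^sup>2) \<partial>lborel)"
      by (intro nn_integral_cong) (auto simp: power_mult_distrib norm_divide norm_power power_divide simp flip: ennreal_mult)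
    also have "\<dots> = ennreal (?c\<^sup>2) * (\<integral>\<^sup>+x. ennreal ((cmod (LINT \<xi>|lborel. cis (x \<bullet> \<xi>) * (indicator A \<xi> * w \<xi>)))\<^sup>2) \<partial>lborel)"
      by (rule nn_integral_cmult) measurable
    also have "\<dots> \<le> ennreal (?c\<^sup>2) * ennreal ((2 * pi) ^ CARD('n) * (LINT \<xi>|lborel. (cmod (indicator A \<xi> * w \<xi>))\<^sup>2))"
      using plancherel_le[OF wR[OF A]] by (intro mult_left_mono) auto
    also have "\<dots> = ennreal (?c\<^sup>2 * ((2 * pi) ^ CARD('n) * (LINT \<xi>|lborel. (cmod (indicator A \<xi> * w \<xi>))\<^sup>2)))"
      by (subst ennreal_mult) (auto intro!: integral_nonneg_AE)
    also have "?c\<^sup>2 * ((2 * pi) ^ CARD('n) * (LINT \<xi>|lborel. (cmod (indicator A \<xi> * w \<xi>))\<^sup>2)) = ?c * (LINT \<xi>|lborel. (cmod (indicator A \<xi> * w \<xi>))\<^sup>2)"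
      by (simp add: power2_eq_square)
    finally show ?thesis .
  qed
  define v where "v x = ?c *\<^sub>R (LINT \<xi>|lborel. cis (x \<bullet> \<xi>) * w \<xi>)" for x
  have v[measurable]: "v \<in> borel_measurable borel" unfolding v_def by measurable
  have "v \<in> L2"
  proof -
    have "(\<integral>\<^sup>+x. ennreal ((cmod (v x))\<^sup>2) \<partial>lborel) \<le> ennreal (?c * (LINT \<xi>|lborel. (cmod (w \<xi>))\<^sup>2))"
      using VA[of UNIV] by (simp add: v_def)
    then have "(\<integral>\<^sup>+x. ennreal ((cmod (v x))\<^sup>2) \<partial>lborel) < \<infinity>" by (simp add: le_less_trans)
    then show ?thesis by (auto simp: L2_def integrable_iff_bounded)
  qed
  moreover have "w \<in> L2" using w2 by (auto simp: L2_def)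
  moreover have "L2_lim V v"
  proof -
    have Vv: "V R x - v x = - (?c *\<^sub>R (LINT \<xi>|lborel. cis (x \<bullet> \<xi>) * (indicator (- cball 0 R) \<xi> * w \<xi>)))" for R x
    proof -
      have i: "integrable lborel (\<lambda>\<xi>. cis (x \<bullet> \<xi>) * (indicator A \<xi> * w \<xi>))" if [measurable]: "A \<in> sets borel" for A
        by (rule Bochner_Integration.integrable_bound[OF w]) (auto simp: indicator_def norm_mult)
      have "(LINT \<xi>|lborel. cis (x \<bullet> \<xi>) * w \<xi>) = (LINT \<xi>|lborel. cis (x \<bullet> \<xi>) * (indicator (cball 0 R) \<xi> * w \<xi>) + cis (x \<bullet> \<xi>) * (indicator (- cball 0 R) \<xi> * w \<xi>))"
        by (intro Bochner_Integration.integral_cong) (auto simp: indicator_def)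
      also have "\<dots> = (LINT \<xi>|lborel. cis (x \<bullet> \<xi>) * (indicator (cball 0 R) \<xi> * w \<xi>)) + (LINT \<xi>|lborel. cis (x \<bullet> \<xi>) * (indicator (- cball 0 R) \<xi> * w \<xi>))"
        by (intro Bochner_Integration.integral_add i) auto
      finally show ?thesis unfolding V_def v_def lint_cball_indicator
        by (simp add: scaleR_add_right del: of_real_power)
    qed
    have le: "(\<integral>\<^sup>+x. ennreal ((cmod (V R x - v x))\<^sup>2) \<partial>lborel) \<le> ennreal (?c * (LINT \<xi>|lborel. (cmod (indicator (- cball 0 R) \<xi> * w \<xi>))\<^sup>2))" for R
      unfolding Vv norm_minus_cancel by (rule VA) auto
    have "((\<lambda>R. LINT \<xi>|lborel. (cmod (indicator (- cball 0 R) \<xi> * w \<xi>))\<^sup>2) \<longlongrightarrow> (LINT \<xi>::real^'n|lborel. 0)) at_top"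
    proof (rule integral_dominated_convergence_at_top[where w="\<lambda>\<xi>. (cmod (w \<xi>))\<^sup>2"])
      show "AE x in lborel. ((\<lambda>R. (cmod (indicator (- cball 0 R) x * w x))\<^sup>2) \<longlongrightarrow> 0) at_top"
      proof (intro AE_I2 tendsto_eventually)
        fix x :: "real^'n"
        show "\<forall>\<^sub>F R in at_top. (cmod (indicator (- cball 0 R) x * w x))\<^sup>2 = 0"
          using eventually_ge_at_top[of "norm x"] by eventually_elim (auto simp: indicator_def)
      qed
      have "(cmod (indicator (- cball 0 R) x * w x))\<^sup>2 \<le> (cmod (w x))\<^sup>2" for R x
        by (auto simp: indicator_def)
      then show "\<forall>\<^sub>F R in at_top. AE x in lborel. norm ((cmod (indicator (- cball 0 R) x * w x))\<^sup>2) \<le> (cmod (w x))\<^sup>2"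
        by (intro always_eventually allI AE_I2) simp
      show "(\<lambda>\<xi>. (cmod (indicator (- cball 0 R) \<xi> * w \<xi>))\<^sup>2) \<in> borel_measurable lborel" for R
        by measurable
    qed (auto simp: w2)
    then have "((\<lambda>R. ennreal (?c * (LINT \<xi>|lborel. (cmod (indicator (- cball 0 R) \<xi> * w \<xi>))\<^sup>2))) \<longlongrightarrow> ennreal (?c * 0)) at_top"
      by (intro tendsto_ennrealI tendsto_intros) simp
    then have "((\<lambda>R. ennreal (?c * (LINT \<xi>|lborel. (cmod (indicator (- cball 0 R) \<xi> * w \<xi>))\<^sup>2))) \<longlongrightarrow> 0) at_top"
      by simp
    moreover have "\<forall>\<^sub>F R in at_top. 0 \<le> (\<integral>\<^sup>+x. ennreal ((cmod (V R x - v x))\<^sup>2) \<partial>lborel)"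
      by simp
    ultimately show ?thesis unfolding L2_lim_def
      by (intro tendsto_sandwich[where f="\<lambda>_. 0" and c=0, OF _ always_eventually[OF allI[OF le]] tendsto_const])
  qed
  ultimately have "bessel_potential s f v"
    unfolding bessel_potential_def is_inverse_fourier_def V_def[abs_def] w_def using four by blast
  then have "bessel_potential s f (SOME v. bessel_potential s f v)" by (rule someI[where P="bessel_potential s f"])
  then obtain u uh where u: "u = (SOME v. bessel_potential s f v)" and uh: "is_fourier f uh"
    and inv: "is_inverse_fourier (\<lambda>\<xi>. of_real ((1 + (norm \<xi>)\<^sup>2) powr (s / 2)) * uh \<xi>) u"
    unfolding bessel_potential_def by blast
  have [measurable]: "uh \<in> borel_measurable borel" "u \<in> borel_measurable borel"
    using uh inv by (auto simp: is_fourier_def is_inverse_fourier_def L2_def)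
  have ae: "AE \<xi> in lborel. of_real ((1 + (norm \<xi>)\<^sup>2) powr (s / 2)) * uh \<xi> = w \<xi>"
    using four_uniq[OF uh] by eventually_elim (simp add: w_def)
  have Veq: "?c *\<^sub>R (LINT \<xi>:cball 0 R|lborel. cis (x \<bullet> \<xi>) * (of_real ((1 + (norm \<xi>)\<^sup>2) powr (s / 2)) * uh \<xi>)) = V R x" for R x
    unfolding V_def set_lebesgue_integral_def
    by (rule arg_cong[where f="\<lambda>z. ?c *\<^sub>R z"], rule integral_cong_AE, measurable) (use ae in \<open>auto elim: eventually_mono\<close>)
  have lim: "((\<lambda>R. \<integral>\<^sup>+x. ennreal ((cmod (V R x - u x))\<^sup>2) \<partial>lborel) \<longlongrightarrow> 0) at_top"
    using inv unfolding is_inverse_fourier_def L2_lim_def Veq by auto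
  let ?I = "(LINT \<xi>|lborel. (cmod (w \<xi>))\<^sup>2)"
  have VRm[measurable]: "V R \<in> borel_measurable borel" for R
  proof -
    have [measurable]: "(\<lambda>\<xi>. indicator (cball 0 R) \<xi> * w \<xi>) \<in> borel_measurable borel"
      by measurable
    show ?thesis unfolding V_def lint_cball_indicator by measurable
  qed
  have bound: "(\<integral>\<^sup>+x. ennreal ((cmod (u x))\<^sup>2) \<partial>lborel) \<le> 2 * ennreal (?c * ?I) + 2 * (\<integral>\<^sup>+x. ennreal ((cmod (V R x - u x))\<^sup>2) \<partial>lborel)" for R
  proof -
    have "(\<integral>\<^sup>+x. ennreal ((cmod (u x))\<^sup>2) \<partial>lborel) \<le> (\<integral>\<^sup>+x. 2 * ennreal ((cmod (V R x))\<^sup>2) + 2 * ennreal ((cmod (V R x - u x))\<^sup>2) \<partial>lborel)"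
      by (intro nn_integral_mono ennreal_sq_add_le)
    also have "\<dots> = 2 * (\<integral>\<^sup>+x. ennreal ((cmod (V R x))\<^sup>2) \<partial>lborel) + 2 * (\<integral>\<^sup>+x. ennreal ((cmod (V R x - u x))\<^sup>2) \<partial>lborel)"
      by (subst nn_integral_add) (auto simp: nn_integral_cmult)
    also have "\<dots> \<le> 2 * ennreal (?c * ?I) + 2 * (\<integral>\<^sup>+x. ennreal ((cmod (V R x - u x))\<^sup>2) \<partial>lborel)"
    proof (rule add_right_mono[OF mult_left_mono])
      have "(\<integral>\<^sup>+x. ennreal ((cmod (V R x))\<^sup>2) \<partial>lborel) \<le> ennreal (?c * (LINT \<xi>|lborel. (cmod (indicator (cball 0 R) \<xi> * w \<xi>))\<^sup>2))"
        unfolding V_def lint_cball_indicator by (rule VA) auto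
      also have "\<dots> \<le> ennreal (?c * ?I)"
        by (intro ennreal_leI mult_left_mono integral_mono wR w2) (auto simp: indicator_def)
      finally show "(\<integral>\<^sup>+x. ennreal ((cmod (V R x))\<^sup>2) \<partial>lborel) \<le> ennreal (?c * ?I)" .
    qed simp
    finally show ?thesis .
  qed
  have "((\<lambda>R. 2 * ennreal (?c * ?I) + 2 * (\<integral>\<^sup>+x. ennreal ((cmod (V R x - u x))\<^sup>2) \<partial>lborel)) \<longlongrightarrow> 2 * ennreal (?c * ?I) + 2 * 0) at_top"
    by (intro tendsto_add tendsto_const ennreal_tendsto_cmult lim) auto
  then have "(\<integral>\<^sup>+x. ennreal ((cmod (u x))\<^sup>2) \<partial>lborel) \<le> 2 * ennreal (?c * ?I)"
    using tendsto_lowerbound[of _ "2 * ennreal (?c * ?I) + 2 * 0" at_top, OF _ always_eventually[OF allI[OF bound]] trivial_limit_at_top_linorder] by simp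
  also have "\<dots> = ennreal (2 * ?c * ?I)"
    by (subst ennreal_numeral[symmetric], subst ennreal_mult[symmetric]) (auto simp: mult_ac intro!: integral_nonneg_AE)
  finally have *: "(\<integral>\<^sup>+x. ennreal ((cmod (u x))\<^sup>2) \<partial>lborel) \<le> ennreal (2 * ?c * ?I)" .
  have "(LINT x|lborel. (cmod (u x))\<^sup>2) = enn2real (\<integral>\<^sup>+x. ennreal ((cmod (u x))\<^sup>2) \<partial>lborel)"
    by (rule integral_eq_nn_integral) auto
  also have "\<dots> \<le> 2 * ?c * ?I"
    using enn2real_mono[OF *] by (simp add: integral_nonneg_AE)
  finally show ?thesis
    unfolding Hs_norm_def u[symmetric] L2_norm_def by simp
qed

lemma lborel_integral_scale:
  fixes f :: "'a::euclidean_space \<Rightarrow> 'b::{banach,second_countable_topology}"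
  assumes [measurable]: "f \<in> borel_measurable borel" and m: "m > 0"
  shows "(LINT y|lborel. f y) = (m ^ DIM('a)) *\<^sub>R (LINT y|lborel. f (m *\<^sub>R y))"
  using m by (subst lborel_affine[of m 0]) (auto simp: integral_density integral_distr)

lemma lborel_integrable_scale:
  fixes f :: "'a::euclidean_space \<Rightarrow> 'b::{banach,second_countable_topology}"
  assumes f: "integrable lborel f" and m: "m > 0"
  shows "integrable lborel (\<lambda>y. f (m *\<^sub>R y))"
proof -
  have [measurable]: "f \<in> borel_measurable borel" using borel_measurable_integrable[OF f] by simp
  have "integrable (density (distr lborel borel (\<lambda>x::'a. 0 + m *\<^sub>R x)) (\<lambda>_. ennreal (\<bar>m\<bar> ^ DIM('a)))) f"
    using lborel_affine[of m "0::'a"] f m by simp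
  then show ?thesis using m
    using integrable_scaleR_right[of "1 / m ^ DIM('a)" lborel "\<lambda>y. m ^ DIM('a) *\<^sub>R f (m *\<^sub>R y)"]
    by (subst (asm) integrable_density) (auto simp: integrable_distr_eq)
qed

subsection \<open>A smooth bump function\<close>

definition bumpf :: "real poly \<Rightarrow> nat \<Rightarrow> real \<Rightarrow> real" where
  "bumpf p k y = (if \<bar>y\<bar> < 1 then poly p y * (1 / (1 - y\<^sup>2)) ^ k * exp (- (1 / (1 - y\<^sup>2))) else 0)"

text \<open>\<open>bstep p k\<close> is the polynomial with \<open>(bumpf p k)' = bumpf (bstep p k) (k + 2)\<close>.\<close>

definition bstep :: "real poly \<Rightarrow> nat \<Rightarrow> real poly" where
  "bstep p k = pderiv p * [:1, 0, -1:]\<^sup>2 + smult (2 * real k) ([:0, 1:] * p * [:1, 0, -1:]) - smult 2 ([:0, 1:] * p)"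

lemma abs_less_one_sq: "\<bar>y\<bar> < 1 \<Longrightarrow> 1 - y\<^sup>2 > (0::real)"
  using abs_square_less_1 by fastforce

lemma bumpf_deriv_inside:
  assumes y: "\<bar>y\<bar> < 1"
  shows "(bumpf p k has_real_derivative bumpf (bstep p k) (k + 2) y) (at y)"
proof -
  let ?F = "\<lambda>y. poly p y * (1 / (1 - y\<^sup>2)) ^ k * exp (- (1 / (1 - y\<^sup>2)))"
  define w where "w = 1 / (1 - y\<^sup>2)"
  have pos: "1 - y\<^sup>2 > 0" using y by (rule abs_less_one_sq)
  have ww: "(1 - y\<^sup>2) * w = 1" using pos by (simp add: w_def)
  have Dw: "((\<lambda>y. 1 / (1 - y\<^sup>2)) has_real_derivative 2 * y * w\<^sup>2) (at y)"
    unfolding w_def using pos by (auto intro!: derivative_eq_intros simp: power2_eq_square field_simps)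
  have Dk: "((\<lambda>y. (1 / (1 - y\<^sup>2)) ^ k) has_real_derivative real k * w ^ (k + 1) * (2 * y)) (at y)"
  proof (cases k)
    case (Suc j)
    show ?thesis
      by (rule DERIV_cong[OF DERIV_power[OF Dw, of k]], simp only: w_def[symmetric])
        (simp add: Suc power2_eq_square algebra_simps)
  qed simp
  have "(?F has_real_derivative
      (poly (pderiv p) y * w ^ k + real k * w ^ (k + 1) * (2 * y) * poly p y) * exp (- w) + exp (- w) * (- (2 * y * w\<^sup>2)) * (poly p y * w ^ k)) (at y)"
    using DERIV_mult[OF DERIV_mult[OF poly_DERIV Dk] DERIV_fun_exp[OF DERIV_minus[OF Dw]]]
    by (simp add: w_def[symmetric])
  also have "(poly (pderiv p) y * w ^ k + real k * w ^ (k + 1) * (2 * y) * poly p y) * exp (- w) + exp (- w) * (- (2 * y * w\<^sup>2)) * (poly p y * w ^ k)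
     = bumpf (bstep p k) (k + 2) y"
  proof -
    have q: "poly (bstep p k) y = poly (pderiv p) y * (1 - y\<^sup>2)\<^sup>2 + 2 * real k * y * poly p y * (1 - y\<^sup>2) - 2 * y * poly p y"
      by (simp add: bstep_def power2_eq_square algebra_simps)
    have a: "(1 - y\<^sup>2)\<^sup>2 * w ^ (k + 2) = w ^ k" 
    proof -
      have "(1 - y\<^sup>2)\<^sup>2 * w ^ (k + 2) = ((1 - y\<^sup>2) * w)\<^sup>2 * w ^ k"
        by (simp only: power_add power_mult_distrib mult_ac)
      then show ?thesis by (simp add: ww)
    qed
    have b: "(1 - y\<^sup>2) * w ^ (k + 2) = w ^ (k + 1)" 
    proof -
      have "(1 - y\<^sup>2) * w ^ (k + 2) = ((1 - y\<^sup>2) * w) * w ^ (k + 1)"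
        by (simp add: power2_eq_square)
      then show ?thesis by (simp add: ww)
    qed
    have "bumpf (bstep p k) (k + 2) y = poly (bstep p k) y * w ^ (k + 2) * exp (- w)"
      using y by (simp add: bumpf_def w_def)
    also have "\<dots> = (poly (pderiv p) y * ((1 - y\<^sup>2)\<^sup>2 * w ^ (k + 2)) + 2 * real k * y * poly p y * ((1 - y\<^sup>2) * w ^ (k + 2)) - 2 * y * poly p y * w ^ (k + 2)) * exp (- w)"
      unfolding q by (simp add: algebra_simps)
    finally show ?thesis unfolding a b by (simp add: power_add power2_eq_square algebra_simps)
  qed
  finally have "(?F has_real_derivative bumpf (bstep p k) (k + 2) y) (at y)" .
  then show ?thesis
    by (rule has_field_derivative_transform_within_open[where S="{-1<..<1}"]) (use y in \<open>auto simp: bumpf_def\<close>)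
qed

lemma power_le_fact_exp: "x \<ge> 0 \<Longrightarrow> x ^ n \<le> fact n * exp (x::real)"
proof -
  assume x: "x \<ge> 0"
  have s: "summable (\<lambda>n. x ^ n /\<^sub>R fact n)" by (rule summable_exp_generic)
  have "x ^ n /\<^sub>R fact n \<le> (\<Sum>k\<in>{n}. x ^ k /\<^sub>R fact k)" by simp
  also have "\<dots> \<le> exp x"
    unfolding exp_def by (rule sum_le_suminf[OF s]) (use x in auto)
  finally show ?thesis by (simp add: field_simps)
qed

lemma bumpf_bound:
  assumes "\<bar>y\<bar> < 1"
  shows "\<bar>bumpf p k y\<bar> \<le> \<bar>poly p y\<bar> * fact (k + 2) * (1 - y\<^sup>2)\<^sup>2"
proof -
  define w where "w = 1 / (1 - y\<^sup>2)"
  have pos: "1 - y\<^sup>2 > 0" using assms by (rule abs_less_one_sq)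
  then have w: "w > 0" and ww: "1 - y\<^sup>2 = 1 / w" by (auto simp: w_def)
  have "w ^ (k + 2) * exp (- w) \<le> fact (k + 2)"
    using power_le_fact_exp[of w "k+2"] w by (simp add: exp_minus field_simps)
  then have "w ^ k * exp (- w) \<le> fact (k + 2) * (1 / w)\<^sup>2"
    using w by (simp add: power_add power_divide field_simps power2_eq_square)
  then have "\<bar>poly p y\<bar> * (w ^ k * exp (- w)) \<le> \<bar>poly p y\<bar> * (fact (k + 2) * (1 / w)\<^sup>2)"
    by (rule mult_left_mono) simp
  then show ?thesis
    using assms w unfolding ww by (simp add: bumpf_def ww abs_mult mult_ac power_abs)
qed

lemma bumpf_deriv:
  "(bumpf p k has_real_derivative bumpf (bstep p k) (k + 2) y) (at y)"
proof -
  consider "\<bar>y\<bar> < 1" | "\<bar>y\<bar> > 1" | "\<bar>y\<bar> = 1" by linarith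
  then show ?thesis
  proof cases
    case 1 then show ?thesis by (rule bumpf_deriv_inside)
  next
    case 2
    have "((\<lambda>_. 0) has_real_derivative 0) (at y)" by simp
    then have "(bumpf p k has_real_derivative 0) (at y)"
      by (rule has_field_derivative_transform_within_open[where S="- {-1..1}"]) (use 2 in \<open>auto simp: bumpf_def\<close>)
    then show ?thesis using 2 by (simp add: bumpf_def)
  next
    case 3
    have y2: "y\<^sup>2 = 1" using 3 by (metis power2_abs one_power2)
    have "compact (poly p ` {-2..2})" by (intro compact_continuous_image continuous_intros) auto
    then have "bounded (poly p ` {-2..2})" by (rule compact_imp_bounded)
    then obtain K where "\<forall>x\<in>poly p ` {-2..2}. norm x \<le> K"
      by (auto simp only: bounded_iff)
    then have K: "\<And>z. z \<in> {-2..2} \<Longrightarrow> \<bar>poly p z\<bar> \<le> K" by auto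
    have K0: "K \<ge> 0" using K[of 0] by simp
    have bd: "\<bar>bumpf p k z\<bar> \<le> (K * fact (k + 2) * 9) * \<bar>z - y\<bar>\<^sup>2" if z: "\<bar>z - y\<bar> < 1" for z
    proof (cases "\<bar>z\<bar> < 1")
      case True
      have "1 - z\<^sup>2 = (y - z) * (y + z)" using y2 by (simp add: algebra_simps power2_eq_square)
      then have "(1 - z\<^sup>2)\<^sup>2 = \<bar>z - y\<bar>\<^sup>2 * \<bar>y + z\<bar>\<^sup>2"
        by (simp add: power_mult_distrib power2_commute)
      also have "\<dots> \<le> \<bar>z - y\<bar>\<^sup>2 * 3\<^sup>2"
        by (intro mult_left_mono power_mono) (use True 3 in auto)
      finally have a: "(1 - z\<^sup>2)\<^sup>2 \<le> \<bar>z - y\<bar>\<^sup>2 * 9" by simp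
      have "\<bar>bumpf p k z\<bar> \<le> \<bar>poly p z\<bar> * fact (k + 2) * (1 - z\<^sup>2)\<^sup>2" by (rule bumpf_bound[OF True])
      also have "\<dots> \<le> K * fact (k + 2) * (\<bar>z - y\<bar>\<^sup>2 * 9)"
        by (intro mult_mono K) (use True K0 a in auto)
      finally show ?thesis by (simp only: mult_ac)
    qed (use K0 in \<open>simp add: bumpf_def\<close>)
    have "((\<lambda>z. (bumpf p k z - bumpf p k y) / (z - y)) \<longlongrightarrow> 0) (at y)"
    proof (rule Lim_null_comparison)
      show "((\<lambda>z. (K * fact (k + 2) * 9) * \<bar>z - y\<bar>) \<longlongrightarrow> 0) (at y)"
        by (auto intro!: tendsto_eq_intros)
      have "eventually (\<lambda>z. dist z y < 1) (at y)" unfolding eventually_at by (rule exI[of _ 1]) auto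
      then show "\<forall>\<^sub>F z in at y. norm ((bumpf p k z - bumpf p k y) / (z - y)) \<le> (K * fact (k + 2) * 9) * \<bar>z - y\<bar>"
        using eventually_neq_at_within[of y y UNIV]
      proof eventually_elim
        case (elim z)
        have "bumpf p k y = 0" using 3 by (simp add: bumpf_def)
        moreover have "\<bar>bumpf p k z\<bar> \<le> (K * fact (k + 2) * 9) * \<bar>z - y\<bar> * \<bar>z - y\<bar>"
          using bd[of z] elim by (simp add: dist_real_def power2_eq_square mult_ac)
        ultimately show ?case using elim by (simp add: field_simps)
      qed
    qed
    then have "(bumpf p k has_real_derivative 0) (at y)"
      by (simp add: has_field_derivative_iff)
    then show ?thesis using 3 by (simp add: bumpf_def)
  qed
qed

primrec bumpP :: "real poly \<Rightarrow> nat \<Rightarrow> real poly" where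
  "bumpP p 0 = p"
| "bumpP p (Suc n) = bstep (bumpP p n) (2 * n)"

definition bumpD :: "real poly \<Rightarrow> nat \<Rightarrow> real \<Rightarrow> real" where
  "bumpD p n = bumpf (bumpP p n) (2 * n)"

lemma bumpD_deriv: "(bumpD p n has_real_derivative bumpD p (Suc n) y) (at y)"
  using bumpf_deriv[of "bumpP p n" "2 * n" y] by (simp add: bumpD_def)

lemma bumpD_continuous: "continuous_on A (bumpD p n)"
  by (meson DERIV_isCont bumpD_deriv continuous_at_imp_continuous_on)

lemma bumpD_support: "\<bar>y\<bar> \<ge> 1 \<Longrightarrow> bumpD p n y = 0"
  by (simp add: bumpD_def bumpf_def)

lemma bumpD_integrable: "integrable lborel (bumpD p n)"
proof -
  have "set_integrable lborel {-1..1} (bumpD p n)"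
    by (rule borel_integrable_atLeastAtMost'[OF bumpD_continuous])
  also have "set_integrable lborel {-1..1} (bumpD p n) \<longleftrightarrow> integrable lborel (bumpD p n)"
    unfolding set_integrable_def
  proof (intro Bochner_Integration.integrable_cong refl)
    show "indicat_real {-1..1} x *\<^sub>R bumpD p n x = bumpD p n x" for x
      using bumpD_support[of x p n] by (cases "\<bar>x\<bar> < 1") (auto simp: indicator_def)
  qed
  finally show ?thesis .
qed

definition ft1 :: "(real \<Rightarrow> real) \<Rightarrow> real \<Rightarrow> complex" where
  "ft1 g \<xi> = (LINT x|lborel. cis (- (x * \<xi>)) * of_real (g x))"

lemma ft1_integrable: "integrable lborel g \<Longrightarrow> integrable lborel (\<lambda>x. cis (- (x * \<xi>)) * of_real (g x))"
  by (rule Bochner_Integration.integrable_bound[of _ g]) (auto simp: norm_mult)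

lemma ft1_bumpD_Suc: "ft1 (bumpD p (Suc n)) \<xi> = \<i> * of_real \<xi> * ft1 (bumpD p n) \<xi>"
proof -
  let ?F = "\<lambda>x. cis (- (x * \<xi>)) * of_real (bumpD p n x)"
  let ?f = "\<lambda>x. cis (- (x * \<xi>)) * of_real (bumpD p (Suc n) x) - \<i> * of_real \<xi> * (cis (- (x * \<xi>)) * of_real (bumpD p n x))"
  have D: "(?F has_vector_derivative ?f x) (at x within S)" for x S
  proof -
    have c: "((\<lambda>x. cis (- (x * \<xi>))) has_vector_derivative - (\<i> * of_real \<xi> * cis (- (x * \<xi>)))) (at x within S)"
      unfolding has_vector_derivative_def
      by (auto intro!: derivative_eq_intros simp: scaleR_conv_of_real)
    have b: "((\<lambda>x. complex_of_real (bumpD p n x)) has_vector_derivative of_real (bumpD p (Suc n) x)) (at x within S)"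
      using bumpD_deriv[of p n x] by (intro has_vector_derivative_of_real)
       (auto simp: has_real_derivative_iff_has_vector_derivative intro: has_vector_derivative_at_within)
    show ?thesis
      using has_vector_derivative_mult[OF c b] by (simp add: algebra_simps)
  qed
  have "(LINT x|lborel. indicator {-1..1} x *\<^sub>R ?f x) = ?F 1 - ?F (-1)"
    by (rule integral_FTC_atLeastAtMost) (auto intro!: D continuous_intros continuous_on_of_real bumpD_continuous)
  also have "\<dots> = 0" by (simp add: bumpD_support)
  also have "(LINT x|lborel. indicator {-1..1} x *\<^sub>R ?f x) = (LINT x|lborel. ?f x)"
    by (intro Bochner_Integration.integral_cong) (auto simp: indicator_def bumpD_support)
  also have "\<dots> = ft1 (bumpD p (Suc n)) \<xi> - \<i> * of_real \<xi> * ft1 (bumpD p n) \<xi>"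
    unfolding ft1_def by (subst Bochner_Integration.integral_diff)
      (auto intro!: ft1_integrable bumpD_integrable integrable_mult_right)
  finally show ?thesis by simp
qed

lemma ft1_bound: "cmod (ft1 g \<xi>) \<le> (LINT x|lborel. \<bar>g x\<bar>)"
  unfolding ft1_def by (rule order_trans[OF integral_norm_bound]) (simp add: norm_mult)

lemma ft1_bumpD_power: "ft1 (bumpD p n) \<xi> = (\<i> * of_real \<xi>) ^ n * ft1 (bumpD p 0) \<xi>"
  by (induction n) (auto simp: ft1_bumpD_Suc)

lemma one_plus_power_le: "(1 + a) ^ m \<le> 2 ^ m * (1 + a ^ m)" if "a \<ge> 0" for a :: real
proof (cases "a \<le> 1")
  case True
  then have "(1 + a) ^ m \<le> 2 ^ m" using that by (intro power_mono) auto
  also have "\<dots> \<le> 2 ^ m * (1 + a ^ m)" using that by simp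
  finally show ?thesis .
next
  case False
  then have "(1 + a) ^ m \<le> (2 * a) ^ m" using that by (intro power_mono) auto
  also have "\<dots> \<le> 2 ^ m * (1 + a ^ m)" by (simp add: power_mult_distrib)
  finally show ?thesis .
qed

lemma ft1_bump_decay: "\<exists>C\<ge>0. \<forall>\<xi>. (1 + \<xi>\<^sup>2) ^ m * cmod (ft1 (bumpD p 0) \<xi>) \<le> C"
proof -
  let ?B = "\<lambda>n. (LINT x|lborel. \<bar>bumpD p n x\<bar>)"
  have "(1 + \<xi>\<^sup>2) ^ m * cmod (ft1 (bumpD p 0) \<xi>) \<le> 2 ^ m * (?B 0 + ?B (2 * m))" for \<xi>
  proof -
    have "(1 + \<xi>\<^sup>2) ^ m * cmod (ft1 (bumpD p 0) \<xi>) \<le> 2 ^ m * (1 + (\<xi>\<^sup>2) ^ m) * cmod (ft1 (bumpD p 0) \<xi>)"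
      by (intro mult_right_mono one_plus_power_le) auto
    also have "\<dots> = 2 ^ m * (cmod (ft1 (bumpD p 0) \<xi>) + cmod (ft1 (bumpD p (2 * m)) \<xi>))"
    proof -
      have "cmod ((\<i> * complex_of_real \<xi>) ^ (2 * m)) = (\<xi>\<^sup>2) ^ m"
        by (simp add: norm_mult norm_power power_mult)
      then show ?thesis
        unfolding ft1_bumpD_power[of p "2 * m"] norm_mult by (simp only: distrib_left distrib_right mult_1_left mult.assoc)
    qed
    also have "\<dots> \<le> 2 ^ m * (?B 0 + ?B (2 * m))"
      by (intro mult_left_mono add_mono ft1_bound) auto
    finally show ?thesis .
  qed
  moreover have "0 \<le> 2 ^ m * (?B 0 + ?B (2 * m))" by (simp add: integral_nonneg_AE)
  ultimately show ?thesis by blast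
qed

subsection \<open>The initial data\<close>

definition reflect :: "'a::euclidean_space \<Rightarrow> 'a \<Rightarrow> 'a" where
  "reflect e x = x - (2 * (x \<bullet> e)) *\<^sub>R e"

definition bump :: "'a::euclidean_space \<Rightarrow> 'a \<Rightarrow> real" where
  "bump e x = (\<Prod>b\<in>Basis. bumpD (if b = e then [:0, 1:] else 1) 0 (x \<bullet> b))"

lemma reflect_inner: "e \<in> Basis \<Longrightarrow> b \<in> Basis \<Longrightarrow> reflect e x \<bullet> b = (if b = e then - (x \<bullet> b) else x \<bullet> b)"
  by (auto simp: reflect_def inner_diff_left inner_Basis)

lemma bumpD_0_one: "bumpD 1 0 y = (if \<bar>y\<bar> < 1 then exp (- (1 / (1 - y\<^sup>2))) else 0)"
  by (simp add: bumpD_def bumpf_def)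

lemma bumpD_0_id: "bumpD [:0, 1:] 0 y = y * bumpD 1 0 y"
  by (simp add: bumpD_def bumpf_def)

lemma bump_alt: "e \<in> Basis \<Longrightarrow> bump e x = (x \<bullet> e) * (\<Prod>b\<in>Basis. bumpD 1 0 (x \<bullet> b))"
proof -
  assume e: "e \<in> Basis"
  have "bump e x = (\<Prod>b\<in>Basis. (if b = e then x \<bullet> b else 1) * bumpD 1 0 (x \<bullet> b))"
    unfolding bump_def by (intro prod.cong) (auto simp: bumpD_0_id)
  also have "\<dots> = (x \<bullet> e) * (\<Prod>b\<in>Basis. bumpD 1 0 (x \<bullet> b))"
    using e by (simp add: prod.distrib)
  finally show ?thesis .
qed

lemma bump_reflect: "e \<in> Basis \<Longrightarrow> bump e (reflect e x) = - bump e x"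
proof -
  assume e: "e \<in> Basis"
  have "(\<Prod>b\<in>Basis. bumpD 1 0 (reflect e x \<bullet> b)) = (\<Prod>b\<in>Basis. bumpD 1 0 (x \<bullet> b))"
    by (intro prod.cong) (auto simp: reflect_inner e bumpD_0_one)
  then show ?thesis using e by (simp add: bump_alt reflect_inner)
qed

lemma bump_nonneg: "e \<in> Basis \<Longrightarrow> x \<bullet> e \<ge> 0 \<Longrightarrow> bump e x \<ge> 0"
  by (auto simp: bump_alt bumpD_0_one intro!: mult_nonneg_nonneg prod_nonneg)

lemma bump_pos: "e \<in> Basis \<Longrightarrow> x \<bullet> e > 0 \<Longrightarrow> (\<And>b. b \<in> Basis \<Longrightarrow> \<bar>x \<bullet> b\<bar> < 1) \<Longrightarrow> bump e x > 0"
  by (auto simp: bump_alt bumpD_0_one intro!: mult_pos_pos prod_pos)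

lemma bump_support: "norm x > DIM('a) \<Longrightarrow> bump e (x::'a::euclidean_space) = 0"
proof -
  assume x: "norm x > DIM('a)"
  have "\<exists>b\<in>Basis. \<bar>x \<bullet> b\<bar> > 1"
  proof (rule ccontr)
    assume "\<not> ?thesis"
    then have "(\<Sum>b\<in>Basis. \<bar>x \<bullet> b\<bar>) \<le> (\<Sum>b::'a\<in>Basis. 1)" by (intro sum_mono) force
    then show False using x norm_le_l1[of x] by simp
  qed
  then obtain b where b: "b \<in> Basis" "\<bar>x \<bullet> b\<bar> > 1" by blast
  then have "bumpD (if b = e then [:0, 1:] else 1) 0 (x \<bullet> b) = 0" by (intro bumpD_support) auto
  then show ?thesis unfolding bump_def by (intro prod_zero finite_Basis bexI[OF _ b(1)])
qed

lemma bump_continuous: "continuous_on A (bump e)"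
proof -
  have "continuous_on A (\<lambda>x. bumpD p 0 (x \<bullet> b))" for p b
    by (rule continuous_on_compose2[OF bumpD_continuous[of UNIV]]) (auto intro!: continuous_intros)
  then show ?thesis unfolding bump_def[abs_def] by (intro continuous_on_prod)
qed

lemma bump_measurable [measurable]: "bump e \<in> borel_measurable borel"
  by (rule borel_measurable_continuous_onI[OF bump_continuous])

lemma bump_integrable: "integrable lborel (bump e)"
  unfolding bump_def[abs_def] by (rule integrable_lborel_prod) (rule bumpD_integrable)

lemma bump_bounded: "\<exists>K\<ge>0. \<forall>x::'a::euclidean_space. \<bar>bump e x\<bar> \<le> K"
proof -
  have "compact (bump e ` cball 0 (DIM('a)))"
    by (intro compact_continuous_image bump_continuous) auto
  then have "bounded (bump e ` cball 0 (DIM('a)))" by (rule compact_imp_bounded)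
  then obtain K where "\<forall>y\<in>bump e ` cball 0 (DIM('a)). norm y \<le> K"
    by (auto simp only: bounded_iff)
  then have K: "\<And>x::'a. norm x \<le> DIM('a) \<Longrightarrow> \<bar>bump e x\<bar> \<le> K" by auto
  have "\<bar>bump e x\<bar> \<le> max K 0" for x :: 'a
    using K[of x] bump_support[of x e] by (cases "norm x \<le> DIM('a)") auto
  then show ?thesis by (intro exI[of _ "max K 0"]) auto
qed

lemma bump_sq_integrable: "integrable lborel (\<lambda>x. (bump e x)\<^sup>2)"
proof -
  obtain K where K: "K \<ge> 0" "\<And>x. \<bar>bump e x\<bar> \<le> K" using bump_bounded by blast
  show ?thesis
  proof (rule Bochner_Integration.integrable_bound[OF integrable_mult_right[OF bump_integrable, of "K" e]])
    have "\<bar>bump e x\<bar> * \<bar>bump e x\<bar> \<le> K * \<bar>bump e x\<bar>" for x by (intro mult_right_mono K) auto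
    then show "AE x in lborel. norm ((bump e x)\<^sup>2) \<le> norm (K * bump e x)"
      using K(1) by (auto simp: abs_mult power2_eq_square)
  qed measurable
qed

lemma C_diff_bump_product:
  fixes pp :: "(real^'n) \<Rightarrow> real poly" and m :: "(real^'n) \<Rightarrow> nat"
  shows "C_diff k (\<lambda>x. complex_of_real (A * (\<Prod>b\<in>Basis. bumpD (pp b) (m b) ((\<mu> *\<^sub>R x) \<bullet> b))))"
proof (induction k arbitrary: A m)
  case 0
  have "continuous_on UNIV (\<lambda>x::real^'n. bumpD p j ((\<mu> *\<^sub>R x) \<bullet> b))" for p j b
    by (rule continuous_on_compose2[OF bumpD_continuous[of UNIV]]) (auto intro!: continuous_intros)
  then show ?case by (auto intro!: continuous_intros continuous_on_of_real continuous_on_prod)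
next
  case (Suc k)
  let ?f = "\<lambda>x::real^'n. complex_of_real (A * (\<Prod>b\<in>Basis. bumpD (pp b) (m b) ((\<mu> *\<^sub>R x) \<bullet> b)))"
  let ?g = "\<lambda>(x::real^'n) b. bumpD (pp b) (m b) ((\<mu> *\<^sub>R x) \<bullet> b)"
  let ?d = "\<lambda>x y. complex_of_real (A * (\<Sum>b\<in>Basis. (bumpD (pp b) (Suc (m b)) ((\<mu> *\<^sub>R x) \<bullet> b) * (\<mu> * (y \<bullet> b))) * (\<Prod>j\<in>Basis - {b}. ?g x j)))"
  have D: "(?f has_derivative ?d x) (at x)" for x
  proof -
    have b: "((\<lambda>x. ?g x b) has_derivative (\<lambda>y. bumpD (pp b) (Suc (m b)) ((\<mu> *\<^sub>R x) \<bullet> b) * (\<mu> * (y \<bullet> b)))) (at x)" for b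
    proof -
      have "((\<lambda>x. (\<mu> *\<^sub>R x) \<bullet> b) has_derivative (\<lambda>y. \<mu> * (y \<bullet> b))) (at x)"
        by (auto intro!: derivative_eq_intros)
      from has_derivative_compose[OF this bumpD_deriv[unfolded has_field_derivative_def]]
      show ?thesis .
    qed
    have "((\<lambda>x. \<Prod>b\<in>Basis. ?g x b) has_derivative (\<lambda>y. \<Sum>b\<in>Basis. (bumpD (pp b) (Suc (m b)) ((\<mu> *\<^sub>R x) \<bullet> b) * (\<mu> * (y \<bullet> b))) * (\<Prod>j\<in>Basis - {b}. ?g x j))) (at x)"
      by (rule has_derivative_prod[OF b])
    then show ?thesis
      by (intro has_derivative_of_real has_derivative_mult_right)
  qed
  have fd: "frechet_derivative ?f (at x) = ?d x" for x
    using frechet_derivative_at[OF D] by simp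
  have "frechet_derivative ?f (at x) (axis i 1) = complex_of_real ((A * \<mu>) * (\<Prod>b\<in>Basis. bumpD (pp b) ((m(axis i 1 := Suc (m (axis i 1)))) b) ((\<mu> *\<^sub>R x) \<bullet> b)))" for x i
  proof -
    let ?c = "axis i 1 :: real^'n"
    have c: "?c \<in> Basis" by (simp add: axis_in_Basis_iff)
    have "(\<Sum>b\<in>Basis. (bumpD (pp b) (Suc (m b)) ((\<mu> *\<^sub>R x) \<bullet> b) * (\<mu> * (?c \<bullet> b))) * (\<Prod>j\<in>Basis - {b}. ?g x j)) =
      (\<Sum>b\<in>Basis. if b = ?c then (bumpD (pp b) (Suc (m b)) ((\<mu> *\<^sub>R x) \<bullet> b) * \<mu>) * (\<Prod>j\<in>Basis - {b}. ?g x j) else 0)"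
      using c by (intro sum.cong) (auto simp: inner_Basis)
    also have "\<dots> = (bumpD (pp ?c) (Suc (m ?c)) ((\<mu> *\<^sub>R x) \<bullet> ?c) * \<mu>) * (\<Prod>j\<in>Basis - {?c}. ?g x j)"
      using c by simp
    also have "(\<Prod>j\<in>Basis - {?c}. ?g x j) = (\<Prod>b\<in>Basis - {?c}. bumpD (pp b) ((m(?c := Suc (m ?c))) b) ((\<mu> *\<^sub>R x) \<bullet> b))"
      by (intro prod.cong) auto
    also have "(bumpD (pp ?c) (Suc (m ?c)) ((\<mu> *\<^sub>R x) \<bullet> ?c) * \<mu>) * \<dots> = \<mu> * (\<Prod>b\<in>Basis. bumpD (pp b) ((m(?c := Suc (m ?c))) b) ((\<mu> *\<^sub>R x) \<bullet> b))"
      using c by (subst prod.remove[of Basis ?c]) (auto simp: mult_ac)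
    finally show ?thesis unfolding fd by (simp add: mult_ac)
  qed
  then have "C_diff k (\<lambda>x. frechet_derivative ?f (at x) (axis i 1))" for i
    using Suc.IH[of "A * \<mu>" "m(axis i 1 := Suc (m (axis i 1)))"] by simp
  moreover have "?f differentiable_on UNIV"
    using D by (auto simp: differentiable_on_def differentiable_def)
  ultimately show ?case by simp
qed

lemma bump_Cc_infty:
  assumes m: "\<mu> \<ge> 1"
  shows "(\<lambda>x::real^'n. complex_of_real (A * bump e (\<mu> *\<^sub>R x))) \<in> Cc_infty"
proof -
  have "{x::real^'n. complex_of_real (A * bump e (\<mu> *\<^sub>R x)) \<noteq> 0} \<subseteq> cball 0 CARD('n)"
  proof clarify
    fix x :: "real^'n" assume "complex_of_real (A * bump e (\<mu> *\<^sub>R x)) \<noteq> 0"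
    then have "norm (\<mu> *\<^sub>R x) \<le> CARD('n)" using bump_support[of "\<mu> *\<^sub>R x" e] by force
    moreover have "norm x \<le> norm (\<mu> *\<^sub>R x)" using m mult_right_mono[of 1 \<mu> "norm x"] by simp
    ultimately show "x \<in> cball 0 CARD('n)" by simp
  qed
  then have "compact (closure {x::real^'n. complex_of_real (A * bump e (\<mu> *\<^sub>R x)) \<noteq> 0})"
    using bounded_subset bounded_cball compact_closure by blast
  moreover have "C_diff k (\<lambda>x::real^'n. complex_of_real (A * bump e (\<mu> *\<^sub>R x)))" for k
    unfolding bump_def using C_diff_bump_product[of k A "\<lambda>b. if b = e then [:0, 1:] else 1" "\<lambda>_. 0" \<mu>] by simp
  ultimately show ?thesis by (simp add: Cc_infty_def)
qed

lemma inverse_one_plus_sq_integrable: "integrable lborel (\<lambda>x::real. 1 / (1 + x\<^sup>2))"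
  using integrable_inverse_1_plus_square by (simp add: set_integrable_def inverse_eq_divide)

lemma one_plus_norm_sq_le_prod: "1 + (norm x)\<^sup>2 \<le> (\<Prod>b\<in>Basis. 1 + (x \<bullet> b)\<^sup>2)" for x :: "'a::euclidean_space"
proof -
  have "1 + (\<Sum>b\<in>B. (x \<bullet> b)\<^sup>2) \<le> (\<Prod>b\<in>B. 1 + (x \<bullet> b)\<^sup>2)" if "finite B" for B
    using that
  proof (induction B rule: finite_induct)
    case (insert a B)
    have "1 + (x \<bullet> a)\<^sup>2 + (\<Sum>b\<in>B. (x \<bullet> b)\<^sup>2) \<le> (1 + (x \<bullet> a)\<^sup>2) * (1 + (\<Sum>b\<in>B. (x \<bullet> b)\<^sup>2))"
      by (simp add: algebra_simps sum_nonneg)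
    also have "\<dots> \<le> (1 + (x \<bullet> a)\<^sup>2) * (\<Prod>b\<in>B. 1 + (x \<bullet> b)\<^sup>2)"
      by (intro mult_left_mono insert.IH) auto
    finally show ?case using insert by (simp add: add.assoc)
  qed simp
  from this[of Basis] show ?thesis by (simp add: norm_sq_basis)
qed

definition bump_ft :: "'a::euclidean_space \<Rightarrow> 'a \<Rightarrow> complex" where
  "bump_ft e \<xi> = (LINT x|lborel. cis (- (x \<bullet> \<xi>)) * of_real (bump e x))"

lemma bump_ft_measurable [measurable]: "bump_ft e \<in> borel_measurable borel"
  unfolding bump_ft_def[abs_def] by measurable

lemma bump_ft_prod: "bump_ft e \<xi> = (\<Prod>b\<in>Basis. ft1 (bumpD (if b = e then [:0, 1:] else 1) 0) (\<xi> \<bullet> b))"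
proof -
  have "bump_ft e \<xi> = (LINT x|lborel. (\<Prod>b\<in>Basis. cis (- ((x \<bullet> b) * (\<xi> \<bullet> b))) * of_real (bumpD (if b = e then [:0, 1:] else 1) 0 (x \<bullet> b))))"
    unfolding bump_ft_def bump_def cis_inner_prod of_real_prod prod.distrib ..
  also have "\<dots> = (\<Prod>b\<in>Basis. ft1 (bumpD (if b = e then [:0, 1:] else 1) 0) (\<xi> \<bullet> b))"
    unfolding ft1_def by (rule integral_lborel_prod) (rule ft1_integrable[OF bumpD_integrable])
  finally show ?thesis .
qed

lemma bump_ft_decay:
  assumes s: "s \<ge> 0"
  shows "\<exists>K\<ge>0. \<forall>\<xi>::'a::euclidean_space. (1 + (norm \<xi>)\<^sup>2) powr (s / 2) * cmod (bump_ft e \<xi>) \<le> K * (\<Prod>b\<in>Basis. 1 / (1 + (\<xi> \<bullet> b)\<^sup>2))"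
proof -
  obtain m where m: "s / 2 \<le> real m" using real_arch_simple by blast
  let ?p = "\<lambda>b. if b = e then [:0, 1:] else 1"
  have "\<exists>C. \<forall>b. C b \<ge> 0 \<and> (\<forall>\<xi>. (1 + \<xi>\<^sup>2) ^ (m + 1) * cmod (ft1 (bumpD (?p b) 0) \<xi>) \<le> C b)"
    using ft1_bump_decay[of "m + 1"] by (intro choice allI) metis
  then obtain C where C: "\<And>b::'a. C b \<ge> 0" "\<And>b \<xi>. (1 + \<xi>\<^sup>2) ^ (m + 1) * cmod (ft1 (bumpD (?p b) 0) \<xi>) \<le> C b" by blast
  have "(1 + (norm \<xi>)\<^sup>2) powr (s / 2) * cmod (bump_ft e \<xi>) \<le> (\<Prod>b\<in>Basis. C b) * (\<Prod>b\<in>Basis. 1 / (1 + (\<xi> \<bullet> b)\<^sup>2))" for \<xi> :: 'a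
  proof -
    have "(1 + (norm \<xi>)\<^sup>2) powr (s / 2) \<le> (1 + (norm \<xi>)\<^sup>2) powr (real m)"
      using m by (intro powr_mono) auto
    also have "\<dots> = (1 + (norm \<xi>)\<^sup>2) ^ m" 
      by (rule powr_realpow) (simp add: add_pos_nonneg)
    also have "\<dots> \<le> (\<Prod>b\<in>Basis. 1 + (\<xi> \<bullet> b)\<^sup>2) ^ m"
      by (intro power_mono one_plus_norm_sq_le_prod) auto
    finally have "(1 + (norm \<xi>)\<^sup>2) powr (s / 2) * cmod (bump_ft e \<xi>) \<le> (\<Prod>b\<in>Basis. 1 + (\<xi> \<bullet> b)\<^sup>2) ^ m * cmod (bump_ft e \<xi>)"
      by (rule mult_right_mono) simp
    also have "\<dots> = (\<Prod>b\<in>Basis. (1 + (\<xi> \<bullet> b)\<^sup>2) ^ m * cmod (ft1 (bumpD (?p b) 0) (\<xi> \<bullet> b)))"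
      by (simp add: bump_ft_prod prod_norm[symmetric] prod.distrib prod_power_distrib)
    also have "\<dots> \<le> (\<Prod>b\<in>Basis. C b * (1 / (1 + (\<xi> \<bullet> b)\<^sup>2)))"
    proof (intro prod_mono conjI)
      fix b :: 'a
      have p: "1 + (\<xi> \<bullet> b)\<^sup>2 > 0" by (simp add: add_pos_nonneg)
      show "(1 + (\<xi> \<bullet> b)\<^sup>2) ^ m * cmod (ft1 (bumpD (?p b) 0) (\<xi> \<bullet> b)) \<le> C b * (1 / (1 + (\<xi> \<bullet> b)\<^sup>2))"
        using C(2)[of "\<xi> \<bullet> b" b] p by (simp add: field_simps)
    qed auto
    finally show ?thesis unfolding prod.distrib .
  qed
  moreover have "(\<Prod>b\<in>Basis. C b) \<ge> 0" by (intro prod_nonneg C)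
  ultimately show ?thesis by blast
qed

lemma bump_Hs_norm:
  assumes s: "s \<ge> 0"
  shows "\<exists>C\<ge>0. \<forall>A \<mu>. \<mu> \<ge> 1 \<longrightarrow> Hs_norm s (\<lambda>x::real^'n. complex_of_real (A * bump e (\<mu> *\<^sub>R x))) \<le> C * \<bar>A\<bar> * \<mu> powr (s - CARD('n) / 2)"
proof -
  obtain K where K: "K \<ge> 0" "\<And>\<xi>::real^'n. (1 + (norm \<xi>)\<^sup>2) powr (s / 2) * cmod (bump_ft e \<xi>) \<le> K * (\<Prod>b\<in>Basis. 1 / (1 + (\<xi> \<bullet> b)\<^sup>2))"
    using bump_ft_decay[OF s] by blast
  define E where "E \<xi> = (\<Prod>b\<in>Basis. 1 / (1 + (\<xi> \<bullet> b)\<^sup>2))" for \<xi> :: "real^'n"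
  have Eint: "integrable lborel E"
    unfolding E_def by (rule integrable_lborel_prod) (rule inverse_one_plus_sq_integrable)
  have [measurable]: "E \<in> borel_measurable borel" using borel_measurable_integrable[OF Eint] by simp
  have E0: "0 \<le> E \<xi>" for \<xi> unfolding E_def by (intro prod_nonneg) (auto simp: add_nonneg_nonneg)
  have E1: "E \<xi> \<le> 1" for \<xi> unfolding E_def
    by (intro prod_le_1) (auto simp: add_nonneg_nonneg divide_le_eq_1 add_pos_nonneg)
  let ?N = "CARD('n)"
  define C where "C = sqrt (2 / (2 * pi) ^ ?N * (K\<^sup>2 * (LINT \<xi>|lborel. E \<xi>)))"
  have "Hs_norm s (\<lambda>x::real^'n. complex_of_real (A * bump e (\<mu> *\<^sub>R x))) \<le> C * \<bar>A\<bar> * \<mu> powr (s - ?N / 2)"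
    if mu: "\<mu> \<ge> 1" for A \<mu>
  proof -
    let ?f = "\<lambda>x::real^'n. complex_of_real (A * bump e (\<mu> *\<^sub>R x))"
    define fh where "fh \<xi> = (LINT x|lborel. cis (- (x \<bullet> \<xi>)) * ?f x)" for \<xi>
    have fh_eq: "fh \<xi> = of_real (A / \<mu> ^ ?N) * bump_ft e (\<xi> /\<^sub>R \<mu>)" for \<xi>
    proof -
      have "bump_ft e (\<xi> /\<^sub>R \<mu>) = \<mu> ^ ?N *\<^sub>R (LINT x|lborel. cis (- ((\<mu> *\<^sub>R x) \<bullet> (\<xi> /\<^sub>R \<mu>))) * of_real (bump e (\<mu> *\<^sub>R x)))"
        unfolding bump_ft_def using mu by (subst lborel_integral_scale[where m=\<mu>]) auto
      also have "(LINT x|lborel. cis (- ((\<mu> *\<^sub>R x) \<bullet> (\<xi> /\<^sub>R \<mu>))) * of_real (bump e (\<mu> *\<^sub>R x))) = (LINT x|lborel. cis (- (x \<bullet> \<xi>)) * complex_of_real (bump e (\<mu> *\<^sub>R x)))"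
      proof (intro Bochner_Integration.integral_cong refl)
        have "(\<mu> *\<^sub>R x) \<bullet> (\<xi> /\<^sub>R \<mu>) = x \<bullet> \<xi>" for x
          using mu by simp
        then show "cis (- ((\<mu> *\<^sub>R x) \<bullet> (\<xi> /\<^sub>R \<mu>))) * complex_of_real (bump e (\<mu> *\<^sub>R x)) = cis (- (x \<bullet> \<xi>)) * complex_of_real (bump e (\<mu> *\<^sub>R x))" for x
          by (simp only:)
      qed
      finally have *: "bump_ft e (\<xi> /\<^sub>R \<mu>) = \<mu> ^ ?N *\<^sub>R (LINT x|lborel. cis (- (x \<bullet> \<xi>)) * complex_of_real (bump e (\<mu> *\<^sub>R x)))" .
      have "fh \<xi> = (LINT x|lborel. of_real A * (cis (- (x \<bullet> \<xi>)) * complex_of_real (bump e (\<mu> *\<^sub>R x))))"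
        unfolding fh_def by (intro Bochner_Integration.integral_cong) auto
      also have "\<dots> = of_real A * (LINT x|lborel. cis (- (x \<bullet> \<xi>)) * complex_of_real (bump e (\<mu> *\<^sub>R x)))"
        by (rule integral_mult_right_zero)
      finally show ?thesis using mu unfolding * by (simp add: scaleR_conv_of_real)
    qed
    have fh_meas[measurable]: "fh \<in> borel_measurable borel"
      unfolding fh_eq[abs_def] by measurable
    define w where "w = (\<lambda>\<xi>. of_real ((1 + (norm \<xi>)\<^sup>2) powr (s / 2)) * fh \<xi>)"
    have [measurable]: "w \<in> borel_measurable borel" unfolding w_def by measurable
    let ?a = "\<bar>A\<bar> / \<mu> ^ ?N * \<mu> powr s * K"
    have w_le: "cmod (w \<xi>) \<le> ?a * E (\<xi> /\<^sub>R \<mu>)" for \<xi>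
    proof -
      have "1 + (norm \<xi>)\<^sup>2 \<le> \<mu>\<^sup>2 * (1 + (norm (\<xi> /\<^sub>R \<mu>))\<^sup>2)"
      proof -
        have "\<mu>\<^sup>2 * (norm (\<xi> /\<^sub>R \<mu>))\<^sup>2 = (norm \<xi>)\<^sup>2"
          using mu by (simp flip: power_mult_distrib)
        moreover have "1 \<le> \<mu>\<^sup>2" using mu by simp
        ultimately show ?thesis by (simp only: distrib_left)
      qed
      then have "(1 + (norm \<xi>)\<^sup>2) powr (s / 2) \<le> (\<mu>\<^sup>2 * (1 + (norm (\<xi> /\<^sub>R \<mu>))\<^sup>2)) powr (s / 2)"
        using s by (intro powr_mono2) auto
      also have "\<dots> = (\<mu>\<^sup>2) powr (s / 2) * (1 + (norm (\<xi> /\<^sub>R \<mu>))\<^sup>2) powr (s / 2)"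
        by (rule powr_mult)
      also have "(\<mu>\<^sup>2) powr (s / 2) = \<mu> powr s"
        using mu by (simp add: powr_powr flip: powr_numeral)
      finally have 1: "(1 + (norm \<xi>)\<^sup>2) powr (s / 2) \<le> \<mu> powr s * (1 + (norm (\<xi> /\<^sub>R \<mu>))\<^sup>2) powr (s / 2)" .
      have "cmod (w \<xi>) = (1 + (norm \<xi>)\<^sup>2) powr (s / 2) * (\<bar>A\<bar> / \<mu> ^ ?N * cmod (bump_ft e (\<xi> /\<^sub>R \<mu>)))"
        using mu by (simp add: w_def fh_eq norm_mult norm_divide norm_power)
      also have "\<dots> \<le> (\<mu> powr s * (1 + (norm (\<xi> /\<^sub>R \<mu>))\<^sup>2) powr (s / 2)) * (\<bar>A\<bar> / \<mu> ^ ?N * cmod (bump_ft e (\<xi> /\<^sub>R \<mu>)))"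
        using mu by (intro mult_right_mono 1) auto
      also have "\<dots> = \<bar>A\<bar> / \<mu> ^ ?N * \<mu> powr s * ((1 + (norm (\<xi> /\<^sub>R \<mu>))\<^sup>2) powr (s / 2) * cmod (bump_ft e (\<xi> /\<^sub>R \<mu>)))"
        by (simp add: mult_ac)
      also have "\<dots> \<le> \<bar>A\<bar> / \<mu> ^ ?N * \<mu> powr s * (K * E (\<xi> /\<^sub>R \<mu>))"
        unfolding E_def using mu by (intro mult_left_mono K(2)) auto
      finally show ?thesis by (simp add: mult_ac)
    qed
    have a0: "?a \<ge> 0" using mu K by auto
    have EM: "integrable lborel (\<lambda>\<xi>. E (\<xi> /\<^sub>R \<mu>))"
      using lborel_integrable_scale[OF Eint, of "1 / \<mu>"] mu by (simp add: divide_inverse)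
    have EMi: "(LINT \<xi>|lborel. E (\<xi> /\<^sub>R \<mu>)) = \<mu> ^ ?N * (LINT \<xi>|lborel. E \<xi>)"
      using mu by (subst lborel_integral_scale[of "\<lambda>\<xi>. E (\<xi> /\<^sub>R \<mu>)" \<mu>]) auto
    have w1: "integrable lborel w"
    proof (rule Bochner_Integration.integrable_bound[OF integrable_mult_right[OF EM, of ?a]])
      show "AE \<xi> in lborel. norm (w \<xi>) \<le> norm (?a * E (\<xi> /\<^sub>R \<mu>))"
        unfolding real_norm_def by (intro AE_I2 order_trans[OF w_le abs_ge_self])
    qed measurable
    have w2_le: "(cmod (w \<xi>))\<^sup>2 \<le> ?a\<^sup>2 * E (\<xi> /\<^sub>R \<mu>)" for \<xi>
    proof -
      have "(cmod (w \<xi>))\<^sup>2 \<le> (?a * E (\<xi> /\<^sub>R \<mu>))\<^sup>2" by (intro power_mono w_le) auto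
      also have "\<dots> = ?a\<^sup>2 * (E (\<xi> /\<^sub>R \<mu>) * E (\<xi> /\<^sub>R \<mu>))" by (simp add: power2_eq_square mult_ac)
      also have "\<dots> \<le> ?a\<^sup>2 * (E (\<xi> /\<^sub>R \<mu>) * 1)" by (intro mult_left_mono E0 E1) auto
      finally show ?thesis by simp
    qed
    have w2: "integrable lborel (\<lambda>\<xi>. (cmod (w \<xi>))\<^sup>2)"
    proof (rule Bochner_Integration.integrable_bound[OF integrable_mult_right[OF EM, of "?a\<^sup>2"]])
      show "AE \<xi> in lborel. norm ((cmod (w \<xi>))\<^sup>2) \<le> norm (?a\<^sup>2 * E (\<xi> /\<^sub>R \<mu>))"
        using w2_le order_trans[OF w2_le abs_ge_self] by auto
    qed measurable
    have fh2: "fh \<in> L2"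
    proof -
      have le: "cmod (fh \<xi>) \<le> cmod (w \<xi>)" for \<xi>
      proof -
        have "1 \<le> (1 + (norm \<xi>)\<^sup>2) powr (s / 2)" using s by (intro ge_one_powr_ge_zero) auto
        from mult_right_mono[OF this, of "cmod (fh \<xi>)"] show ?thesis by (simp add: w_def norm_mult)
      qed
      have "integrable lborel (\<lambda>\<xi>. (cmod (fh \<xi>))\<^sup>2)"
        by (rule Bochner_Integration.integrable_bound[OF w2]) (use le in \<open>auto intro!: power_mono\<close>)
      then show ?thesis by (simp add: L2_def)
    qed
    have f2: "?f \<in> L2"
    proof -
      have "integrable lborel (\<lambda>x. A\<^sup>2 * (bump e (\<mu> *\<^sub>R x :: real^'n))\<^sup>2)"
        using lborel_integrable_scale[OF bump_sq_integrable, of \<mu>] mu by auto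
      then show ?thesis by (simp add: L2_def power_mult_distrib norm_mult)
    qed
    have supp: "?f x = 0" if "norm x > ?N" for x
    proof -
      have "norm x \<le> norm (\<mu> *\<^sub>R x)" using mu mult_right_mono[of 1 \<mu> "norm x"] by simp
      then have "norm (\<mu> *\<^sub>R x) > DIM(real^'n)" using that by simp
      then show ?thesis using bump_support[of "\<mu> *\<^sub>R x" e] by simp
    qed
    have "Hs_norm s ?f \<le> sqrt (2 / (2 * pi) ^ ?N * (LINT \<xi>|lborel. (cmod (w \<xi>))\<^sup>2))"
      by (rule Hs_norm_le[OF f2 supp fh_def fh2 w_def w1 w2])
    also have "\<dots> \<le> sqrt (2 / (2 * pi) ^ ?N * (LINT \<xi>|lborel. ?a\<^sup>2 * E (\<xi> /\<^sub>R \<mu>)))"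
      by (intro real_sqrt_le_mono mult_left_mono integral_mono w2 integrable_mult_right EM w2_le) auto
    also have "(LINT \<xi>|lborel. ?a\<^sup>2 * E (\<xi> /\<^sub>R \<mu>)) = ?a\<^sup>2 * (\<mu> ^ ?N * (LINT \<xi>|lborel. E \<xi>))"
      by (simp add: EMi)
    also have "2 / (2 * pi) ^ ?N * (?a\<^sup>2 * (\<mu> ^ ?N * (LINT \<xi>|lborel. E \<xi>))) = 
       (2 / (2 * pi) ^ ?N * (K\<^sup>2 * (LINT \<xi>|lborel. E \<xi>))) * (\<bar>A\<bar> * \<mu> powr (s - ?N / 2))\<^sup>2"
    proof -
      have "\<mu> powr (s - ?N / 2) = \<mu> powr s / sqrt \<mu> ^ ?N"
        using mu by (simp add: powr_diff powr_half_power)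
      then have "(\<mu> powr (s - ?N / 2))\<^sup>2 = (\<mu> powr s)\<^sup>2 / \<mu> ^ ?N"
        using mu by (simp add: power_divide flip: power_mult) (simp add: mult.commute[of _ 2] power_mult)
      then show ?thesis using mu by (simp add: power_mult_distrib power_divide power2_eq_square field_simps)
    qed
    also have "sqrt \<dots> = C * \<bar>A\<bar> * \<mu> powr (s - ?N / 2)"
      by (subst real_sqrt_mult) (simp add: C_def)
    finally show ?thesis .
  qed
  moreover have "C \<ge> 0" unfolding C_def by (simp add: integral_nonneg_AE E0)
  ultimately show ?thesis by blast
qed

subsection \<open>The power nonlinearity\<close>

lemma powr_tangent:
  fixes a x y :: real
  assumes a: "a > 0" and x: "x \<ge> 0" and y: "y \<ge> 0"
  shows "x powr (1 + a) + (1 + a) * x powr a * (y - x) \<le> y powr (1 + a)"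
proof (cases "x = 0")
  case True then show ?thesis by simp
next
  case False
  then have x: "x > 0" using x by simp
  have conv: "convex_on {0<..} (\<lambda>y. y powr (1 + a))"
  proof (rule convex_on_realI[where f' = "\<lambda>z. (1 + a) * z powr a"])
    show "((\<lambda>y. y powr (1 + a)) has_real_derivative (1 + a) * z powr a) (at z)" if "z \<in> {0<..}" for z
      using that by (auto intro!: derivative_eq_intros simp: field_simps)
    show "(1 + a) * z powr a \<le> (1 + a) * y powr a" if "z \<in> {0<..}" "z \<le> y" for z y
      using that a by (intro mult_left_mono powr_mono2) auto
  qed auto
  show ?thesis
  proof (cases "y = 0")
    case True
    have "x powr (1 + a) = x powr a * x" using x by (simp add: powr_add)
    then show ?thesis using True a x by (simp add: algebra_simps)
  next
    case False
    then have y: "y > 0" using y by simp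
    have D: "((\<lambda>y. y powr (1 + a)) has_real_derivative (1 + a) * x powr a) (at x within {0<..})"
      using x by (auto intro!: derivative_eq_intros simp: field_simps)
    have "y powr (1 + a) - x powr (1 + a) \<ge> ((1 + a) * x powr a) * (y - x)"
      by (rule convex_on_imp_above_tangent[OF conv _ _ _ D]) (use x y in \<open>auto simp: interior_open\<close>)
    then show ?thesis by simp
  qed
qed

definition pw :: "real \<Rightarrow> 'b::real_normed_vector \<Rightarrow> 'b" where
  "pw \<alpha> z = (norm z powr \<alpha>) *\<^sub>R z"

lemma norm_pw: "norm (pw \<alpha> z) = norm z powr \<alpha> * norm z"
  by (simp add: pw_def)

lemma pw_0 [simp]: "pw \<alpha> 0 = 0"
  by (simp add: pw_def)

lemma pw_minus [simp]: "pw \<alpha> (- z) = - pw \<alpha> z"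
  by (simp add: pw_def)

lemma pw_of_real: "pw \<alpha> (complex_of_real z) = of_real (pw \<alpha> z)"
  by (simp add: pw_def scaleR_conv_of_real)

lemma pw_measurable [measurable (raw)]:
  fixes f :: "'a \<Rightarrow> 'b::{real_normed_vector,second_countable_topology}"
  shows "f \<in> borel_measurable M \<Longrightarrow> (\<lambda>x. pw \<alpha> (f x)) \<in> borel_measurable M"
  unfolding pw_def by measurable

lemma norm_pw_le:
  assumes "norm z \<le> K" "\<alpha> > 0"
  shows "norm (pw \<alpha> z) \<le> K powr \<alpha> * norm z"
  unfolding norm_pw using assms by (intro mult_right_mono powr_mono2) auto

lemma pw_lipschitz_aux:
  fixes a b :: "'b::real_normed_vector"
  assumes al: "\<alpha> > 0" and ab: "norm b \<le> norm a"
  shows "norm (pw \<alpha> a - pw \<alpha> b) \<le> (1 + \<alpha>) * norm a powr \<alpha> * norm (a - b)"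
proof -
  let ?x = "norm a" and ?y = "norm b"
  have "pw \<alpha> a - pw \<alpha> b = (?x powr \<alpha>) *\<^sub>R (a - b) + (?x powr \<alpha> - ?y powr \<alpha>) *\<^sub>R b"
    by (simp add: pw_def algebra_simps)
  then have "norm (pw \<alpha> a - pw \<alpha> b) \<le> ?x powr \<alpha> * norm (a - b) + \<bar>?x powr \<alpha> - ?y powr \<alpha>\<bar> * ?y"
    by (metis norm_triangle_ineq norm_scaleR abs_of_nonneg powr_ge_zero)
  also have "\<bar>?x powr \<alpha> - ?y powr \<alpha>\<bar> = ?x powr \<alpha> - ?y powr \<alpha>"
    using ab al by (simp add: powr_mono2)
  also have "(?x powr \<alpha> - ?y powr \<alpha>) * ?y \<le> \<alpha> * ?x powr \<alpha> * (?x - ?y)"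
    using powr_tangent[OF al, of ?x ?y] by (simp add: powr_add algebra_simps)
  also have "\<dots> \<le> \<alpha> * ?x powr \<alpha> * norm (a - b)"
    using al by (intro mult_left_mono norm_triangle_ineq2) auto
  finally show ?thesis by (simp add: algebra_simps)
qed

lemma pw_lipschitz:
  fixes a b :: "'b::real_normed_vector"
  assumes al: "\<alpha> > 0" and a: "norm a \<le> K" and b: "norm b \<le> K"
  shows "norm (pw \<alpha> a - pw \<alpha> b) \<le> (1 + \<alpha>) * K powr \<alpha> * norm (a - b)"
proof (cases "norm b \<le> norm a")
  case True
  have "(1 + \<alpha>) * norm a powr \<alpha> * norm (a - b) \<le> (1 + \<alpha>) * K powr \<alpha> * norm (a - b)"
    using al a by (intro mult_right_mono mult_left_mono powr_mono2) auto
  with pw_lipschitz_aux[OF al True] show ?thesis by simp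
next
  case False
  then have "norm a \<le> norm b" by simp
  from pw_lipschitz_aux[OF al this]
  have "norm (pw \<alpha> a - pw \<alpha> b) \<le> (1 + \<alpha>) * norm b powr \<alpha> * norm (a - b)"
    by (simp add: norm_minus_commute)
  also have "\<dots> \<le> (1 + \<alpha>) * K powr \<alpha> * norm (a - b)"
    using al b by (intro mult_right_mono mult_left_mono powr_mono2) auto
  finally show ?thesis .
qed

subsection \<open>Space-time integrals\<close>

lemma spacetime_integrable:
  fixes k :: "real \<Rightarrow> 'a::euclidean_space \<Rightarrow> real" and W :: "real \<Rightarrow> 'a \<Rightarrow> 'b::{banach,second_countable_topology}"
  assumes k: "case_prod k \<in> borel_measurable borel" and W: "case_prod W \<in> borel_measurable borel"
    and c: "integrable lborel c" and kc: "\<And>\<rho>. (\<integral>\<^sup>+y. ennreal \<bar>k \<rho> y\<bar> \<partial>lborel) \<le> ennreal (c \<rho>)"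
    and B: "\<And>\<rho> y. norm (W \<rho> y) \<le> B"
  shows "integrable (lborel \<Otimes>\<^sub>M lborel) (\<lambda>(\<rho>,y). k \<rho> y *\<^sub>R W \<rho> y)"
proof (rule integrableI_bounded)
  have [measurable]: "case_prod k \<in> borel_measurable (borel \<Otimes>\<^sub>M borel)" "case_prod W \<in> borel_measurable (borel \<Otimes>\<^sub>M borel)"
    using k W by (simp_all add: borel_prod)
  have [measurable]: "c \<in> borel_measurable borel" using borel_measurable_integrable[OF c] by simp
  show "(\<lambda>(\<rho>,y). k \<rho> y *\<^sub>R W \<rho> y) \<in> borel_measurable (lborel \<Otimes>\<^sub>M lborel)" by measurable
  have B0: "0 \<le> B" using B[of 0 0] norm_ge_zero order_trans by blast
  have "(\<integral>\<^sup>+p. ennreal (norm (case p of (\<rho>,y) \<Rightarrow> k \<rho> y *\<^sub>R W \<rho> y)) \<partial>(lborel \<Otimes>\<^sub>M lborel)) =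
    (\<integral>\<^sup>+\<rho>. \<integral>\<^sup>+y. ennreal (norm (k \<rho> y *\<^sub>R W \<rho> y)) \<partial>lborel \<partial>lborel)"
    by (subst lborel.nn_integral_fst[symmetric]) auto
  also have "\<dots> \<le> (\<integral>\<^sup>+\<rho>. \<integral>\<^sup>+y. ennreal B * ennreal \<bar>k \<rho> y\<bar> \<partial>lborel \<partial>lborel)"
  proof (intro nn_integral_mono)
    fix \<rho> y
    have "norm (k \<rho> y *\<^sub>R W \<rho> y) \<le> B * \<bar>k \<rho> y\<bar>"
      using mult_right_mono[OF B[of \<rho> y], of "\<bar>k \<rho> y\<bar>"] by (simp add: mult.commute)
    then show "ennreal (norm (k \<rho> y *\<^sub>R W \<rho> y)) \<le> ennreal B * ennreal \<bar>k \<rho> y\<bar>"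
      using B0 by (simp flip: ennreal_mult)
  qed
  also have "\<dots> = (\<integral>\<^sup>+\<rho>. ennreal B * (\<integral>\<^sup>+y. ennreal \<bar>k \<rho> y\<bar> \<partial>lborel) \<partial>lborel)"
    by (intro nn_integral_cong nn_integral_cmult) measurable
  also have "\<dots> \<le> (\<integral>\<^sup>+\<rho>. ennreal B * ennreal (c \<rho>) \<partial>lborel)"
    by (intro nn_integral_mono mult_left_mono kc) auto
  also have "\<dots> = ennreal B * (\<integral>\<^sup>+\<rho>. ennreal (c \<rho>) \<partial>lborel)"
    by (rule nn_integral_cmult) measurable
  also have "\<dots> < \<infinity>"
  proof -
    have "(\<integral>\<^sup>+\<rho>. ennreal (c \<rho>) \<partial>lborel) \<le> (\<integral>\<^sup>+\<rho>. ennreal (norm (c \<rho>)) \<partial>lborel)"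
      by (intro nn_integral_mono ennreal_leI) auto
    also have "\<dots> < \<infinity>" using c by (simp add: integrable_iff_bounded)
    finally show ?thesis by (simp add: ennreal_mult_less_top)
  qed
  finally show "(\<integral>\<^sup>+p. ennreal (norm (case p of (\<rho>,y) \<Rightarrow> k \<rho> y *\<^sub>R W \<rho> y)) \<partial>(lborel \<Otimes>\<^sub>M lborel)) < \<infinity>" .
qed

lemma bounded_mult_integrable:
  fixes w :: "'a::euclidean_space \<Rightarrow> 'b::{banach,second_countable_topology}"
  assumes k: "integrable lborel k" and w: "w \<in> borel_measurable borel" and B: "\<And>y. norm (w y) \<le> B"
  shows "integrable lborel (\<lambda>y. k y *\<^sub>R w y)"
proof (rule Bochner_Integration.integrable_bound)
  show "integrable lborel (\<lambda>y. B * k y)" using k by simp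
  have "0 \<le> B" using B[of 0] norm_ge_zero order_trans by blast
  then have "norm (k y *\<^sub>R w y) \<le> norm (B * k y)" for y
    using mult_right_mono[OF B[of y], of "\<bar>k y\<bar>"] by (simp add: abs_mult mult.commute)
  then show "AE y in lborel. norm (k y *\<^sub>R w y) \<le> norm (B * k y)" by simp
  have [measurable]: "k \<in> borel_measurable borel" using borel_measurable_integrable[OF k] by simp
  show "(\<lambda>y. k y *\<^sub>R w y) \<in> borel_measurable lborel" using w by measurable
qed

lemma norm_hk_conv_le:
  fixes w :: "'a::euclidean_space \<Rightarrow> 'b::{banach,second_countable_topology}"
  assumes B: "\<And>y. norm (w y) \<le> B"
  shows "norm (LINT y|lborel. hk r (x - y) *\<^sub>R w y) \<le> B"
proof -
  have B0: "0 \<le> B" using B[of 0] norm_ge_zero order_trans by blast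
  have "ennreal (norm (LINT y|lborel. hk r (x - y) *\<^sub>R w y)) \<le> (\<integral>\<^sup>+y. ennreal (norm (hk r (x - y) *\<^sub>R w y)) \<partial>lborel)"
    by (rule ennreal_norm_integral_le)
  also have "\<dots> \<le> (\<integral>\<^sup>+y. ennreal B * ennreal (hk r (x - y)) \<partial>lborel)"
    using B B0 by (intro nn_integral_mono) (auto simp: mult.commute intro!: mult_right_mono ennreal_leI simp flip: ennreal_mult)
  also have "\<dots> = ennreal B * (\<integral>\<^sup>+y. ennreal (hk r (x - y)) \<partial>lborel)"
    by (rule nn_integral_cmult) measurable
  also have "\<dots> \<le> ennreal B * 1" by (intro mult_left_mono hk_shift_nn_integral_le) auto
  finally show ?thesis using B0 by simp
qed

lemma hk_spacetime_integrable:
  fixes W :: "real \<Rightarrow> 'a::euclidean_space \<Rightarrow> 'b::{banach,second_countable_topology}"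
  assumes W: "case_prod W \<in> borel_measurable borel" and B: "\<And>\<rho> y. norm (W \<rho> y) \<le> B"
    and supp: "\<And>\<rho> y. \<rho> \<notin> {0..t} \<Longrightarrow> W \<rho> y = 0"
  shows "integrable (lborel \<Otimes>\<^sub>M lborel) (\<lambda>(\<rho>,y). hk (s - \<rho>) (x - y) *\<^sub>R W \<rho> y)"
proof -
  let ?k = "\<lambda>\<rho> y. indicator {0..t} \<rho> * hk (s - \<rho>) (x - y)"
  have "integrable (lborel \<Otimes>\<^sub>M lborel) (\<lambda>(\<rho>,y). ?k \<rho> y *\<^sub>R W \<rho> y)"
  proof (rule spacetime_integrable[OF _ W _ _ B])
    show "case_prod ?k \<in> borel_measurable borel"
      unfolding borel_prod[symmetric] by measurable
    show "integrable lborel (indicator {0..t} :: real \<Rightarrow> real)"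
      by (rule integrable_real_indicator) (auto simp: emeasure_lborel_Icc_eq)
    show "(\<integral>\<^sup>+y. ennreal \<bar>?k \<rho> y\<bar> \<partial>lborel) \<le> ennreal (indicator {0..t} \<rho>)" for \<rho>
      using hk_shift_nn_integral_le[of "s - \<rho>" x] by (auto simp: indicator_def)
  qed
  also have "(\<lambda>(\<rho>,y). ?k \<rho> y *\<^sub>R W \<rho> y) = (\<lambda>(\<rho>,y). hk (s - \<rho>) (x - y) *\<^sub>R W \<rho> y)"
    using supp by (auto simp: indicator_def fun_eq_iff)
  finally show ?thesis .
qed

lemma hk_time_integrable:
  fixes W :: "real \<Rightarrow> 'a::euclidean_space \<Rightarrow> 'b::{banach,second_countable_topology}"
  assumes W: "case_prod W \<in> borel_measurable borel" and B: "\<And>\<rho> y. norm (W \<rho> y) \<le> B"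
    and supp: "\<And>\<rho> y. \<rho> \<notin> {0..t} \<Longrightarrow> W \<rho> y = 0"
  shows "integrable lborel (\<lambda>\<rho>. LINT y|lborel. hk (s - \<rho>) (x - y) *\<^sub>R W \<rho> y)"
  using lborel_pair.integrable_fst'[OF hk_spacetime_integrable[OF assms]] by simp

lemma section_measurable:
  fixes W :: "real \<Rightarrow> 'a::euclidean_space \<Rightarrow> 'b::topological_space"
  assumes "case_prod W \<in> borel_measurable borel"
  shows "W \<rho> \<in> borel_measurable borel"
proof -
  have [measurable]: "case_prod W \<in> borel_measurable (borel \<Otimes>\<^sub>M borel)" using assms by (simp add: borel_prod)
  have "(\<lambda>y. case_prod W (\<rho>, y)) \<in> borel_measurable borel" by measurable
  then show ?thesis by simp
qed

lemma norm_duhamel_le: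
  fixes W :: "real \<Rightarrow> 'a::euclidean_space \<Rightarrow> 'b::{banach,second_countable_topology}"
  assumes b: "\<And>\<rho> y. 0 < \<rho> \<Longrightarrow> \<rho> < s \<Longrightarrow> norm (W \<rho> y) \<le> C * \<rho> ^ k" and C: "C \<ge> 0" and s: "s \<ge> 0"
    and supp: "\<And>\<rho> y. \<rho> < 0 \<Longrightarrow> W \<rho> y = 0"
  shows "norm (LINT \<rho>|lborel. LINT y|lborel. hk (s - \<rho>) (x - y) *\<^sub>R W \<rho> y) \<le> C * s ^ (k + 1) / (k + 1)"
proof -
  have D: "((\<lambda>\<rho>. C * \<rho> ^ (k + 1) / (k + 1)) has_real_derivative C * \<rho> ^ k) (at \<rho> within A)" for \<rho> A
    by (rule DERIV_cong[OF DERIV_cdivide[OF DERIV_cmult[OF DERIV_pow]]]) simp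
  have int: "integrable lborel (\<lambda>\<rho>. indicator {0..s} \<rho> *\<^sub>R (C * \<rho> ^ k))"
    using borel_integrable_atLeastAtMost'[of 0 s "\<lambda>\<rho>. C * \<rho> ^ k"] by (simp add: set_integrable_def continuous_intros)
  have "ennreal (norm (LINT \<rho>|lborel. LINT y|lborel. hk (s - \<rho>) (x - y) *\<^sub>R W \<rho> y)) \<le>
     (\<integral>\<^sup>+\<rho>. ennreal (norm (LINT y|lborel. hk (s - \<rho>) (x - y) *\<^sub>R W \<rho> y)) \<partial>lborel)"
    by (rule ennreal_norm_integral_le)
  also have "\<dots> \<le> (\<integral>\<^sup>+\<rho>. ennreal (indicator {0..s} \<rho> *\<^sub>R (C * \<rho> ^ k)) \<partial>lborel)"
  proof (rule nn_integral_mono_AE)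
    show "AE \<rho> in lborel. ennreal (norm (LINT y|lborel. hk (s - \<rho>) (x - y) *\<^sub>R W \<rho> y)) \<le> ennreal (indicator {0..s} \<rho> *\<^sub>R (C * \<rho> ^ k))"
      using AE_lborel_singleton[of 0]
    proof eventually_elim
      case (elim \<rho>)
      consider "\<rho> < 0" | "\<rho> \<ge> s" | "0 < \<rho>" "\<rho> < s" using elim by linarith
      then show ?case
      proof cases
        case 3
        then show ?thesis using norm_hk_conv_le[OF b[OF 3], of "s - \<rho>" x] by (auto intro!: ennreal_leI)
      qed (auto simp: supp)
    qed
  qed
  also have "\<dots> = ennreal (LINT \<rho>|lborel. indicator {0..s} \<rho> *\<^sub>R (C * \<rho> ^ k))"
    by (rule nn_integral_eq_integral[OF int]) (use C in \<open>auto simp: indicator_def\<close>)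
  also have "(LINT \<rho>|lborel. indicator {0..s} \<rho> *\<^sub>R (C * \<rho> ^ k)) = C * s ^ (k + 1) / (k + 1) - C * 0 ^ (k + 1) / (k + 1)"
    by (rule integral_FTC_atLeastAtMost[OF s])
      (rule D[unfolded has_real_derivative_iff_has_vector_derivative], intro continuous_intros)
  finally show ?thesis using C s by simp
qed

lemma factorial_iteration:
  fixes D :: "real \<Rightarrow> 'a \<Rightarrow> real"
  assumes base: "\<And>s x. 0 < s \<Longrightarrow> s \<le> t \<Longrightarrow> D s x \<le> B" and B: "B \<ge> 0" and L: "L \<ge> 0"
    and step: "\<And>C k s x. C \<ge> 0 \<Longrightarrow> (\<And>\<rho> y. 0 < \<rho> \<Longrightarrow> \<rho> \<le> t \<Longrightarrow> D \<rho> y \<le> C * \<rho> ^ k) \<Longrightarrow> 0 < s \<Longrightarrow> s \<le> t \<Longrightarrow>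
      D s x \<le> L * (C * s ^ (k + 1) / (k + 1))"
    and s: "0 < s" "s \<le> t"
  shows "D s x \<le> 0"
proof -
  have main: "\<forall>s x. 0 < s \<longrightarrow> s \<le> t \<longrightarrow> D s x \<le> (B * L ^ k / fact k) * s ^ k" for k
  proof (induction k)
    case 0 then show ?case using base by simp
  next
    case (Suc k)
    show ?case
    proof (intro allI impI)
      fix s x assume s: "0 < s" "s \<le> t"
      have "D s x \<le> L * ((B * L ^ k / fact k) * s ^ (k + 1) / (k + 1))"
        by (rule step) (use Suc s B L in auto)
      also have "\<dots> = (B * L ^ Suc k / fact (Suc k)) * s ^ Suc k" by (simp add: field_simps)
      finally show "D s x \<le> (B * L ^ Suc k / fact (Suc k)) * s ^ Suc k" .
    qed
  qed
  have "(\<lambda>k. (L * s) ^ k /\<^sub>R fact k) \<longlonglongrightarrow> 0"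
    by (rule summable_LIMSEQ_zero[OF summable_exp_generic])
  then have "(\<lambda>k. B * ((L * s) ^ k /\<^sub>R fact k)) \<longlonglongrightarrow> B * 0" by (rule tendsto_mult_left)
  then have "(\<lambda>k. (B * L ^ k / fact k) * s ^ k) \<longlonglongrightarrow> 0" by (simp add: power_mult_distrib field_simps)
  then show ?thesis by (rule tendsto_lowerbound) (use main s in auto)
qed

subsection \<open>Bounded solutions of Duhamel's equation\<close>

text \<open>
  Bounded measurable solutions on \<open>[0,t]\<close>, with values in any Banach space and set to zero
  outside \<open>[0,t]\<close>; as \<open>hk\<close> vanishes for nonpositive times, the time integral is over \<open>[0,s]\<close>.
\<close>

definition dsol :: "real \<Rightarrow> real \<Rightarrow> real \<Rightarrow> real \<Rightarrow> ('a::euclidean_space \<Rightarrow> 'b::{banach,second_countable_topology}) \<Rightarrow> (real \<Rightarrow> 'a \<Rightarrow> 'b) \<Rightarrow> bool" where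
  "dsol \<alpha> lam t M u0 u \<longleftrightarrow> case_prod u \<in> borel_measurable borel \<and> (\<forall>\<rho> y. norm (u \<rho> y) \<le> M) \<and>
     (\<forall>\<rho> y. \<rho> \<notin> {0..t} \<longrightarrow> u \<rho> y = 0) \<and>
     (\<forall>s x. 0 < s \<longrightarrow> s \<le> t \<longrightarrow> u s x = (LINT y|lborel. hk s (x - y) *\<^sub>R u0 y) +
        lam *\<^sub>R (LINT \<rho>|lborel. LINT y|lborel. hk (s - \<rho>) (x - y) *\<^sub>R pw \<alpha> (u \<rho> y)))"

lemma case_prod_pw_measurable:
  fixes u :: "real \<Rightarrow> 'a::euclidean_space \<Rightarrow> 'b::{banach,second_countable_topology}"
  assumes "case_prod u \<in> borel_measurable borel"
  shows "(\<lambda>(\<rho>, y). pw \<alpha> (u \<rho> y)) \<in> borel_measurable borel"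
proof -
  have [measurable]: "case_prod u \<in> borel_measurable (borel \<Otimes>\<^sub>M borel)" using assms by (simp add: borel_prod)
  show ?thesis unfolding borel_prod[symmetric] by measurable
qed

lemma dsol_unique:
  fixes u v :: "real \<Rightarrow> 'a::euclidean_space \<Rightarrow> 'b::{banach,second_countable_topology}"
  assumes u: "dsol \<alpha> lam t M u0 u" and v: "dsol \<alpha> lam t M u0 v" and al: "\<alpha> > 0" and lam: "lam > 0"
    and s: "0 < s" "s \<le> t"
  shows "u s x = v s x"
proof -
  have M: "M \<ge> 0" using u unfolding dsol_def by (meson norm_ge_zero order_trans)
  have um: "case_prod u \<in> borel_measurable borel" and ub: "\<And>\<rho> y. norm (u \<rho> y) \<le> M" and us: "\<And>\<rho> y. \<rho> \<notin> {0..t} \<Longrightarrow> u \<rho> y = 0"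
    and ud: "\<And>s x. 0 < s \<Longrightarrow> s \<le> t \<Longrightarrow> u s x = (LINT y|lborel. hk s (x - y) *\<^sub>R u0 y) +
        lam *\<^sub>R (LINT \<rho>|lborel. LINT y|lborel. hk (s - \<rho>) (x - y) *\<^sub>R pw \<alpha> (u \<rho> y))"
    using u unfolding dsol_def by blast+
  have vm: "case_prod v \<in> borel_measurable borel" and vb: "\<And>\<rho> y. norm (v \<rho> y) \<le> M" and vs: "\<And>\<rho> y. \<rho> \<notin> {0..t} \<Longrightarrow> v \<rho> y = 0"
    and vd: "\<And>s x. 0 < s \<Longrightarrow> s \<le> t \<Longrightarrow> v s x = (LINT y|lborel. hk s (x - y) *\<^sub>R u0 y) +
        lam *\<^sub>R (LINT \<rho>|lborel. LINT y|lborel. hk (s - \<rho>) (x - y) *\<^sub>R pw \<alpha> (v \<rho> y))"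
    using v unfolding dsol_def by blast+
  have Bb: "norm (pw \<alpha> z) \<le> M powr \<alpha> * M" if "norm z \<le> M" for z :: 'b
    using norm_pw_le[OF that al] mult_left_mono[OF that, of "M powr \<alpha>"] by simp
  define Lc where "Lc = (1 + \<alpha>) * M powr \<alpha>"
  have Lc: "Lc \<ge> 0" using al by (simp add: Lc_def)
  have diff: "u s x - v s x = lam *\<^sub>R (LINT \<rho>|lborel. LINT y|lborel. hk (s - \<rho>) (x - y) *\<^sub>R (pw \<alpha> (u \<rho> y) - pw \<alpha> (v \<rho> y)))"
    if s: "0 < s" "s \<le> t" for s x
  proof -
    have um': "u \<rho> \<in> borel_measurable borel" and vm': "v \<rho> \<in> borel_measurable borel" for \<rho>
      using section_measurable um vm by auto
    have iu: "integrable lborel (\<lambda>y. hk (s - \<rho>) (x - y) *\<^sub>R pw \<alpha> (u \<rho> y))" for \<rho>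
      by (rule bounded_mult_integrable[OF hk_shift_integrable _ Bb[OF ub]]) (use um' in measurable)
    have iv: "integrable lborel (\<lambda>y. hk (s - \<rho>) (x - y) *\<^sub>R pw \<alpha> (v \<rho> y))" for \<rho>
      by (rule bounded_mult_integrable[OF hk_shift_integrable _ Bb[OF vb]]) (use vm' in measurable)
    have tu: "integrable lborel (\<lambda>\<rho>. LINT y|lborel. hk (s - \<rho>) (x - y) *\<^sub>R pw \<alpha> (u \<rho> y))"
      by (rule hk_time_integrable[OF case_prod_pw_measurable[OF um] Bb[OF ub], where t=t]) (simp add: us)
    have tv: "integrable lborel (\<lambda>\<rho>. LINT y|lborel. hk (s - \<rho>) (x - y) *\<^sub>R pw \<alpha> (v \<rho> y))"
      by (rule hk_time_integrable[OF case_prod_pw_measurable[OF vm] Bb[OF vb], where t=t]) (simp add: vs)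
    show ?thesis
      unfolding ud[OF s] vd[OF s] scaleR_diff_right Bochner_Integration.integral_diff[OF iu iv] Bochner_Integration.integral_diff[OF tu tv]
      by simp
  qed
  have "norm (u s x - v s x) \<le> 0"
  proof (rule factorial_iteration[where t=t and B="2 * M" and L="lam * Lc" and D="\<lambda>s x. norm (u s x - v s x)"])
    show "norm (u s x - v s x) \<le> 2 * M" for s x
      using norm_triangle_ineq4[of "u s x" "v s x"] ub[of s x] vb[of s x] by linarith
    fix C k s x
    assume C: "C \<ge> (0::real)" and hyp: "\<And>\<rho> y. 0 < \<rho> \<Longrightarrow> \<rho> \<le> t \<Longrightarrow> norm (u \<rho> y - v \<rho> y) \<le> C * \<rho> ^ k"
      and s: "0 < s" "s \<le> t"
    have "norm (LINT \<rho>|lborel. LINT y|lborel. hk (s - \<rho>) (x - y) *\<^sub>R (pw \<alpha> (u \<rho> y) - pw \<alpha> (v \<rho> y))) \<le> (Lc * C) * s ^ (k + 1) / (k + 1)"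
    proof (rule norm_duhamel_le)
      fix \<rho> y assume r: "0 < \<rho>" "\<rho> < s"
      have "norm (pw \<alpha> (u \<rho> y) - pw \<alpha> (v \<rho> y)) \<le> Lc * norm (u \<rho> y - v \<rho> y)"
        unfolding Lc_def by (rule pw_lipschitz[OF al ub vb])
      also have "\<dots> \<le> Lc * (C * \<rho> ^ k)" using r s by (intro mult_left_mono hyp Lc) auto
      finally show "norm (pw \<alpha> (u \<rho> y) - pw \<alpha> (v \<rho> y)) \<le> (Lc * C) * \<rho> ^ k" by (simp add: mult.assoc)
    qed (use C Lc s us vs in auto)
    then have "lam * norm (LINT \<rho>|lborel. LINT y|lborel. hk (s - \<rho>) (x - y) *\<^sub>R (pw \<alpha> (u \<rho> y) - pw \<alpha> (v \<rho> y))) \<le> lam * ((Lc * C) * s ^ (k + 1) / (k + 1))"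
      using lam by (intro mult_left_mono) auto
    then show "norm (u s x - v s x) \<le> lam * Lc * (C * s ^ (k + 1) / (k + 1))"
      unfolding diff[OF s] norm_scaleR using lam by (simp add: mult.assoc)
  qed (use M s lam Lc in auto)
  then show ?thesis by simp
qed

lemma reflect_reflect [simp]: "e \<in> Basis \<Longrightarrow> reflect e (reflect e x) = x"
  by (rule euclidean_eqI) (simp add: reflect_inner)

lemma reflect_diff: "reflect e (x - y) = reflect e x - reflect e y"
  by (simp add: reflect_def inner_diff_left algebra_simps)

lemma norm_reflect: "e \<in> Basis \<Longrightarrow> norm (reflect e x) = norm x"
  by (rule power2_eq_imp_eq) (auto simp: norm_sq_basis reflect_inner intro!: sum.cong)

lemma hk_reflect: "e \<in> Basis \<Longrightarrow> hk r (reflect e x) = hk r x"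
  by (simp add: hk_def norm_reflect)

lemma reflect_measurable [measurable]: "reflect e \<in> borel_measurable borel"
  unfolding reflect_def[abs_def] by measurable

lemma lborel_distr_reflect:
  assumes e: "(e::'a::euclidean_space) \<in> Basis"
  shows "distr lborel borel (reflect e) = lborel"
proof -
  let ?c = "\<lambda>j::'a. if j = e then -1 else 1 :: real"
  have "reflect e = (\<lambda>x. 0 + (\<Sum>j\<in>Basis. (?c j * (x \<bullet> j)) *\<^sub>R j))"
  proof
    show "reflect e x = 0 + (\<Sum>j\<in>Basis. (?c j * (x \<bullet> j)) *\<^sub>R j)" for x
      by (rule euclidean_eqI) (auto simp: reflect_inner e)
  qed
  moreover have "(\<Prod>j\<in>Basis. \<bar>?c j\<bar>) = 1" by (intro prod.neutral) auto
  ultimately show ?thesis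
    using lborel_affine_euclidean[of ?c 0] by (simp add: density_1)
qed

lemma lborel_integral_reflect:
  fixes f :: "'a::euclidean_space \<Rightarrow> 'b::{banach,second_countable_topology}"
  assumes e: "e \<in> Basis" and f: "f \<in> borel_measurable borel"
  shows "(LINT y|lborel. f (reflect e y)) = (LINT y|lborel. f y)"
proof -
  have "(LINT y|lborel. f y) = (LINT y|distr lborel borel (reflect e). f y)"
    by (simp add: lborel_distr_reflect[OF e])
  also have "\<dots> = (LINT y|lborel. f (reflect e y))" using f by (subst integral_distr) auto
  finally show ?thesis by simp
qed

lemma dsol_reflect:
  fixes u :: "real \<Rightarrow> 'a::euclidean_space \<Rightarrow> 'b::{banach,second_countable_topology}"
  assumes u: "dsol \<alpha> lam t M u0 u" and e: "e \<in> Basis" and u0: "u0 \<in> borel_measurable borel"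
    and odd: "\<And>x. u0 (reflect e x) = - u0 x"
  shows "dsol \<alpha> lam t M u0 (\<lambda>s x. - u s (reflect e x))"
  unfolding dsol_def
proof (intro conjI allI impI)
  have um: "case_prod u \<in> borel_measurable borel" and ub: "\<And>\<rho> y. norm (u \<rho> y) \<le> M" and us: "\<And>\<rho> y. \<rho> \<notin> {0..t} \<Longrightarrow> u \<rho> y = 0"
    and ud: "\<And>s x. 0 < s \<Longrightarrow> s \<le> t \<Longrightarrow> u s x = (LINT y|lborel. hk s (x - y) *\<^sub>R u0 y) +
        lam *\<^sub>R (LINT \<rho>|lborel. LINT y|lborel. hk (s - \<rho>) (x - y) *\<^sub>R pw \<alpha> (u \<rho> y))"
    using u unfolding dsol_def by blast+
  have [measurable]: "case_prod u \<in> borel_measurable (borel \<Otimes>\<^sub>M borel)" using um by (simp add: borel_prod)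
  show "(\<lambda>(s, x). - u s (reflect e x)) \<in> borel_measurable borel"
    unfolding borel_prod[symmetric] by measurable
  show "norm (- u \<rho> (reflect e y)) \<le> M" for \<rho> y using ub by simp
  show "\<rho> \<notin> {0..t} \<Longrightarrow> - u \<rho> (reflect e y) = 0" for \<rho> y using us by simp
  fix s x assume s: "0 < s" "s \<le> t"
  have hkr: "hk r (reflect e x - y) = hk r (x - reflect e y)" for r y
    using hk_reflect[OF e, of r "x - reflect e y"] e by (simp add: reflect_diff)
  have um': "u \<rho> \<in> borel_measurable borel" for \<rho>
    using section_measurable um by auto
  have 1: "(LINT y|lborel. hk s (reflect e x - y) *\<^sub>R u0 y) = - (LINT y|lborel. hk s (x - y) *\<^sub>R u0 y)"
  proof -
    have "(LINT y|lborel. hk s (reflect e x - y) *\<^sub>R u0 y) = (LINT y|lborel. hk s (x - reflect e y) *\<^sub>R (- u0 (reflect e y)))"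
      by (simp add: hkr odd)
    also have "\<dots> = (LINT y|lborel. hk s (x - y) *\<^sub>R (- u0 y))"
      using u0 by (subst lborel_integral_reflect[OF e, of "\<lambda>y. hk s (x - y) *\<^sub>R (- u0 y)"]) auto
    finally show ?thesis by simp
  qed
  have 2: "(LINT y|lborel. hk (s - \<rho>) (reflect e x - y) *\<^sub>R pw \<alpha> (u \<rho> y)) = - (LINT y|lborel. hk (s - \<rho>) (x - y) *\<^sub>R pw \<alpha> (- u \<rho> (reflect e y)))" for \<rho>
  proof -
    have [measurable]: "u \<rho> \<in> borel_measurable borel" by (rule um')
    have "(LINT y|lborel. hk (s - \<rho>) (reflect e x - y) *\<^sub>R pw \<alpha> (u \<rho> y)) = (LINT y|lborel. hk (s - \<rho>) (x - reflect e y) *\<^sub>R pw \<alpha> (u \<rho> (reflect e (reflect e y))))"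
      by (simp add: hkr e)
    also have "\<dots> = (LINT y|lborel. hk (s - \<rho>) (x - y) *\<^sub>R pw \<alpha> (u \<rho> (reflect e y)))"
      by (subst lborel_integral_reflect[OF e, of "\<lambda>y. hk (s - \<rho>) (x - y) *\<^sub>R pw \<alpha> (u \<rho> (reflect e y))"]) auto
    finally show ?thesis by simp
  qed
  show "- u s (reflect e x) = (LINT y|lborel. hk s (x - y) *\<^sub>R u0 y) +
        lam *\<^sub>R (LINT \<rho>|lborel. LINT y|lborel. hk (s - \<rho>) (x - y) *\<^sub>R pw \<alpha> (- u \<rho> (reflect e y)))"
    unfolding ud[OF s] 1 2 by simp
qed

lemma dsol_cnj:
  fixes u :: "real \<Rightarrow> 'a::euclidean_space \<Rightarrow> complex"
  assumes u: "dsol \<alpha> lam t M u0 u" and real: "\<And>x. cnj (u0 x) = u0 x"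
  shows "dsol \<alpha> lam t M u0 (\<lambda>s x. cnj (u s x))"
  unfolding dsol_def
proof (intro conjI allI impI)
  have um: "case_prod u \<in> borel_measurable borel" and ub: "\<And>\<rho> y. norm (u \<rho> y) \<le> M" and us: "\<And>\<rho> y. \<rho> \<notin> {0..t} \<Longrightarrow> u \<rho> y = 0"
    and ud: "\<And>s x. 0 < s \<Longrightarrow> s \<le> t \<Longrightarrow> u s x = (LINT y|lborel. hk s (x - y) *\<^sub>R u0 y) +
        lam *\<^sub>R (LINT \<rho>|lborel. LINT y|lborel. hk (s - \<rho>) (x - y) *\<^sub>R pw \<alpha> (u \<rho> y))"
    using u unfolding dsol_def by blast+
  have [measurable]: "case_prod u \<in> borel_measurable (borel \<Otimes>\<^sub>M borel)" using um by (simp add: borel_prod)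
  show "(\<lambda>(s, x). cnj (u s x)) \<in> borel_measurable borel"
    unfolding borel_prod[symmetric] by measurable
  show "norm (cnj (u \<rho> y)) \<le> M" for \<rho> y using ub by simp
  show "\<rho> \<notin> {0..t} \<Longrightarrow> cnj (u \<rho> y) = 0" for \<rho> y using us by simp
  fix s x assume s: "0 < s" "s \<le> t"
  have pwc: "cnj (pw \<alpha> z) = pw \<alpha> (cnj z)" for z by (simp add: pw_def)
  have "(LINT y|lborel. hk s (x - y) *\<^sub>R u0 y) = cnj (LINT y|lborel. hk s (x - y) *\<^sub>R u0 y)"
    using Bochner_Integration.integral_cnj[of lborel "\<lambda>y. hk s (x - y) *\<^sub>R u0 y"] by (simp add: real)
  moreover have "(LINT \<rho>|lborel. LINT y|lborel. hk (s - \<rho>) (x - y) *\<^sub>R pw \<alpha> (cnj (u \<rho> y))) =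
    cnj (LINT \<rho>|lborel. LINT y|lborel. hk (s - \<rho>) (x - y) *\<^sub>R pw \<alpha> (u \<rho> y))"
    by (simp add: pwc[symmetric] flip: complex_cnj_scaleR)
  ultimately show "cnj (u s x) = (LINT y|lborel. hk s (x - y) *\<^sub>R u0 y) +
        lam *\<^sub>R (LINT \<rho>|lborel. LINT y|lborel. hk (s - \<rho>) (x - y) *\<^sub>R pw \<alpha> (cnj (u \<rho> y)))"
    unfolding ud[OF s] by simp
qed

lemma C0_bounded:
  assumes "f \<in> (C0 :: ((real^'n) \<Rightarrow> complex) set)"
  shows "\<exists>B\<ge>0. \<forall>x. cmod (f x) \<le> B"
proof -
  have c: "continuous_on UNIV f" and l: "(f \<longlongrightarrow> 0) at_infinity" using assms by (auto simp: C0_def)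
  have "\<forall>\<^sub>F x in at_infinity. dist (f x) 0 < 1" using l by (rule tendstoD) simp
  then obtain b where b: "\<And>x. norm x \<ge> b \<Longrightarrow> cmod (f x) < 1" unfolding eventually_at_infinity by auto
  have "compact (f ` cball 0 b)" by (intro compact_continuous_image continuous_on_subset[OF c]) auto
  then have "bounded (f ` cball 0 b)" by (rule compact_imp_bounded)
  then obtain K where "\<forall>y\<in>f ` cball 0 b. norm y \<le> K" by (auto simp only: bounded_iff)
  then have K: "norm x \<le> b \<Longrightarrow> cmod (f x) \<le> K" for x by auto
  have "cmod (f x) \<le> max K 1" for x
    using K[of x] b[of x] by (cases "norm x \<le> b") auto
  then show ?thesis by (intro exI[of _ "max K 1"]) auto
qed

lemma solution_imp_dsol:
  fixes u0 :: "(real^'n) \<Rightarrow> complex"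
  assumes sol: "is_solution \<alpha> lam u0 T u" and t: "0 < t" "ereal t < T"
  shows "\<exists>M. dsol \<alpha> lam t M u0 (\<lambda>s x. indicator {0..t} s *\<^sub>R u s x) \<and> (\<forall>x. cmod (u0 x) \<le> M) \<and> continuous_on UNIV u0 \<and> (\<forall>x. u 0 x = u0 x)"
proof -
  have sub: "{0..t} \<subseteq> time_interval T" using t by (auto simp: time_interval_def intro: le_less_trans[of _ "ereal t"])
  have C0: "u s \<in> C0" if "s \<in> {0..t}" for s using sol that sub unfolding is_solution_def by blast
  have ul: "uniform_limit UNIV u (u s) (at s within time_interval T)" if "s \<in> {0..t}" for s 
    using sol that sub unfolding is_solution_def by blast
  have ud: "u s x = heat s u0 x + of_real lam * (LINT \<sigma>:{0..s}|lborel. heat (s - \<sigma>) (nonlin \<alpha> (u \<sigma>)) x)" if "s \<in> {0..t}" for s x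
    using sol that sub unfolding is_solution_def by blast
  have near: "\<exists>d>0. \<forall>\<sigma>\<in>{0..t}. dist \<sigma> s < d \<longrightarrow> (\<forall>x. cmod (u \<sigma> x - u s x) < \<epsilon>)" if s: "s \<in> {0..t}" and \<epsilon>: "\<epsilon> > 0" for s \<epsilon>
  proof -
    have "\<forall>\<^sub>F \<sigma> in at s within time_interval T. \<forall>x\<in>UNIV. dist (u \<sigma> x) (u s x) < \<epsilon>"
      using ul[OF s] \<epsilon> unfolding uniform_limit_iff by blast
    then obtain d where d: "d > 0" "\<And>\<sigma>. \<sigma> \<in> time_interval T \<Longrightarrow> \<sigma> \<noteq> s \<Longrightarrow> dist \<sigma> s < d \<Longrightarrow> \<forall>x. dist (u \<sigma> x) (u s x) < \<epsilon>"
      unfolding eventually_at by auto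
    have "cmod (u \<sigma> x - u s x) < \<epsilon>" if "\<sigma> \<in> {0..t}" "dist \<sigma> s < d" for \<sigma> x
      using d(2)[of \<sigma>] that sub \<epsilon> by (cases "\<sigma> = s") (auto simp: dist_norm)
    then show ?thesis using d(1) by blast
  qed
  have cont: "continuous_on ({0..t} \<times> UNIV) (\<lambda>p. u (fst p) (snd p))"
    unfolding continuous_on_iff
  proof (intro ballI allI impI)
    fix p :: "real \<times> (real^'n)" and \<epsilon> :: real assume p: "p \<in> {0..t} \<times> UNIV" and \<epsilon>: "\<epsilon> > 0"
    obtain s x where sx: "p = (s, x)" "s \<in> {0..t}" using p by (cases p) auto
    obtain d1 where d1: "d1 > 0" "\<And>\<sigma> y. \<sigma> \<in> {0..t} \<Longrightarrow> dist \<sigma> s < d1 \<Longrightarrow> cmod (u \<sigma> y - u s y) < \<epsilon> / 2"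
      using near[OF sx(2), of "\<epsilon> / 2"] \<epsilon> by auto
    have "continuous_on UNIV (u s)" using C0[OF sx(2)] by (simp add: C0_def)
    then obtain d2 where d2: "d2 > 0" "\<And>y. dist y x < d2 \<Longrightarrow> dist (u s y) (u s x) < \<epsilon> / 2"
      using \<epsilon> unfolding continuous_on_iff by (metis UNIV_I half_gt_zero)
    show "\<exists>d>0. \<forall>q\<in>{0..t} \<times> UNIV. dist q p < d \<longrightarrow> dist (u (fst q) (snd q)) (u (fst p) (snd p)) < \<epsilon>"
    proof (intro exI[of _ "min d1 d2"] conjI ballI impI)
      fix q :: "real \<times> (real^'n)" assume q: "q \<in> {0..t} \<times> UNIV" "dist q p < min d1 d2"
      have "dist (fst q) s < d1" "dist (snd q) x < d2"
        using q(2) sx dist_fst_le[of q p] dist_snd_le[of q p] by auto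
      then have "cmod (u (fst q) (snd q) - u s (snd q)) < \<epsilon> / 2" "cmod (u s (snd q) - u s x) < \<epsilon> / 2"
        using d1(2)[of "fst q" "snd q"] d2(2)[of "snd q"] q(1) by (auto simp: dist_norm)
      then show "dist (u (fst q) (snd q)) (u (fst p) (snd p)) < \<epsilon>"
        unfolding sx dist_norm fst_conv snd_conv
        using norm_triangle_ineq[of "u (fst q) (snd q) - u s (snd q)" "u s (snd q) - u s x"] by simp
    qed (use d1 d2 in auto)
  qed
  have "\<exists>M. \<forall>s\<in>{0..t}. \<forall>x. cmod (u s x) \<le> M"
  proof -
    have "\<exists>d B. d > 0 \<and> (\<forall>\<sigma>\<in>{0..t}. dist \<sigma> s < d \<longrightarrow> (\<forall>x. cmod (u \<sigma> x) \<le> B))" if s: "s \<in> {0..t}" for s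
    proof -
      obtain B where B: "\<And>x. cmod (u s x) \<le> B" using C0_bounded[OF C0[OF s]] by blast
      obtain d where d: "d > 0" "\<And>\<sigma> x. \<sigma> \<in> {0..t} \<Longrightarrow> dist \<sigma> s < d \<Longrightarrow> cmod (u \<sigma> x - u s x) < 1"
        using near[OF s, of 1] by auto
      have "cmod (u \<sigma> x) \<le> B + 1" if "\<sigma> \<in> {0..t}" "dist \<sigma> s < d" for \<sigma> x
        using d(2)[OF that, of x] B[of x] norm_triangle_sub[of "u \<sigma> x" "u s x"] by linarith
      then show ?thesis using d(1) by blast
    qed
    then obtain d B where dB: "\<And>s. s \<in> {0..t} \<Longrightarrow> d s > 0" "\<And>s \<sigma> x. s \<in> {0..t} \<Longrightarrow> \<sigma> \<in> {0..t} \<Longrightarrow> dist \<sigma> s < d s \<Longrightarrow> cmod (u \<sigma> x) \<le> B s"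
      by metis
    obtain S where S: "S \<subseteq> {0..t}" "finite S" "{0..t} \<subseteq> (\<Union>s\<in>S. ball s (d s))"
    proof (rule compactE_image[of "{0..t}" "{0..t}" "\<lambda>s. ball s (d s)"])
      show "{0..t} \<subseteq> (\<Union>s\<in>{0..t}. ball s (d s))" using dB(1) by force
    qed auto
    have "cmod (u \<sigma> x) \<le> Max (insert 0 (B ` S))" if \<sigma>: "\<sigma> \<in> {0..t}" for \<sigma> x
    proof -
      obtain s where s: "s \<in> S" "dist \<sigma> s < d s" using S(3) \<sigma> by (auto simp: dist_commute)
      have "cmod (u \<sigma> x) \<le> B s" using dB(2)[of s \<sigma> x] s S \<sigma> by auto
      also have "\<dots> \<le> Max (insert 0 (B ` S))" using s S by (intro Max_ge) auto
      finally show ?thesis .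
    qed
    then show ?thesis by blast
  qed
  then obtain M where M: "\<And>s x. s \<in> {0..t} \<Longrightarrow> cmod (u s x) \<le> M" by blast
  have M0: "M \<ge> 0" using M[of 0 0] t by (meson atLeastAtMost_iff less_eq_real_def norm_ge_zero order_trans order_refl)
  let ?u = "\<lambda>s x. indicator {0..t} s *\<^sub>R u s x"
  have u_0: "u 0 x = u0 x" for x
  proof -
    have "(LINT \<sigma>:{0..0}|lborel. heat (0 - \<sigma>) (nonlin \<alpha> (u \<sigma>)) x) = 0"
      unfolding set_lebesgue_integral_def
      by (rule integral_eq_zero_AE) (use AE_lborel_singleton[of "0::real"] in \<open>auto elim!: eventually_mono\<close>)
    then show ?thesis using ud[of 0 x] t by (simp add: heat_def)
  qed
  have "dsol \<alpha> lam t M u0 ?u"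
    unfolding dsol_def
  proof (intro conjI allI impI)
    have "(\<lambda>p. indicator ({0..t} \<times> UNIV) p *\<^sub>R u (fst p) (snd p)) \<in> borel_measurable borel"
      by (rule borel_measurable_continuous_on_indicator[OF _ cont]) (auto intro!: borel_closed closed_Times)
    also have "(\<lambda>p. indicator ({0..t} \<times> UNIV) p *\<^sub>R u (fst p) (snd p)) = case_prod ?u"
      by (auto simp: fun_eq_iff indicator_def)
    finally show "case_prod ?u \<in> borel_measurable borel" .
    show "cmod (?u s x) \<le> M" for s x using M[of s x] M0 by (auto simp: indicator_def)
    show "s \<notin> {0..t} \<Longrightarrow> ?u s x = 0" for s x by simp
    fix s x assume s: "0 < s" "s \<le> t"
    have heat_hk: "heat r f x = (LINT y|lborel. hk r (x - y) *\<^sub>R f y)" if "r > 0" for r and f :: "(real^'n) \<Rightarrow> complex"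
      using that by (simp add: heat_def hk_def scaleR_conv_of_real)
    have "(LINT \<sigma>:{0..s}|lborel. heat (s - \<sigma>) (nonlin \<alpha> (u \<sigma>)) x) = (LINT \<sigma>|lborel. indicator {0..s} \<sigma> *\<^sub>R heat (s - \<sigma>) (nonlin \<alpha> (u \<sigma>)) x)"
      by (simp add: set_lebesgue_integral_def)
    also have "\<dots> = (LINT \<rho>|lborel. LINT y|lborel. hk (s - \<rho>) (x - y) *\<^sub>R pw \<alpha> (?u \<rho> y))"
    proof (rule integral_discrete_difference[where X="{s}"])
      fix \<rho> assume "\<rho> \<notin> {s}"
      then consider "\<rho> < 0" | "\<rho> > s" | "0 \<le> \<rho>" "\<rho> < s" by force
      then show "indicator {0..s} \<rho> *\<^sub>R heat (s - \<rho>) (nonlin \<alpha> (u \<rho>)) x = (LINT y|lborel. hk (s - \<rho>) (x - y) *\<^sub>R pw \<alpha> (?u \<rho> y))"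
      proof cases
        case 3
        have "nonlin \<alpha> (u \<rho>) y = pw \<alpha> (?u \<rho> y)" for y
          using 3 s by (simp add: nonlin_def pw_def scaleR_conv_of_real)
        then show ?thesis using 3 by (simp add: heat_hk)
      qed auto
    qed auto
    finally show "?u s x = (LINT y|lborel. hk s (x - y) *\<^sub>R u0 y) +
        lam *\<^sub>R (LINT \<rho>|lborel. LINT y|lborel. hk (s - \<rho>) (x - y) *\<^sub>R pw \<alpha> (?u \<rho> y))"
      using ud[of s x] s by (simp add: heat_hk scaleR_conv_of_real)
  qed
  moreover have "continuous_on UNIV u0" using C0[of 0] t u_0 by (simp add: C0_def)
  moreover have "cmod (u0 x) \<le> M" for x using M[of 0 x] t u_0 by simp
  ultimately show ?thesis using u_0 by blast
qed

subsection \<open>Pairing Duhamel's equation with an integrable function\<close>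

definition hkconv :: "('a::euclidean_space \<Rightarrow> real) \<Rightarrow> real \<Rightarrow> 'a \<Rightarrow> real" where
  "hkconv \<phi> r z = (LINT y|lborel. \<phi> y * hk r (y - z))"

lemma pair_hk_conv:
  fixes \<phi> w :: "'a::euclidean_space \<Rightarrow> real"
  assumes phi: "integrable lborel \<phi>" and w: "w \<in> borel_measurable borel" and B: "\<And>y. \<bar>w y\<bar> \<le> B"
  shows "(LINT y|lborel. \<phi> y * (LINT z|lborel. hk r (y - z) * w z)) = (LINT z|lborel. hkconv \<phi> r z * w z)"
    and "integrable lborel (\<lambda>y. \<phi> y * (LINT z|lborel. hk r (y - z) * w z))"
proof -
  have [measurable]: "\<phi> \<in> borel_measurable borel" using borel_measurable_integrable[OF phi] by simp
  note w[measurable]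
  have B0: "B \<ge> 0" using B[of 0] by linarith
  have int: "integrable (lborel \<Otimes>\<^sub>M lborel) (\<lambda>(y, z). \<phi> y * (hk r (y - z) * w z))"
  proof (rule integrableI_bounded)
    have "(\<integral>\<^sup>+p. ennreal (norm (case p of (y, z) \<Rightarrow> \<phi> y * (hk r (y - z) * w z))) \<partial>(lborel \<Otimes>\<^sub>M lborel)) =
      (\<integral>\<^sup>+y. \<integral>\<^sup>+z. ennreal (norm (\<phi> y * (hk r (y - z) * w z))) \<partial>lborel \<partial>lborel)"
      by (subst lborel.nn_integral_fst[symmetric]) auto
    also have "\<dots> \<le> (\<integral>\<^sup>+y. \<integral>\<^sup>+z. ennreal (B * \<bar>\<phi> y\<bar>) * ennreal (hk r (y - z)) \<partial>lborel \<partial>lborel)"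
    proof (intro nn_integral_mono)
      fix y z :: 'a
      have "\<bar>\<phi> y\<bar> * (hk r (y - z) * \<bar>w z\<bar>) \<le> \<bar>\<phi> y\<bar> * (hk r (y - z) * B)"
        by (intro mult_left_mono B) auto
      then show "ennreal (norm (\<phi> y * (hk r (y - z) * w z))) \<le> ennreal (B * \<bar>\<phi> y\<bar>) * ennreal (hk r (y - z))"
        using B0 by (auto simp: abs_mult mult_ac simp flip: ennreal_mult intro!: ennreal_leI)
    qed
    also have "\<dots> = (\<integral>\<^sup>+y. ennreal (B * \<bar>\<phi> y\<bar>) * (\<integral>\<^sup>+z. ennreal (hk r (y - z)) \<partial>lborel) \<partial>lborel)"
      by (intro nn_integral_cong nn_integral_cmult) measurable
    also have "\<dots> \<le> (\<integral>\<^sup>+y. ennreal (B * \<bar>\<phi> y\<bar>) * 1 \<partial>lborel)"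
      by (intro nn_integral_mono mult_left_mono hk_shift_nn_integral_le) auto
    also have "\<dots> = (\<integral>\<^sup>+y. ennreal (norm (B * \<phi> y)) \<partial>lborel)"
      using B0 by (simp add: abs_mult)
    also have "\<dots> < \<infinity>" using integrable_mult_right[OF phi, of B] unfolding integrable_iff_bounded by blast
    finally show "(\<integral>\<^sup>+p. ennreal (norm (case p of (y, z) \<Rightarrow> \<phi> y * (hk r (y - z) * w z))) \<partial>(lborel \<Otimes>\<^sub>M lborel)) < \<infinity>" .
  qed measurable
  have "(LINT y|lborel. \<phi> y * (LINT z|lborel. hk r (y - z) * w z)) = (LINT y|lborel. (LINT z|lborel. \<phi> y * (hk r (y - z) * w z)))"
    by simp
  also have "\<dots> = (LINT z|lborel. (LINT y|lborel. \<phi> y * (hk r (y - z) * w z)))"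
    using lborel_pair.Fubini_integral[OF int] by simp
  also have "\<dots> = (LINT z|lborel. hkconv \<phi> r z * w z)"
    unfolding hkconv_def by (simp add: mult.assoc[symmetric])
  finally show "(LINT y|lborel. \<phi> y * (LINT z|lborel. hk r (y - z) * w z)) = (LINT z|lborel. hkconv \<phi> r z * w z)" .
  show "integrable lborel (\<lambda>y. \<phi> y * (LINT z|lborel. hk r (y - z) * w z))"
    using lborel_pair.integrable_fst'[OF int] by simp
qed

lemma pair_hk_spacetime:
  fixes \<phi> :: "'a::euclidean_space \<Rightarrow> real" and W :: "real \<Rightarrow> 'a \<Rightarrow> real"
  assumes phi: "integrable lborel \<phi>" and W: "case_prod W \<in> borel_measurable borel" and B: "\<And>\<rho> y. \<bar>W \<rho> y\<bar> \<le> B"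
    and supp: "\<And>\<rho> y. \<rho> \<notin> {0..t} \<Longrightarrow> W \<rho> y = 0" and t: "t > 0"
  shows "(LINT y|lborel. \<phi> y * (LINT \<rho>|lborel. LINT z|lborel. hk (s - \<rho>) (y - z) * W \<rho> z)) =
      (LINT \<rho>|lborel. LINT z|lborel. hkconv \<phi> (s - \<rho>) z * W \<rho> z)"
    and "integrable lborel (\<lambda>y. \<phi> y * (LINT \<rho>|lborel. LINT z|lborel. hk (s - \<rho>) (y - z) * W \<rho> z))"
    and "integrable lborel (\<lambda>\<rho>. LINT z|lborel. hkconv \<phi> (s - \<rho>) z * W \<rho> z)"
proof -
  have [measurable]: "\<phi> \<in> borel_measurable borel" using borel_measurable_integrable[OF phi] by simp
  have Wm[measurable]: "case_prod W \<in> borel_measurable (borel \<Otimes>\<^sub>M borel)" using W by (simp add: borel_prod)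
  have B0: "B \<ge> 0" using B[of 0 0] by linarith
  let ?P = "lborel \<Otimes>\<^sub>M lborel :: (real \<times> 'a) measure"
  interpret P: pair_sigma_finite "lborel :: 'a measure" ?P by standard
  have SP: "sigma_finite_measure ?P"
    unfolding lborel_prod by (rule sigma_finite_lborel)
  have int: "integrable (lborel \<Otimes>\<^sub>M ?P) (\<lambda>(y, p). \<phi> y * (hk (s - fst p) (y - snd p) * W (fst p) (snd p)))"
  proof (rule integrableI_bounded)
    have "(\<integral>\<^sup>+q. ennreal (norm (case q of (y, p) \<Rightarrow> \<phi> y * (hk (s - fst p) (y - snd p) * W (fst p) (snd p)))) \<partial>(lborel \<Otimes>\<^sub>M ?P)) =
      (\<integral>\<^sup>+y. \<integral>\<^sup>+p. ennreal (norm (\<phi> y * (hk (s - fst p) (y - snd p) * W (fst p) (snd p)))) \<partial>?P \<partial>lborel)"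
      by (subst sigma_finite_measure.nn_integral_fst[OF SP, symmetric]) auto
    also have "\<dots> = (\<integral>\<^sup>+y. \<integral>\<^sup>+\<rho>. \<integral>\<^sup>+z. ennreal (norm (\<phi> y * (hk (s - \<rho>) (y - z) * W \<rho> z))) \<partial>lborel \<partial>lborel \<partial>lborel)"
      by (intro nn_integral_cong, subst lborel.nn_integral_fst[symmetric]) auto
    also have "\<dots> \<le> (\<integral>\<^sup>+y. \<integral>\<^sup>+\<rho>. \<integral>\<^sup>+z. ennreal (B * \<bar>\<phi> y\<bar> * indicator {0..t} \<rho>) * ennreal (hk (s - \<rho>) (y - z)) \<partial>lborel \<partial>lborel \<partial>lborel)"
    proof (intro nn_integral_mono)
      fix y z :: 'a and \<rho>
      have "\<bar>\<phi> y\<bar> * (hk (s - \<rho>) (y - z) * \<bar>W \<rho> z\<bar>) \<le> \<bar>\<phi> y\<bar> * (hk (s - \<rho>) (y - z) * (B * indicator {0..t} \<rho>))"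
        using B[of \<rho> z] supp[of \<rho> z] by (intro mult_left_mono) (auto simp: indicator_def)
      then show "ennreal (norm (\<phi> y * (hk (s - \<rho>) (y - z) * W \<rho> z))) \<le> ennreal (B * \<bar>\<phi> y\<bar> * indicator {0..t} \<rho>) * ennreal (hk (s - \<rho>) (y - z))"
        using B0 by (auto simp: abs_mult mult_ac simp flip: ennreal_mult intro!: ennreal_leI)
    qed
    also have "\<dots> = (\<integral>\<^sup>+y. \<integral>\<^sup>+\<rho>. ennreal (B * \<bar>\<phi> y\<bar> * indicator {0..t} \<rho>) * (\<integral>\<^sup>+z. ennreal (hk (s - \<rho>) (y - z)) \<partial>lborel) \<partial>lborel \<partial>lborel)"
      by (intro nn_integral_cong nn_integral_cmult) measurable
    also have "\<dots> \<le> (\<integral>\<^sup>+y. \<integral>\<^sup>+\<rho>. ennreal (B * \<bar>\<phi> y\<bar> * indicator {0..t} \<rho>) * 1 \<partial>lborel \<partial>lborel)"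
      by (intro nn_integral_mono mult_left_mono hk_shift_nn_integral_le) auto
    also have "\<dots> = (\<integral>\<^sup>+y. \<integral>\<^sup>+\<rho>. ennreal (B * \<bar>\<phi> y\<bar>) * indicator {0..t} \<rho> \<partial>lborel \<partial>lborel)"
      using B0 by (intro nn_integral_cong) (auto simp: indicator_def)
    also have "\<dots> = (\<integral>\<^sup>+y. ennreal (norm (t * B * \<phi> y)) \<partial>lborel)"
      using B0 t by (intro nn_integral_cong, subst nn_integral_cmult_indicator)
        (auto simp: abs_mult mult_ac simp flip: ennreal_mult)
    also have "\<dots> < \<infinity>" using integrable_mult_right[OF phi, of "t * B"] unfolding integrable_iff_bounded by blast
    finally show "(\<integral>\<^sup>+q. ennreal (norm (case q of (y, p) \<Rightarrow> \<phi> y * (hk (s - fst p) (y - snd p) * W (fst p) (snd p)))) \<partial>(lborel \<Otimes>\<^sub>M ?P)) < \<infinity>" .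
  qed measurable
  have in_int: "integrable ?P (\<lambda>p. hk (s - fst p) (y - snd p) * W (fst p) (snd p))" for y
    using hk_spacetime_integrable[OF W, of B t s y] B supp by (simp add: case_prod_beta')
  have eq1: "(LINT \<rho>|lborel. LINT z|lborel. hk (s - \<rho>) (y - z) * W \<rho> z) = (LINT p|?P. hk (s - fst p) (y - snd p) * W (fst p) (snd p))" for y
    using lborel_pair.integral_fst'[OF in_int] by simp
  have int2: "integrable ?P (\<lambda>p. hkconv \<phi> (s - fst p) (snd p) * W (fst p) (snd p))"
  proof -
    have "integrable ?P (\<lambda>p. LINT y|lborel. \<phi> y * (hk (s - fst p) (y - snd p) * W (fst p) (snd p)))"
      using P.integrable_snd[OF int] by simp
    then show ?thesis unfolding hkconv_def by (simp add: mult.assoc[symmetric])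
  qed
  have "(LINT y|lborel. \<phi> y * (LINT \<rho>|lborel. LINT z|lborel. hk (s - \<rho>) (y - z) * W \<rho> z)) =
     (LINT y|lborel. (LINT p|?P. \<phi> y * (hk (s - fst p) (y - snd p) * W (fst p) (snd p))))"
    unfolding eq1 by simp
  also have "\<dots> = (LINT p|?P. (LINT y|lborel. \<phi> y * (hk (s - fst p) (y - snd p) * W (fst p) (snd p))))"
    using P.Fubini_integral[OF int] by simp
  also have "\<dots> = (LINT p|?P. hkconv \<phi> (s - fst p) (snd p) * W (fst p) (snd p))"
    unfolding hkconv_def by (simp add: mult.assoc[symmetric])
  also have "\<dots> = (LINT \<rho>|lborel. LINT z|lborel. hkconv \<phi> (s - \<rho>) z * W \<rho> z)"
    using lborel_pair.integral_fst'[OF int2] by simp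
  finally show "(LINT y|lborel. \<phi> y * (LINT \<rho>|lborel. LINT z|lborel. hk (s - \<rho>) (y - z) * W \<rho> z)) =
      (LINT \<rho>|lborel. LINT z|lborel. hkconv \<phi> (s - \<rho>) z * W \<rho> z)" .
  show "integrable lborel (\<lambda>y. \<phi> y * (LINT \<rho>|lborel. LINT z|lborel. hk (s - \<rho>) (y - z) * W \<rho> z))"
    unfolding eq1 using P.integrable_fst'[OF int] by simp
  show "integrable lborel (\<lambda>\<rho>. LINT z|lborel. hkconv \<phi> (s - \<rho>) z * W \<rho> z)"
    using lborel_pair.integrable_fst'[OF int2] by simp
qed

lemma hkconv_hk:
  assumes "r > 0"
  shows "hkconv (\<lambda>y. hk r (x - y)) s z = (if s > 0 then hk (r + s) (x - z) else 0)"
  using hk_semigroup[of r s x z] assms by (auto simp: hkconv_def)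

subsection \<open>Odd solutions\<close>

text \<open>The heat kernel acting on functions that are odd in direction \<open>e\<close>; it is positive on the half-space.\<close>

definition odd_hk :: "'a::euclidean_space \<Rightarrow> real \<Rightarrow> 'a \<Rightarrow> 'a \<Rightarrow> real" where
  "odd_hk e r x y = (hk r (x - y) - hk r (x - reflect e y)) / 2"

lemma norm_minus_reflect:
  assumes e: "e \<in> Basis"
  shows "(norm (x - reflect e y))\<^sup>2 = (norm (x - y))\<^sup>2 + 4 * (x \<bullet> e) * (y \<bullet> e)"
proof -
  have eq: "x - reflect e y = (x - y) + (2 * (y \<bullet> e)) *\<^sub>R e" by (simp add: reflect_def)
  have "e \<bullet> e = 1" using e by (simp add: inner_Basis)
  then show ?thesis
    unfolding eq power2_norm_eq_inner
    by (simp add: inner_add_left inner_add_right inner_diff_left inner_diff_right algebra_simps inner_commute power2_eq_square)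
qed

lemma odd_hk_sign:
  assumes e: "e \<in> Basis" and x: "x \<bullet> e \<ge> 0"
  shows "y \<bullet> e \<ge> 0 \<Longrightarrow> odd_hk e r x y \<ge> 0" and "y \<bullet> e \<le> 0 \<Longrightarrow> odd_hk e r x y \<le> 0"
proof -
  have *: "hk r (x - reflect e y) \<le> hk r (x - y)" if "(norm (x - y))\<^sup>2 \<le> (norm (x - reflect e y))\<^sup>2" for y
    using that by (auto simp: hk_def divide_right_mono)
  have **: "hk r (x - y) \<le> hk r (x - reflect e y)" if "(norm (x - reflect e y))\<^sup>2 \<le> (norm (x - y))\<^sup>2" for y
    using that by (auto simp: hk_def divide_right_mono)
  show "y \<bullet> e \<ge> 0 \<Longrightarrow> odd_hk e r x y \<ge> 0"
    using *[of y] x by (simp add: odd_hk_def norm_minus_reflect[OF e])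
  show "y \<bullet> e \<le> 0 \<Longrightarrow> odd_hk e r x y \<le> 0"
    using **[of y] x by (simp add: odd_hk_def norm_minus_reflect[OF e] mult_nonneg_nonpos)
qed

lemma odd_hk_pos:
  assumes e: "e \<in> Basis" and x: "x \<bullet> e > 0" and y: "y \<bullet> e > 0" and r: "r > 0"
  shows "odd_hk e r x y > 0"
proof -
  have "4 * (x \<bullet> e) * (y \<bullet> e) > 0" using x y by simp
  then have "- (norm (x - reflect e y))\<^sup>2 / (4 * r) < - (norm (x - y))\<^sup>2 / (4 * r)"
    using r by (intro divide_strict_right_mono) (auto simp: norm_minus_reflect[OF e])
  then show ?thesis using r by (simp add: odd_hk_def hk_def)
qed

lemma hk_reflect_shift_integrable:
  assumes e: "e \<in> Basis"
  shows "integrable lborel (\<lambda>y. hk r (x - reflect e y :: 'a::euclidean_space))"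
    "r > 0 \<Longrightarrow> (LINT y|lborel. hk r (x - reflect e y :: 'a::euclidean_space)) = 1"
proof -
  have "integrable (distr lborel borel (reflect e)) (\<lambda>y. hk r (x - y))"
    using hk_shift_integrable by (simp add: lborel_distr_reflect[OF e])
  then show "integrable lborel (\<lambda>y. hk r (x - reflect e y))"
    by (subst (asm) integrable_distr_eq) auto
  show "r > 0 \<Longrightarrow> (LINT y|lborel. hk r (x - reflect e y)) = 1"
    using lborel_integral_reflect[OF e, of "\<lambda>y. hk r (x - y)"] by (simp add: hk_shift_integral)
qed

lemma odd_hk_integrable: "e \<in> Basis \<Longrightarrow> integrable lborel (odd_hk e r x)"
  unfolding odd_hk_def[abs_def] by (intro integrable_divide_zero Bochner_Integration.integrable_diff hk_shift_integrable hk_reflect_shift_integrable)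

lemma odd_hk_abs_integral:
  assumes e: "e \<in> Basis"
  shows "(LINT y|lborel. \<bar>odd_hk e r x y\<bar>) \<le> 1"
proof (cases "r > 0")
  case True
  have "(LINT y|lborel. \<bar>odd_hk e r x y\<bar>) \<le> (LINT y|lborel. (hk r (x - y) + hk r (x - reflect e y)) / 2)"
  proof (rule integral_mono)
    show "\<bar>odd_hk e r x y\<bar> \<le> (hk r (x - y) + hk r (x - reflect e y)) / 2" for y
    proof -
      have "\<bar>(a - b) / 2\<bar> \<le> (a + b) / 2" if "0 \<le> a" "0 \<le> b" for a b :: real
        using that by (auto simp: abs_real_def field_simps)
      then show ?thesis unfolding odd_hk_def by simp
    qed
  qed (intro integrable_abs odd_hk_integrable e integrable_divide_zero Bochner_Integration.integrable_add hk_shift_integrable hk_reflect_shift_integrable)+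
  also have "\<dots> = ((LINT y|lborel. hk r (x - y)) + (LINT y|lborel. hk r (x - reflect e y))) / 2"
    by (subst Bochner_Integration.integral_add[symmetric]) (auto intro: hk_shift_integrable hk_reflect_shift_integrable e)
  also have "\<dots> = 1" using True e by (simp add: hk_shift_integral hk_reflect_shift_integrable)
  finally show ?thesis .
qed (simp add: odd_hk_def)

lemma odd_hk_conv:
  fixes w :: "'a::euclidean_space \<Rightarrow> real"
  assumes e: "e \<in> Basis" and w: "w \<in> borel_measurable borel" and B: "\<And>y. \<bar>w y\<bar> \<le> B" and odd: "\<And>y. w (reflect e y) = - w y"
  shows "(LINT y|lborel. hk r (x - y) * w y) = (LINT y|lborel. odd_hk e r x y * w y)"
    and "integrable lborel (\<lambda>y. odd_hk e r x y * w y)"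
proof -
  note w[measurable]
  have i1: "integrable lborel (\<lambda>y. hk r (x - y) * w y)"
    using bounded_mult_integrable[OF hk_shift_integrable w, of B r x] B by simp
  have i2: "integrable lborel (\<lambda>y. hk r (x - reflect e y) * w y)"
    using bounded_mult_integrable[OF hk_reflect_shift_integrable(1)[OF e] w, of B r x] B by simp
  have "(LINT y|lborel. hk r (x - reflect e y) * w y) = (LINT y|lborel. hk r (x - reflect e (reflect e y)) * w (reflect e y))"
    by (subst lborel_integral_reflect[OF e, of "\<lambda>y. hk r (x - reflect e y) * w y"]) auto
  also have "\<dots> = - (LINT y|lborel. hk r (x - y) * w y)" by (simp add: e odd)
  finally have eq: "(LINT y|lborel. hk r (x - reflect e y) * w y) = - (LINT y|lborel. hk r (x - y) * w y)" .
  have "(LINT y|lborel. odd_hk e r x y * w y) = (LINT y|lborel. (hk r (x - y) * w y - hk r (x - reflect e y) * w y) / 2)"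
    by (intro Bochner_Integration.integral_cong) (auto simp: odd_hk_def field_simps)
  also have "\<dots> = (LINT y|lborel. hk r (x - y) * w y)"
    using eq by (simp add: i1 i2)
  finally show "(LINT y|lborel. hk r (x - y) * w y) = (LINT y|lborel. odd_hk e r x y * w y)" ..
  show "integrable lborel (\<lambda>y. odd_hk e r x y * w y)"
    using bounded_mult_integrable[OF odd_hk_integrable[OF e] w, of B r x] B by simp
qed

lemma odd_sign_mult:
  assumes e: "e \<in> Basis" and x: "x \<bullet> e \<ge> 0" and odd: "\<And>y. w (reflect e y) = - w y" and pos: "\<And>y. y \<bullet> e \<ge> 0 \<Longrightarrow> w y \<ge> (0::real)"
  shows "odd_hk e r x y * w y = \<bar>odd_hk e r x y\<bar> * \<bar>w y\<bar>"
proof (cases "y \<bullet> e \<ge> 0")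
  case True
  then show ?thesis using odd_hk_sign(1)[OF e x True, of r] pos[OF True] by simp
next
  case False
  then have "reflect e y \<bullet> e \<ge> 0" using e by (simp add: reflect_inner)
  from pos[OF this] have "w y \<le> 0" by (simp add: odd)
  moreover have "odd_hk e r x y \<le> 0" using odd_hk_sign(2)[OF e x, of y r] False by simp
  ultimately show ?thesis by simp
qed

lemma odd_hk_conv_nonneg:
  fixes w :: "'a::euclidean_space \<Rightarrow> real"
  assumes e: "e \<in> Basis" and w: "w \<in> borel_measurable borel" and B: "\<And>y. \<bar>w y\<bar> \<le> B" and odd: "\<And>y. w (reflect e y) = - w y"
    and x: "x \<bullet> e \<ge> 0" and pos: "\<And>y. y \<bullet> e \<ge> 0 \<Longrightarrow> w y \<ge> 0"
  shows "(LINT y|lborel. hk r (x - y) * w y) = (LINT y|lborel. \<bar>odd_hk e r x y\<bar> * \<bar>w y\<bar>)"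
    and "integrable lborel (\<lambda>y. \<bar>odd_hk e r x y\<bar> * \<bar>w y\<bar>)"
    and "(LINT y|lborel. hk r (x - y) * w y) \<ge> 0"
proof -
  have s: "odd_hk e r x y * w y = \<bar>odd_hk e r x y\<bar> * \<bar>w y\<bar>" for y
    by (rule odd_sign_mult[OF e x]) (auto simp: odd pos)
  show 1: "(LINT y|lborel. hk r (x - y) * w y) = (LINT y|lborel. \<bar>odd_hk e r x y\<bar> * \<bar>w y\<bar>)"
    unfolding odd_hk_conv(1)[where w=w, OF e w B odd] s ..
  show "integrable lborel (\<lambda>y. \<bar>odd_hk e r x y\<bar> * \<bar>w y\<bar>)"
    using odd_hk_conv(2)[where w=w, OF e w B odd, of r x] unfolding s .
  show "(LINT y|lborel. hk r (x - y) * w y) \<ge> 0"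
    unfolding 1 by (rule integral_nonneg_AE) auto
qed

locale odd_solution =
  fixes \<alpha> lam t M :: real and e :: "'a::euclidean_space" and U0 :: "'a \<Rightarrow> real" and U :: "real \<Rightarrow> 'a \<Rightarrow> real"
  assumes al: "\<alpha> > 0" and lam: "lam > 0" and t: "t > 0" and e: "e \<in> Basis"
    and sol: "dsol \<alpha> lam t M U0 U"
    and U_init: "\<And>x. U 0 x = U0 x"
    and U_odd: "\<And>s x. U s (reflect e x) = - U s x"
    and U0_meas [measurable]: "U0 \<in> borel_measurable borel"
    and U0_nonneg: "\<And>x. x \<bullet> e \<ge> 0 \<Longrightarrow> U0 x \<ge> 0"
begin

abbreviation F :: "real \<Rightarrow> 'a \<Rightarrow> real" where "F \<rho> y \<equiv> pw \<alpha> (U \<rho> y)"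

lemma U_meas: "case_prod U \<in> borel_measurable borel" and U_bound: "\<bar>U \<rho> y\<bar> \<le> M"
  and U_supp: "\<rho> \<notin> {0..t} \<Longrightarrow> U \<rho> y = 0"
  and U_eq: "0 < s \<Longrightarrow> s \<le> t \<Longrightarrow> U s x = (LINT y|lborel. hk s (x - y) * U0 y) +
        lam * (LINT \<rho>|lborel. LINT y|lborel. hk (s - \<rho>) (x - y) * F \<rho> y)"
  using sol unfolding dsol_def by auto

lemma M_nonneg: "M \<ge> 0" using U_bound[of 0 0] by linarith

lemma U0_bound: "\<bar>U0 y\<bar> \<le> M" using U_bound[of 0 y] by (simp add: U_init)

lemma U0_odd: "U0 (reflect e x) = - U0 x" using U_odd[of 0 x] by (simp add: U_init)

lemma U_section [measurable]: "U \<rho> \<in> borel_measurable borel"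
  by (rule section_measurable[OF U_meas])

lemma F_meas: "case_prod F \<in> borel_measurable borel"
  using case_prod_pw_measurable[OF U_meas] .

lemma F_bound: "\<bar>F \<rho> y\<bar> \<le> M powr \<alpha> * M"
proof -
  have "norm (F \<rho> y) \<le> M powr \<alpha> * norm (U \<rho> y)" by (rule norm_pw_le) (auto simp: U_bound al)
  also have "\<dots> \<le> M powr \<alpha> * M" using U_bound by (intro mult_left_mono) auto
  finally show ?thesis by simp
qed

lemma F_supp: "\<rho> \<notin> {0..t} \<Longrightarrow> F \<rho> y = 0"
  by (simp add: U_supp)

lemma F_odd: "F \<rho> (reflect e y) = - F \<rho> y"
  by (simp add: U_odd)

lemma F_time_integrable: "integrable lborel (\<lambda>\<rho>. LINT y|lborel. hk (s - \<rho>) (x - y) * F \<rho> y)"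
  using hk_time_integrable[OF F_meas, of "M powr \<alpha> * M" t s x] F_bound F_supp by simp

lemma U0_conv_nonneg: "x \<bullet> e \<ge> 0 \<Longrightarrow> (LINT y|lborel. hk s (x - y) * U0 y) \<ge> 0"
  by (rule odd_hk_conv_nonneg(3)[where w=U0, OF e U0_meas U0_bound U0_odd _ U0_nonneg])

lemma U_nonneg:
  assumes x: "x \<bullet> e \<ge> 0"
  shows "U s x \<ge> 0"
proof -
  define P where "P y = (if y \<bullet> e \<ge> 0 then y else reflect e y)" for y
  have Pe: "P y \<bullet> e \<ge> 0" for y using e by (auto simp: P_def reflect_inner)
  have "- U s (P x) \<le> 0" if s: "0 < s" "s \<le> t"
  proof (rule factorial_iteration[where t=t and B=M and L="lam * M powr \<alpha>" and D="\<lambda>s x. - U s (P x)"])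
    show "- U s (P x) \<le> M" for s x using U_bound[of s "P x"] by linarith
    fix C k s x
    assume C: "C \<ge> (0::real)" and hyp: "\<And>\<rho> y. 0 < \<rho> \<Longrightarrow> \<rho> \<le> t \<Longrightarrow> - U \<rho> (P y) \<le> C * \<rho> ^ k" and s: "0 < s" "s \<le> t"
    let ?C = "M powr \<alpha> * C"
    have inner: "- (LINT y|lborel. hk (s - \<rho>) (P x - y) * F \<rho> y) \<le> ?C * \<rho> ^ k" if r: "0 < \<rho>" "\<rho> \<le> t" for \<rho>
    proof -
      have "- (LINT y|lborel. hk (s - \<rho>) (P x - y) * F \<rho> y) = (LINT y|lborel. - (odd_hk e (s - \<rho>) (P x) y * F \<rho> y))"
        by (subst odd_hk_conv(1)[where w="\<lambda>y. F \<rho> y", OF e _ F_bound F_odd]) auto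
      also have "\<dots> \<le> (LINT y|lborel. \<bar>odd_hk e (s - \<rho>) (P x) y\<bar> * (?C * \<rho> ^ k))"
      proof (rule integral_mono)
        show "integrable lborel (\<lambda>y. - (odd_hk e (s - \<rho>) (P x) y * F \<rho> y))"
          by (intro Bochner_Integration.integrable_minus odd_hk_conv(2)[where w="\<lambda>y. F \<rho> y", OF e _ F_bound F_odd]) measurable
        show "integrable lborel (\<lambda>y. \<bar>odd_hk e (s - \<rho>) (P x) y\<bar> * (?C * \<rho> ^ k))"
          by (intro integrable_mult_left integrable_abs odd_hk_integrable e)
        fix y
        have Ck: "0 \<le> C * \<rho> ^ k" using C r by simp
        have Uy: "- U \<rho> y \<le> C * \<rho> ^ k" if "y \<bullet> e \<ge> 0" for y
          using hyp[OF r, of y] that by (simp add: P_def)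
        have Fy: "- F \<rho> y \<le> ?C * \<rho> ^ k" if y: "y \<bullet> e \<ge> 0" for y
        proof -
          have "- F \<rho> y = \<bar>U \<rho> y\<bar> powr \<alpha> * (- U \<rho> y)" by (simp add: pw_def)
          also have "\<dots> \<le> \<bar>U \<rho> y\<bar> powr \<alpha> * (C * \<rho> ^ k)" by (intro mult_left_mono Uy y) auto
          also have "\<dots> \<le> M powr \<alpha> * (C * \<rho> ^ k)" using Ck al U_bound by (intro mult_right_mono powr_mono2) auto
          finally show ?thesis by (simp add: mult.assoc)
        qed
        show "- (odd_hk e (s - \<rho>) (P x) y * F \<rho> y) \<le> \<bar>odd_hk e (s - \<rho>) (P x) y\<bar> * (?C * \<rho> ^ k)"
        proof (cases "y \<bullet> e \<ge> 0")
          case True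
          then have "odd_hk e (s - \<rho>) (P x) y \<ge> 0" using odd_hk_sign(1)[OF e Pe] by blast
          then show ?thesis using mult_left_mono[OF Fy[OF True], of "odd_hk e (s - \<rho>) (P x) y"] by simp
        next
          case False
          then have k: "odd_hk e (s - \<rho>) (P x) y \<le> 0" using odd_hk_sign(2)[OF e Pe] by auto
          have "reflect e y \<bullet> e \<ge> 0" using False e by (simp add: reflect_inner)
          from Fy[OF this] have "F \<rho> y \<le> ?C * \<rho> ^ k" by (simp add: F_odd)
          then show ?thesis using mult_left_mono[of "F \<rho> y" "?C * \<rho> ^ k" "- odd_hk e (s - \<rho>) (P x) y"] k by simp
        qed
      qed
      also have "\<dots> = (LINT y|lborel. \<bar>odd_hk e (s - \<rho>) (P x) y\<bar>) * (?C * \<rho> ^ k)" by simp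
      also have "\<dots> \<le> 1 * (?C * \<rho> ^ k)" using C r by (intro mult_right_mono odd_hk_abs_integral e) auto
      finally show ?thesis by simp
    qed
    have D: "((\<lambda>\<rho>. ?C * \<rho> ^ (k + 1) / (k + 1)) has_real_derivative ?C * \<rho> ^ k) (at \<rho> within A)" for \<rho> A
      by (rule DERIV_cong[OF DERIV_cdivide[OF DERIV_cmult[OF DERIV_pow]]]) simp
    have "- (LINT \<rho>|lborel. LINT y|lborel. hk (s - \<rho>) (P x - y) * F \<rho> y) = (LINT \<rho>|lborel. - (LINT y|lborel. hk (s - \<rho>) (P x - y) * F \<rho> y))"
      by simp
    also have "\<dots> \<le> (LINT \<rho>|lborel. indicator {0..s} \<rho> *\<^sub>R (?C * \<rho> ^ k))"
    proof (rule integral_mono_AE)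
      show "integrable lborel (\<lambda>\<rho>. indicator {0..s} \<rho> *\<^sub>R (?C * \<rho> ^ k))"
        using borel_integrable_atLeastAtMost'[of 0 s "\<lambda>\<rho>. ?C * \<rho> ^ k"] by (simp add: set_integrable_def continuous_intros)
      show "AE \<rho> in lborel. - (LINT y|lborel. hk (s - \<rho>) (P x - y) * F \<rho> y) \<le> indicator {0..s} \<rho> *\<^sub>R (?C * \<rho> ^ k)"
        using AE_lborel_singleton[of 0]
      proof eventually_elim
        case (elim \<rho>)
        consider "\<rho> < 0" | "\<rho> > s" | "0 < \<rho>" "\<rho> \<le> s" using elim by linarith
        then show ?case
        proof cases
          case 1 then show ?thesis by (simp add: F_supp)
        next
          case 3 then show ?thesis using inner[of \<rho>] s by simp
        qed simp
      qed
    qed (intro Bochner_Integration.integrable_minus F_time_integrable)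
    also have "\<dots> = ?C * s ^ (k + 1) / (k + 1) - ?C * 0 ^ (k + 1) / (k + 1)"
      using s by (intro integral_FTC_atLeastAtMost continuous_intros D[unfolded has_real_derivative_iff_has_vector_derivative]) auto
    finally have "- (LINT \<rho>|lborel. LINT y|lborel. hk (s - \<rho>) (P x - y) * F \<rho> y) \<le> ?C * s ^ (k + 1) / (k + 1)" by simp
    then have "lam * - (LINT \<rho>|lborel. LINT y|lborel. hk (s - \<rho>) (P x - y) * F \<rho> y) \<le> lam * (?C * s ^ (k + 1) / (k + 1))"
      using lam by (intro mult_left_mono) auto
    then show "- U s (P x) \<le> lam * M powr \<alpha> * (C * s ^ (k + 1) / (k + 1))"
      unfolding U_eq[OF s] using U0_conv_nonneg[OF Pe, of s x] by (simp add: mult.assoc)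
  qed (use M_nonneg lam s in auto)
  moreover have "U s x \<ge> 0" if "s \<le> 0 \<or> s > t"
    using that U_supp[of s x] U_init[of x] U0_nonneg[OF x] by (cases "s = 0") auto
  ultimately show ?thesis using x by (cases "0 < s \<and> s \<le> t") (auto simp: P_def)
qed

lemma F_nonneg: "y \<bullet> e \<ge> 0 \<Longrightarrow> F \<rho> y \<ge> 0"
  using U_nonneg by (simp add: pw_def)

lemma F_conv_nonneg: "x \<bullet> e \<ge> 0 \<Longrightarrow> (LINT y|lborel. hk r (x - y) * F \<rho> y) \<ge> 0"
  by (rule odd_hk_conv_nonneg(3)[where w="\<lambda>y. F \<rho> y", OF e _ F_bound F_odd _ F_nonneg]) measurable

lemma U_lower: "0 < s \<Longrightarrow> s \<le> t \<Longrightarrow> x \<bullet> e \<ge> 0 \<Longrightarrow> U s x \<ge> (LINT y|lborel. hk s (x - y) * U0 y)"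
  unfolding U_eq using lam F_conv_nonneg by (simp add: integral_nonneg_AE)

lemma pairing:
  assumes phi: "integrable lborel \<phi>" and s: "0 < s" "s \<le> t"
  shows "(LINT y|lborel. \<phi> y * U s y) = (LINT z|lborel. hkconv \<phi> s z * U0 z) +
      lam * (LINT \<rho>|lborel. LINT z|lborel. hkconv \<phi> (s - \<rho>) z * F \<rho> z)"
    and "integrable lborel (\<lambda>\<rho>. LINT z|lborel. hkconv \<phi> (s - \<rho>) z * F \<rho> z)"
proof -
  have st: "(LINT y|lborel. \<phi> y * (LINT \<rho>|lborel. LINT z|lborel. hk (s - \<rho>) (y - z) * F \<rho> z)) =
      (LINT \<rho>|lborel. LINT z|lborel. hkconv \<phi> (s - \<rho>) z * F \<rho> z)"
    "integrable lborel (\<lambda>y. \<phi> y * (LINT \<rho>|lborel. LINT z|lborel. hk (s - \<rho>) (y - z) * F \<rho> z))"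
    "integrable lborel (\<lambda>\<rho>. LINT z|lborel. hkconv \<phi> (s - \<rho>) z * F \<rho> z)"
    by (rule pair_hk_spacetime[OF phi F_meas F_bound F_supp t]; assumption)+
  note sp = pair_hk_conv[where w=U0, OF phi U0_meas U0_bound, of s]
  have "(LINT y|lborel. \<phi> y * U s y) = (LINT y|lborel. \<phi> y * (LINT z|lborel. hk s (y - z) * U0 z) +
      lam * (\<phi> y * (LINT \<rho>|lborel. LINT z|lborel. hk (s - \<rho>) (y - z) * F \<rho> z)))"
    unfolding U_eq[OF s] by (intro Bochner_Integration.integral_cong) (auto simp: algebra_simps)
  also have "\<dots> = (LINT y|lborel. \<phi> y * (LINT z|lborel. hk s (y - z) * U0 z)) +
      lam * (LINT y|lborel. \<phi> y * (LINT \<rho>|lborel. LINT z|lborel. hk (s - \<rho>) (y - z) * F \<rho> z))"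
    using Bochner_Integration.integral_add[OF sp(2) integrable_mult_right[OF st(2), of lam]]
    by (simp only: integral_mult_right_zero)
  finally show "(LINT y|lborel. \<phi> y * U s y) = (LINT z|lborel. hkconv \<phi> s z * U0 z) +
      lam * (LINT \<rho>|lborel. LINT z|lborel. hkconv \<phi> (s - \<rho>) z * F \<rho> z)"
    unfolding sp(1) st(1) .
  show "integrable lborel (\<lambda>\<rho>. LINT z|lborel. hkconv \<phi> (s - \<rho>) z * F \<rho> z)" by (rule st(3))
qed

end

lemma solution_imp_odd_solution:
  fixes U0 :: "(real^'n) \<Rightarrow> real"
  assumes sol: "is_solution \<alpha> lam (\<lambda>x. of_real (U0 x)) T u" and t: "0 < t" "ereal t < T"
    and al: "\<alpha> > 0" and lam: "lam > 0" and e: "e \<in> Basis"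
    and odd: "\<And>x. U0 (reflect e x) = - U0 x" and pos: "\<And>x. x \<bullet> e \<ge> 0 \<Longrightarrow> U0 x \<ge> 0"
  shows "\<exists>M. odd_solution \<alpha> lam t M e U0 (\<lambda>s x. indicator {0..t} s * Re (u s x)) \<and> (\<forall>s x. s \<in> {0..t} \<longrightarrow> u s x = of_real (Re (u s x)))"
proof -
  let ?ini = "\<lambda>x. complex_of_real (U0 x)"
  let ?u = "\<lambda>s x. indicator {0..t} s *\<^sub>R u s x"
  let ?U = "\<lambda>s x. indicator {0..t} s * Re (u s x)"
  obtain M where d: "dsol \<alpha> lam t M ?ini ?u" and b: "\<And>x. cmod (?ini x) \<le> M" and c: "continuous_on UNIV ?ini" and i: "\<And>x. u 0 x = ?ini x"
    using solution_imp_dsol[OF sol t] by blast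
  have [measurable]: "?ini \<in> borel_measurable borel" by (rule borel_measurable_continuous_onI[OF c])
  have U0m: "U0 \<in> borel_measurable borel"
  proof -
    have "(\<lambda>x. Re (?ini x)) \<in> borel_measurable borel" by measurable
    then show ?thesis by simp
  qed
  have real: "u s x = of_real (Re (u s x))" if s: "s \<in> {0..t}" for s x
  proof (cases "s = 0")
    case False
    have "?u s x = cnj (?u s x)"
      by (rule dsol_unique[OF d dsol_cnj[OF d] al lam]) (use False s in auto)
    then show ?thesis using s by (simp add: complex_eq_iff)
  qed (simp add: i)
  have oddu: "u s (reflect e x) = - u s x" if s: "s \<in> {0..t}" for s x
  proof (cases "s = 0")
    case False
    have "?u s (reflect e x) = - ?u s (reflect e (reflect e x))"
      by (rule dsol_unique[OF d dsol_reflect[OF d e] al lam]) (use False s odd in auto)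
    then show ?thesis using s e by simp
  qed (simp add: i odd)
  have uU: "?u = (\<lambda>s x. of_real (?U s x))"
    using real by (auto simp: fun_eq_iff indicator_def)
  have "dsol \<alpha> lam t M U0 ?U"
    unfolding dsol_def
  proof (intro conjI allI impI)
    have "case_prod ?u \<in> borel_measurable borel" using d unfolding dsol_def by blast
    then have [measurable]: "case_prod ?u \<in> borel_measurable (borel \<Otimes>\<^sub>M borel)" by (simp add: borel_prod)
    have "(\<lambda>p. Re (case_prod ?u p)) \<in> borel_measurable (borel \<Otimes>\<^sub>M borel)" by measurable
    then show "case_prod ?U \<in> borel_measurable borel" by (simp add: borel_prod case_prod_beta')
    show "norm (?U \<rho> y) \<le> M" for \<rho> y
    proof -
      have "cmod (?u \<rho> y) \<le> M" using d unfolding dsol_def by blast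
      moreover have "?u \<rho> y = complex_of_real (?U \<rho> y)" by (rule fun_cong[OF fun_cong[OF uU]])
      ultimately show ?thesis by (simp only: norm_of_real real_norm_def)
    qed
    show "\<rho> \<notin> {0..t} \<Longrightarrow> ?U \<rho> y = 0" for \<rho> y by simp
    fix s x assume s: "0 < s" "s \<le> t"
    have "complex_of_real (?U s x) = (LINT y|lborel. hk s (x - y) *\<^sub>R ?ini y) +
        lam *\<^sub>R (LINT \<rho>|lborel. LINT y|lborel. hk (s - \<rho>) (x - y) *\<^sub>R pw \<alpha> (complex_of_real (?U \<rho> y)))"
      using d s unfolding dsol_def uU by blast
    also have "\<dots> = of_real ((LINT y|lborel. hk s (x - y) *\<^sub>R U0 y) +
        lam *\<^sub>R (LINT \<rho>|lborel. LINT y|lborel. hk (s - \<rho>) (x - y) *\<^sub>R pw \<alpha> (?U \<rho> y)))"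
      unfolding pw_of_real scaleR_conv_of_real of_real_mult[symmetric] integral_complex_of_real of_real_add by simp
    finally show "?U s x = (LINT y|lborel. hk s (x - y) *\<^sub>R U0 y) +
        lam *\<^sub>R (LINT \<rho>|lborel. LINT y|lborel. hk (s - \<rho>) (x - y) *\<^sub>R pw \<alpha> (?U \<rho> y))"
      using of_real_eq_iff by blast
  qed
  then have "odd_solution \<alpha> lam t M e U0 ?U"
    using al lam t e pos U0m i oddu
    by unfold_locales (auto simp: indicator_def)
  then show ?thesis using real by blast
qed

subsection \<open>Blow-up\<close>

context odd_solution begin

lemma hk_conv_powr_le:
  assumes x: "x \<bullet> e \<ge> 0"
  shows "(LINT y|lborel. hk r (x - y) * U \<rho> y) powr (1 + \<alpha>) \<le> (LINT y|lborel. hk r (x - y) * F \<rho> y)"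
proof -
  define k where "k y = \<bar>odd_hk e r x y\<bar>" for y
  define m where "m = (LINT y|lborel. k y)"
  define h where "h = (LINT y|lborel. k y * \<bar>U \<rho> y\<bar>)"
  have kint: "integrable lborel k" unfolding k_def by (intro integrable_abs odd_hk_integrable e)
  have m: "m \<le> 1" unfolding m_def k_def by (rule odd_hk_abs_integral[OF e])
  have hU: "(LINT y|lborel. hk r (x - y) * U \<rho> y) = h" unfolding h_def k_def
    by (rule odd_hk_conv_nonneg(1)[OF e U_section U_bound U_odd x U_nonneg])
  have hi: "integrable lborel (\<lambda>y. k y * \<bar>U \<rho> y\<bar>)" unfolding k_def
    by (rule odd_hk_conv_nonneg(2)[OF e U_section U_bound U_odd x U_nonneg])
  have gF: "(LINT y|lborel. hk r (x - y) * F \<rho> y) = (LINT y|lborel. k y * \<bar>F \<rho> y\<bar>)" unfolding k_def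
    by (rule odd_hk_conv_nonneg(1)[where w="\<lambda>y. F \<rho> y", OF e _ F_bound F_odd x F_nonneg]) measurable
  have gi: "integrable lborel (\<lambda>y. k y * \<bar>F \<rho> y\<bar>)" unfolding k_def
    by (rule odd_hk_conv_nonneg(2)[where w="\<lambda>y. F \<rho> y", OF e _ F_bound F_odd x F_nonneg]) measurable
  have h0: "h \<ge> 0" unfolding h_def k_def by (rule integral_nonneg_AE) auto
  let ?c = "h powr (1 + \<alpha>)" and ?d = "(1 + \<alpha>) * h powr \<alpha>"
  have hh: "h powr (1 + \<alpha>) = h powr \<alpha> * h" using h0 by (cases "h = 0") (auto simp: powr_add)
  have "h powr (1 + \<alpha>) \<le> ?c + \<alpha> * ?c * (1 - m)" using m al by simp
  also have "\<dots> = ?c * m + (?d * h - ?d * h * m)" unfolding hh by (simp add: algebra_simps)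
  also have "\<dots> = (LINT y|lborel. ?c * k y + (?d * (k y * \<bar>U \<rho> y\<bar>) - ?d * h * k y))"
  proof -
    have "(LINT y|lborel. ?c * k y + (?d * (k y * \<bar>U \<rho> y\<bar>) - ?d * h * k y)) =
      (LINT y|lborel. ?c * k y) + ((LINT y|lborel. ?d * (k y * \<bar>U \<rho> y\<bar>)) - (LINT y|lborel. ?d * h * k y))"
      using kint hi by simp
    also have "\<dots> = ?c * m + (?d * h - ?d * h * m)"
      unfolding integral_mult_right_zero m_def[symmetric] h_def[symmetric] ..
    finally show ?thesis ..
  qed
  also have "\<dots> \<le> (LINT y|lborel. k y * \<bar>F \<rho> y\<bar>)"
  proof (rule integral_mono)
    show "integrable lborel (\<lambda>y. ?c * k y + (?d * (k y * \<bar>U \<rho> y\<bar>) - ?d * h * k y))"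
      using kint hi by simp
    show "integrable lborel (\<lambda>y. k y * \<bar>F \<rho> y\<bar>)" by (rule gi)
    fix y
    have F: "\<bar>F \<rho> y\<bar> = \<bar>U \<rho> y\<bar> powr (1 + \<alpha>)"
      by (cases "U \<rho> y = 0") (auto simp: pw_def abs_mult powr_add)
    have "?c + ?d * (\<bar>U \<rho> y\<bar> - h) \<le> \<bar>F \<rho> y\<bar>" unfolding F by (rule powr_tangent[OF al h0]) simp
    then have "k y * (?c + ?d * (\<bar>U \<rho> y\<bar> - h)) \<le> k y * \<bar>F \<rho> y\<bar>" by (rule mult_left_mono) (simp add: k_def)
    then show "?c * k y + (?d * (k y * \<bar>U \<rho> y\<bar>) - ?d * h * k y) \<le> k y * \<bar>F \<rho> y\<bar>" by (simp add: algebra_simps)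
  qed
  finally show ?thesis unfolding hU gF .
qed

text \<open>
  The function \<open>J \<tau> = (e\<^bsup>(t - \<tau>)\<Delta>\<^esup> U(\<tau>)) x\<close> satisfies \<open>J' \<ge> lam * J powr (1 + \<alpha>)\<close> and is finite
  up to time \<open>t\<close>.
\<close>

lemma positive_conv_bound:
  assumes x: "x \<bullet> e \<ge> 0" and A: "A = (LINT y|lborel. hk t (x - y) * U0 y)" "A > 0"
  shows "\<alpha> * lam * t * A powr \<alpha> \<le> 1"
proof -
  define G where "G \<rho> = (LINT z|lborel. hk (t - \<rho>) (x - z) * F \<rho> z)" for \<rho>
  have G0: "G \<rho> \<ge> 0" for \<rho> unfolding G_def by (rule F_conv_nonneg[OF x])
  have Gsupp: "G \<rho> = 0" if "\<rho> < 0" for \<rho> unfolding G_def using that by (simp add: F_supp)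
  have Gint: "integrable lborel G" unfolding G_def[abs_def] by (rule F_time_integrable)
  have Gset: "set_integrable lborel S G" if "S \<in> sets borel" for S
    using integrable_mult_indicator[OF _ Gint, of S] that by (simp add: set_integrable_def)
  have Gon: "G integrable_on {0..\<tau>}" for \<tau>
    using set_borel_integral_eq_integral(1)[OF Gset[of "{0..\<tau>}"]] by simp
  define J where "J \<tau> = A + lam * integral {0..\<tau>} G" for \<tau>
  have HJ: "(LINT y|lborel. hk (t - \<tau>) (x - y) * U \<tau> y) = J \<tau>" if tau: "0 \<le> \<tau>" "\<tau> < t" for \<tau>
  proof (cases "\<tau> = 0")
    case True then show ?thesis by (simp add: J_def U_init A)
  next
    case False
    with tau have tau: "0 < \<tau>" "\<tau> < t" by auto
    have hkc: "hkconv (\<lambda>y. hk (t - \<tau>) (x - y)) \<tau> z = hk t (x - z)"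
      "hkconv (\<lambda>y. hk (t - \<tau>) (x - y)) (\<tau> - \<rho>) z = (if \<tau> - \<rho> > 0 then hk (t - \<rho>) (x - z) else 0)" for z \<rho>
      using tau by (simp_all add: hkconv_hk)
    have "(LINT y|lborel. hk (t - \<tau>) (x - y) * U \<tau> y) = A +
      lam * (LINT \<rho>|lborel. LINT z|lborel. (if \<tau> - \<rho> > 0 then hk (t - \<rho>) (x - z) else 0) * F \<rho> z)"
      using pairing(1)[OF hk_shift_integrable[of "t - \<tau>" x], of \<tau>] tau unfolding hkc A by simp
    also have "(LINT \<rho>|lborel. LINT z|lborel. (if \<tau> - \<rho> > 0 then hk (t - \<rho>) (x - z) else 0) * F \<rho> z) =
      (LINT \<rho>|lborel. indicator {0..\<tau>} \<rho> *\<^sub>R G \<rho>)"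
    proof (rule integral_discrete_difference[where X="{\<tau>}"])
      show "(LINT z|lborel. (if \<tau> - \<rho> > 0 then hk (t - \<rho>) (x - z) else 0) * F \<rho> z) = indicator {0..\<tau>} \<rho> *\<^sub>R G \<rho>"
        if "\<rho> \<notin> {\<tau>}" for \<rho>
        using that Gsupp[of \<rho>] by (cases "\<rho> < 0") (auto simp: G_def indicator_def F_supp)
    qed auto
    also have "\<dots> = integral {0..\<tau>} G"
      using set_borel_integral_eq_integral(2)[OF Gset[of "{0..\<tau>}"]] by (simp add: set_lebesgue_integral_def)
    finally show ?thesis by (simp add: J_def)
  qed
  have GJ: "J \<tau> powr (1 + \<alpha>) \<le> G \<tau>" if tau: "0 \<le> \<tau>" "\<tau> < t" for \<tau>
    using hk_conv_powr_le[OF x, of "t - \<tau>" \<tau>] HJ[OF tau] by (simp add: G_def)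
  have J_A: "J \<tau> \<ge> A" for \<tau>
    unfolding J_def using lam integral_nonneg[OF Gon] G0 by simp
  have Jcont: "continuous_on {0..\<tau>} J" for \<tau>
    unfolding J_def[abs_def] by (intro continuous_intros indefinite_integral_continuous_1 Gon)
  define g where "g \<rho> = J \<rho> powr (1 + \<alpha>)" for \<rho>
  have Jpos: "J \<tau> > 0" for \<tau> using J_A[of \<tau>] A(2) by linarith
  have gcont: "continuous_on {0..\<tau>} g" for \<tau>
    unfolding g_def using Jpos by (intro continuous_on_powr Jcont continuous_intros) (auto simp: less_imp_neq[symmetric])
  define Q where "Q \<tau> = A + lam * integral {0..\<tau>} g" for \<tau>
  have gon: "g integrable_on {0..\<tau>}" for \<tau>
    by (rule integrable_continuous_real[OF gcont])
  have QA: "Q \<tau> \<ge> A" for \<tau>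
    unfolding Q_def using lam integral_nonneg[OF gon] by (simp add: g_def)
  have Qpos: "Q \<tau> > 0" for \<tau> using QA[of \<tau>] A(2) by linarith
  have QJ: "Q \<tau> \<le> J \<tau>" if "0 \<le> \<tau>" "\<tau> < t" for \<tau>
    unfolding Q_def J_def using lam
    by (intro add_left_mono mult_left_mono integral_le gon Gon) (use GJ that in \<open>auto simp: g_def\<close>)
  have Qcont: "continuous_on {0..\<tau>} Q" for \<tau>
    unfolding Q_def[abs_def] by (intro continuous_intros indefinite_integral_continuous_1 gon)
  have main: "\<alpha> * lam * \<tau> < A powr (- \<alpha>)" if tau: "0 < \<tau>" "\<tau> < t" for \<tau>
  proof -
    define q where "q \<rho> = Q \<rho> powr (- \<alpha>) + \<alpha> * lam * \<rho>" for \<rho>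
    have "q \<tau> \<le> q 0"
    proof (rule DERIV_nonpos_imp_decreasing_open[where f=q and a=0 and b=\<tau>])
      show "0 \<le> \<tau>" using tau by simp
      show "continuous_on {0..\<tau>} q"
        unfolding q_def using Qpos by (intro continuous_intros Qcont continuous_on_powr) (auto simp: less_imp_neq[symmetric])
      fix \<rho> assume rho: "0 < \<rho>" "\<rho> < \<tau>"
      have "((\<lambda>x. integral {0..x} g) has_real_derivative g \<rho>) (at \<rho> within {0..\<tau>})"
        by (rule integral_has_real_derivative[OF gcont]) (use rho in auto)
      then have "((\<lambda>x. integral {0..x} g) has_real_derivative g \<rho>) (at \<rho>)"
        using rho by (simp add: at_within_Icc_at)
      then have DQ: "(Q has_real_derivative lam * g \<rho>) (at \<rho>)"
        unfolding Q_def[abs_def] by (auto intro!: derivative_eq_intros)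
      have Dq: "(q has_real_derivative (- \<alpha>) * Q \<rho> powr (- \<alpha> - 1) * (lam * g \<rho>) + \<alpha> * lam) (at \<rho>)"
      proof -
        have "((\<lambda>x. Q x powr (- \<alpha>)) has_real_derivative (- \<alpha>) * Q \<rho> powr (- \<alpha> - 1) * (lam * g \<rho>)) (at \<rho>)"
          using DERIV_fun_powr[OF DQ Qpos, of "- \<alpha>"] by simp
        from DERIV_add[OF this DERIV_cmult_Id[of "\<alpha> * lam"]] show ?thesis unfolding q_def[abs_def] .
      qed
      have "Q \<rho> powr (1 + \<alpha>) \<le> g \<rho>"
        unfolding g_def using QJ[of \<rho>] Qpos[of \<rho>] rho tau al by (intro powr_mono2) auto
      then have "Q \<rho> powr (- \<alpha> - 1) * Q \<rho> powr (1 + \<alpha>) \<le> Q \<rho> powr (- \<alpha> - 1) * g \<rho>"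
        by (intro mult_left_mono) auto
      then have "1 \<le> Q \<rho> powr (- \<alpha> - 1) * g \<rho>"
        using Qpos[of \<rho>] by (simp flip: powr_add)
      then have "\<alpha> * lam * 1 \<le> \<alpha> * lam * (Q \<rho> powr (- \<alpha> - 1) * g \<rho>)"
        using al lam by (intro mult_left_mono) auto
      then have "(- \<alpha>) * Q \<rho> powr (- \<alpha> - 1) * (lam * g \<rho>) + \<alpha> * lam \<le> 0" by (simp add: mult_ac)
      then show "\<exists>y. (q has_real_derivative y) (at \<rho>) \<and> y \<le> 0" using Dq by blast
    qed
    moreover have "Q \<tau> powr (- \<alpha>) > 0" using Qpos[of \<tau>] by simp
    moreover have "q 0 = A powr (- \<alpha>)" by (simp add: q_def Q_def)
    ultimately show ?thesis unfolding q_def by linarith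
  qed
  have "\<alpha> * lam * t \<le> A powr (- \<alpha>)"
  proof (rule dense_le)
    fix z assume z: "z < \<alpha> * lam * t"
    have al0: "\<alpha> * lam > 0" using al lam by simp
    show "z \<le> A powr (- \<alpha>)"
    proof (cases "z \<le> 0")
      case True then show ?thesis using order_trans[OF True powr_ge_zero] by simp
    next
      case False
      have "z = \<alpha> * lam * (z / (\<alpha> * lam))" using al lam by simp
      also have "\<dots> < A powr (- \<alpha>)"
        using main[of "z / (\<alpha> * lam)"] False z al0 by (simp add: field_simps)
      finally show ?thesis by simp
    qed
  qed
  then have "\<alpha> * lam * t * A powr \<alpha> \<le> A powr (- \<alpha>) * A powr \<alpha>"
    by (rule mult_right_mono) simp
  then show ?thesis using A(2) by (simp flip: powr_add)
qed

end

lemma integral_pos_of_box: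
  fixes f :: "'a::euclidean_space \<Rightarrow> real"
  assumes f: "integrable lborel f" and nn: "\<And>x. f x \<ge> 0" and pos: "\<And>x. x \<in> box 0 One \<Longrightarrow> f x > 0"
  shows "(LINT x|lborel. f x) > 0"
proof (rule ccontr)
  assume "\<not> ?thesis"
  moreover have "0 \<le> (LINT x|lborel. f x)" by (rule integral_nonneg_AE) (simp add: nn)
  ultimately have "(LINT x|lborel. f x) = 0" by linarith
  then have "AE x in lborel. f x = 0"
    using integral_nonneg_eq_0_iff_AE[OF f] nn by simp
  then have "AE x in lborel. x \<notin> box 0 (One::'a)"
    by eventually_elim (use pos in force)
  then have "emeasure lborel (box 0 (One::'a)) = 0"
    by (subst (asm) AE_iff_measurable[where N="box 0 One"]) auto
  moreover have One: "One \<bullet> b = 1" if "b \<in> Basis" for b :: 'a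
    using that by (simp add: inner_sum_left inner_Basis)
  have "emeasure lborel (box 0 (One::'a)) = (\<Prod>b\<in>Basis. (One - 0) \<bullet> (b::'a))"
    by (rule emeasure_lborel_box) (simp add: One)
  moreover have "(\<Prod>b\<in>Basis. (One - 0) \<bullet> (b::'a)) = 1"
    by (intro prod.neutral) (simp add: One)
  ultimately show False by simp
qed

lemma hk_scale: "\<mu> > 0 \<Longrightarrow> hk (1 / \<mu>\<^sup>2) (z::'a::euclidean_space) = \<mu> ^ DIM('a) * hk 1 (\<mu> *\<^sub>R z)"
proof -
  assume m: "\<mu> > 0"
  have "(4 * pi / \<mu>\<^sup>2) powr (- real DIM('a) / 2) = (4 * pi) powr (- real DIM('a) / 2) / (\<mu>\<^sup>2) powr (- real DIM('a) / 2)"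
    by (rule powr_divide)
  also have "(\<mu>\<^sup>2) powr (- real DIM('a) / 2) = 1 / \<mu> ^ DIM('a)"
    using m by (simp add: powr_minus powr_half_power inverse_eq_divide)
  finally show ?thesis using m by (simp add: hk_def power_mult_distrib)
qed

lemma bump_conv_pos:
  assumes e: "(e::'a::euclidean_space) \<in> Basis"
  shows "(LINT y|lborel. hk 1 (e - y) * bump e y) > 0"
proof -
  obtain K where K: "\<And>x. \<bar>bump e x\<bar> \<le> K" using bump_bounded by blast
  have ee: "e \<bullet> e = 1" using e by (simp add: inner_Basis)
  then have ee0: "e \<bullet> e \<ge> 0" by simp
  note n = odd_hk_conv_nonneg[where w="bump e", OF e bump_measurable K bump_reflect[OF e] ee0 bump_nonneg[OF e], of 1]
  have "(LINT y|lborel. \<bar>odd_hk e 1 e y\<bar> * \<bar>bump e y\<bar>) > 0"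
  proof (rule integral_pos_of_box[OF n(2)])
    fix y :: 'a assume "y \<in> box 0 One"
    then have y: "\<And>b. b \<in> Basis \<Longrightarrow> 0 < y \<bullet> b \<and> y \<bullet> b < 1" by (auto simp: mem_box)
    have "odd_hk e 1 e y > 0" using y[OF e] ee by (intro odd_hk_pos e) auto
    moreover have "bump e y > 0"
    proof (rule bump_pos[OF e])
      show "\<bar>y \<bullet> b\<bar> < 1" if "b \<in> Basis" for b using y[OF that] by simp
    qed (use y[OF e] in simp)
    ultimately show "\<bar>odd_hk e 1 e y\<bar> * \<bar>bump e y\<bar> > 0" by simp
  qed auto
  then show ?thesis by (simp only: n(1))
qed

lemma well_posedD:
  assumes "locally_well_posed_small_data TYPE('n::finite) \<alpha> lam s"
  shows "\<exists>\<delta>>0. \<exists>T>0. \<forall>u0 :: (real^'n) \<Rightarrow> complex. u0 \<in> Cc_infty \<longrightarrow> Hs_norm s u0 \<le> \<delta> \<longrightarrow>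
      (\<exists>Tmax u. is_solution \<alpha> lam u0 Tmax u \<and> ereal T \<le> Tmax \<and>
        (\<forall>t. 0 \<le> t \<and> t \<le> T \<and> ereal t < Tmax \<longrightarrow> u t \<in> Hs s))"
proof -
  obtain \<delta> T where d: "\<delta> > 0" and T: "T > 0" and wp: "\<forall>u0 :: (real^'n) \<Rightarrow> complex.
        u0 \<in> Cc_infty \<and> Hs_norm s u0 \<le> \<delta> \<longrightarrow>
        (\<exists>Tmax u. is_maximal_solution \<alpha> lam u0 Tmax u \<and> ereal T \<le> Tmax \<and>
           (\<forall>t. 0 \<le> t \<and> t \<le> T \<and> ereal t < Tmax \<longrightarrow> u t \<in> Hs s))"
    using assms unfolding locally_well_posed_small_data_def by (elim exE conjE)
  show ?thesis
  proof (rule exI[of _ \<delta>], intro conjI d, rule exI[of _ T], intro conjI T allI impI)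
    fix u0 :: "(real^'n) \<Rightarrow> complex" assume "u0 \<in> Cc_infty" "Hs_norm s u0 \<le> \<delta>"
    then obtain Tmax u where "is_maximal_solution \<alpha> lam u0 Tmax u" "ereal T \<le> Tmax"
      "\<forall>t. 0 \<le> t \<and> t \<le> T \<and> ereal t < Tmax \<longrightarrow> u t \<in> Hs s"
      using wp[THEN spec, of u0] by (elim impE exE conjE) simp
    then show "\<exists>Tmax u. is_solution \<alpha> lam u0 Tmax u \<and> ereal T \<le> Tmax \<and>
        (\<forall>t. 0 \<le> t \<and> t \<le> T \<and> ereal t < Tmax \<longrightarrow> u t \<in> Hs s)"
      unfolding is_maximal_solution_def by (intro exI conjI) simp_all
  qed
qed

lemma not_well_posed_supercritical:
  fixes \<alpha> lam s :: real
  assumes al: "0 < \<alpha>" and lam: "lam > 0" and s: "s \<ge> 0" and sN: "s < real CARD('n::finite) / 2 - 2 / \<alpha>"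
  shows "\<not> locally_well_posed_small_data TYPE('n) \<alpha> lam s"
proof
  assume "locally_well_posed_small_data TYPE('n) \<alpha> lam s"
  from well_posedD[OF this] obtain \<delta> T where d: "\<delta> > 0" and T: "T > 0"
    and wp: "\<forall>u0 :: (real^'n) \<Rightarrow> complex. u0 \<in> Cc_infty \<longrightarrow> Hs_norm s u0 \<le> \<delta> \<longrightarrow>
      (\<exists>Tmax u. is_solution \<alpha> lam u0 Tmax u \<and> ereal T \<le> Tmax \<and>
        (\<forall>t. 0 \<le> t \<and> t \<le> T \<and> ereal t < Tmax \<longrightarrow> u t \<in> Hs s))"
    by (elim exE conjE)
  obtain e :: "real^'n" where e: "e \<in> Basis" by (rule that[OF SOME_Basis])
  have ee: "e \<bullet> e = 1" using e by (simp add: inner_Basis)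
  define c where "c = (LINT y|lborel. hk 1 (e - y) * bump e y)"
  have c: "c > 0" unfolding c_def by (rule bump_conv_pos[OF e])
  obtain C where "C \<ge> 0 \<and> (\<forall>A \<mu>. \<mu> \<ge> 1 \<longrightarrow> Hs_norm s (\<lambda>x::real^'n. complex_of_real (A * bump e (\<mu> *\<^sub>R x))) \<le> C * \<bar>A\<bar> * \<mu> powr (s - CARD('n) / 2))"
    using bump_Hs_norm[OF s, of e] by (rule exE)
  then have C: "C \<ge> 0" "\<And>A \<mu>. \<mu> \<ge> 1 \<Longrightarrow> Hs_norm s (\<lambda>x::real^'n. complex_of_real (A * bump e (\<mu> *\<^sub>R x))) \<le> C * \<bar>A\<bar> * \<mu> powr (s - CARD('n) / 2)"
    by simp_all
  define \<kappa> where "\<kappa> = (2 / (\<alpha> * lam)) powr (1 / \<alpha>) / c"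
  have kap: "\<kappa> > 0" using c al lam by (simp add: \<kappa>_def)
  have kc: "\<alpha> * lam * (\<kappa> * c) powr \<alpha> = 2"
    using c al lam by (simp add: \<kappa>_def powr_powr)
  let ?p = "2 / \<alpha> + s - CARD('n) / 2"
  have p: "?p < 0" using sN by simp
  have "((\<lambda>\<mu>. C * \<kappa> * \<mu> powr ?p) \<longlongrightarrow> C * \<kappa> * 0) at_top"
    by (intro tendsto_intros tendsto_neg_powr p filterlim_ident)
  then have ev1: "\<forall>\<^sub>F \<mu> in at_top. C * \<kappa> * \<mu> powr ?p < \<delta>"
    using d by (auto dest: order_tendstoD(2))
  have ev2: "\<forall>\<^sub>F \<mu>::real in at_top. \<mu> \<ge> 1" by (rule eventually_ge_at_top)
  have ev3: "\<forall>\<^sub>F \<mu>::real in at_top. \<mu> > 1 / T" by (rule eventually_gt_at_top)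
  obtain \<mu> :: real where mu: "C * \<kappa> * \<mu> powr ?p < \<delta>" "\<mu> \<ge> 1" "\<mu> > 1 / T"
    using eventually_happens[OF eventually_conj[OF ev1 eventually_conj[OF ev2 ev3]]] by auto
  define A where "A = \<kappa> * \<mu> powr (2 / \<alpha>)"
  have A0: "A > 0" using kap mu by (simp add: A_def)
  define U0 where "U0 x = A * bump e (\<mu> *\<^sub>R x)" for x
  define t where "t = 1 / \<mu>\<^sup>2"
  have t: "0 < t" using mu by (simp add: t_def)
  have "t \<le> 1 / \<mu>" using mu by (simp add: t_def power2_eq_square field_simps)
  also have "\<dots> < T" using mu T by (simp add: field_simps)
  finally have tT: "t < T" .
  have "Hs_norm s (\<lambda>x. complex_of_real (U0 x)) \<le> C * \<bar>A\<bar> * \<mu> powr (s - CARD('n) / 2)"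
    unfolding U0_def by (rule C(2)[OF mu(2)])
  also have "\<dots> = C * \<kappa> * \<mu> powr ?p"
    using kap mu by (simp add: A_def abs_mult powr_add[symmetric] add_diff_eq mult.assoc)
  also have "\<dots> \<le> \<delta>" using mu by simp
  finally have "Hs_norm s (\<lambda>x. complex_of_real (U0 x)) \<le> \<delta>" .
  moreover have "(\<lambda>x. complex_of_real (U0 x)) \<in> Cc_infty"
    unfolding U0_def by (rule bump_Cc_infty[OF mu(2)])
  ultimately obtain Tmax u where sol: "is_solution \<alpha> lam (\<lambda>x. complex_of_real (U0 x)) Tmax u" and Tm: "ereal T \<le> Tmax"
    using wp by blast
  have tTm: "ereal t < Tmax" using tT Tm by (metis ereal_less_eq(3) less_le_trans less_ereal.simps(1))
  have U0_odd: "U0 (reflect e x) = - U0 x" for x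
  proof -
    have "\<mu> *\<^sub>R reflect e x = reflect e (\<mu> *\<^sub>R x)" by (simp add: reflect_def algebra_simps)
    then show ?thesis by (simp add: U0_def bump_reflect[OF e])
  qed
  have U0_nonneg: "U0 x \<ge> 0" if "x \<bullet> e \<ge> 0" for x
    unfolding U0_def using A0 mu that by (intro mult_nonneg_nonneg bump_nonneg e) auto
  obtain M where "odd_solution \<alpha> lam t M e U0 (\<lambda>s x. indicator {0..t} s * Re (u s x))"
    using solution_imp_odd_solution[OF sol t tTm al lam e U0_odd U0_nonneg] by blast
  then interpret odd_solution \<alpha> lam t M e U0 "\<lambda>s x. indicator {0..t} s * Re (u s x)" .
  let ?x = "(1 / \<mu>) *\<^sub>R e"
  have "(LINT y|lborel. hk t (?x - y) * U0 y) = (LINT y|lborel. A * (\<mu> ^ CARD('n) * (hk 1 (e - \<mu> *\<^sub>R y) * bump e (\<mu> *\<^sub>R y))))"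
  proof (intro Bochner_Integration.integral_cong refl)
    fix y :: "real^'n"
    have "\<mu> *\<^sub>R (?x - y) = e - \<mu> *\<^sub>R y" using mu by (simp add: scaleR_diff_right)
    then have "hk t (?x - y) = \<mu> ^ CARD('n) * hk 1 (e - \<mu> *\<^sub>R y)"
      unfolding t_def using hk_scale[of \<mu> "?x - y"] mu by simp
    then show "hk t (?x - y) * U0 y = A * (\<mu> ^ CARD('n) * (hk 1 (e - \<mu> *\<^sub>R y) * bump e (\<mu> *\<^sub>R y)))"
      by (simp add: U0_def)
  qed
  also have "\<dots> = A * (\<mu> ^ CARD('n) * (LINT y|lborel. hk 1 (e - \<mu> *\<^sub>R y) * bump e (\<mu> *\<^sub>R y)))"
    by (simp only: integral_mult_right_zero)
  also have "\<mu> ^ CARD('n) * (LINT y|lborel. hk 1 (e - \<mu> *\<^sub>R y) * bump e (\<mu> *\<^sub>R y)) = c"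
    unfolding c_def using mu by (subst lborel_integral_scale[of "\<lambda>y. hk 1 (e - y) * bump e y" \<mu>]) auto
  finally have Aeq: "A * c = (LINT y|lborel. hk t (?x - y) * U0 y)" by simp
  have "\<alpha> * lam * t * (A * c) powr \<alpha> \<le> 1"
    by (rule positive_conv_bound[OF _ Aeq]) (use mu A0 c ee in auto)
  moreover have "(A * c) powr \<alpha> = (\<kappa> * c) powr \<alpha> * \<mu>\<^sup>2"
  proof -
    have "(A * c) powr \<alpha> = ((\<kappa> * c) * \<mu> powr (2 / \<alpha>)) powr \<alpha>" by (simp add: A_def mult_ac)
    also have "\<dots> = (\<kappa> * c) powr \<alpha> * (\<mu> powr (2 / \<alpha>)) powr \<alpha>" by (rule powr_mult)
    also have "(\<mu> powr (2 / \<alpha>)) powr \<alpha> = \<mu>\<^sup>2" using al mu by (simp add: powr_powr)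
    finally show ?thesis .
  qed
  ultimately have "\<alpha> * lam * (\<kappa> * c) powr \<alpha> \<le> 1" using mu by (simp add: t_def)
  then show False using kc by simp
qed

subsection \<open>Gaussian moments\<close>

lemma gauss_power_bound:
  fixes c :: real assumes c: "c > 0"
  shows "\<exists>K\<ge>0. \<forall>x::real. \<bar>x\<bar> ^ n * exp (- c * x\<^sup>2) \<le> K * exp (- (c / 2) * x\<^sup>2)"
proof (intro exI conjI allI)
  let ?K = "1 + fact n * (2 / c) ^ n"
  show "0 \<le> ?K" using c by simp
  fix x :: real
  let ?E = "exp (c / 2 * x\<^sup>2)"
  have A: "\<bar>x\<bar> ^ n \<le> 1 + (x\<^sup>2) ^ n"
  proof (cases "\<bar>x\<bar> \<le> 1")
    case True
    then have "\<bar>x\<bar> ^ n \<le> 1" by (simp add: power_le_one)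
    then show ?thesis by (simp add: add_increasing2)
  next
    case False
    then have "\<bar>x\<bar> ^ n \<le> \<bar>x\<bar> ^ (2 * n)" by (intro power_increasing) auto
    then show ?thesis by (simp add: power_mult)
  qed
  have "(x\<^sup>2) ^ n = (2 / c) ^ n * (c / 2 * x\<^sup>2) ^ n"
    using c by (simp flip: power_mult_distrib)
  also have "\<dots> \<le> (2 / c) ^ n * (fact n * ?E)"
    using c by (intro mult_left_mono power_le_fact_exp) auto
  finally have B: "(x\<^sup>2) ^ n \<le> (2 / c) ^ n * (fact n * ?E)" .
  have "1 \<le> ?E" using c by simp
  with A B have "\<bar>x\<bar> ^ n \<le> ?E + (2 / c) ^ n * (fact n * ?E)" by linarith
  also have "\<dots> = ?K * ?E" by (simp add: algebra_simps)
  finally have "\<bar>x\<bar> ^ n * exp (- c * x\<^sup>2) \<le> ?K * ?E * exp (- c * x\<^sup>2)"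
    by (rule mult_right_mono) (rule exp_ge_zero)
  also have "\<dots> = ?K * exp (- (c / 2) * x\<^sup>2)"
    by (simp add: mult.assoc flip: exp_add)
  finally show "\<bar>x\<bar> ^ n * exp (- c * x\<^sup>2) \<le> ?K * exp (- (c / 2) * x\<^sup>2)" .
qed

lemma gauss_powr_bound:
  fixes c p :: real assumes c: "c > 0" and p: "p \<ge> 0"
  shows "\<exists>K\<ge>0. \<forall>x::real. \<bar>x\<bar> powr p * \<bar>x\<bar> ^ n * exp (- c * x\<^sup>2) \<le> K * exp (- (c / 2) * x\<^sup>2)"
proof -
  obtain m where m: "p \<le> real m" using real_arch_simple by blast
  obtain K1 where K1: "K1 \<ge> 0" "\<And>x::real. \<bar>x\<bar> ^ n * exp (- c * x\<^sup>2) \<le> K1 * exp (- (c / 2) * x\<^sup>2)"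
    using gauss_power_bound[OF c, of n] by blast
  obtain K2 where K2: "K2 \<ge> 0" "\<And>x::real. \<bar>x\<bar> ^ (m + n) * exp (- c * x\<^sup>2) \<le> K2 * exp (- (c / 2) * x\<^sup>2)"
    using gauss_power_bound[OF c, of "m + n"] by blast
  have "\<bar>x\<bar> powr p * \<bar>x\<bar> ^ n * exp (- c * x\<^sup>2) \<le> (K1 + K2) * exp (- (c / 2) * x\<^sup>2)" for x :: real
  proof -
    have "\<bar>x\<bar> powr p \<le> 1 + \<bar>x\<bar> ^ m"
    proof (cases "\<bar>x\<bar> \<le> 1")
      case True
      then have "\<bar>x\<bar> powr p \<le> 1" using p by (intro powr_le1) auto
      then show ?thesis by (simp add: add_increasing2)
    next
      case False
      then have "\<bar>x\<bar> powr p \<le> \<bar>x\<bar> powr (real m)" using m by (intro powr_mono) auto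
      also have "\<dots> = \<bar>x\<bar> ^ m" using False by (intro powr_realpow) auto
      finally show ?thesis by simp
    qed
    then have "\<bar>x\<bar> powr p * (\<bar>x\<bar> ^ n * exp (- c * x\<^sup>2)) \<le> (1 + \<bar>x\<bar> ^ m) * (\<bar>x\<bar> ^ n * exp (- c * x\<^sup>2))"
      by (rule mult_right_mono) simp
    also have "\<dots> = \<bar>x\<bar> ^ n * exp (- c * x\<^sup>2) + \<bar>x\<bar> ^ (m + n) * exp (- c * x\<^sup>2)"
      by (simp add: power_add algebra_simps)
    also have "\<dots> \<le> (K1 + K2) * exp (- (c / 2) * x\<^sup>2)" using K1(2)[of x] K2(2)[of x] by (simp add: distrib_right)
    finally show ?thesis by (simp add: mult.assoc)
  qed
  then show ?thesis using K1(1) K2(1) by (intro exI[of _ "K1 + K2"]) auto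
qed

lemma integrable_gauss_bound:
  fixes f :: "real \<Rightarrow> 'b::{banach,second_countable_topology}"
  assumes f: "f \<in> borel_measurable borel" and b: "\<And>x. norm (f x) \<le> K * exp (- c * x\<^sup>2)" and c: "c > 0"
  shows "integrable lborel f"
proof (rule Bochner_Integration.integrable_bound[OF integrable_mult_right[OF gauss_integrable[OF c], of K]])
  show "AE x in lborel. norm (f x) \<le> norm (K * exp (- c * x\<^sup>2))"
    using b by (auto intro: order_trans[OF _ abs_ge_self])
qed (use f in simp)

lemma gauss_powr_integrable:
  fixes c p :: real assumes c: "c > 0" and p: "p \<ge> 0"
  shows "integrable lborel (\<lambda>x. \<bar>x\<bar> powr p * x ^ n * exp (- c * x\<^sup>2))"
proof -
  obtain K where K: "\<And>x::real. \<bar>x\<bar> powr p * \<bar>x\<bar> ^ n * exp (- c * x\<^sup>2) \<le> K * exp (- (c / 2) * x\<^sup>2)"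
    using gauss_powr_bound[OF c p] by blast
  show ?thesis
    by (rule integrable_gauss_bound[of _ K "c / 2"]) (use K c in \<open>auto simp: abs_mult power_abs\<close>)
qed

lemma gauss_power_integrable:
  fixes c :: real assumes c: "c > 0"
  shows "integrable lborel (\<lambda>x. x ^ n * exp (- c * x\<^sup>2))"
proof -
  obtain K where K: "\<And>x::real. \<bar>x\<bar> ^ n * exp (- c * x\<^sup>2) \<le> K * exp (- (c / 2) * x\<^sup>2)"
    using gauss_power_bound[OF c] by blast
  show ?thesis
    by (rule integrable_gauss_bound[of _ K "c / 2"]) (use K c in \<open>auto simp: abs_mult power_abs\<close>)
qed

lemma gauss_bound_tendsto:
  fixes f :: "real \<Rightarrow> 'b::real_normed_vector"
  assumes b: "\<And>x. norm (f x) \<le> K * exp (- c * x\<^sup>2)" and c: "c > 0"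
  shows "(f \<longlongrightarrow> 0) at_infinity"
proof (rule Lim_null_comparison)
  have "LIM x at_infinity. c * (norm (x::real))\<^sup>2 :> at_top"
    by (intro filterlim_tendsto_pos_mult_at_top[OF tendsto_const c] filterlim_pow_at_top filterlim_norm_at_top) auto
  then have "LIM x at_infinity. - (c * (norm (x::real))\<^sup>2) :> at_bot"
    by (simp add: filterlim_uminus_at_top)
  then have "((\<lambda>x::real. exp (- (c * (norm x)\<^sup>2))) \<longlongrightarrow> 0) at_infinity"
    by (rule filterlim_compose[OF exp_at_bot])
  then show "((\<lambda>x. K * exp (- c * x\<^sup>2)) \<longlongrightarrow> 0) at_infinity"
    by (intro tendsto_mult_right_zero) simp
qed (use b in simp)

lemma integral_derivative_zero:
  fixes F f :: "real \<Rightarrow> 'b::euclidean_space"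
  assumes D: "\<And>x. (F has_vector_derivative f x) (at x)" and c: "continuous_on UNIV f" and i: "integrable lborel f"
    and lim: "(F \<longlongrightarrow> 0) at_infinity"
  shows "(LINT x|lborel. f x) = 0"
proof -
  have "(LBINT x=-\<infinity>..\<infinity>. f x) = 0 - 0"
  proof (rule interval_integral_FTC_integrable[where F=F])
    show "isCont f x" for x using c by (simp add: continuous_on_eq_continuous_at)
    show "set_integrable lborel (einterval (-\<infinity>) \<infinity>) f" using i by (simp add: set_integrable_def)
    show "((F \<circ> real_of_ereal) \<longlongrightarrow> 0) (at_right (-\<infinity>))"
      using tendsto_mono[OF at_bot_le_at_infinity lim] by (simp add: ereal_tendsto_simps)
    show "((F \<circ> real_of_ereal) \<longlongrightarrow> 0) (at_left \<infinity>)"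
      using tendsto_mono[OF at_top_le_at_infinity lim] by (simp add: ereal_tendsto_simps)
  qed (auto simp: D)
  then show ?thesis by (simp add: interval_lebesgue_integral_def set_lebesgue_integral_def)
qed

definition gft :: "nat \<Rightarrow> real \<Rightarrow> complex" where
  "gft k x = (LINT \<xi>|lborel. cis (- (x * \<xi>)) * of_real (\<xi> ^ k * exp (- (\<xi>\<^sup>2))))"

lemma gft_integrable: "integrable lborel (\<lambda>\<xi>. cis (- (x * \<xi>)) * of_real (\<xi> ^ k * exp (- (\<xi>\<^sup>2))))"
  by (rule Bochner_Integration.integrable_bound[OF gauss_power_integrable[of 1 k]]) (auto simp: norm_mult simp del: of_real_mult)

lemma gft_Suc: "2 * gft (Suc k) x = of_nat k * gft (k - 1) x - \<i> * of_real x * gft k x"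
proof -
  let ?F = "\<lambda>\<xi>. cis (- (x * \<xi>)) * complex_of_real (\<xi> ^ k * exp (- (\<xi>\<^sup>2)))"
  let ?f = "\<lambda>\<xi>. of_nat k * (cis (- (x * \<xi>)) * of_real (\<xi> ^ (k - 1) * exp (- (\<xi>\<^sup>2)))) -
     \<i> * of_real x * (cis (- (x * \<xi>)) * of_real (\<xi> ^ k * exp (- (\<xi>\<^sup>2)))) -
     2 * (cis (- (x * \<xi>)) * of_real (\<xi> ^ Suc k * exp (- (\<xi>\<^sup>2))))"
  have "(LINT \<xi>|lborel. ?f \<xi>) = 0"
  proof (rule integral_derivative_zero[where F="?F"])
    fix \<xi> :: real
    have c: "((\<lambda>\<xi>. cis (- (x * \<xi>))) has_vector_derivative - (\<i> * of_real x * cis (- (x * \<xi>)))) (at \<xi>)"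
      unfolding has_vector_derivative_def
      by (auto intro!: derivative_eq_intros simp: scaleR_conv_of_real)
    have "((\<lambda>\<xi>. \<xi> ^ k * exp (- (\<xi>\<^sup>2))) has_real_derivative (real k * \<xi> ^ (k - 1) * exp (- (\<xi>\<^sup>2)) - 2 * (\<xi> ^ Suc k * exp (- (\<xi>\<^sup>2))))) (at \<xi>)"
      by (auto intro!: derivative_eq_intros simp: power2_eq_square algebra_simps)
    then have b: "((\<lambda>\<xi>. complex_of_real (\<xi> ^ k * exp (- (\<xi>\<^sup>2)))) has_vector_derivative
       of_real (real k * \<xi> ^ (k - 1) * exp (- (\<xi>\<^sup>2)) - 2 * (\<xi> ^ Suc k * exp (- (\<xi>\<^sup>2))))) (at \<xi>)"
      by (intro has_vector_derivative_of_real) (simp add: has_real_derivative_iff_has_vector_derivative)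
    show "(?F has_vector_derivative ?f \<xi>) (at \<xi>)"
      using has_vector_derivative_mult[OF c b] by (simp add: algebra_simps)
  next
    show "continuous_on UNIV ?f" by (intro continuous_intros)
    show "integrable lborel ?f"
      by (intro Bochner_Integration.integrable_diff integrable_mult_right gft_integrable)
    obtain K where K: "\<And>x::real. \<bar>x\<bar> ^ k * exp (- 1 * x\<^sup>2) \<le> K * exp (- (1 / 2) * x\<^sup>2)"
      using gauss_power_bound[of 1 k] by auto
    show "(?F \<longlongrightarrow> 0) at_infinity"
      by (rule gauss_bound_tendsto[of _ K "1/2"]) (use K in \<open>auto simp: norm_mult norm_power\<close>)
  qed
  then have "of_nat k * gft (k - 1) x - \<i> * of_real x * gft k x - 2 * gft (Suc k) x = 0"
    unfolding gft_def
    by (subst (asm) Bochner_Integration.integral_diff, intro Bochner_Integration.integrable_diff integrable_mult_right gft_integrable,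
        intro integrable_mult_right gft_integrable,
        subst (asm) Bochner_Integration.integral_diff, intro integrable_mult_right gft_integrable, intro integrable_mult_right gft_integrable)
      (simp only: integral_mult_right_zero)
  then show ?thesis by (simp add: algebra_simps)
qed

text \<open>The fifth Hermite function: \<open>-\<i> * Q\<close> is the Fourier transform of \<open>\<xi> ^ 5 * exp (- \<xi>\<^sup>2)\<close>.\<close>

definition Q :: "real \<Rightarrow> real" where
  "Q w = sqrt pi / 8 * (15 * w - 5 * w ^ 3 + w ^ 5 / 4) * exp (- (1 / 4) * w\<^sup>2)"

lemma gft_5: "gft 5 x = - \<i> * of_real (Q x)"
proof -
  have g0: "gft 0 x = of_real (sqrt pi * exp (- (1 / 4) * x\<^sup>2))"
    using gauss_cis_integral[of 1 x] by (simp add: gft_def)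
  let ?x = "complex_of_real x"
  have g1: "gft 1 x = - \<i> * ?x / 2 * gft 0 x" using gft_Suc[of 0 x] by (simp add: field_simps)
  have g2: "gft 2 x = (gft 0 x - \<i> * ?x * gft 1 x) / 2" using gft_Suc[of 1 x] by (simp add: numeral_2_eq_2 field_simps)
  have g3: "gft 3 x = (2 * gft 1 x - \<i> * ?x * gft 2 x) / 2" using gft_Suc[of 2 x] by (simp add: field_simps)
  have g4: "gft 4 x = (3 * gft 2 x - \<i> * ?x * gft 3 x) / 2" using gft_Suc[of 3 x] by (simp add: field_simps)
  have g5: "gft 5 x = (4 * gft 3 x - \<i> * ?x * gft 4 x) / 2" using gft_Suc[of 4 x] by (simp add: field_simps)
  have "gft 5 x = - \<i> * (15 * ?x - 5 * ?x ^ 3 + ?x ^ 5 / 4) / 8 * gft 0 x"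
    unfolding g5 g4 g3 g2 g1 by (simp add: field_simps power2_eq_square power3_eq_cube eval_nat_numeral)
  then show ?thesis unfolding g0 by (simp add: Q_def)
qed

lemma Q_measurable [measurable]: "Q \<in> borel_measurable borel"
  unfolding Q_def[abs_def] by measurable

lemma Q_bound: "\<exists>K\<ge>0. \<forall>w. \<bar>Q w\<bar> \<le> K * exp (- (1 / 8) * w\<^sup>2)"
proof -
  obtain K1 where K1: "K1 \<ge> 0" "\<And>x::real. \<bar>x\<bar> ^ 1 * exp (- (1/4) * x\<^sup>2) \<le> K1 * exp (- (1 / 4 / 2) * x\<^sup>2)"
    using gauss_power_bound[of "1/4" 1] by auto
  obtain K3 where K3: "K3 \<ge> 0" "\<And>x::real. \<bar>x\<bar> ^ 3 * exp (- (1/4) * x\<^sup>2) \<le> K3 * exp (- (1 / 4 / 2) * x\<^sup>2)"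
    using gauss_power_bound[of "1/4" 3] by auto
  obtain K5 where K5: "K5 \<ge> 0" "\<And>x::real. \<bar>x\<bar> ^ 5 * exp (- (1/4) * x\<^sup>2) \<le> K5 * exp (- (1 / 4 / 2) * x\<^sup>2)"
    using gauss_power_bound[of "1/4" 5] by auto
  have "\<bar>Q w\<bar> \<le> (sqrt pi / 8 * (15 * K1 + 5 * K3 + K5 / 4)) * exp (- (1 / 8) * w\<^sup>2)" for w
  proof -
    have "\<bar>15 * w - 5 * w ^ 3 + w ^ 5 / 4\<bar> \<le> 15 * \<bar>w\<bar> ^ 1 + 5 * \<bar>w\<bar> ^ 3 + \<bar>w\<bar> ^ 5 / 4"
      using abs_triangle_ineq[of "15 * w - 5 * w ^ 3" "w ^ 5 / 4"] abs_triangle_ineq4[of "15 * w" "5 * w ^ 3"]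
      by (simp add: abs_mult power_abs)
    then have "\<bar>15 * w - 5 * w ^ 3 + w ^ 5 / 4\<bar> * exp (- (1 / 4) * w\<^sup>2) \<le> (15 * \<bar>w\<bar> ^ 1 + 5 * \<bar>w\<bar> ^ 3 + \<bar>w\<bar> ^ 5 / 4) * exp (- (1 / 4) * w\<^sup>2)"
      by (rule mult_right_mono) simp
    also have "\<dots> = 15 * (\<bar>w\<bar> ^ 1 * exp (- (1/4) * w\<^sup>2)) + 5 * (\<bar>w\<bar> ^ 3 * exp (- (1/4) * w\<^sup>2)) + (\<bar>w\<bar> ^ 5 * exp (- (1/4) * w\<^sup>2)) / 4"
      by (simp add: algebra_simps)
    also have "\<dots> \<le> 15 * (K1 * exp (- (1 / 4 / 2) * w\<^sup>2)) + 5 * (K3 * exp (- (1 / 4 / 2) * w\<^sup>2)) + (K5 * exp (- (1 / 4 / 2) * w\<^sup>2)) / 4"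
      by (intro add_mono mult_left_mono divide_right_mono K1(2) K3(2) K5(2)) auto
    also have "\<dots> = (15 * K1 + 5 * K3 + K5 / 4) * exp (- (1 / 8) * w\<^sup>2)" by (simp add: algebra_simps)
    finally have "sqrt pi / 8 * (\<bar>15 * w - 5 * w ^ 3 + w ^ 5 / 4\<bar> * exp (- (1 / 4) * w\<^sup>2)) \<le> sqrt pi / 8 * ((15 * K1 + 5 * K3 + K5 / 4) * exp (- (1 / 8) * w\<^sup>2))"
      by (rule mult_left_mono) simp
    then show ?thesis by (simp add: Q_def abs_mult mult.assoc)
  qed
  moreover have "sqrt pi / 8 * (15 * K1 + 5 * K3 + K5 / 4) \<ge> 0" using K1 K3 K5 by simp
  ultimately show ?thesis by blast
qed

lemma Q_powr_integrable:
  assumes "p \<ge> 0"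
  shows "integrable lborel (\<lambda>w. \<bar>Q w\<bar> * \<bar>w\<bar> powr p)"
proof -
  obtain K where K: "K \<ge> 0" "\<And>w. \<bar>Q w\<bar> \<le> K * exp (- (1 / 8) * w\<^sup>2)" using Q_bound by blast
  show ?thesis
  proof (rule Bochner_Integration.integrable_bound[OF integrable_mult_right[OF gauss_powr_integrable[of "1/8" p 0], of K]])
    have "\<bar>Q w\<bar> * \<bar>w\<bar> powr p \<le> K * (\<bar>w\<bar> powr p * w ^ 0 * exp (- (1 / 8) * w\<^sup>2))" for w
      using mult_right_mono[OF K(2)[of w], of "\<bar>w\<bar> powr p"] by (simp add: mult_ac)
    then show "AE w in lborel. norm (\<bar>Q w\<bar> * \<bar>w\<bar> powr p) \<le> norm (K * (\<bar>w\<bar> powr p * w ^ 0 * exp (- (1 / 8) * w\<^sup>2)))"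
      using K(1) by (simp add: abs_mult)
  qed (use assms in auto)
qed

lemma Q_integrable: "integrable lborel Q"
proof -
  obtain K where K: "K \<ge> 0" "\<And>w. \<bar>Q w\<bar> \<le> K * exp (- (1 / 8) * w\<^sup>2)" using Q_bound by blast
  show ?thesis by (rule integrable_gauss_bound[of _ K "1/8"]) (use K in auto)
qed

lemma gauss_powr_moment_step:
  assumes al: "\<alpha> > 0" and j: "j \<ge> 1"
  shows "(LINT w|lborel. \<bar>w\<bar> powr \<alpha> * w ^ (j + 2) * exp (- (1/4) * w\<^sup>2)) =
    2 * (\<alpha> + real j + 1) * (LINT w|lborel. \<bar>w\<bar> powr \<alpha> * w ^ j * exp (- (1/4) * w\<^sup>2))"
proof -
  let ?F = "\<lambda>w::real. \<bar>w\<bar> powr \<alpha> * w ^ (j + 1) * exp (- (1/4) * w\<^sup>2)"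
  let ?f = "\<lambda>w::real. (\<alpha> + real j + 1) * (\<bar>w\<bar> powr \<alpha> * w ^ j * exp (- (1/4) * w\<^sup>2)) - (1/2) * (\<bar>w\<bar> powr \<alpha> * w ^ (j + 2) * exp (- (1/4) * w\<^sup>2))"
  have D1: "((\<lambda>w. \<bar>w\<bar> powr \<alpha> * w ^ (j + 1)) has_real_derivative (\<alpha> + real j + 1) * (\<bar>w\<bar> powr \<alpha> * w ^ j)) (at w)" for w :: real
  proof (cases "w = 0")
    case True
    have "continuous_on UNIV (\<lambda>h::real. \<bar>h\<bar> powr \<alpha> * h ^ j)"
      using al by (intro continuous_intros continuous_on_powr') auto
    then have "isCont (\<lambda>h::real. \<bar>h\<bar> powr \<alpha> * h ^ j) 0"
      by (simp add: continuous_on_eq_continuous_at)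
    then have "((\<lambda>h::real. \<bar>h\<bar> powr \<alpha> * h ^ j) \<longlongrightarrow> \<bar>0\<bar> powr \<alpha> * 0 ^ j) (at 0)"
      by (simp only: isCont_def)
    then have "((\<lambda>h::real. \<bar>h\<bar> powr \<alpha> * h ^ j) \<longlongrightarrow> 0) (at 0)" using al by simp
    moreover have "\<forall>\<^sub>F h in at 0. \<bar>h\<bar> powr \<alpha> * h ^ j = (\<bar>h\<bar> powr \<alpha> * h ^ (j + 1) - \<bar>0\<bar> powr \<alpha> * 0 ^ (j + 1)) / (h - 0)"
      unfolding eventually_at by (rule exI[of _ 1]) simp
    ultimately have "((\<lambda>h::real. (\<bar>h\<bar> powr \<alpha> * h ^ (j + 1) - \<bar>0\<bar> powr \<alpha> * 0 ^ (j + 1)) / (h - 0)) \<longlongrightarrow> 0) (at 0)"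
      by (rule Lim_transform_eventually)
    then show ?thesis using True al by (simp add: has_field_derivative_iff)
  next
    case False
    have sq: "\<bar>w\<bar> powr \<alpha> = (w\<^sup>2) powr (\<alpha> / 2)" for w :: real
    proof -
      have "(\<bar>w\<bar> powr 2) powr (\<alpha> / 2) = \<bar>w\<bar> powr \<alpha>" by (subst powr_powr) simp
      moreover have "\<bar>w\<bar> powr 2 = w\<^sup>2" by simp
      ultimately show ?thesis by (simp only:)
    qed
    have "((\<lambda>w. w\<^sup>2) has_real_derivative 2 * w) (at w)" by (auto intro!: derivative_eq_intros)
    from DERIV_fun_powr[OF this, of "\<alpha> / 2"] False
    have "((\<lambda>w. \<bar>w\<bar> powr \<alpha>) has_real_derivative \<alpha> * (w\<^sup>2) powr (\<alpha> / 2 - 1) * w) (at w)"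
      unfolding sq by (simp add: mult_ac)
    from DERIV_mult[OF this DERIV_pow[of "j + 1" w]]
    have D0: "((\<lambda>w. \<bar>w\<bar> powr \<alpha> * w ^ (j + 1)) has_real_derivative \<alpha> * ((w\<^sup>2) powr (\<alpha> / 2 - 1) * w * w ^ (j + 1)) + real (j + 1) * w ^ j * \<bar>w\<bar> powr \<alpha>) (at w)"
      by (simp add: mult.assoc)
    have eq: "(w\<^sup>2) powr (\<alpha> / 2 - 1) * w * w ^ (j + 1) = \<bar>w\<bar> powr \<alpha> * w ^ j"
    proof -
      have "(w\<^sup>2) powr (\<alpha> / 2 - 1) * w\<^sup>2 = (w\<^sup>2) powr (\<alpha> / 2)"
        using False by (simp add: powr_diff)
      then have "(w\<^sup>2) powr (\<alpha> / 2 - 1) * w\<^sup>2 * w ^ j = (w\<^sup>2) powr (\<alpha> / 2) * w ^ j" by simp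
      then show ?thesis unfolding sq by (simp add: power2_eq_square mult_ac)
    qed
    show ?thesis
      by (rule DERIV_cong[OF D0], simp only: eq) (simp add: algebra_simps)
  qed
  have D: "(?F has_real_derivative ?f w) (at w)" for w
  proof -
    have "((\<lambda>w. exp (- (1/4) * w\<^sup>2)) has_real_derivative exp (- (1/4) * w\<^sup>2) * (- (1/2) * w)) (at w)"
      by (auto intro!: derivative_eq_intros)
    from DERIV_mult[OF D1 this] show ?thesis by (rule DERIV_cong) (simp add: algebra_simps power2_eq_square)
  qed
  have i: "integrable lborel (\<lambda>w. \<bar>w\<bar> powr \<alpha> * w ^ n * exp (- (1/4) * w\<^sup>2))" for n
    using al by (intro gauss_powr_integrable) auto
  have "(LINT w|lborel. ?f w) = 0"
  proof (rule integral_derivative_zero[where F="?F"])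
    show "(?F has_vector_derivative ?f w) (at w)" for w
      using D by (simp only: has_real_derivative_iff_has_vector_derivative)
    show "continuous_on UNIV ?f" using al by (intro continuous_intros continuous_on_powr') auto
    show "integrable lborel ?f"
      using al by (intro Bochner_Integration.integrable_diff integrable_mult_right gauss_powr_integrable) auto
    obtain K where K: "\<And>x::real. \<bar>x\<bar> powr \<alpha> * \<bar>x\<bar> ^ (j + 1) * exp (- (1/4) * x\<^sup>2) \<le> K * exp (- (1 / 4 / 2) * x\<^sup>2)"
      using gauss_powr_bound[of "1/4" \<alpha> "j + 1"] al by auto
    have "norm (?F x) \<le> K * exp (- (1 / 4 / 2) * x\<^sup>2)" for x
      using K[of x] by (simp add: abs_mult power_abs)
    then show "(?F \<longlongrightarrow> 0) at_infinity"
      by (rule gauss_bound_tendsto) simp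
  qed
  then have "(\<alpha> + real j + 1) * (LINT w|lborel. \<bar>w\<bar> powr \<alpha> * w ^ j * exp (- (1/4) * w\<^sup>2)) - (1/2) * (LINT w|lborel. \<bar>w\<bar> powr \<alpha> * w ^ (j + 2) * exp (- (1/4) * w\<^sup>2)) = 0"
    unfolding Bochner_Integration.integral_diff[OF integrable_mult_right[OF i] integrable_mult_right[OF i]] integral_mult_right_zero .
  moreover have "Y = 2 * c * X" if "c * X - (1/2) * Y = 0" for c X Y :: real
    using that by simp
  ultimately show ?thesis by blast
qed

lemma Q_pw_moment_neg:
  assumes al: "0 < \<alpha>" "\<alpha> < 2"
  shows "(LINT w|lborel. Q w * pw \<alpha> w) < 0"
proof -
  let ?m = "\<lambda>j. (LINT w|lborel. \<bar>w\<bar> powr \<alpha> * w ^ j * exp (- (1/4) * w\<^sup>2))"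
  have i: "integrable lborel (\<lambda>w. \<bar>w\<bar> powr \<alpha> * w ^ j * exp (- (1/4) * w\<^sup>2))" for j
    using al by (intro gauss_powr_integrable) auto
  have "(LINT w|lborel. Q w * pw \<alpha> w) = (LINT w|lborel. sqrt pi / 8 * (15 * (\<bar>w\<bar> powr \<alpha> * w ^ 2 * exp (- (1/4) * w\<^sup>2))
      - 5 * (\<bar>w\<bar> powr \<alpha> * w ^ 4 * exp (- (1/4) * w\<^sup>2)) + (1/4) * (\<bar>w\<bar> powr \<alpha> * w ^ 6 * exp (- (1/4) * w\<^sup>2))))"
    by (intro Bochner_Integration.integral_cong) (auto simp: Q_def pw_def algebra_simps eval_nat_numeral)
  also have "\<dots> = sqrt pi / 8 * (15 * ?m 2 - 5 * ?m 4 + (1/4) * ?m 6)"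
    using i[of 2] i[of 4] i[of 6] 
    by (simp only: integral_mult_right_zero Bochner_Integration.integral_add Bochner_Integration.integral_diff integrable_mult_right Bochner_Integration.integrable_diff)
  also have "?m 6 = 2 * (\<alpha> + 5) * ?m 4" using gauss_powr_moment_step[OF al(1), of 4] by simp
  also have "?m 4 = 2 * (\<alpha> + 3) * ?m 2" using gauss_powr_moment_step[OF al(1), of 2] by simp
  also have "sqrt pi / 8 * (15 * ?m 2 - 5 * (2 * (\<alpha> + 3) * ?m 2) + (1/4) * (2 * (\<alpha> + 5) * (2 * (\<alpha> + 3) * ?m 2))) =
    sqrt pi / 8 * (\<alpha> * (\<alpha> - 2)) * ?m 2" by (simp add: algebra_simps)
  also have "\<dots> < 0"
  proof -
    have "?m 2 > 0"
      by (rule integral_pos_of_box[OF i]) (auto simp: box_real)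
    moreover have "\<alpha> * (\<alpha> - 2) < 0" using al by (simp add: mult_pos_neg)
    ultimately show ?thesis by (simp add: mult_pos_neg mult_neg_pos)
  qed
  finally show ?thesis .
qed

lemma Q_scale_integral:
  assumes r: "r > 0" and p: "\<And>v. p (sqrt r * v) = r powr (\<beta> / 2) * p v"
  shows "(LINT w|lborel. 1 / r ^ 3 * q (w / sqrt r) * p w) = r powr (\<beta> / 2 - 5 / 2) * (LINT v|lborel. q v * p v :: real)"
proof -
  have "(LINT w|lborel. 1 / r ^ 3 * q (w / sqrt r) * p w) = \<bar>sqrt r\<bar> *\<^sub>R (LINT v|lborel. 1 / r ^ 3 * q ((0 + sqrt r * v) / sqrt r) * p (0 + sqrt r * v))"
    using r by (intro lborel_integral_real_affine) auto
  also have "(LINT v|lborel. 1 / r ^ 3 * q ((0 + sqrt r * v) / sqrt r) * p (0 + sqrt r * v)) = (LINT v|lborel. (1 / r ^ 3 * r powr (\<beta> / 2)) * (q v * p v))"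
    using r by (intro Bochner_Integration.integral_cong) (auto simp: p)
  also have "\<dots> = (1 / r ^ 3 * r powr (\<beta> / 2)) * (LINT v|lborel. q v * p v)"
    by (rule integral_mult_right_zero)
  also have "\<bar>sqrt r\<bar> *\<^sub>R \<dots> = (sqrt r / r ^ 3 * r powr (\<beta> / 2)) * (LINT v|lborel. q v * p v)" using r by simp
  also have "sqrt r / r ^ 3 * r powr (\<beta> / 2) = r powr (\<beta> / 2 - 5 / 2)"
  proof -
    have "r powr (\<beta> / 2 - 5 / 2) = r powr (1/2) * r powr (\<beta> / 2) / r powr 3"
      by (simp flip: powr_add powr_diff)
    then show ?thesis using r by (simp add: powr_half_sqrt powr_numeral)
  qed
  finally show ?thesis .
qed

subsection \<open>The test functions\<close>

definition Gp :: "'a::euclidean_space \<Rightarrow> real \<Rightarrow> 'a \<Rightarrow> real" where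
  "Gp e \<tau> x = (\<Prod>b\<in>Basis - {e}. sqrt (pi / \<tau>) * exp (- (x \<bullet> b)\<^sup>2 / (4 * \<tau>)))"

lemma Gp_measurable [measurable]: "Gp e \<tau> \<in> borel_measurable borel"
  unfolding Gp_def[abs_def] by measurable

lemma Gp_nonneg: "\<tau> > 0 \<Longrightarrow> Gp e \<tau> x \<ge> 0"
  unfolding Gp_def by (intro prod_nonneg) auto

lemma Gp_proj: "e \<in> Basis \<Longrightarrow> Gp e \<tau> (x - (x \<bullet> e) *\<^sub>R e) = Gp e \<tau> x"
  unfolding Gp_def by (intro prod.cong) (auto simp: inner_diff_left inner_Basis)

lemma
  fixes e :: "'a::euclidean_space" and q :: "real \<Rightarrow> real"
  assumes e: "e \<in> Basis" and tau: "\<tau> > 0" and q: "integrable lborel q"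
  shows Gp_integrable: "integrable lborel (\<lambda>x. q (x \<bullet> e) * Gp e \<tau> x)"
    and Gp_integral: "(LINT x|lborel. q (x \<bullet> e) * Gp e \<tau> x) = (2 * pi) ^ (DIM('a) - 1) * (LINT w|lborel. q w)"
proof -
  let ?g = "\<lambda>w. sqrt (pi / \<tau>) * exp (- (1 / (4 * \<tau>)) * w\<^sup>2)"
  let ?f = "\<lambda>b w. if b = e then q w else ?g w"
  have gi: "integrable lborel ?g" using tau by (intro integrable_mult_right gauss_integrable) auto
  have g2: "(LINT w|lborel. ?g w) = 2 * pi"
  proof -
    have "(LINT w|lborel. ?g w) = sqrt (pi / \<tau>) * sqrt (pi / (1 / (4 * \<tau>)))"
      unfolding integral_mult_right_zero using tau by (subst gauss_integral) auto
    also have "\<dots> = sqrt ((2 * pi)\<^sup>2)" using tau by (simp add: power2_eq_square flip: real_sqrt_mult)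
    also have "\<dots> = 2 * pi" by (rule real_sqrt_unique) auto
    finally show ?thesis .
  qed
  have fi: "integrable lborel (?f b)" for b using q gi by (cases "b = e") auto
  have eq: "q (x \<bullet> e) * Gp e \<tau> x = (\<Prod>b\<in>Basis. ?f b (x \<bullet> b))" for x
  proof -
    have "(\<Prod>b\<in>Basis. ?f b (x \<bullet> b)) = ?f e (x \<bullet> e) * (\<Prod>b\<in>Basis - {e}. ?f b (x \<bullet> b))"
      using e by (intro prod.remove) auto
    also have "(\<Prod>b\<in>Basis - {e}. ?f b (x \<bullet> b)) = Gp e \<tau> x"
      unfolding Gp_def by (intro prod.cong) auto
    finally show ?thesis by simp
  qed
  show "integrable lborel (\<lambda>x. q (x \<bullet> e) * Gp e \<tau> x)"
    unfolding eq by (rule integrable_lborel_prod) (rule fi)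
  have "(LINT x|lborel. q (x \<bullet> e) * Gp e \<tau> x) = (\<Prod>b\<in>Basis. (LINT w|lborel. ?f b w))"
    unfolding eq by (rule integral_lborel_prod) (rule fi)
  also have "\<dots> = (LINT w|lborel. ?f e w) * (\<Prod>b\<in>Basis - {e}. (LINT w|lborel. ?f b w))"
    using e by (intro prod.remove) auto
  also have "(\<Prod>b\<in>Basis - {e}. (LINT w|lborel. ?f b w)) = (\<Prod>b\<in>Basis - {e}. 2 * pi)"
    by (intro prod.cong) (auto simp: g2[simplified])
  also have "\<dots> = (2 * pi) ^ (DIM('a) - 1)" using e by simp
  finally show "(LINT x|lborel. q (x \<bullet> e) * Gp e \<tau> x) = (2 * pi) ^ (DIM('a) - 1) * (LINT w|lborel. q w)" by simp
qed

text \<open>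
  \<open>Psi e r \<tau>\<close> is, up to a factor, the fifth \<open>e\<close>-derivative of a Gaussian of variance \<open>2 r\<close> in
  direction \<open>e\<close> and \<open>2 \<tau>\<close> in the others, and \<open>hPsi\<close> its Fourier transform; the heat flow
  shifts both \<open>r\<close> and \<open>\<tau>\<close>.
\<close>

definition Psi :: "'a::euclidean_space \<Rightarrow> real \<Rightarrow> real \<Rightarrow> 'a \<Rightarrow> real" where
  "Psi e r \<tau> x = 1 / r ^ 3 * Q ((x \<bullet> e) / sqrt r) * Gp e \<tau> x"

definition hPsi :: "'a::euclidean_space \<Rightarrow> real \<Rightarrow> real \<Rightarrow> 'a \<Rightarrow> real" where
  "hPsi e r \<tau> \<xi> = (\<Prod>b\<in>Basis. if b = e then (\<xi> \<bullet> b) ^ 5 * exp (- r * (\<xi> \<bullet> b)\<^sup>2) else exp (- \<tau> * (\<xi> \<bullet> b)\<^sup>2))"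

lemma Psi_measurable [measurable]: "Psi e r \<tau> \<in> borel_measurable borel"
  unfolding Psi_def[abs_def] by measurable

lemma hPsi_measurable [measurable]: "hPsi e r \<tau> \<in> borel_measurable borel"
  unfolding hPsi_def[abs_def] by measurable

lemma Q_scaled_integrable: "r > 0 \<Longrightarrow> integrable lborel (\<lambda>w. 1 / r ^ 3 * Q (w / sqrt r))"
  using lborel_integrable_real_affine[OF Q_integrable, of "1 / sqrt r" 0] by (intro integrable_mult_right) simp

lemma Psi_integrable:
  "e \<in> Basis \<Longrightarrow> r > 0 \<Longrightarrow> \<tau> > 0 \<Longrightarrow> integrable lborel (Psi e r \<tau>)"
  unfolding Psi_def[abs_def] by (rule Gp_integrable[OF _ _ Q_scaled_integrable])

lemma hPsi_integrable:
  "r > 0 \<Longrightarrow> \<tau> > 0 \<Longrightarrow> integrable lborel (hPsi e r \<tau>)"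
proof -
  assume r: "r > 0" "\<tau> > 0"
  have "integrable lborel (\<lambda>w. if b = e then w ^ 5 * exp (- r * w\<^sup>2) else exp (- \<tau> * w\<^sup>2))" for b
    using gauss_power_integrable[OF r(1), of 5] gauss_integrable[OF r(2)] by (cases "b = e") auto
  then show ?thesis unfolding hPsi_def[abs_def] by (rule integrable_lborel_prod)
qed

lemma gauss5_cis_integral:
  assumes r: "r > 0"
  shows "(LINT \<xi>|lborel. cis (- (x * \<xi>)) * of_real (\<xi> ^ 5 * exp (- r * \<xi>\<^sup>2))) = - \<i> * of_real (1 / r ^ 3 * Q (x / sqrt r))"
proof -
  let ?c = "1 / sqrt r"
  have "(LINT \<xi>|lborel. cis (- (x * \<xi>)) * complex_of_real (\<xi> ^ 5 * exp (- r * \<xi>\<^sup>2))) =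
    \<bar>?c\<bar> *\<^sub>R (LINT \<xi>|lborel. cis (- (x * (0 + ?c * \<xi>))) * complex_of_real ((0 + ?c * \<xi>) ^ 5 * exp (- r * (0 + ?c * \<xi>)\<^sup>2)))"
    using r by (intro lborel_integral_real_affine) auto
  also have "(LINT \<xi>|lborel. cis (- (x * (0 + ?c * \<xi>))) * complex_of_real ((0 + ?c * \<xi>) ^ 5 * exp (- r * (0 + ?c * \<xi>)\<^sup>2))) =
    (LINT \<xi>|lborel. of_real (?c ^ 5) * (cis (- (x / sqrt r * \<xi>)) * complex_of_real (\<xi> ^ 5 * exp (- (\<xi>\<^sup>2)))))"
    using r by (intro Bochner_Integration.integral_cong) (auto simp: power_divide)
  also have "\<dots> = of_real (?c ^ 5) * gft 5 (x / sqrt r)"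
    unfolding gft_def by (rule integral_mult_right_zero)
  also have "\<bar>?c\<bar> *\<^sub>R \<dots> = of_real (?c ^ 6) * gft 5 (x / sqrt r)"
    using r by (simp add: scaleR_conv_of_real eval_nat_numeral)
  also have "?c ^ 6 = 1 / r ^ 3"
  proof -
    have "?c ^ 6 = (?c\<^sup>2) ^ 3" by (simp flip: power_mult)
    also have "?c\<^sup>2 = 1 / r" using r by (simp add: power_divide)
    finally show ?thesis by (simp add: power_divide)
  qed
  finally show ?thesis unfolding gft_5 by simp
qed

lemma Psi_fourier:
  fixes e x :: "'a::euclidean_space"
  assumes e: "e \<in> Basis" and r: "r > 0" and tau: "\<tau> > 0"
  shows "(LINT \<xi>|lborel. cis (- (x \<bullet> \<xi>)) * of_real (hPsi e r \<tau> \<xi>)) = - \<i> * of_real (Psi e r \<tau> x)"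
proof -
  let ?k = "\<lambda>b w. if b = e then w ^ 5 * exp (- r * w\<^sup>2) else exp (- \<tau> * w\<^sup>2)"
  let ?f = "\<lambda>b w. cis (- ((x \<bullet> b) * w)) * complex_of_real (?k b w)"
  have fi: "integrable lborel (?f b)" for b
  proof -
    have "integrable lborel (?k b)"
      using gauss_power_integrable[OF r(1), of 5] gauss_integrable[OF tau] by (cases "b = e") auto
    then show ?thesis by (rule Bochner_Integration.integrable_bound) (auto simp: norm_mult)
  qed
  have "(LINT \<xi>|lborel. cis (- (x \<bullet> \<xi>)) * of_real (hPsi e r \<tau> \<xi>)) = (LINT \<xi>|lborel. (\<Prod>b\<in>Basis. ?f b (\<xi> \<bullet> b)))"
    unfolding hPsi_def cis_inner_prod of_real_prod prod.distrib ..
  also have "\<dots> = (\<Prod>b\<in>Basis. (LINT w|lborel. ?f b w))"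
    by (rule integral_lborel_prod) (rule fi)
  also have "\<dots> = (LINT w|lborel. ?f e w) * (\<Prod>b\<in>Basis - {e}. (LINT w|lborel. ?f b w))"
    using e by (intro prod.remove) auto
  also have "(LINT w|lborel. ?f e w) = - \<i> * of_real (1 / r ^ 3 * Q ((x \<bullet> e) / sqrt r))"
    using gauss5_cis_integral[OF r, of "x \<bullet> e"] by (simp only: if_True refl)
  also have "(\<Prod>b\<in>Basis - {e}. (LINT w|lborel. ?f b w)) = (\<Prod>b\<in>Basis - {e}. complex_of_real (sqrt (pi / \<tau>) * exp (- (x \<bullet> b)\<^sup>2 / (4 * \<tau>))))"
  proof (intro prod.cong refl)
    fix b assume "b \<in> Basis - {e}"
    then have "b \<noteq> e" by simp
    then show "(LINT w|lborel. ?f b w) = complex_of_real (sqrt (pi / \<tau>) * exp (- (x \<bullet> b)\<^sup>2 / (4 * \<tau>)))"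
      using gauss_cis_integral[OF tau, of "x \<bullet> b"] by (simp only: if_False)
  qed
  also have "\<dots> = complex_of_real (Gp e \<tau> x)" unfolding Gp_def by simp
  finally show ?thesis by (simp add: Psi_def mult.assoc)
qed

lemma hPsi_exp:
  assumes e: "e \<in> Basis"
  shows "exp (- \<rho> * (norm \<xi>)\<^sup>2) * hPsi e r \<tau> \<xi> = hPsi e (r + \<rho>) (\<tau> + \<rho>) \<xi>"
proof -
  have e0: "exp (- \<rho> * c) * exp (- a * c) = exp (- (a + \<rho>) * c)" for a c :: real
    by (simp add: algebra_simps flip: exp_add)
  have e1: "exp (- \<rho> * c) * (y * exp (- a * c)) = y * exp (- (a + \<rho>) * c)" for a c y :: real
    unfolding e0[symmetric] by (simp only: mult_ac)
  show ?thesis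
    unfolding exp_norm_prod hPsi_def prod.distrib[symmetric]
  proof (intro prod.cong refl)
    show "exp (- \<rho> * (\<xi> \<bullet> b)\<^sup>2) * (if b = e then (\<xi> \<bullet> b) ^ 5 * exp (- r * (\<xi> \<bullet> b)\<^sup>2) else exp (- \<tau> * (\<xi> \<bullet> b)\<^sup>2)) =
      (if b = e then (\<xi> \<bullet> b) ^ 5 * exp (- (r + \<rho>) * (\<xi> \<bullet> b)\<^sup>2) else exp (- (\<tau> + \<rho>) * (\<xi> \<bullet> b)\<^sup>2))" for b
      by (cases "b = e") (simp_all only: if_True if_False e0 e1 refl)
  qed
qed

lemma hkconv_Psi:
  fixes e :: "'a::euclidean_space"
  assumes e: "e \<in> Basis" and r: "r > 0" and tau: "\<tau> > 0" and rho: "\<rho> > 0"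
  shows "hkconv (Psi e r \<tau>) \<rho> z = Psi e (r + \<rho>) (\<tau> + \<rho>) z"
proof -
  have hi: "integrable lborel (\<lambda>\<xi>. complex_of_real (hPsi e r \<tau> \<xi>))"
    using hPsi_integrable[OF r tau] by (rule integrable_of_real)
  have "- \<i> * of_real (hkconv (Psi e r \<tau>) \<rho> z) = - \<i> * (LINT y|lborel. of_real (Psi e r \<tau> y * hk \<rho> (y - z)))"
    unfolding hkconv_def integral_complex_of_real ..
  also have "\<dots> = (LINT y|lborel. of_real (hk \<rho> (z - y)) * (- \<i> * of_real (Psi e r \<tau> y)))"
    unfolding integral_mult_right_zero[symmetric] by (intro Bochner_Integration.integral_cong) (auto simp: hk_commute)
  also have "\<dots> = (LINT \<xi>|lborel. cis (- (z \<bullet> \<xi>)) * of_real (exp (- \<rho> * (norm \<xi>)\<^sup>2)) * of_real (hPsi e r \<tau> \<xi>))"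
    unfolding Psi_fourier[OF e r tau, symmetric] by (rule hk_conv_fourier[OF rho hi])
  also have "\<dots> = (LINT \<xi>|lborel. cis (- (z \<bullet> \<xi>)) * of_real (hPsi e (r + \<rho>) (\<tau> + \<rho>) \<xi>))"
    unfolding hPsi_exp[OF e, symmetric] of_real_mult mult.assoc ..
  also have "\<dots> = - \<i> * of_real (Psi e (r + \<rho>) (\<tau> + \<rho>) z)"
    by (rule Psi_fourier[OF e]) (use r tau rho in auto)
  finally show ?thesis by simp
qed

lemma
  fixes e :: "'a::euclidean_space"
  assumes e: "e \<in> Basis" and r: "r > 0" and tau: "\<tau> > 0" and p: "p > 0"
  shows Psi_abs_moment_integrable: "integrable lborel (\<lambda>x. \<bar>Psi e r \<tau> x\<bar> * \<bar>x \<bullet> e\<bar> powr p)"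
    and Psi_abs_moment: "(LINT x|lborel. \<bar>Psi e r \<tau> x\<bar> * \<bar>x \<bullet> e\<bar> powr p) = 
      ((2 * pi) ^ (DIM('a) - 1) * (LINT w|lborel. \<bar>Q w\<bar> * \<bar>w\<bar> powr p)) * r powr (p / 2 - 5 / 2)"
proof -
  let ?q = "\<lambda>w. 1 / r ^ 3 * \<bar>Q (w / sqrt r)\<bar> * \<bar>w\<bar> powr p"
  have hom: "\<bar>sqrt r * v\<bar> powr p = r powr (p / 2) * \<bar>v\<bar> powr p" for v
    using r by (simp add: abs_mult powr_mult powr_powr flip: powr_half_sqrt)
  have "integrable lborel (\<lambda>w. \<bar>Q (0 + (1 / sqrt r) * w)\<bar> * \<bar>0 + (1 / sqrt r) * w\<bar> powr p)"
    by (rule lborel_integrable_real_affine[OF Q_powr_integrable]) (use p r in auto)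
  then have "integrable lborel (\<lambda>w. (1 / r ^ 3 * r powr (p / 2)) * (\<bar>Q (0 + (1 / sqrt r) * w)\<bar> * \<bar>0 + (1 / sqrt r) * w\<bar> powr p))"
    by (rule integrable_mult_right)
  moreover have "(1 / r ^ 3 * r powr (p / 2)) * (\<bar>Q (0 + (1 / sqrt r) * w)\<bar> * \<bar>0 + (1 / sqrt r) * w\<bar> powr p) = ?q w" for w
    using hom[of "(1 / sqrt r) * w"] r by simp
  ultimately have qi: "integrable lborel ?q" by (simp only:)
  have eq: "\<bar>Psi e r \<tau> x\<bar> * \<bar>x \<bullet> e\<bar> powr p = ?q (x \<bullet> e) * Gp e \<tau> x" for x
    using r Gp_nonneg[OF tau, of e x] by (simp add: Psi_def abs_mult)
  show "integrable lborel (\<lambda>x. \<bar>Psi e r \<tau> x\<bar> * \<bar>x \<bullet> e\<bar> powr p)"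
    unfolding eq by (rule Gp_integrable[OF e tau qi])
  show "(LINT x|lborel. \<bar>Psi e r \<tau> x\<bar> * \<bar>x \<bullet> e\<bar> powr p) = 
      ((2 * pi) ^ (DIM('a) - 1) * (LINT w|lborel. \<bar>Q w\<bar> * \<bar>w\<bar> powr p)) * r powr (p / 2 - 5 / 2)"
    unfolding eq Gp_integral[OF e tau qi] 
    using Q_scale_integral[where q="\<lambda>w. \<bar>Q w\<bar>" and p="\<lambda>w. \<bar>w\<bar> powr p" and \<beta>=p, OF r hom] by simp
qed

lemma Psi_abs_integral:
  fixes e :: "'a::euclidean_space"
  assumes e: "e \<in> Basis" and r: "r > 0" and tau: "\<tau> > 0"
  shows "(LINT x|lborel. \<bar>Psi e r \<tau> x\<bar>) = ((2 * pi) ^ (DIM('a) - 1) * (LINT w|lborel. \<bar>Q w\<bar>)) * r powr (- 5 / 2)"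
proof -
  let ?q = "\<lambda>w. \<bar>1 / r ^ 3 * Q (w / sqrt r)\<bar>"
  have eq: "\<bar>Psi e r \<tau> x\<bar> = ?q (x \<bullet> e) * Gp e \<tau> x" for x
    using r Gp_nonneg[OF tau, of e x] by (simp add: Psi_def abs_mult)
  show ?thesis
    unfolding eq Gp_integral[OF e tau integrable_abs[OF Q_scaled_integrable[OF r]]]
    using Q_scale_integral[where q="\<lambda>w. \<bar>Q w\<bar>" and p="\<lambda>w. 1" and \<beta>=0, OF r] r by (simp add: abs_mult)
qed

subsection \<open>Differentiating the heat kernel in one direction\<close>

definition Dhk :: "'a::euclidean_space \<Rightarrow> real \<Rightarrow> 'a \<Rightarrow> real" where
  "Dhk e r x = - (x \<bullet> e) / (2 * r) * hk r x"

definition D2hk :: "'a::euclidean_space \<Rightarrow> real \<Rightarrow> 'a \<Rightarrow> real" where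
  "D2hk e r x = ((x \<bullet> e)\<^sup>2 / (4 * r\<^sup>2) - 1 / (2 * r)) * hk r x"

lemma Dhk_measurable [measurable (raw)]:
  fixes g :: "'b \<Rightarrow> 'a::euclidean_space"
  assumes [measurable]: "f \<in> borel_measurable M" "g \<in> borel_measurable M"
  shows "(\<lambda>x. Dhk e (f x) (g x)) \<in> borel_measurable M"
  unfolding Dhk_def by measurable

lemma D2hk_measurable [measurable (raw)]:
  fixes g :: "'b \<Rightarrow> 'a::euclidean_space"
  assumes [measurable]: "f \<in> borel_measurable M" "g \<in> borel_measurable M"
  shows "(\<lambda>x. D2hk e (f x) (g x)) \<in> borel_measurable M"
  unfolding D2hk_def by measurable

lemma norm_add_scaleR_sq:
  assumes e: "e \<in> Basis" shows "(norm (x + s *\<^sub>R e))\<^sup>2 = (norm x)\<^sup>2 + 2 * s * (x \<bullet> e) + s\<^sup>2"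
proof -
  have "e \<bullet> e = 1" using e by (simp add: inner_Basis)
  then show ?thesis
    unfolding power2_norm_eq_inner by (simp add: inner_add_left inner_add_right inner_commute power2_eq_square)
qed

lemma hk_line_deriv:
  assumes e: "e \<in> Basis" and r: "r > 0"
  shows "((\<lambda>s. hk r (x + s *\<^sub>R e)) has_real_derivative Dhk e r (x + s *\<^sub>R e)) (at s within S)"
proof -
  have ee: "e \<bullet> e = 1" using e by (simp add: inner_Basis)
  let ?c = "(4 * pi * r) powr (- real DIM('a) / 2)"
  have "((\<lambda>s. ?c * exp (- ((norm x)\<^sup>2 + 2 * s * (x \<bullet> e) + s\<^sup>2) / (4 * r))) has_real_derivative
     ?c * (exp (- ((norm x)\<^sup>2 + 2 * s * (x \<bullet> e) + s\<^sup>2) / (4 * r)) * (- (2 * (x \<bullet> e) + 2 * s) / (4 * r)))) (at s within S)"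
    using r by (auto intro!: derivative_eq_intros simp: field_simps)
  moreover have hk: "hk r (x + v *\<^sub>R e) = ?c * exp (- ((norm x)\<^sup>2 + 2 * v * (x \<bullet> e) + v\<^sup>2) / (4 * r))" for v
    using r by (simp add: hk_def norm_add_scaleR_sq[OF e])
  moreover have "- (2 * (x \<bullet> e) + 2 * s) / (4 * r) = - ((x + s *\<^sub>R e) \<bullet> e) / (2 * r)"
    using r by (simp add: inner_add_left ee field_simps)
  ultimately show ?thesis
    unfolding Dhk_def by (simp only: mult_ac)
qed

lemma Dhk_line_deriv:
  assumes e: "e \<in> Basis" and r: "r > 0"
  shows "((\<lambda>s. Dhk e r (x + s *\<^sub>R e)) has_real_derivative D2hk e r (x + s *\<^sub>R e)) (at s within S)"
proof -
  have ee: "e \<bullet> e = 1" using e by (simp add: inner_Basis)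
  have "((\<lambda>s. - (x \<bullet> e + s) / (2 * r)) has_real_derivative - 1 / (2 * r)) (at s within S)"
    using r by (auto intro!: derivative_eq_intros)
  from DERIV_mult[OF this hk_line_deriv[OF e r, of x s S]]
  have "((\<lambda>s. - (x \<bullet> e + s) / (2 * r) * hk r (x + s *\<^sub>R e)) has_real_derivative
      (- 1 / (2 * r)) * hk r (x + s *\<^sub>R e) + Dhk e r (x + s *\<^sub>R e) * (- (x \<bullet> e + s) / (2 * r))) (at s within S)" .
  moreover have "(- 1 / (2 * r)) * hk r (x + s *\<^sub>R e) + Dhk e r (x + s *\<^sub>R e) * (- (x \<bullet> e + s) / (2 * r)) = D2hk e r (x + s *\<^sub>R e)"
    using r by (simp add: Dhk_def D2hk_def inner_add_left ee power2_eq_square field_simps)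
  moreover have "(\<lambda>s. - (x \<bullet> e + s) / (2 * r) * hk r (x + s *\<^sub>R e)) = (\<lambda>s. Dhk e r (x + s *\<^sub>R e))"
    by (simp add: Dhk_def inner_add_left ee)
  ultimately show ?thesis by simp
qed

lemma hk_double: "r > 0 \<Longrightarrow> hk r x = 2 powr (real DIM('a) / 2) * exp (- (norm x)\<^sup>2 / (8 * r)) * hk (2 * r) (x :: 'a::euclidean_space)"
proof -
  assume r: "r > 0"
  have "(4 * pi * (2 * r)) powr (- real DIM('a) / 2) = 2 powr (- real DIM('a) / 2) * (4 * pi * r) powr (- real DIM('a) / 2)"
    by (subst powr_mult[symmetric]) (simp add: mult_ac)
  moreover have "2 powr (real DIM('a) / 2) * 2 powr (- real DIM('a) / 2) = 1" by (simp flip: powr_add)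
  moreover have "exp (- (norm x)\<^sup>2 / (4 * r)) = exp (- (norm x)\<^sup>2 / (8 * r)) * exp (- (norm x)\<^sup>2 / (4 * (2 * r)))"
    by (simp flip: exp_add)
  ultimately show ?thesis using r by (simp add: hk_def mult_ac)
qed

lemma inner_sq_le: "e \<in> Basis \<Longrightarrow> (x \<bullet> e)\<^sup>2 \<le> (norm x)\<^sup>2"
  by (metis Basis_le_norm abs_ge_zero power2_abs power_mono)

lemma Dhk_bound:
  fixes x :: "'a::euclidean_space"
  assumes e: "e \<in> Basis" and r: "r > 0"
  shows "\<bar>Dhk e r x\<bar> \<le> 2 powr (real DIM('a) / 2) * sqrt 2 * r powr (- 1 / 2) * hk (2 * r) x"
proof -
  define v where "v = \<bar>x \<bullet> e\<bar> / sqrt (8 * r)"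
  have v0: "v \<ge> 0" using r by (simp add: v_def)
  have v2: "v\<^sup>2 = (x \<bullet> e)\<^sup>2 / (8 * r)" using r by (simp add: v_def power_divide)
  have "v \<le> 1 + v\<^sup>2"
  proof -
    have "0 \<le> (v - 1/2)\<^sup>2" by simp
    then show ?thesis by (simp add: power2_eq_square algebra_simps)
  qed
  also have "\<dots> \<le> exp (v\<^sup>2)" by (rule exp_ge_add_one_self)
  also have "\<dots> \<le> exp ((norm x)\<^sup>2 / (8 * r))" unfolding v2 using r inner_sq_le[OF e] by (auto intro: divide_right_mono)
  finally have "v * exp (- (norm x)\<^sup>2 / (8 * r)) \<le> exp ((norm x)\<^sup>2 / (8 * r)) * exp (- (norm x)\<^sup>2 / (8 * r))"
    by (rule mult_right_mono) (rule exp_ge_zero)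
  then have v1: "v * exp (- (norm x)\<^sup>2 / (8 * r)) \<le> 1" by (simp flip: exp_add)
  have "\<bar>x \<bullet> e\<bar> / (2 * r) = sqrt 2 * r powr (- 1 / 2) * v"
  proof -
    have "sqrt (8 * r) = 2 * sqrt 2 * sqrt r"
      using real_sqrt_mult[of 4 "2 * r"] by (simp add: real_sqrt_mult)
    moreover have "r powr (- 1 / 2) = 1 / sqrt r" using r by (simp add: powr_minus_divide powr_half_sqrt)
    moreover have "sqrt 2 * (1 / sqrt r) * (\<bar>x \<bullet> e\<bar> / (2 * sqrt 2 * sqrt r)) = \<bar>x \<bullet> e\<bar> / (2 * (sqrt r * sqrt r))"
      by simp
    ultimately show ?thesis using r by (simp add: v_def)
  qed
  moreover have "\<bar>Dhk e r x\<bar> = \<bar>x \<bullet> e\<bar> / (2 * r) * hk r x" using r by (simp add: Dhk_def abs_mult)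
  ultimately have "\<bar>Dhk e r x\<bar> = 2 powr (real DIM('a) / 2) * sqrt 2 * r powr (- 1 / 2) * hk (2 * r) x * (v * exp (- (norm x)\<^sup>2 / (8 * r)))"
    unfolding hk_double[OF r] by (simp only: mult_ac)
  also have "\<dots> \<le> 2 powr (real DIM('a) / 2) * sqrt 2 * r powr (- 1 / 2) * hk (2 * r) x * 1"
    by (intro mult_left_mono v1) auto
  finally show ?thesis by simp
qed

lemma D2hk_bound:
  fixes x :: "'a::euclidean_space"
  assumes e: "e \<in> Basis" and r: "r > 0"
  shows "\<bar>D2hk e r x\<bar> \<le> 2 powr (real DIM('a) / 2) * (5 / 2) / r * hk (2 * r) x"
proof -
  define y where "y = (x \<bullet> e)\<^sup>2 / (8 * r)"
  let ?E = "exp (- (norm x)\<^sup>2 / (8 * r))"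
  have y0: "y \<ge> 0" using r by (simp add: y_def)
  have "y \<le> exp y" using exp_ge_add_one_self[of y] by linarith
  also have "\<dots> \<le> exp ((norm x)\<^sup>2 / (8 * r))" unfolding y_def using r inner_sq_le[OF e] by (auto intro: divide_right_mono)
  finally have "y * ?E \<le> exp ((norm x)\<^sup>2 / (8 * r)) * ?E"
    by (rule mult_right_mono) (rule exp_ge_zero)
  then have y1: "y * ?E \<le> 1" by (simp flip: exp_add)
  have E1: "?E \<le> 1" using r by simp
  have "\<bar>(x \<bullet> e)\<^sup>2 / (4 * r\<^sup>2) - 1 / (2 * r)\<bar> = \<bar>2 * y - 1 / 2\<bar> / r"
  proof -
    have "(x \<bullet> e)\<^sup>2 / (4 * r\<^sup>2) - 1 / (2 * r) = (2 * y - 1 / 2) / r"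
      using r by (simp add: y_def power2_eq_square field_simps)
    then show ?thesis using r by (simp only: abs_divide)
  qed
  also have "\<dots> \<le> (2 * y + 1 / 2) / r" using r y0 by (intro divide_right_mono) auto
  finally have "\<bar>(x \<bullet> e)\<^sup>2 / (4 * r\<^sup>2) - 1 / (2 * r)\<bar> * ?E \<le> (2 * y + 1 / 2) / r * ?E"
    by (rule mult_right_mono) simp
  also have "\<dots> = (2 * (y * ?E) + 1 / 2 * ?E) / r" by (simp add: algebra_simps add_divide_distrib)
  also have "\<dots> \<le> (2 * 1 + 1 / 2 * 1) / r" using r y1 E1 by (intro divide_right_mono add_mono mult_left_mono) auto
  finally have b: "\<bar>(x \<bullet> e)\<^sup>2 / (4 * r\<^sup>2) - 1 / (2 * r)\<bar> * ?E \<le> (5 / 2) / r" by simp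
  have "\<bar>D2hk e r x\<bar> = 2 powr (real DIM('a) / 2) * hk (2 * r) x * (\<bar>(x \<bullet> e)\<^sup>2 / (4 * r\<^sup>2) - 1 / (2 * r)\<bar> * ?E)"
    using r unfolding D2hk_def hk_double[OF r] by (simp add: abs_mult)
  also have "\<dots> \<le> 2 powr (real DIM('a) / 2) * hk (2 * r) x * ((5 / 2) / r)"
    by (intro mult_left_mono b) auto
  finally show ?thesis by (simp add: mult_ac)
qed

lemma nn_integral_lborel_shift:
  fixes f :: "'a::euclidean_space \<Rightarrow> ennreal"
  assumes [measurable]: "f \<in> borel_measurable borel"
  shows "(\<integral>\<^sup>+x. f (x + c) \<partial>lborel) = (\<integral>\<^sup>+x. f x \<partial>lborel)"
proof -
  have "(\<integral>\<^sup>+x. f x \<partial>lborel) = (\<integral>\<^sup>+x. f x \<partial>distr lborel borel ((+) c))"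
    by (simp add: lborel_distr_plus)
  also have "\<dots> = (\<integral>\<^sup>+x. f (x + c) \<partial>lborel)" by (subst nn_integral_distr) (auto simp: add.commute)
  finally show ?thesis ..
qed

lemma nn_integral_lborel_minus:
  fixes f :: "'a::euclidean_space \<Rightarrow> ennreal"
  assumes [measurable]: "f \<in> borel_measurable borel"
  shows "(\<integral>\<^sup>+y. f (x - y) \<partial>lborel) = (\<integral>\<^sup>+y. f y \<partial>lborel)"
proof -
  have "lborel = distr lborel borel (\<lambda>y::'a. x - y)"
    using lborel_affine[of "-1" x] by (simp add: density_1 one_ennreal_def[symmetric])
  then have "(\<integral>\<^sup>+y. f y \<partial>lborel) = (\<integral>\<^sup>+y. f y \<partial>distr lborel borel (\<lambda>y::'a. x - y))" by metis
  then show ?thesis by (subst (asm) nn_integral_distr) auto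
qed

lemma hk_nn_integral: "r > 0 \<Longrightarrow> (\<integral>\<^sup>+y. ennreal (hk r (y :: 'a::euclidean_space)) \<partial>lborel) = 1"
  using hk_shift_nn_integral[of r "0::'a"] by (simp add: hk_commute[of r 0])

lemma nn_integral_le_hk:
  fixes f :: "'a::euclidean_space \<Rightarrow> real"
  assumes f: "\<And>x. \<bar>f x\<bar> \<le> C * hk r x" and r: "r > 0" and C: "C \<ge> 0"
  shows "(\<integral>\<^sup>+x. ennreal \<bar>f x\<bar> \<partial>lborel) \<le> ennreal C"
proof -
  have "(\<integral>\<^sup>+x. ennreal \<bar>f x\<bar> \<partial>lborel) \<le> (\<integral>\<^sup>+x. ennreal C * ennreal (hk r (x::'a)) \<partial>lborel)"
    using f C by (intro nn_integral_mono) (auto intro!: ennreal_leI simp flip: ennreal_mult)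
  also have "\<dots> = ennreal C" using r by (subst nn_integral_cmult) (auto simp: hk_nn_integral)
  finally show ?thesis .
qed

lemma nn_integral_time_average:
  fixes G :: "real \<Rightarrow> 'a::euclidean_space \<Rightarrow> real"
  assumes G [measurable]: "case_prod G \<in> borel_measurable (borel \<Otimes>\<^sub>M borel)" and z: "z > 0"
    and f: "\<And>x. f x = (LINT s|lborel. indicator {0..z} s *\<^sub>R G s x)"
    and b: "\<And>s. 0 \<le> s \<Longrightarrow> s \<le> z \<Longrightarrow> (\<integral>\<^sup>+x. ennreal \<bar>G s x\<bar> \<partial>lborel) \<le> ennreal B" and B: "B \<ge> 0"
  shows "(\<integral>\<^sup>+x. ennreal \<bar>f x\<bar> \<partial>lborel) \<le> ennreal (z * B)"
proof -
  have "(\<integral>\<^sup>+x. ennreal \<bar>f x\<bar> \<partial>lborel) \<le> (\<integral>\<^sup>+x. \<integral>\<^sup>+s. indicator {0..z} s * ennreal \<bar>G s x\<bar> \<partial>lborel \<partial>lborel)"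
  proof (intro nn_integral_mono)
    fix x
    have "ennreal \<bar>f x\<bar> \<le> (\<integral>\<^sup>+s. ennreal (norm (indicator {0..z} s *\<^sub>R G s x)) \<partial>lborel)"
      unfolding f real_norm_def[symmetric] by (rule ennreal_norm_integral_le)
    also have "\<dots> = (\<integral>\<^sup>+s. indicator {0..z} s * ennreal \<bar>G s x\<bar> \<partial>lborel)"
      by (intro nn_integral_cong) (auto simp: indicator_def)
    finally show "ennreal \<bar>f x\<bar> \<le> (\<integral>\<^sup>+s. indicator {0..z} s * ennreal \<bar>G s x\<bar> \<partial>lborel)" .
  qed
  also have "\<dots> = (\<integral>\<^sup>+s. \<integral>\<^sup>+x. indicator {0..z} s * ennreal \<bar>G s x\<bar> \<partial>lborel \<partial>lborel)"
    by (rule lborel_pair.Fubini') measurable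
  also have "\<dots> = (\<integral>\<^sup>+s. indicator {0..z} s * (\<integral>\<^sup>+x. ennreal \<bar>G s x\<bar> \<partial>lborel) \<partial>lborel)"
    by (intro nn_integral_cong nn_integral_cmult) measurable
  also have "\<dots> \<le> (\<integral>\<^sup>+s. ennreal B * indicator {0..z} s \<partial>lborel)"
    using b by (intro nn_integral_mono) (auto simp: indicator_def)
  also have "\<dots> = ennreal (z * B)"
    using z B by (subst nn_integral_cmult_indicator) (auto simp: mult.commute simp flip: ennreal_mult)
  finally show ?thesis .
qed

definition Ehk :: "'a::euclidean_space \<Rightarrow> real \<Rightarrow> real \<Rightarrow> 'a \<Rightarrow> real" where
  "Ehk e r s x = Dhk e r (x + s *\<^sub>R e) - Dhk e r x"

definition hk_rem :: "'a::euclidean_space \<Rightarrow> real \<Rightarrow> real \<Rightarrow> 'a \<Rightarrow> real" where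
  "hk_rem e r z x = hk r (x + z *\<^sub>R e) - hk r x - z * Dhk e r x"

lemma hk_rem_measurable [measurable (raw)]:
  fixes g :: "'b \<Rightarrow> 'a::euclidean_space"
  assumes [measurable]: "f \<in> borel_measurable M" "g \<in> borel_measurable M"
  shows "(\<lambda>x. hk_rem e (f x) z (g x)) \<in> borel_measurable M"
  unfolding hk_rem_def by measurable

lemma hk_continuous_line: "continuous_on S (\<lambda>s. hk r (x + s *\<^sub>R e))"
  unfolding hk_def by (cases "r > 0") (auto intro!: continuous_intros)

lemma Dhk_continuous_line: "continuous_on S (\<lambda>s. Dhk e r (x + s *\<^sub>R e))"
  unfolding Dhk_def by (cases "r > 0") (auto intro!: continuous_intros hk_continuous_line)

lemma D2hk_continuous_line: "continuous_on S (\<lambda>s. D2hk e r (x + s *\<^sub>R e))"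
  unfolding D2hk_def by (cases "r > 0") (auto intro!: continuous_intros hk_continuous_line)

lemma Ehk_nn_integral:
  fixes e :: "'a::euclidean_space"
  assumes e: "e \<in> Basis" and r: "r > 0" and s: "s > 0"
  shows "(\<integral>\<^sup>+x. ennreal \<bar>Ehk e r s x\<bar> \<partial>lborel) \<le> ennreal (2 powr (real DIM('a) / 2) * 3 * sqrt s * r powr (- 3 / 4))"
proof -
  let ?c = "2 powr (real DIM('a) / 2)"
  let ?I = "(\<integral>\<^sup>+x. ennreal \<bar>Ehk e r s x\<bar> \<partial>lborel)"
  have D: "(\<integral>\<^sup>+x. ennreal \<bar>Dhk e r x\<bar> \<partial>lborel) \<le> ennreal (?c * sqrt 2 * r powr (- 1 / 2))"
    using Dhk_bound[OF e r] r by (intro nn_integral_le_hk[where r="2 * r"]) auto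
  have D2: "(\<integral>\<^sup>+x. ennreal \<bar>D2hk e r x\<bar> \<partial>lborel) \<le> ennreal (?c * (5 / 2) / r)"
    using D2hk_bound[OF e r] r by (intro nn_integral_le_hk[where r="2 * r"]) auto
  have "?I \<le> (\<integral>\<^sup>+x. ennreal \<bar>Dhk e r (x + s *\<^sub>R e)\<bar> + ennreal \<bar>Dhk e r x\<bar> \<partial>lborel)"
    unfolding Ehk_def by (intro nn_integral_mono) (auto intro!: ennreal_leI simp flip: ennreal_plus)
  also have "\<dots> = (\<integral>\<^sup>+x. ennreal \<bar>Dhk e r (x + s *\<^sub>R e)\<bar> \<partial>lborel) + (\<integral>\<^sup>+x. ennreal \<bar>Dhk e r x\<bar> \<partial>lborel)"
    by (rule nn_integral_add) measurable
  also have "(\<integral>\<^sup>+x. ennreal \<bar>Dhk e r (x + s *\<^sub>R e)\<bar> \<partial>lborel) = (\<integral>\<^sup>+x. ennreal \<bar>Dhk e r x\<bar> \<partial>lborel)"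
    by (rule nn_integral_lborel_shift) measurable
  also have "\<dots> + \<dots> \<le> ennreal (?c * sqrt 2 * r powr (- 1 / 2)) + ennreal (?c * sqrt 2 * r powr (- 1 / 2))"
    by (intro add_mono D)
  also have "\<dots> = ennreal (?c * (2 * sqrt 2 * r powr (- 1 / 2)))" by (simp flip: ennreal_plus)
  finally have b1: "?I \<le> ennreal (?c * (2 * sqrt 2 * r powr (- 1 / 2)))" .
  have b2: "?I \<le> ennreal (s * (?c * (5 / 2) / r))"
  proof (rule nn_integral_time_average[where G="\<lambda>v x. D2hk e r (x + v *\<^sub>R e)"])
    show "(\<lambda>(v, x). D2hk e r (x + v *\<^sub>R e)) \<in> borel_measurable (borel \<Otimes>\<^sub>M borel)" by measurable
    show "Ehk e r s x = (LINT v|lborel. indicator {0..s} v *\<^sub>R D2hk e r (x + v *\<^sub>R e))" for x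
    proof -
      have "(LINT v|lborel. indicator {0..s} v *\<^sub>R D2hk e r (x + v *\<^sub>R e)) = Dhk e r (x + s *\<^sub>R e) - Dhk e r (x + 0 *\<^sub>R e)"
        using s by (intro integral_FTC_atLeastAtMost D2hk_continuous_line Dhk_line_deriv[OF e r, unfolded has_real_derivative_iff_has_vector_derivative]) auto
      then show ?thesis by (simp add: Ehk_def)
    qed
    show "(\<integral>\<^sup>+x. ennreal \<bar>D2hk e r (x + v *\<^sub>R e)\<bar> \<partial>lborel) \<le> ennreal (?c * (5 / 2) / r)" for v
    proof -
      have "(\<integral>\<^sup>+x. ennreal \<bar>D2hk e r (x + v *\<^sub>R e)\<bar> \<partial>lborel) = (\<integral>\<^sup>+x. ennreal \<bar>D2hk e r x\<bar> \<partial>lborel)"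
        by (rule nn_integral_lborel_shift) measurable
      then show ?thesis using D2 by (simp only:)
    qed
  qed (use s r in auto)
  let ?a = "2 * sqrt 2 * r powr (- 1 / 2)" and ?b = "s * (5 / 2) / r"
  have a0: "?a \<ge> 0" and b0: "?b \<ge> 0" using r s by auto
  have "min ?a ?b \<le> sqrt (?a * ?b)"
  proof (rule real_le_rsqrt)
    show "(min ?a ?b)\<^sup>2 \<le> ?a * ?b"
      unfolding power2_eq_square using a0 b0 by (intro mult_mono) (auto simp: min_def)
  qed
  also have "\<dots> = sqrt (5 * sqrt 2) * (sqrt s * r powr (- 3 / 4))"
  proof -
    have "?a * ?b = (5 * sqrt 2) * (s * r powr (- 3 / 2))"
    proof -
      have "r powr (- 1 / 2) / r = r powr (- 3 / 2)"
        using r powr_diff[of r "- 1 / 2" 1] by simp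
      moreover have "?a * ?b = (5 * sqrt 2) * (s * (r powr (- 1 / 2) / r))" by simp
      ultimately show ?thesis by (simp only:)
    qed
    moreover have "sqrt (r powr (- 3 / 2)) = r powr (- 3 / 4)" 
      using r by (simp add: powr_powr flip: powr_half_sqrt)
    ultimately show ?thesis by (simp add: real_sqrt_mult)
  qed
  also have "\<dots> \<le> 3 * (sqrt s * r powr (- 3 / 4))"
  proof (intro mult_right_mono)
    have "sqrt 2 \<le> 9 / 5" by (rule real_le_lsqrt) (auto simp: power2_eq_square)
    then show "sqrt (5 * sqrt 2) \<le> 3" by (intro real_le_lsqrt) auto
  qed (use s in auto)
  finally have "?c * min ?a ?b \<le> ?c * 3 * sqrt s * r powr (- 3 / 4)" by simp
  moreover have "?I \<le> ennreal (?c * min ?a ?b)"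
    using b1 b2 by (auto simp: min_def mult_ac)
  ultimately show ?thesis using order_trans ennreal_leI by blast
qed

lemma hk_rem_nn_integral:
  fixes e :: "'a::euclidean_space"
  assumes e: "e \<in> Basis" and r: "r > 0" and z: "z > 0"
  shows "(\<integral>\<^sup>+x. ennreal \<bar>hk_rem e r z x\<bar> \<partial>lborel) \<le> ennreal (2 powr (real DIM('a) / 2) * 3 * z powr (3 / 2) * r powr (- 3 / 4))"
proof -
  let ?c = "2 powr (real DIM('a) / 2) * 3 * sqrt z * r powr (- 3 / 4)"
  have "(\<integral>\<^sup>+x. ennreal \<bar>hk_rem e r z x\<bar> \<partial>lborel) \<le> ennreal (z * ?c)"
  proof (rule nn_integral_time_average[where G="\<lambda>s x. Ehk e r s x"])
    show "(\<lambda>(s, x). Ehk e r s x) \<in> borel_measurable (borel \<Otimes>\<^sub>M borel)" unfolding Ehk_def by measurable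
    show "hk_rem e r z x = (LINT s|lborel. indicator {0..z} s *\<^sub>R Ehk e r s x)" for x
    proof -
      have "(LINT s|lborel. indicator {0..z} s *\<^sub>R Ehk e r s x) = (hk r (x + z *\<^sub>R e) - z * Dhk e r x) - (hk r (x + 0 *\<^sub>R e) - 0 * Dhk e r x)"
      proof (rule integral_FTC_atLeastAtMost)
        have "((\<lambda>s. hk r (x + s *\<^sub>R e) - s * Dhk e r x) has_real_derivative Dhk e r (x + s *\<^sub>R e) - 1 * Dhk e r x) (at s within {0..z})" for s
          by (intro DERIV_diff hk_line_deriv e r DERIV_cmult_right DERIV_ident)
        then show "((\<lambda>s. hk r (x + s *\<^sub>R e) - s * Dhk e r x) has_vector_derivative Ehk e r s x) (at s within {0..z})" for s
          by (simp add: Ehk_def has_real_derivative_iff_has_vector_derivative)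
        show "continuous_on {0..z} (\<lambda>s. Ehk e r s x)" unfolding Ehk_def by (intro continuous_intros Dhk_continuous_line)
      qed (use z in simp)
      then show ?thesis by (simp add: hk_rem_def)
    qed
    show "(\<integral>\<^sup>+x. ennreal \<bar>Ehk e r s x\<bar> \<partial>lborel) \<le> ennreal ?c" if s: "0 \<le> s" "s \<le> z" for s
    proof (cases "s = 0")
      case True then show ?thesis by (simp add: Ehk_def)
    next
      case False
      have "(\<integral>\<^sup>+x. ennreal \<bar>Ehk e r s x\<bar> \<partial>lborel) \<le> ennreal (2 powr (real DIM('a) / 2) * 3 * sqrt s * r powr (- 3 / 4))"
        using False s by (intro Ehk_nn_integral e r) auto
      also have "\<dots> \<le> ennreal ?c" using s by (intro ennreal_leI mult_right_mono mult_left_mono) auto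
      finally show ?thesis .
    qed
  qed (use z in auto)
  also have "z * ?c = 2 powr (real DIM('a) / 2) * 3 * z powr (3 / 2) * r powr (- 3 / 4)"
  proof -
    have "z powr (3 / 2) = z * sqrt z" using z powr_add[of z 1 "1/2"] by (simp add: powr_half_sqrt)
    then show ?thesis by simp
  qed
  finally show ?thesis .
qed

lemma
  assumes a: "0 \<le> a" "a < 1" and r: "\<rho> > (0::real)"
  shows powr_time_integrable: "integrable lborel (\<lambda>\<sigma>. indicator {0..\<rho>} \<sigma> * (\<rho> - \<sigma>) powr (- a))"
    and powr_time_integral: "(LINT \<sigma>|lborel. indicator {0..\<rho>} \<sigma> * (\<rho> - \<sigma>) powr (- a)) = \<rho> powr (1 - a) / (1 - a)"
proof -
  let ?f = "\<lambda>\<sigma>::real. indicator {0..\<rho>} \<sigma> * \<sigma> powr (- a)"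
  let ?I = "\<rho> powr (1 - a) / (1 - a)"
  have "((\<lambda>x. x powr (- a)) has_integral (\<rho> powr (- a + 1) / (- a + 1))) {0..\<rho>}"
    by (rule has_integral_powr_from_0) (use a r in auto)
  then have "((\<lambda>x. if x \<in> {0..\<rho>} then x powr (- a) else 0) has_integral ?I) UNIV"
    unfolding has_integral_restrict_UNIV by (simp add: add.commute)
  also have "(\<lambda>x. if x \<in> {0..\<rho>} then x powr (- a) else 0) = ?f" by (auto simp: indicator_def)
  finally have h: "(?f has_integral ?I) UNIV" .
  have nn: "(\<integral>\<^sup>+x. ennreal (?f x) \<partial>lborel) = ennreal ?I"
    by (rule nn_integral_has_integral_lborel[OF _ _ h]) auto
  have i: "integrable lborel ?f"
    by (rule integrableI_nn_integral_finite[OF _ _ nn]) auto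
  have v: "(LINT x|lborel. ?f x) = ?I"
    using nn a r by (subst integral_eq_nn_integral) auto
  have eq: "?f (\<rho> - \<sigma>) = indicator {0..\<rho>} \<sigma> * (\<rho> - \<sigma>) powr (- a)" for \<sigma>
    by (auto simp: indicator_def)
  show "integrable lborel (\<lambda>\<sigma>. indicator {0..\<rho>} \<sigma> * (\<rho> - \<sigma>) powr (- a))"
    using lborel_integrable_shift[OF i, of \<rho>] unfolding eq .
  show "(LINT \<sigma>|lborel. indicator {0..\<rho>} \<sigma> * (\<rho> - \<sigma>) powr (- a)) = ?I"
    using lborel_integral_shift[of ?f \<rho>] unfolding eq v by simp
qed

lemma kernel_conv_bound:
  fixes k w :: "'a::euclidean_space \<Rightarrow> real"
  assumes k: "k \<in> borel_measurable borel" and kc: "(\<integral>\<^sup>+y. ennreal \<bar>k y\<bar> \<partial>lborel) \<le> ennreal c" and c: "c \<ge> 0" and w: "\<And>y. \<bar>w y\<bar> \<le> B"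
  shows "\<bar>LINT y|lborel. k y * w y\<bar> \<le> c * B"
proof -
  have B0: "B \<ge> 0" using w[of 0] by linarith
  have "ennreal \<bar>LINT y|lborel. k y * w y\<bar> \<le> (\<integral>\<^sup>+y. ennreal (norm (k y * w y)) \<partial>lborel)"
    using ennreal_norm_integral_le[of lborel "\<lambda>y. k y * w y"] by simp
  also have "\<dots> \<le> (\<integral>\<^sup>+y. ennreal B * ennreal \<bar>k y\<bar> \<partial>lborel)"
  proof (intro nn_integral_mono)
    fix y
    have "\<bar>k y\<bar> * \<bar>w y\<bar> \<le> \<bar>k y\<bar> * B" by (intro mult_left_mono w) auto
    then show "ennreal (norm (k y * w y)) \<le> ennreal B * ennreal \<bar>k y\<bar>"
      using B0 by (simp add: abs_mult mult.commute flip: ennreal_mult)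
  qed
  also have "\<dots> = ennreal B * (\<integral>\<^sup>+y. ennreal \<bar>k y\<bar> \<partial>lborel)" using k by (intro nn_integral_cmult) measurable
  also have "\<dots> \<le> ennreal B * ennreal c" by (intro mult_left_mono kc) auto
  also have "\<dots> = ennreal (c * B)" using B0 c by (simp add: mult.commute flip: ennreal_mult)
  finally show ?thesis using B0 c by simp
qed

subsection \<open>First order expansion of odd solutions\<close>

definition proj :: "'a::euclidean_space \<Rightarrow> 'a \<Rightarrow> 'a" where
  "proj e x = x - (x \<bullet> e) *\<^sub>R e"

lemma proj_measurable [measurable]: "proj e \<in> borel_measurable borel"
  unfolding proj_def[abs_def] by measurable

lemma proj_proj: "e \<in> Basis \<Longrightarrow> proj e (proj e x) = proj e x"
  by (simp add: proj_def inner_diff_left inner_Basis)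

lemma proj_inner: "e \<in> Basis \<Longrightarrow> proj e x \<bullet> e = 0"
  by (simp add: proj_def inner_diff_left inner_Basis)

lemma proj_add: "proj e x + (x \<bullet> e) *\<^sub>R e = x"
  by (simp add: proj_def)

lemma reflect_proj_add: "e \<in> Basis \<Longrightarrow> reflect e (proj e x + z *\<^sub>R e) = proj e x - z *\<^sub>R e"
proof -
  assume e: "e \<in> Basis"
  have "(2 * z) *\<^sub>R e = z *\<^sub>R e + z *\<^sub>R e" by (metis mult_2 scaleR_add_left)
  then show ?thesis using e by (simp add: reflect_def proj_inner inner_add_left inner_Basis)
qed

context odd_solution begin

text \<open>The \<open>e\<close>-derivative of \<open>U \<rho>\<close> at the projection of \<open>x\<close> to the hyperplane orthogonal to \<open>e\<close>.\<close>

definition slope :: "real \<Rightarrow> 'a \<Rightarrow> real" where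
  "slope \<rho> x = (LINT y|lborel. Dhk e \<rho> (proj e x - y) * U0 y) +
     lam * (LINT \<sigma>|lborel. LINT y|lborel. Dhk e (\<rho> - \<sigma>) (proj e x - y) * F \<sigma> y)"

lemma slope_proj: "slope \<rho> (proj e x) = slope \<rho> x"
  unfolding slope_def by (simp add: proj_proj e)

lemma U_proj: "U \<rho> (proj e x) = 0"
proof -
  have "reflect e (proj e x) = proj e x" using reflect_proj_add[OF e, of x 0] by simp
  then show ?thesis using U_odd[of \<rho> "proj e x"] by simp
qed

lemma Dhk_shift_integrable:
  assumes r: "r > 0" shows "integrable lborel (\<lambda>y. Dhk e r (x - y))"
proof (rule integrableI_bounded)
  have "(\<integral>\<^sup>+y. ennreal \<bar>Dhk e r (x - y)\<bar> \<partial>lborel) = (\<integral>\<^sup>+y. ennreal \<bar>Dhk e r y\<bar> \<partial>lborel)"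
    by (rule nn_integral_lborel_minus) measurable
  also have "\<dots> \<le> ennreal (2 powr (real DIM('a) / 2) * sqrt 2 * r powr (- 1 / 2))"
    using Dhk_bound[OF e r] r by (intro nn_integral_le_hk[where r="2 * r"]) auto
  also have "\<dots> < \<infinity>" by simp
  finally show "(\<integral>\<^sup>+y. ennreal (norm (Dhk e r (x - y))) \<partial>lborel) < \<infinity>" by simp
qed measurable

lemma U_expansion_half_line:
  assumes rho: "0 < \<rho>" "\<rho> \<le> t" and z: "z > 0"
  shows "\<bar>U \<rho> (proj e x + z *\<^sub>R e) - z * slope \<rho> x\<bar> \<le>
    2 powr (real DIM('a) / 2) * 3 * z powr (3 / 2) * (M * \<rho> powr (- 3 / 4) + lam * (M powr \<alpha> * M) * (4 * \<rho> powr (1 / 4)))"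
proof -
  let ?x = "proj e x" and ?c = "2 powr (real DIM('a) / 2) * 3 * z powr (3 / 2)" and ?B = "M powr \<alpha> * M"
  have F': "F \<sigma> \<in> borel_measurable borel" for \<sigma> by measurable
  have B0: "?B \<ge> 0" using M_nonneg by simp
  have i1: "integrable lborel (\<lambda>y. hk \<rho> (w - y) * U0 y)" for w
    using bounded_mult_integrable[OF hk_shift_integrable U0_meas, of M \<rho> w] U0_bound by simp
  have i2: "integrable lborel (\<lambda>y. Dhk e \<rho> (?x - y) * U0 y)"
    using bounded_mult_integrable[OF Dhk_shift_integrable[OF rho(1), of ?x] U0_meas, of M] U0_bound by simp
  have j1: "integrable lborel (\<lambda>y. hk (\<rho> - \<sigma>) (w - y) * F \<sigma> y)" for w \<sigma>
    using bounded_mult_integrable[OF hk_shift_integrable F', of \<sigma> ?B "\<rho> - \<sigma>" w] F_bound by simp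
  have j2: "integrable lborel (\<lambda>y. Dhk e (\<rho> - \<sigma>) (?x - y) * F \<sigma> y)" for \<sigma>
  proof (cases "\<rho> - \<sigma> > 0")
    case True
    then show ?thesis
      using bounded_mult_integrable[OF Dhk_shift_integrable[OF True, of ?x] F', of \<sigma> ?B] F_bound by simp
  qed (simp add: Dhk_def)
  let ?k = "\<lambda>\<sigma> y. indicator {0..} \<sigma> * Dhk e (\<rho> - \<sigma>) (?x - y)"
  have "integrable (lborel \<Otimes>\<^sub>M lborel) (\<lambda>(\<sigma>, y). ?k \<sigma> y *\<^sub>R F \<sigma> y)"
  proof (rule spacetime_integrable[where c="\<lambda>\<sigma>. 2 powr (real DIM('a) / 2) * sqrt 2 * (indicator {0..\<rho>} \<sigma> * (\<rho> - \<sigma>) powr (- (1 / 2)))" and B="?B"])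
    show "case_prod ?k \<in> borel_measurable borel" unfolding borel_prod[symmetric] by measurable
    show "integrable lborel (\<lambda>\<sigma>. 2 powr (real DIM('a) / 2) * sqrt 2 * (indicator {0..\<rho>} \<sigma> * (\<rho> - \<sigma>) powr (- (1 / 2))))"
      by (intro integrable_mult_right powr_time_integrable) (use rho in auto)
    show "(\<integral>\<^sup>+y. ennreal \<bar>?k \<sigma> y\<bar> \<partial>lborel) \<le> ennreal (2 powr (real DIM('a) / 2) * sqrt 2 * (indicator {0..\<rho>} \<sigma> * (\<rho> - \<sigma>) powr (- (1 / 2))))" for \<sigma>
    proof (cases "0 \<le> \<sigma> \<and> \<sigma> < \<rho>")
      case True
      then have r: "\<rho> - \<sigma> > 0" by simp
      have "(\<integral>\<^sup>+y. ennreal \<bar>?k \<sigma> y\<bar> \<partial>lborel) = (\<integral>\<^sup>+y. ennreal \<bar>Dhk e (\<rho> - \<sigma>) (?x - y)\<bar> \<partial>lborel)" using True by simp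
      also have "\<dots> = (\<integral>\<^sup>+y. ennreal \<bar>Dhk e (\<rho> - \<sigma>) y\<bar> \<partial>lborel)"
        by (rule nn_integral_lborel_minus) measurable
      also have "\<dots> \<le> ennreal (2 powr (real DIM('a) / 2) * sqrt 2 * (\<rho> - \<sigma>) powr (- 1 / 2))"
        using Dhk_bound[OF e r] r by (intro nn_integral_le_hk[where r="2 * (\<rho> - \<sigma>)"]) auto
      finally show ?thesis using True by simp
    qed (auto simp: Dhk_def indicator_def)
  qed (use F_meas F_bound in auto)
  then have "integrable lborel (\<lambda>\<sigma>. LINT y|lborel. ?k \<sigma> y * F \<sigma> y)"
    by (drule_tac lborel_pair.integrable_fst') (simp only: prod.case real_scaleR_def)
  moreover have "(LINT y|lborel. ?k \<sigma> y * F \<sigma> y) = (LINT y|lborel. Dhk e (\<rho> - \<sigma>) (?x - y) * F \<sigma> y)" for \<sigma>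
    by (cases "\<sigma> < 0") (auto simp: F_supp)
  ultimately have k2: "integrable lborel (\<lambda>\<sigma>. LINT y|lborel. Dhk e (\<rho> - \<sigma>) (?x - y) * F \<sigma> y)" by simp
  have k1: "integrable lborel (\<lambda>\<sigma>. LINT y|lborel. hk (\<rho> - \<sigma>) (w - y) * F \<sigma> y)" for w
    by (rule F_time_integrable)
  have rem_eq: "hk_rem e r z (?x - y) = hk r (?x + z *\<^sub>R e - y) - hk r (?x - y) - z * Dhk e r (?x - y)" for r y
    unfolding hk_rem_def by (simp add: algebra_simps)
  have R0: "(LINT y|lborel. hk_rem e \<rho> z (?x - y) * U0 y) = (LINT y|lborel. hk \<rho> (?x + z *\<^sub>R e - y) * U0 y) -
     (LINT y|lborel. hk \<rho> (?x - y) * U0 y) - z * (LINT y|lborel. Dhk e \<rho> (?x - y) * U0 y)"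
  proof -
    have "(LINT y|lborel. hk_rem e \<rho> z (?x - y) * U0 y) = (LINT y|lborel. hk \<rho> (?x + z *\<^sub>R e - y) * U0 y - hk \<rho> (?x - y) * U0 y - z * (Dhk e \<rho> (?x - y) * U0 y))"
      unfolding rem_eq by (simp add: algebra_simps)
    then show ?thesis
      using Bochner_Integration.integral_diff[OF Bochner_Integration.integrable_diff[OF i1 i1] integrable_mult_right[OF i2]]
        Bochner_Integration.integral_diff[OF i1 i1] by (simp only: integral_mult_right_zero)
  qed
  have Rs: "(LINT y|lborel. hk_rem e (\<rho> - \<sigma>) z (?x - y) * F \<sigma> y) = (LINT y|lborel. hk (\<rho> - \<sigma>) (?x + z *\<^sub>R e - y) * F \<sigma> y) -
     (LINT y|lborel. hk (\<rho> - \<sigma>) (?x - y) * F \<sigma> y) - z * (LINT y|lborel. Dhk e (\<rho> - \<sigma>) (?x - y) * F \<sigma> y)" for \<sigma>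
  proof -
    have "(LINT y|lborel. hk_rem e (\<rho> - \<sigma>) z (?x - y) * F \<sigma> y) = (LINT y|lborel. hk (\<rho> - \<sigma>) (?x + z *\<^sub>R e - y) * F \<sigma> y - hk (\<rho> - \<sigma>) (?x - y) * F \<sigma> y - z * (Dhk e (\<rho> - \<sigma>) (?x - y) * F \<sigma> y))"
      unfolding rem_eq by (simp add: algebra_simps)
    then show ?thesis
      using Bochner_Integration.integral_diff[OF Bochner_Integration.integrable_diff[OF j1 j1] integrable_mult_right[OF j2]]
        Bochner_Integration.integral_diff[OF j1 j1] by (simp only: integral_mult_right_zero)
  qed
  have RT: "(LINT \<sigma>|lborel. LINT y|lborel. hk_rem e (\<rho> - \<sigma>) z (?x - y) * F \<sigma> y) = (LINT \<sigma>|lborel. LINT y|lborel. hk (\<rho> - \<sigma>) (?x + z *\<^sub>R e - y) * F \<sigma> y) -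
     (LINT \<sigma>|lborel. LINT y|lborel. hk (\<rho> - \<sigma>) (?x - y) * F \<sigma> y) - z * (LINT \<sigma>|lborel. LINT y|lborel. Dhk e (\<rho> - \<sigma>) (?x - y) * F \<sigma> y)"
    unfolding Rs
    using Bochner_Integration.integral_diff[OF Bochner_Integration.integrable_diff[OF k1 k1] integrable_mult_right[OF k2]]
        Bochner_Integration.integral_diff[OF k1 k1] by (simp only: integral_mult_right_zero)
  have "U \<rho> (?x + z *\<^sub>R e) - z * slope \<rho> x = (U \<rho> (?x + z *\<^sub>R e) - U \<rho> ?x) - z * slope \<rho> x" by (simp add: U_proj)
  also have "\<dots> = (LINT y|lborel. hk_rem e \<rho> z (?x - y) * U0 y) + lam * (LINT \<sigma>|lborel. LINT y|lborel. hk_rem e (\<rho> - \<sigma>) z (?x - y) * F \<sigma> y)"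
    unfolding U_eq[OF rho] slope_def R0 RT by (simp add: algebra_simps)
  finally have eq: "U \<rho> (?x + z *\<^sub>R e) - z * slope \<rho> x = (LINT y|lborel. hk_rem e \<rho> z (?x - y) * U0 y) + lam * (LINT \<sigma>|lborel. LINT y|lborel. hk_rem e (\<rho> - \<sigma>) z (?x - y) * F \<sigma> y)" .
  have remi: "(\<integral>\<^sup>+y. ennreal \<bar>hk_rem e r z (?x - y)\<bar> \<partial>lborel) \<le> ennreal (?c * r powr (- 3 / 4))" if "r > 0" for r
    using hk_rem_nn_integral[OF e that z] by (subst nn_integral_lborel_minus[of "\<lambda>y. ennreal \<bar>hk_rem e r z y\<bar>"]) auto
  have b1: "\<bar>LINT y|lborel. hk_rem e \<rho> z (?x - y) * U0 y\<bar> \<le> (?c * \<rho> powr (- 3 / 4)) * M"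
    by (rule kernel_conv_bound[OF _ remi]) (use rho U0_bound in auto)
  have b2: "\<bar>LINT y|lborel. hk_rem e (\<rho> - \<sigma>) z (?x - y) * F \<sigma> y\<bar> \<le> (?c * ?B) * (indicator {0..\<rho>} \<sigma> * (\<rho> - \<sigma>) powr (- (3 / 4)))" for \<sigma>
  proof -
    consider "\<sigma> < 0" | "\<sigma> \<ge> \<rho>" | "0 \<le> \<sigma>" "\<sigma> < \<rho>" by linarith
    then show ?thesis
    proof cases
      case 3
      have "\<bar>LINT y|lborel. hk_rem e (\<rho> - \<sigma>) z (?x - y) * F \<sigma> y\<bar> \<le> (?c * (\<rho> - \<sigma>) powr (- 3 / 4)) * ?B"
        by (rule kernel_conv_bound[OF _ remi]) (use 3 F_bound in auto)
      then show ?thesis using 3 by (simp add: mult_ac)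
    qed (use B0 in \<open>auto simp: F_supp hk_rem_def Dhk_def\<close>)
  qed
  have "ennreal \<bar>LINT \<sigma>|lborel. LINT y|lborel. hk_rem e (\<rho> - \<sigma>) z (?x - y) * F \<sigma> y\<bar> \<le> (\<integral>\<^sup>+\<sigma>. ennreal \<bar>LINT y|lborel. hk_rem e (\<rho> - \<sigma>) z (?x - y) * F \<sigma> y\<bar> \<partial>lborel)"
    using ennreal_norm_integral_le[of lborel "\<lambda>\<sigma>. LINT y|lborel. hk_rem e (\<rho> - \<sigma>) z (?x - y) * F \<sigma> y"] by simp
  also have "\<dots> \<le> (\<integral>\<^sup>+\<sigma>. ennreal ((?c * ?B) * (indicator {0..\<rho>} \<sigma> * (\<rho> - \<sigma>) powr (- (3 / 4)))) \<partial>lborel)"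
    by (intro nn_integral_mono ennreal_leI b2)
  also have "\<dots> = ennreal (LINT \<sigma>|lborel. (?c * ?B) * (indicator {0..\<rho>} \<sigma> * (\<rho> - \<sigma>) powr (- (3 / 4))))"
    using rho B0 by (intro nn_integral_eq_integral integrable_mult_right powr_time_integrable) auto
  also have "(LINT \<sigma>|lborel. (?c * ?B) * (indicator {0..\<rho>} \<sigma> * (\<rho> - \<sigma>) powr (- (3 / 4)))) = (?c * ?B) * (4 * \<rho> powr (1 / 4))"
    unfolding integral_mult_right_zero using rho by (subst powr_time_integral) auto
  finally have "ennreal \<bar>LINT \<sigma>|lborel. LINT y|lborel. hk_rem e (\<rho> - \<sigma>) z (?x - y) * F \<sigma> y\<bar> \<le> ennreal ((?c * ?B) * (4 * \<rho> powr (1 / 4)))" .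
  moreover have "0 \<le> (?c * ?B) * (4 * \<rho> powr (1 / 4))" using M_nonneg by (intro mult_nonneg_nonneg) auto
  ultimately have b3: "\<bar>LINT \<sigma>|lborel. LINT y|lborel. hk_rem e (\<rho> - \<sigma>) z (?x - y) * F \<sigma> y\<bar> \<le> (?c * ?B) * (4 * \<rho> powr (1 / 4))"
    by (simp only: ennreal_le_iff)
  have "\<bar>U \<rho> (?x + z *\<^sub>R e) - z * slope \<rho> x\<bar> \<le> \<bar>LINT y|lborel. hk_rem e \<rho> z (?x - y) * U0 y\<bar> + lam * \<bar>LINT \<sigma>|lborel. LINT y|lborel. hk_rem e (\<rho> - \<sigma>) z (?x - y) * F \<sigma> y\<bar>"
    unfolding eq using lam by (intro order_trans[OF abs_triangle_ineq]) (simp add: abs_mult)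
  also have "\<dots> \<le> (?c * \<rho> powr (- 3 / 4)) * M + lam * ((?c * ?B) * (4 * \<rho> powr (1 / 4)))"
    using lam by (intro add_mono b1 mult_left_mono b3) auto
  also have "\<dots> = ?c * (M * \<rho> powr (- 3 / 4) + lam * ?B * (4 * \<rho> powr (1 / 4)))" by (simp add: algebra_simps)
  finally show ?thesis .
qed

lemma U_expansion:
  "\<exists>C\<ge>0. \<forall>\<rho> x. t / 2 \<le> \<rho> \<longrightarrow> \<rho> \<le> t \<longrightarrow> \<bar>U \<rho> x - (x \<bullet> e) * slope \<rho> x\<bar> \<le> C * \<bar>x \<bullet> e\<bar> powr (3 / 2)"
proof -
  let ?c = "2 powr (real DIM('a) / 2) * 3"
  define C where "C = ?c * (M * (t / 2) powr (- 3 / 4) + lam * (M powr \<alpha> * M) * (4 * t powr (1 / 4)))"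
  have C0: "C \<ge> 0" unfolding C_def using M_nonneg lam by simp
  have pos: "\<bar>U \<rho> (proj e x + z *\<^sub>R e) - z * slope \<rho> x\<bar> \<le> C * z powr (3 / 2)"
    if rho: "t / 2 \<le> \<rho>" "\<rho> \<le> t" and z: "z > 0" for \<rho> x z
  proof -
    have rho0: "\<rho> > 0" using rho t by linarith
    have "\<bar>U \<rho> (proj e x + z *\<^sub>R e) - z * slope \<rho> x\<bar> \<le>
      ?c * z powr (3 / 2) * (M * \<rho> powr (- 3 / 4) + lam * (M powr \<alpha> * M) * (4 * \<rho> powr (1 / 4)))"
      by (rule U_expansion_half_line[OF rho0 rho(2) z])
    also have "\<dots> \<le> ?c * z powr (3 / 2) * (M * (t / 2) powr (- 3 / 4) + lam * (M powr \<alpha> * M) * (4 * t powr (1 / 4)))"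
    proof (intro mult_left_mono add_mono)
      show "\<rho> powr (- 3 / 4) \<le> (t / 2) powr (- 3 / 4)" using rho t by (intro powr_mono2') auto
      show "\<rho> powr (1 / 4) \<le> t powr (1 / 4)" using rho rho0 by (intro powr_mono2) auto
    qed (use M_nonneg lam in auto)
    finally show ?thesis by (simp add: C_def mult_ac)
  qed
  have "\<bar>U \<rho> x - (x \<bullet> e) * slope \<rho> x\<bar> \<le> C * \<bar>x \<bullet> e\<bar> powr (3 / 2)" if rho: "t / 2 \<le> \<rho>" "\<rho> \<le> t" for \<rho> x
  proof -
    consider "x \<bullet> e > 0" | "x \<bullet> e = 0" | "x \<bullet> e < 0" by linarith
    then show ?thesis
    proof cases
      case 1
      then show ?thesis using pos[OF rho 1, of x] by (simp add: proj_add)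
    next
      case 2
      then have "x = proj e x" by (simp add: proj_def)
      then show ?thesis using 2 U_proj[of \<rho> x] by simp
    next
      case 3
      have "U \<rho> (proj e x + (- (x \<bullet> e)) *\<^sub>R e) = - U \<rho> x"
        using U_odd[of \<rho> "x"] reflect_proj_add[OF e, of x "x \<bullet> e"] by (simp add: proj_add)
      then have "\<bar>- U \<rho> x - (- (x \<bullet> e)) * slope \<rho> x\<bar> \<le> C * (- (x \<bullet> e)) powr (3 / 2)"
        using pos[OF rho, of "- (x \<bullet> e)" x] 3 by simp
      moreover have "\<bar>- U \<rho> x - (- (x \<bullet> e)) * slope \<rho> x\<bar> = \<bar>U \<rho> x - (x \<bullet> e) * slope \<rho> x\<bar>" by (simp add: abs_minus_commute)
      ultimately show ?thesis using 3 by simp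
    qed
  qed
  then show ?thesis using C0 by blast
qed

lemma slope_limit:
  assumes rho: "t / 2 \<le> \<rho>" "\<rho> \<le> t"
  shows "(\<lambda>n. real (Suc n) * U \<rho> (proj e x + (1 / real (Suc n)) *\<^sub>R e)) \<longlonglongrightarrow> slope \<rho> x"
proof -
  obtain C where C: "C \<ge> 0" "\<And>\<rho> x. t / 2 \<le> \<rho> \<Longrightarrow> \<rho> \<le> t \<Longrightarrow> \<bar>U \<rho> x - (x \<bullet> e) * slope \<rho> x\<bar> \<le> C * \<bar>x \<bullet> e\<bar> powr (3 / 2)"
    using U_expansion by blast
  have "(\<lambda>n. real (Suc n) * U \<rho> (proj e x + (1 / real (Suc n)) *\<^sub>R e) - slope \<rho> x) \<longlonglongrightarrow> 0"
  proof (rule Lim_null_comparison)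
    have "(\<lambda>n. inverse (real (Suc n)) powr (1 / 2)) \<longlonglongrightarrow> 0"
      by (rule tendsto_zero_powrI[OF LIMSEQ_inverse_real_of_nat tendsto_const]) auto
    then show "(\<lambda>n. C * inverse (real (Suc n)) powr (1 / 2)) \<longlonglongrightarrow> 0" by (rule tendsto_mult_right_zero)
    have "norm (real (Suc n) * U \<rho> (proj e x + (1 / real (Suc n)) *\<^sub>R e) - slope \<rho> x) \<le> C * inverse (real (Suc n)) powr (1 / 2)" for n
    proof -
      let ?h = "1 / real (Suc n)" and ?y = "proj e x + (1 / real (Suc n)) *\<^sub>R e"
      have h: "?h > 0" by simp
      have ye: "?y \<bullet> e = ?h" using e by (simp add: inner_add_left proj_inner inner_Basis)
      have "proj e ?y = proj e x" unfolding proj_def[of e ?y] ye by simp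
      then have sl: "slope \<rho> ?y = slope \<rho> x" using slope_proj by metis
      have "\<bar>U \<rho> ?y - ?h * slope \<rho> x\<bar> \<le> C * ?h powr (3 / 2)"
        using C(2)[OF rho, of ?y] unfolding ye sl using h by simp
      then have "real (Suc n) * \<bar>U \<rho> ?y - ?h * slope \<rho> x\<bar> \<le> real (Suc n) * (C * ?h powr (3 / 2))"
        by (rule mult_left_mono) simp
      moreover have "real (Suc n) * \<bar>U \<rho> ?y - ?h * slope \<rho> x\<bar> = \<bar>real (Suc n) * U \<rho> ?y - slope \<rho> x\<bar>"
      proof -
        have "real (Suc n) * U \<rho> ?y - slope \<rho> x = real (Suc n) * (U \<rho> ?y - ?h * slope \<rho> x)"
          by (simp add: right_diff_distrib)
        then show ?thesis by (simp add: abs_mult)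
      qed
      moreover have "real (Suc n) * (C * ?h powr (3 / 2)) = C * inverse (real (Suc n)) powr (1 / 2)"
      proof -
        have "?h powr (3 / 2) = ?h * ?h powr (1 / 2)" using powr_add[of ?h 1 "1/2"] h by simp
        then show ?thesis by (simp add: inverse_eq_divide)
      qed
      ultimately show ?thesis by (simp only: real_norm_def)
    qed
    then show "\<forall>\<^sub>F n in sequentially. norm (real (Suc n) * U \<rho> (proj e x + (1 / real (Suc n)) *\<^sub>R e) - slope \<rho> x) \<le> C * inverse (real (Suc n)) powr (1 / 2)"
      by simp
  qed
  then show ?thesis by (simp only: LIM_zero_iff)
qed

lemma slope_measurable:
  assumes rho: "t / 2 \<le> \<rho>" "\<rho> \<le> t"
  shows "slope \<rho> \<in> borel_measurable borel"
  by (rule borel_measurable_LIMSEQ_real[OF slope_limit[OF rho]]) measurable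

lemma slope_nonneg:
  assumes rho: "t / 2 \<le> \<rho>" "\<rho> \<le> t"
  shows "slope \<rho> x \<ge> 0"
proof (rule tendsto_lowerbound[OF slope_limit[OF rho]])
  have "(proj e x + (1 / real (Suc n)) *\<^sub>R e) \<bullet> e \<ge> 0" for n
    using e by (simp add: inner_add_left proj_inner inner_Basis)
  then show "\<forall>\<^sub>F n in sequentially. 0 \<le> real (Suc n) * U \<rho> (proj e x + (1 / real (Suc n)) *\<^sub>R e)"
    by (intro always_eventually allI mult_nonneg_nonneg U_nonneg) auto
qed simp

end

subsection \<open>Divergence of the fifth derivative\<close>

lemma le_exp_minus_one: "s \<ge> 0 \<Longrightarrow> s \<le> exp s - (1::real)"
  using exp_ge_add_one_self[of s] by linarith

lemma pw_mult: "pw \<alpha> (a * b) = pw \<alpha> a * pw \<alpha> (b::real)"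
  by (simp add: pw_def abs_mult powr_mult)

lemma norm_le_DIM_of_box: "y \<in> box 0 One \<Longrightarrow> norm (y::'a::euclidean_space) \<le> DIM('a)"
proof -
  assume y: "y \<in> box 0 One"
  have "norm y \<le> (\<Sum>b\<in>Basis. \<bar>y \<bullet> b\<bar>)" by (rule norm_le_l1)
  also have "\<dots> \<le> (\<Sum>b::'a\<in>Basis. 1)"
    using y by (intro sum_mono) (force simp: mem_box)
  finally show ?thesis by simp
qed

lemma norm_proj_le: "e \<in> Basis \<Longrightarrow> norm (proj e x) \<le> norm x"
proof -
  assume e: "e \<in> Basis"
  have "(norm x)\<^sup>2 = (norm (proj e x))\<^sup>2 + (x \<bullet> e)\<^sup>2"
    using norm_add_scaleR_sq[OF e, of "proj e x" "x \<bullet> e"] by (simp add: proj_add proj_inner e)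
  then have "(norm (proj e x))\<^sup>2 \<le> (norm x)\<^sup>2" by simp
  then show ?thesis by (rule power2_le_imp_le) simp
qed

lemma odd_hk_lower:
  fixes e :: "'a::euclidean_space"
  assumes e: "e \<in> Basis" and rho: "t / 2 \<le> \<rho>" "\<rho> \<le> t" and t: "t > 0"
    and w: "0 < w" and y: "y \<bullet> e \<ge> 0" and D: "norm (proj e z + w *\<^sub>R e - reflect e y) \<le> D"
  shows "odd_hk e \<rho> (proj e z + w *\<^sub>R e) y \<ge> w * ((4 * pi * t) powr (- real DIM('a) / 2) * exp (- D\<^sup>2 / (2 * t)) / (2 * t)) * (y \<bullet> e)"
proof -
  have rho0: "\<rho> > 0" using rho t by linarith
  let ?x = "proj e z + w *\<^sub>R e"
  have xe: "?x \<bullet> e = w" using e by (simp add: inner_add_left proj_inner inner_Basis)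
  let ?H = "hk \<rho> (?x - reflect e y)"
  have "hk \<rho> (?x - y) = ?H * exp (w * (y \<bullet> e) / \<rho>)"
  proof -
    have "- (norm (?x - y))\<^sup>2 / (4 * \<rho>) = - (norm (?x - reflect e y))\<^sup>2 / (4 * \<rho>) + w * (y \<bullet> e) / \<rho>"
      unfolding norm_minus_reflect[OF e] xe using rho0 by (simp add: field_simps)
    then show ?thesis using rho0 by (simp only: hk_def exp_add) simp
  qed
  then have odd_hk: "odd_hk e \<rho> ?x y = ?H * (exp (w * (y \<bullet> e) / \<rho>) - 1) / 2"
    unfolding odd_hk_def by (simp add: algebra_simps)
  have H: "(4 * pi * t) powr (- real DIM('a) / 2) * exp (- D\<^sup>2 / (2 * t)) \<le> ?H"
  proof -
    have "(4 * pi * t) powr (- real DIM('a) / 2) \<le> (4 * pi * \<rho>) powr (- real DIM('a) / 2)"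
      using rho rho0 by (intro powr_mono2') auto
    moreover have "exp (- D\<^sup>2 / (2 * t)) \<le> exp (- (norm (?x - reflect e y))\<^sup>2 / (4 * \<rho>))"
    proof -
      have "(norm (?x - reflect e y))\<^sup>2 / (4 * \<rho>) \<le> D\<^sup>2 / (2 * t)"
        using D rho t by (intro frac_le power_mono) auto
      then show ?thesis by simp
    qed
    ultimately show ?thesis using rho0 unfolding hk_def by (auto intro!: mult_mono)
  qed
  have E: "w * (y \<bullet> e) / t \<le> exp (w * (y \<bullet> e) / \<rho>) - 1"
  proof -
    have "w * (y \<bullet> e) / t \<le> w * (y \<bullet> e) / \<rho>" using rho rho0 w y by (intro divide_left_mono) auto
    also have "\<dots> \<le> exp (w * (y \<bullet> e) / \<rho>) - 1" using rho0 w y by (intro le_exp_minus_one) auto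
    finally show ?thesis .
  qed
  have "((4 * pi * t) powr (- real DIM('a) / 2) * exp (- D\<^sup>2 / (2 * t))) * (w * (y \<bullet> e) / t) \<le> ?H * (exp (w * (y \<bullet> e) / \<rho>) - 1)"
    using w y t by (intro mult_mono H E) auto
  then show ?thesis unfolding odd_hk by (simp add: field_simps)
qed

context odd_solution begin

lemma slope_lower:
  assumes box_pos: "\<And>y. y \<in> box 0 One \<Longrightarrow> U0 y > 0"
  shows "\<exists>c>0. \<forall>\<rho> x. t / 2 \<le> \<rho> \<longrightarrow> \<rho> \<le> t \<longrightarrow> x \<in> box 0 One \<longrightarrow> slope \<rho> x \<ge> c"
proof -
  let ?N = "real DIM('a)"
  let ?D = "2 * ?N + 1"
  define \<kappa> where "\<kappa> = (4 * pi * t) powr (- ?N / 2) * exp (- ?D\<^sup>2 / (2 * t)) / (2 * t)"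
  have k0: "\<kappa> > 0" unfolding \<kappa>_def using t by simp
  let ?g = "\<lambda>y. indicator (box 0 One) y * ((y \<bullet> e) * \<bar>U0 y\<bar>)"
  have gi: "integrable lborel ?g"
  proof (rule Bochner_Integration.integrable_bound[where f="\<lambda>y::'a. M * indicator (box 0 One) y"])
    show "integrable lborel (\<lambda>y::'a. M * indicator (box 0 One) y)"
      by (intro integrable_mult_right integrable_real_indicator) (auto simp: emeasure_lborel_box_eq)
    have "norm (?g y) \<le> norm (M * indicator (box 0 One) y)" for y
    proof (cases "y \<in> box 0 One")
      case True
      then have "0 < y \<bullet> e" "y \<bullet> e < 1" using e by (auto simp: mem_box)
      then have "(y \<bullet> e) * \<bar>U0 y\<bar> \<le> 1 * M" using U0_bound by (intro mult_mono) auto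
      then show ?thesis using True \<open>0 < y \<bullet> e\<close> M_nonneg by (simp add: abs_mult)
    qed simp
    then show "AE y in lborel. norm (?g y) \<le> norm (M * indicator (box 0 One) y)" by simp
  qed measurable
  define I0 where "I0 = (LINT y|lborel. ?g y)"
  have I0: "I0 > 0"
    unfolding I0_def
  proof (rule integral_pos_of_box[OF gi])
    show "?g y \<ge> 0" for y using e by (auto simp: indicator_def mem_box less_imp_le)
    show "?g y > 0" if y: "y \<in> box 0 One" for y
    proof -
      have "0 < y \<bullet> e" using y e by (auto simp: mem_box)
      then show ?thesis using y box_pos[OF y] by simp
    qed
  qed
  have main: "U \<rho> (proj e x + w *\<^sub>R e) \<ge> w * (\<kappa> * I0)"
    if rho: "t / 2 \<le> \<rho>" "\<rho> \<le> t" and x: "x \<in> box 0 One" and w: "0 < w" "w \<le> 1" for \<rho> x w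
  proof -
    let ?x = "proj e x + w *\<^sub>R e"
    have rho0: "\<rho> > 0" using rho t by linarith
    have xe: "?x \<bullet> e \<ge> 0" using e w by (simp add: inner_add_left proj_inner inner_Basis)
    have "w * (\<kappa> * I0) = (LINT y|lborel. w * \<kappa> * ?g y)"
      unfolding I0_def integral_mult_right_zero by (simp only: mult.assoc)
    also have "\<dots> \<le> (LINT y|lborel. \<bar>odd_hk e \<rho> ?x y\<bar> * \<bar>U0 y\<bar>)"
    proof (rule integral_mono)
      show "integrable lborel (\<lambda>y. w * \<kappa> * ?g y)" by (intro integrable_mult_right gi)
      show "integrable lborel (\<lambda>y. \<bar>odd_hk e \<rho> ?x y\<bar> * \<bar>U0 y\<bar>)"
        by (rule odd_hk_conv_nonneg(2)[where w=U0, OF e U0_meas U0_bound U0_odd xe U0_nonneg])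
      show "w * \<kappa> * ?g y \<le> \<bar>odd_hk e \<rho> ?x y\<bar> * \<bar>U0 y\<bar>" for y
      proof (cases "y \<in> box 0 One")
        case True
        then have ye: "0 \<le> y \<bullet> e" using e by (auto simp: mem_box less_imp_le)
        have "norm (?x - reflect e y) \<le> norm (proj e x) + norm (w *\<^sub>R e) + norm (reflect e y)"
          by (intro order_trans[OF norm_triangle_ineq4] add_right_mono norm_triangle_ineq)
        also have "\<dots> \<le> ?N + 1 + ?N"
          using norm_proj_le[OF e, of x] norm_le_DIM_of_box[OF x] norm_le_DIM_of_box[OF True] w e
          by (intro add_mono) (auto simp: norm_reflect)
        finally have D: "norm (?x - reflect e y) \<le> ?D" by simp
        have "w * \<kappa> * (y \<bullet> e) \<le> odd_hk e \<rho> ?x y"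
          unfolding \<kappa>_def by (rule odd_hk_lower[OF e rho t w(1) ye D])
        then have "w * \<kappa> * (y \<bullet> e) * \<bar>U0 y\<bar> \<le> \<bar>odd_hk e \<rho> ?x y\<bar> * \<bar>U0 y\<bar>"
          by (intro mult_right_mono) auto
        then show ?thesis using True by (simp add: mult.assoc)
      qed simp
    qed
    also have "\<dots> = (LINT y|lborel. hk \<rho> (?x - y) * U0 y)"
      by (rule odd_hk_conv_nonneg(1)[where w=U0, OF e U0_meas U0_bound U0_odd xe U0_nonneg, symmetric])
    also have "\<dots> \<le> U \<rho> ?x" by (rule U_lower[OF rho0 rho(2) xe])
    finally show ?thesis .
  qed
  have "slope \<rho> x \<ge> \<kappa> * I0" if rho: "t / 2 \<le> \<rho>" "\<rho> \<le> t" and x: "x \<in> box 0 One" for \<rho> x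
  proof (rule tendsto_lowerbound[OF slope_limit[OF rho]])
    have "\<kappa> * I0 \<le> real (Suc n) * U \<rho> (proj e x + (1 / real (Suc n)) *\<^sub>R e)" for n
    proof -
      have "1 / real (Suc n) * (\<kappa> * I0) \<le> U \<rho> (proj e x + (1 / real (Suc n)) *\<^sub>R e)"
        by (rule main[OF rho x]) auto
      then have "real (Suc n) * (1 / real (Suc n) * (\<kappa> * I0)) \<le> real (Suc n) * U \<rho> (proj e x + (1 / real (Suc n)) *\<^sub>R e)"
        by (rule mult_left_mono) simp
      then show ?thesis by simp
    qed
    then show "\<forall>\<^sub>F n in sequentially. \<kappa> * I0 \<le> real (Suc n) * U \<rho> (proj e x + (1 / real (Suc n)) *\<^sub>R e)" by simp
  qed simp
  then show ?thesis using k0 I0 by (intro exI[of _ "\<kappa> * I0"]) auto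
qed

lemma Psi_F_decomposition:
  "\<exists>K L. K \<ge> 0 \<and> (\<forall>\<rho> x. t / 2 \<le> \<rho> \<longrightarrow> \<rho> \<le> t \<longrightarrow> \<bar>slope \<rho> x\<bar> \<le> L \<and>
     \<bar>F \<rho> x - pw \<alpha> (x \<bullet> e) * pw \<alpha> (slope \<rho> x)\<bar> \<le> K * \<bar>x \<bullet> e\<bar> powr (\<alpha> + 3 / 2))"
proof -
  obtain C where C: "C \<ge> 0" "\<And>\<rho> x. t / 2 \<le> \<rho> \<Longrightarrow> \<rho> \<le> t \<Longrightarrow> \<bar>U \<rho> x - (x \<bullet> e) * slope \<rho> x\<bar> \<le> C * \<bar>x \<bullet> e\<bar> powr (3 / 2)"
    using U_expansion by blast
  let ?L = "M + C" let ?K = "?L + C + M"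
  have L: "\<bar>slope \<rho> x\<bar> \<le> ?L" if rho: "t / 2 \<le> \<rho>" "\<rho> \<le> t" for \<rho> x
  proof -
    let ?y = "proj e x + 1 *\<^sub>R e"
    have ye: "?y \<bullet> e = 1" using e by (simp add: inner_add_left proj_inner inner_Basis)
    have "proj e ?y = proj e x" unfolding proj_def[of e ?y] ye by simp
    then have sl: "slope \<rho> ?y = slope \<rho> x" using slope_proj by metis
    have "\<bar>U \<rho> ?y - slope \<rho> x\<bar> \<le> C" using C(2)[OF rho, of ?y] unfolding ye sl by simp
    then show ?thesis using U_bound[of \<rho> ?y] by linarith
  qed
  have "\<bar>F \<rho> x - pw \<alpha> (x \<bullet> e) * pw \<alpha> (slope \<rho> x)\<bar> \<le> ((1 + \<alpha>) * ?K powr \<alpha> * C) * \<bar>x \<bullet> e\<bar> powr (\<alpha> + 3 / 2)"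
    if rho: "t / 2 \<le> \<rho>" "\<rho> \<le> t" for \<rho> x
  proof (cases "x \<bullet> e = 0")
    case True
    then have "x = proj e x" by (simp add: proj_def)
    then show ?thesis using True U_proj[of \<rho> x] by simp
  next
    case False
    let ?z = "\<bar>x \<bullet> e\<bar>"
    have z: "?z > 0" using False by simp
    have exp: "\<bar>U \<rho> x - (x \<bullet> e) * slope \<rho> x\<bar> \<le> C * ?z powr (3 / 2)" by (rule C(2)[OF rho])
    have sz: "\<bar>(x \<bullet> e) * slope \<rho> x\<bar> \<le> ?z * ?L" unfolding abs_mult by (intro mult_left_mono L rho) auto
    have a: "\<bar>(x \<bullet> e) * slope \<rho> x\<bar> \<le> ?K * ?z"
    proof -
      have "?z * ?L \<le> ?z * ?K" using C(1) M_nonneg by (intro mult_left_mono) auto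
      then show ?thesis using sz by (simp add: mult.commute)
    qed
    have b: "\<bar>U \<rho> x\<bar> \<le> ?K * ?z"
    proof (cases "?z \<le> 1")
      case True
      have "?z powr (3 / 2) \<le> ?z powr 1" using True z by (intro powr_mono') auto
      then have "C * ?z powr (3 / 2) \<le> C * ?z" using C(1) z by (intro mult_left_mono) auto
      then have "\<bar>U \<rho> x\<bar> \<le> ?z * ?L + C * ?z" using exp sz by linarith
      also have "\<dots> \<le> ?K * ?z" using M_nonneg z by (simp add: algebra_simps)
      finally show ?thesis .
    next
      case False
      have "\<bar>U \<rho> x\<bar> \<le> M * 1" using U_bound by simp
      also have "\<dots> \<le> ?K * ?z" using False M_nonneg C(1) by (intro mult_mono) auto
      finally show ?thesis .
    qed
    have "\<bar>F \<rho> x - pw \<alpha> ((x \<bullet> e) * slope \<rho> x)\<bar> \<le> (1 + \<alpha>) * (?K * ?z) powr \<alpha> * \<bar>U \<rho> x - (x \<bullet> e) * slope \<rho> x\<bar>"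
      using pw_lipschitz[OF al, of "U \<rho> x" "?K * ?z" "(x \<bullet> e) * slope \<rho> x"] a b by simp
    also have "\<dots> \<le> (1 + \<alpha>) * (?K * ?z) powr \<alpha> * (C * ?z powr (3 / 2))"
      using al by (intro mult_left_mono exp) auto
    also have "\<dots> = ((1 + \<alpha>) * ?K powr \<alpha> * C) * (?z powr \<alpha> * ?z powr (3 / 2))"
      by (simp add: powr_mult mult_ac)
    also have "?z powr \<alpha> * ?z powr (3 / 2) = ?z powr (\<alpha> + 3 / 2)" by (simp add: powr_add)
    finally show ?thesis unfolding pw_mult .
  qed
  moreover have "(1 + \<alpha>) * ?K powr \<alpha> * C \<ge> 0" using al C(1) by simp
  ultimately show ?thesis using L by blast
qed

lemma Psi_F_upper:
  assumes box_pos: "\<And>y. y \<in> box 0 One \<Longrightarrow> U0 y > 0" and al2: "\<alpha> < 2"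
  shows "\<exists>c>0. \<exists>r0>0. \<forall>r \<tau> \<rho>. 0 < r \<longrightarrow> r \<le> r0 \<longrightarrow> 1 \<le> \<tau> \<longrightarrow> \<tau> \<le> 1 + t \<longrightarrow> t / 2 \<le> \<rho> \<longrightarrow> \<rho> \<le> t \<longrightarrow>
    (LINT z|lborel. Psi e r \<tau> z * F \<rho> z) \<le> - c / r"
proof -
  let ?N = "DIM('a)"
  obtain K L where K0: "K \<ge> 0" and KL: "\<And>\<rho> x. t / 2 \<le> \<rho> \<Longrightarrow> \<rho> \<le> t \<Longrightarrow> \<bar>slope \<rho> x\<bar> \<le> L"
    "\<And>\<rho> x. t / 2 \<le> \<rho> \<Longrightarrow> \<rho> \<le> t \<Longrightarrow> \<bar>F \<rho> x - pw \<alpha> (x \<bullet> e) * pw \<alpha> (slope \<rho> x)\<bar> \<le> K * \<bar>x \<bullet> e\<bar> powr (\<alpha> + 3 / 2)"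
    using Psi_F_decomposition by blast
  obtain a0 where a0: "a0 > 0" "\<And>\<rho> x. t / 2 \<le> \<rho> \<Longrightarrow> \<rho> \<le> t \<Longrightarrow> x \<in> box 0 One \<Longrightarrow> slope \<rho> x \<ge> a0"
    using slope_lower[OF box_pos] by blast
  define c0 where "c0 = - (LINT w|lborel. Q w * pw \<alpha> w)"
  have c0: "c0 > 0" unfolding c0_def using Q_pw_moment_neg[OF al al2] by simp
  define qK where "qK = (2 * pi) ^ (?N - 1) * (LINT w|lborel. \<bar>Q w\<bar> * \<bar>w\<bar> powr (\<alpha> + 3 / 2))"
  have qK: "qK \<ge> 0" unfolding qK_def by (intro mult_nonneg_nonneg integral_nonneg_AE) auto
  define g0 where "g0 = (sqrt (pi / (1 + t)) * exp (- 1 / 4)) ^ (?N - 1)"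
  have g0: "g0 > 0" unfolding g0_def using t by simp
  define c2 where "c2 = exp (- 1) * g0 * pw \<alpha> a0"
  have c2: "c2 > 0" unfolding c2_def pw_def using g0 a0(1) by simp
  define c3 where "c3 = c0 * c2 / sqrt pi"
  have c3: "c3 > 0" using c0 c2 by (simp add: c3_def)
  have spi: "(LINT w|lborel. exp (- (w\<^sup>2) :: real)) = sqrt pi" using gauss_integral[of 1] by simp
  have gi: "integrable lborel (\<lambda>w::real. exp (- (w\<^sup>2)))" using gauss_integrable[of 1] by simp
  have key: "(LINT z|lborel. Psi e r \<tau> z * F \<rho> z) \<le> - c3 * r powr (\<alpha> / 2 - 2) + K * qK * r powr (\<alpha> / 2 - 7 / 4)"
    if r: "r > 0" and tau: "1 \<le> \<tau>" "\<tau> \<le> 1 + t" and rho: "t / 2 \<le> \<rho>" "\<rho> \<le> t" for r \<tau> \<rho>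
  proof -
    have tau0: "\<tau> > 0" using tau by simp
    let ?S = "\<lambda>x. pw \<alpha> (slope \<rho> x)"
    have [measurable]: "slope \<rho> \<in> borel_measurable borel" by (rule slope_measurable[OF rho])
    have S0: "?S x \<ge> 0" for x using slope_nonneg[OF rho] by (simp add: pw_def)
    have SL: "\<bar>?S x\<bar> \<le> L powr \<alpha> * L" for x
    proof -
      have "norm (?S x) \<le> L powr \<alpha> * norm (slope \<rho> x)" by (rule norm_pw_le) (auto simp: KL(1)[OF rho] al)
      also have "\<dots> \<le> L powr \<alpha> * L" using KL(1)[OF rho, of x] by (intro mult_left_mono) auto
      finally show ?thesis by simp
    qed
    let ?g = "\<lambda>z. Gp e \<tau> z * ?S z"
    have g_proj: "?g z = ?g (z - (z \<bullet> e) *\<^sub>R e)" for z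
      using Gp_proj[OF e, of \<tau> z] slope_proj[of \<rho> z] by (simp add: proj_def)
    have mult_g: "integrable lborel (\<lambda>x. q (x \<bullet> e) * ?g x)" if q: "integrable lborel q" for q
    proof -
      have "integrable lborel (\<lambda>x. (q (x \<bullet> e) * Gp e \<tau> x) *\<^sub>R ?S x)"
        by (rule bounded_mult_integrable[OF Gp_integrable[OF e tau0 q], of _ "L powr \<alpha> * L"]) (use SL in auto)
      then show ?thesis by (simp add: mult.assoc)
    qed
    let ?q = "\<lambda>w. 1 / r ^ 3 * Q (w / sqrt r) * pw \<alpha> w"
    have hom: "pw \<alpha> (sqrt r * v) = r powr ((1 + \<alpha>) / 2) * pw \<alpha> v" for v
    proof -
      have "pw \<alpha> (sqrt r) = r powr ((1 + \<alpha>) / 2)"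
        using r by (simp add: pw_def powr_powr powr_add[symmetric] field_simps flip: powr_half_sqrt)
      then show ?thesis by (simp add: pw_mult)
    qed
    have qval: "(LINT w|lborel. ?q w) = - c0 * r powr (\<alpha> / 2 - 2)"
    proof -
      have "(1 + \<alpha>) / 2 - 5 / 2 = \<alpha> / 2 - 2" by (simp add: field_simps)
      then show ?thesis
        using Q_scale_integral[where q=Q and p="pw \<alpha>" and \<beta>="1 + \<alpha>", OF r hom] by (simp only: c0_def) simp
    qed
    have Pint: "integrable lborel (\<lambda>x. ?q (x \<bullet> e) * ?g x)"
    proof -
      have "integrable lborel (\<lambda>x. \<bar>Psi e r \<tau> x\<bar> * \<bar>x \<bullet> e\<bar> powr (1 + \<alpha>))"
        by (rule Psi_abs_moment_integrable[OF e r tau0]) (use al in simp)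
      then have "integrable lborel (\<lambda>x. (L powr \<alpha> * L) * (\<bar>Psi e r \<tau> x\<bar> * \<bar>x \<bullet> e\<bar> powr (1 + \<alpha>)))" by (rule integrable_mult_right)
      then show ?thesis
      proof (rule Bochner_Integration.integrable_bound)
        have "\<bar>?q (x \<bullet> e) * ?g x\<bar> \<le> \<bar>(L powr \<alpha> * L) * (\<bar>Psi e r \<tau> x\<bar> * \<bar>x \<bullet> e\<bar> powr (1 + \<alpha>))\<bar>" for x
        proof -
          have "?q (x \<bullet> e) * ?g x = Psi e r \<tau> x * pw \<alpha> (x \<bullet> e) * ?S x" by (simp add: Psi_def)
          moreover have "\<bar>pw \<alpha> (x \<bullet> e)\<bar> = \<bar>x \<bullet> e\<bar> powr (1 + \<alpha>)"
            by (cases "x \<bullet> e = 0") (auto simp: pw_def abs_mult powr_add)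
          ultimately have "\<bar>?q (x \<bullet> e) * ?g x\<bar> = (\<bar>Psi e r \<tau> x\<bar> * \<bar>x \<bullet> e\<bar> powr (1 + \<alpha>)) * \<bar>?S x\<bar>" by (simp only: abs_mult)
          also have "\<dots> \<le> (\<bar>Psi e r \<tau> x\<bar> * \<bar>x \<bullet> e\<bar> powr (1 + \<alpha>)) * (L powr \<alpha> * L)" by (intro mult_left_mono SL) auto
          also have "\<dots> \<le> \<bar>(L powr \<alpha> * L) * (\<bar>Psi e r \<tau> x\<bar> * \<bar>x \<bullet> e\<bar> powr (1 + \<alpha>))\<bar>"
            by (simp only: mult.commute[of "\<bar>Psi e r \<tau> x\<bar> * \<bar>x \<bullet> e\<bar> powr (1 + \<alpha>)"] abs_ge_self)
          finally show ?thesis .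
        qed
        then show "AE x in lborel. norm (?q (x \<bullet> e) * ?g x) \<le> norm ((L powr \<alpha> * L) * (\<bar>Psi e r \<tau> x\<bar> * \<bar>x \<bullet> e\<bar> powr (1 + \<alpha>)))" by simp
      qed measurable
    qed
    have lower: "c2 \<le> (LINT x|lborel. exp (- ((x \<bullet> e)\<^sup>2)) * ?g x)"
    proof -
      have "measure lborel (box 0 (One::'a)) = 1"
        by (subst measure_lborel_box_eq) (auto simp: inner_sum_left inner_Basis)
      then have "c2 = (LINT x::'a|lborel. c2 * indicator (box 0 One) x)" by simp
      also have "\<dots> \<le> (LINT x|lborel. exp (- ((x \<bullet> e)\<^sup>2)) * ?g x)"
      proof (rule integral_mono)
        show "integrable lborel (\<lambda>x::'a. c2 * indicator (box 0 One) x)"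
          by (intro integrable_mult_right integrable_real_indicator) (auto simp: emeasure_lborel_box_eq)
        show "integrable lborel (\<lambda>x. exp (- ((x \<bullet> e)\<^sup>2)) * ?g x)" by (rule mult_g[OF gi])
        show "c2 * indicator (box 0 One) x \<le> exp (- ((x \<bullet> e)\<^sup>2)) * ?g x" for x :: 'a
        proof (cases "x \<in> box 0 One")
          case True
          have xb: "0 < x \<bullet> b \<and> x \<bullet> b < 1" if "b \<in> Basis" for b using True that by (auto simp: mem_box)
          have xb2: "(x \<bullet> b)\<^sup>2 \<le> 1" if "b \<in> Basis" for b
            using xb[OF that] by (simp add: power_le_one)
          have 1: "exp (- 1) \<le> exp (- ((x \<bullet> e)\<^sup>2))" using xb2[OF e] by simp
          have 2: "g0 \<le> Gp e \<tau> x"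
          proof -
            have "g0 = (\<Prod>b\<in>Basis - {e}. sqrt (pi / (1 + t)) * exp (- 1 / 4))" unfolding g0_def using e by simp
            also have "\<dots> \<le> Gp e \<tau> x" unfolding Gp_def
            proof (intro prod_mono conjI mult_mono)
              fix b assume b: "b \<in> Basis - {e}"
              show "sqrt (pi / (1 + t)) \<le> sqrt (pi / \<tau>)" using tau tau0 by (intro real_sqrt_le_mono divide_left_mono) auto
              have "(x \<bullet> b)\<^sup>2 / (4 * \<tau>) \<le> 1 / (4 * 1)" using b xb2[of b] tau by (intro frac_le) auto
              then show "exp (- 1 / 4) \<le> exp (- (x \<bullet> b)\<^sup>2 / (4 * \<tau>))" by simp
            qed (use t tau0 in auto)
            finally show ?thesis .
          qed
          have 3: "pw \<alpha> a0 \<le> ?S x"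
          proof -
            have "a0 \<le> slope \<rho> x" by (rule a0(2)[OF rho True])
            then have "a0 powr \<alpha> * a0 \<le> slope \<rho> x powr \<alpha> * slope \<rho> x"
              using a0(1) al by (intro mult_mono powr_mono2) auto
            then show ?thesis using a0(1) slope_nonneg[OF rho, of x] by (simp add: pw_def)
          qed
          have pa: "pw \<alpha> a0 \<ge> 0" using a0(1) by (simp add: pw_def)
          have "c2 \<le> exp (- ((x \<bullet> e)\<^sup>2)) * Gp e \<tau> x * ?S x"
            unfolding c2_def using g0 S0 pa Gp_nonneg[OF tau0, of e x] by (intro mult_mono 1 2 3) auto
          then show ?thesis using True by (simp add: mult.assoc)
        next
          case False
          then show ?thesis using S0[of x] Gp_nonneg[OF tau0, of e x] by simp
        qed
      qed
      finally show ?thesis .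
    qed
    have split: "(LINT x|lborel. ?q (x \<bullet> e) * ?g x) * sqrt pi = (LINT x|lborel. exp (- ((x \<bullet> e)\<^sup>2)) * ?g x) * (- c0 * r powr (\<alpha> / 2 - 2))"
      using lborel_integral_split_coordinate[where g="?g" and p="?q" and q="\<lambda>w. exp (- (w\<^sup>2))", OF e g_proj Pint mult_g[OF gi]]
      unfolding spi qval .
    have main: "(LINT x|lborel. ?q (x \<bullet> e) * ?g x) \<le> - c3 * r powr (\<alpha> / 2 - 2)"
    proof -
      have "c2 * (c0 * r powr (\<alpha> / 2 - 2)) \<le> (LINT x|lborel. exp (- ((x \<bullet> e)\<^sup>2)) * ?g x) * (c0 * r powr (\<alpha> / 2 - 2))"
        using c0 by (intro mult_right_mono lower) auto
      then have "(LINT x|lborel. ?q (x \<bullet> e) * ?g x) * sqrt pi \<le> - (c2 * (c0 * r powr (\<alpha> / 2 - 2)))"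
        unfolding split by simp
      then have "(LINT x|lborel. ?q (x \<bullet> e) * ?g x) \<le> - (c2 * (c0 * r powr (\<alpha> / 2 - 2))) / sqrt pi"
        by (subst pos_le_divide_eq) (auto simp only: real_sqrt_gt_zero[OF pi_gt_zero])
      then show ?thesis by (simp add: c3_def mult_ac)
    qed
    have eq: "Psi e r \<tau> z * F \<rho> z = ?q (z \<bullet> e) * ?g z + Psi e r \<tau> z * (F \<rho> z - pw \<alpha> (z \<bullet> e) * ?S z)" for z
      by (simp add: Psi_def algebra_simps)
    have ri: "integrable lborel (\<lambda>z. \<bar>Psi e r \<tau> z\<bar> * \<bar>z \<bullet> e\<bar> powr (\<alpha> + 3 / 2))"
      by (rule Psi_abs_moment_integrable[OF e r tau0]) (use al in simp)
    have rb: "\<bar>Psi e r \<tau> z * (F \<rho> z - pw \<alpha> (z \<bullet> e) * ?S z)\<bar> \<le> K * (\<bar>Psi e r \<tau> z\<bar> * \<bar>z \<bullet> e\<bar> powr (\<alpha> + 3 / 2))" for z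
      using mult_left_mono[OF KL(2)[OF rho, of z], of "\<bar>Psi e r \<tau> z\<bar>"] by (simp add: abs_mult mult_ac)
    have rint: "integrable lborel (\<lambda>z. Psi e r \<tau> z * (F \<rho> z - pw \<alpha> (z \<bullet> e) * ?S z))"
    proof (rule Bochner_Integration.integrable_bound[OF integrable_mult_right[OF ri, of K]])
      show "AE z in lborel. norm (Psi e r \<tau> z * (F \<rho> z - pw \<alpha> (z \<bullet> e) * ?S z)) \<le> norm (K * (\<bar>Psi e r \<tau> z\<bar> * \<bar>z \<bullet> e\<bar> powr (\<alpha> + 3 / 2)))"
        unfolding real_norm_def by (intro AE_I2 order_trans[OF rb abs_ge_self])
    qed measurable
    have rest: "(LINT z|lborel. Psi e r \<tau> z * (F \<rho> z - pw \<alpha> (z \<bullet> e) * ?S z)) \<le> K * qK * r powr (\<alpha> / 2 - 7 / 4)"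
    proof -
      have "(LINT z|lborel. Psi e r \<tau> z * (F \<rho> z - pw \<alpha> (z \<bullet> e) * ?S z)) \<le> (LINT z|lborel. K * (\<bar>Psi e r \<tau> z\<bar> * \<bar>z \<bullet> e\<bar> powr (\<alpha> + 3 / 2)))"
        by (intro integral_mono rint integrable_mult_right ri order_trans[OF abs_ge_self rb])
      also have "\<dots> = K * (qK * r powr ((\<alpha> + 3 / 2) / 2 - 5 / 2))"
        unfolding integral_mult_right_zero qK_def using al by (subst Psi_abs_moment[OF e r tau0]) auto
      also have "(\<alpha> + 3 / 2) / 2 - 5 / 2 = \<alpha> / 2 - 7 / 4" by (simp add: field_simps)
      finally show ?thesis by (simp add: mult.assoc)
    qed
    have "(LINT z|lborel. Psi e r \<tau> z * F \<rho> z) = (LINT x|lborel. ?q (x \<bullet> e) * ?g x) + (LINT z|lborel. Psi e r \<tau> z * (F \<rho> z - pw \<alpha> (z \<bullet> e) * ?S z))"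
      unfolding eq by (rule Bochner_Integration.integral_add[OF Pint rint])
    then show ?thesis using main rest by linarith
  qed
  define r0 where "r0 = min 1 ((c3 / (2 * (K * qK + 1))) ^ 4)"
  have Kq: "K * qK + 1 > 0" using K0 qK by (simp add: add_nonneg_pos)
  have r0: "r0 > 0" unfolding r0_def using c3 Kq by simp
  have "(LINT z|lborel. Psi e r \<tau> z * F \<rho> z) \<le> - (c3 / 2) / r"
    if r: "0 < r" "r \<le> r0" and tau: "1 \<le> \<tau>" "\<tau> \<le> 1 + t" and rho: "t / 2 \<le> \<rho>" "\<rho> \<le> t" for r \<tau> \<rho>
  proof -
    have r1: "r \<le> 1" using r by (simp add: r0_def)
    have "r powr (1 / 4) \<le> ((c3 / (2 * (K * qK + 1))) ^ 4) powr (1 / 4)"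
      using r by (intro powr_mono2) (auto simp: r0_def)
    also have "\<dots> = c3 / (2 * (K * qK + 1))"
    proof -
      have "(p ^ 4) powr (1 / 4) = p" if "p > 0" for p :: real
        by (subst powr_realpow[OF that, symmetric], subst powr_powr) (use that in simp)
      then show ?thesis using c3 Kq by simp
    qed
    finally have "(K * qK + 1) * r powr (1 / 4) \<le> c3 / 2" using Kq by (simp add: field_simps)
    moreover have "K * qK * r powr (1 / 4) \<le> (K * qK + 1) * r powr (1 / 4)" by (intro mult_right_mono) auto
    ultimately have small: "K * qK * r powr (1 / 4) \<le> c3 / 2" by linarith
    have "r powr (\<alpha> / 2 - 7 / 4) = r powr (1 / 4) * r powr (\<alpha> / 2 - 2)" by (simp flip: powr_add)
    then have "K * qK * r powr (\<alpha> / 2 - 7 / 4) = (K * qK * r powr (1 / 4)) * r powr (\<alpha> / 2 - 2)" by simp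
    also have "\<dots> \<le> (c3 / 2) * r powr (\<alpha> / 2 - 2)" by (intro mult_right_mono small) auto
    finally have "(LINT z|lborel. Psi e r \<tau> z * F \<rho> z) \<le> - (c3 / 2) * r powr (\<alpha> / 2 - 2)"
      using key[OF r(1) tau rho] by (simp add: algebra_simps)
    also have "\<dots> \<le> - (c3 / 2) * r powr (- 1)"
    proof -
      have "r powr (- 1) \<le> r powr (\<alpha> / 2 - 2)" using r r1 al2 by (intro powr_mono') auto
      then have "c3 / 2 * r powr (- 1) \<le> c3 / 2 * r powr (\<alpha> / 2 - 2)" using c3 by (intro mult_left_mono) auto
      then show ?thesis by linarith
    qed
    finally show ?thesis using r by (simp add: powr_minus_divide)
  qed
  then show ?thesis using c3 r0 by (intro exI[of _ "c3 / 2"] conjI exI[of _ r0]) auto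
qed

lemma Psi_pairing_unbounded:
  assumes box_pos: "\<And>y. y \<in> box 0 One \<Longrightarrow> U0 y > 0" and al2: "\<alpha> < 2"
    and B: "\<And>\<epsilon>. 0 < \<epsilon> \<Longrightarrow> \<bar>LINT y|lborel. Psi e \<epsilon> 1 y * U t y\<bar> \<le> B"
  shows False
proof -
  obtain c r0 where c: "c > 0" and r0: "r0 > 0"
    and up: "\<And>r \<tau> \<rho>. 0 < r \<Longrightarrow> r \<le> r0 \<Longrightarrow> 1 \<le> \<tau> \<Longrightarrow> \<tau> \<le> 1 + t \<Longrightarrow> t / 2 \<le> \<rho> \<Longrightarrow> \<rho> \<le> t \<Longrightarrow>
      (LINT z|lborel. Psi e r \<tau> z * F \<rho> z) \<le> - c / r"
    using Psi_F_upper[OF box_pos al2] by blast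
  define K6 where "K6 = (2 * pi) ^ (DIM('a) - 1) * (LINT w|lborel. \<bar>Q w\<bar>)"
  have K6: "K6 \<ge> 0" unfolding K6_def by (intro mult_nonneg_nonneg integral_nonneg_AE) auto
  have Pb: "\<bar>LINT z|lborel. Psi e r \<tau> z * w z\<bar> \<le> K6 * r powr (- 5 / 2) * D"
    if r: "r > 0" and tau: "\<tau> > 0" and w: "\<And>z. \<bar>w z\<bar> \<le> D" for r \<tau> w D
  proof (rule kernel_conv_bound[OF Psi_measurable _ _ w])
    have "(\<integral>\<^sup>+y. ennreal \<bar>Psi e r \<tau> y\<bar> \<partial>lborel) = ennreal (LINT y|lborel. \<bar>Psi e r \<tau> y\<bar>)"
      by (intro nn_integral_eq_integral integrable_abs Psi_integrable e r tau) auto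
    then show "(\<integral>\<^sup>+y. ennreal \<bar>Psi e r \<tau> y\<bar> \<partial>lborel) \<le> ennreal (K6 * r powr (- 5 / 2))"
      unfolding Psi_abs_integral[OF e r tau] K6_def by simp
  qed (use K6 in auto)
  let ?D = "M powr \<alpha> * M"
  define \<eta> where "\<eta> = min (r0 / 2) (t / 2)"
  have eta: "\<eta> > 0" "\<eta> \<le> r0 / 2" "\<eta> \<le> t / 2" using r0 t by (auto simp: \<eta>_def)
  define B1 where "B1 = K6 * \<eta> powr (- 5 / 2) * ?D"
  have B1: "B1 \<ge> 0" using K6 M_nonneg by (simp add: B1_def)
  define B2 where "B2 = M * K6 * t powr (- 5 / 2) + lam * (B1 * t)"
  have main: "lam * c * ln ((\<epsilon> + \<eta>) / \<epsilon>) \<le> B + B2" if eps: "0 < \<epsilon>" "\<epsilon> \<le> r0 / 2" for \<epsilon>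
  proof -
    let ?J = "\<lambda>\<rho>. LINT z|lborel. hkconv (Psi e \<epsilon> 1) (t - \<rho>) z * F \<rho> z"
    have Jeq: "?J \<rho> = (LINT z|lborel. Psi e (\<epsilon> + (t - \<rho>)) (1 + (t - \<rho>)) z * F \<rho> z)" if "\<rho> < t" for \<rho>
      using that eps by (subst hkconv_Psi[OF e]) auto
    note P = pairing[OF Psi_integrable[OF e eps(1) zero_less_one] t order_refl]
    let ?h = "\<lambda>\<rho>. B1 * indicator {0..t} \<rho> - c * (indicator {t - \<eta>..t} \<rho> *\<^sub>R (1 / (\<epsilon> + t - \<rho>)))"
    have cont: "continuous_on {t - \<eta>..t} (\<lambda>\<rho>. 1 / (\<epsilon> + t - \<rho>))" using eps by (auto intro!: continuous_intros)
    have i1: "integrable lborel (\<lambda>\<rho>. indicator {t - \<eta>..t} \<rho> *\<^sub>R (1 / (\<epsilon> + t - \<rho>)))"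
      using borel_integrable_atLeastAtMost'[OF cont] by (simp add: set_integrable_def)
    have i2: "integrable lborel (indicator {0..t} :: real \<Rightarrow> real)"
      by (rule integrable_real_indicator) (auto simp: emeasure_lborel_Icc_eq)
    have "(LINT \<rho>|lborel. ?J \<rho>) \<le> (LINT \<rho>|lborel. ?h \<rho>)"
    proof (rule integral_mono_AE)
      show "integrable lborel ?J" by (rule P(2))
      show "integrable lborel ?h" by (intro Bochner_Integration.integrable_diff integrable_mult_right i1 i2)
      show "AE \<rho> in lborel. ?J \<rho> \<le> ?h \<rho>"
        using AE_lborel_singleton[of t]
      proof eventually_elim
        case (elim \<rho>)
        consider "\<rho> < 0" | "\<rho> > t" | "0 \<le> \<rho>" "\<rho> < t - \<eta>" | "t - \<eta> \<le> \<rho>" "\<rho> < t" using elim by linarith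
        then show ?case
        proof cases
          case 1 then show ?thesis using eta by (simp add: F_supp)
        next
          case 2 then show ?thesis by (simp add: F_supp)
        next
          case 3
          have rho_t: "\<rho> < t" using 3 eta by linarith
          have "?J \<rho> \<le> K6 * (\<epsilon> + (t - \<rho>)) powr (- 5 / 2) * ?D"
            unfolding Jeq[OF rho_t] using 3 eps eta
            by (intro order_trans[OF abs_ge_self Pb]) (auto simp: F_bound)
          also have "\<dots> \<le> B1" unfolding B1_def
            using 3 eps eta K6 M_nonneg by (intro mult_right_mono mult_left_mono powr_mono2') auto
          finally show ?thesis using 3 eta by simp
        next
          case 4
          have "?J \<rho> \<le> - c / (\<epsilon> + (t - \<rho>))"
            unfolding Jeq[OF 4(2)] using 4 eps eta t by (intro up) auto
          then show ?thesis using 4 B1 eta t by (simp add: add_diff_eq)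
        qed
      qed
    qed
    also have "(LINT \<rho>|lborel. ?h \<rho>) = B1 * t - c * ln ((\<epsilon> + \<eta>) / \<epsilon>)"
    proof -
      have "(LINT \<rho>|lborel. indicator {t - \<eta>..t} \<rho> *\<^sub>R (1 / (\<epsilon> + t - \<rho>))) = - ln (\<epsilon> + t - t) - (- ln (\<epsilon> + t - (t - \<eta>)))"
      proof (rule integral_FTC_atLeastAtMost[OF _ _ cont])
        have "((\<lambda>\<rho>. - ln (\<epsilon> + t - \<rho>)) has_real_derivative 1 / (\<epsilon> + t - \<rho>)) (at \<rho> within {t - \<eta>..t})" if "\<rho> \<le> t" for \<rho>
          using that eps by (auto intro!: derivative_eq_intros simp: field_simps)
        then show "((\<lambda>\<rho>. - ln (\<epsilon> + t - \<rho>)) has_vector_derivative 1 / (\<epsilon> + t - \<rho>)) (at \<rho> within {t - \<eta>..t})" if "\<rho> \<le> t" for \<rho>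
          using that by (simp only: has_real_derivative_iff_has_vector_derivative)
      qed (use eta in auto)
      also have "\<dots> = ln ((\<epsilon> + \<eta>) / \<epsilon>)" using eps eta by (simp add: ln_div)
      finally have L: "(LINT \<rho>|lborel. indicator {t - \<eta>..t} \<rho> *\<^sub>R (1 / (\<epsilon> + t - \<rho>))) = ln ((\<epsilon> + \<eta>) / \<epsilon>)" .
      have I: "(LINT \<rho>|lborel. indicator {0..t} \<rho>) = t" using t by simp
      show ?thesis
        unfolding Bochner_Integration.integral_diff[OF integrable_mult_right[OF i2] integrable_mult_right[OF i1]] integral_mult_right_zero L I ..
    qed
    finally have J: "(LINT \<rho>|lborel. ?J \<rho>) \<le> B1 * t - c * ln ((\<epsilon> + \<eta>) / \<epsilon>)" .
    have "(LINT z|lborel. hkconv (Psi e \<epsilon> 1) t z * U0 z) \<le> K6 * (\<epsilon> + t) powr (- 5 / 2) * M"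
    proof -
      have "hkconv (Psi e \<epsilon> 1) t = Psi e (\<epsilon> + t) (1 + t)" using eps t by (intro ext hkconv_Psi[OF e]) auto
      then show ?thesis using eps t by (simp only:) (intro order_trans[OF abs_ge_self Pb] U0_bound, auto)
    qed
    also have "\<dots> \<le> K6 * t powr (- 5 / 2) * M"
      using K6 M_nonneg eps t by (intro mult_right_mono mult_left_mono powr_mono2') auto
    finally have U0: "(LINT z|lborel. hkconv (Psi e \<epsilon> 1) t z * U0 z) \<le> M * K6 * t powr (- 5 / 2)" by (simp add: mult_ac)
    have "- B \<le> (LINT y|lborel. Psi e \<epsilon> 1 y * U t y)" using B[OF eps(1)] by linarith
    also have "\<dots> \<le> M * K6 * t powr (- 5 / 2) + lam * (B1 * t - c * ln ((\<epsilon> + \<eta>) / \<epsilon>))"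
      unfolding P(1) using lam by (intro add_mono U0 mult_left_mono J) auto
    finally show ?thesis by (simp add: B2_def algebra_simps)
  qed
  define X where "X = max (ln (2 * \<eta> / r0)) ((B + B2 + 1) / (lam * c))"
  define \<epsilon> where "\<epsilon> = \<eta> * exp (- X)"
  have eps0: "\<epsilon> > 0" using eta by (simp add: \<epsilon>_def)
  have "\<epsilon> \<le> \<eta> * exp (- ln (2 * \<eta> / r0))" unfolding \<epsilon>_def using eta by (intro mult_left_mono) (auto simp: X_def)
  also have "\<dots> = r0 / 2" using eta r0 by (simp add: exp_minus)
  finally have eps1: "\<epsilon> \<le> r0 / 2" .
  have "\<eta> = \<epsilon> * exp X" by (simp add: \<epsilon>_def mult.assoc flip: exp_add)
  then have "\<eta> / \<epsilon> = exp X" using eps0 by simp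
  then have "X = ln (\<eta> / \<epsilon>)" by simp
  also have "\<dots> \<le> ln ((\<epsilon> + \<eta>) / \<epsilon>)" using eta eps0 by (intro ln_mono divide_right_mono divide_pos_pos add_pos_pos) auto
  finally have "lam * c * X \<le> lam * c * ln ((\<epsilon> + \<eta>) / \<epsilon>)" using lam c by (intro mult_left_mono) auto
  also have "\<dots> \<le> B + B2" by (rule main[OF eps0 eps1])
  finally have "lam * c * X \<le> B + B2" .
  moreover have "B + B2 + 1 \<le> lam * c * X"
  proof -
    have "(B + B2 + 1) / (lam * c) \<le> X" by (simp add: X_def)
    then show ?thesis using lam c by (simp add: pos_divide_le_eq mult_ac)
  qed
  ultimately show False by linarith
qed

end

subsection \<open>Boundedness for Sobolev regular solutions\<close>

lemma one_plus_sq_powr_integrable: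
  assumes p: "p < - 1 / 2"
  shows "integrable lborel (\<lambda>x::real. (1 + x\<^sup>2) powr p)"
proof -
  let ?q = "2 * p + 1"
  have q: "?q < 0" using p by simp
  let ?g = "\<lambda>x::real. indicator {1..} x * x powr (2 * p)"
  have "(\<integral>\<^sup>+x. ennreal (x powr (2 * p)) * indicator {1..} x \<partial>lborel) = ennreal (0 - 1 powr ?q / ?q)"
  proof (rule nn_integral_FTC_atLeast[where F="\<lambda>x. x powr ?q / ?q"])
    show "((\<lambda>x. x powr ?q / ?q) has_real_derivative x powr (2 * p)) (at x)" if "1 \<le> x" for x
      using that q by (auto intro!: derivative_eq_intros)
    have "((\<lambda>x. x powr ?q / ?q) \<longlongrightarrow> 0 / ?q) at_top"
      by (intro tendsto_intros tendsto_neg_powr q filterlim_ident) (use q in auto)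
    then show "((\<lambda>x. x powr ?q / ?q) \<longlongrightarrow> 0) at_top" by simp
  qed auto
  then have "(\<integral>\<^sup>+x. ennreal (norm (?g x)) \<partial>lborel) < \<infinity>"
    by (simp add: ennreal_mult' ennreal_indicator[symmetric] abs_mult mult.commute)
  then have g: "integrable lborel ?g" by (intro integrableI_bounded) auto
  have g': "integrable lborel (\<lambda>x. ?g (- x))"
    using lborel_integrable_real_affine[OF g, of "-1" 0] by simp
  have i: "integrable lborel (indicator {- 1..1} :: real \<Rightarrow> real)"
    by (rule integrable_real_indicator) (auto simp: emeasure_lborel_Icc_eq)
  show ?thesis
  proof (rule Bochner_Integration.integrable_bound[OF Bochner_Integration.integrable_add[OF i Bochner_Integration.integrable_add[OF g g']]])
    have "(1 + x\<^sup>2) powr p \<le> indicator {- 1..1} x + (?g x + ?g (- x))" for x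
    proof (cases "\<bar>x\<bar> \<le> 1")
      case True
      have "(1 + x\<^sup>2) powr p \<le> 1 powr p" using p by (intro powr_mono2') auto
      moreover have "?g x + ?g (- x) \<ge> 0" by (intro add_nonneg_nonneg mult_nonneg_nonneg) auto
      moreover have "indicator {- 1..1} x = (1::real)" using True by (auto simp: indicator_def)
      ultimately show ?thesis unfolding powr_one_eq_one by linarith
    next
      case False
      have "(1 + x\<^sup>2) powr p \<le> (\<bar>x\<bar> powr 2) powr p" using p False by (intro powr_mono2') auto
      also have "\<dots> = \<bar>x\<bar> powr (2 * p)" by (simp only: powr_powr)
      also have "\<dots> \<le> indicator {- 1..1} x + (?g x + ?g (- x))" using False by (auto simp: indicator_def)
      finally show ?thesis .
    qed
    then show "AE x in lborel. norm ((1 + x\<^sup>2) powr p) \<le> norm (indicator {- 1..1} x + (?g x + ?g (- x)))"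
      by (intro AE_I2 order_trans[OF _ abs_ge_self, folded real_norm_def]) simp
  qed measurable
qed

lemma hPsi_sq_integrable:
  "r > 0 \<Longrightarrow> \<tau> > 0 \<Longrightarrow> integrable lborel (\<lambda>\<xi>. (hPsi e r \<tau> \<xi>)\<^sup>2)"
proof -
  assume r: "r > 0" "\<tau> > 0"
  let ?k = "\<lambda>b w. if b = e then w ^ 10 * exp (- (2 * r) * w\<^sup>2) else exp (- (2 * \<tau>) * w\<^sup>2)"
  have i: "integrable lborel (?k b)" for b
    using gauss_power_integrable[of "2 * r" 10] gauss_integrable[of "2 * \<tau>"] r by (cases "b = e") auto
  have "(exp (- a * w\<^sup>2))\<^sup>2 = exp (- (2 * a) * w\<^sup>2)" for a w :: real
    unfolding power2_eq_square exp_add[symmetric] by (simp add: algebra_simps)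
  then have "(hPsi e r \<tau> \<xi>)\<^sup>2 = (\<Prod>b\<in>Basis. ?k b (\<xi> \<bullet> b))" for \<xi>
    unfolding hPsi_def prod_power_distrib by (intro prod.cong) (auto simp: power_mult_distrib simp flip: power_mult)
  then show ?thesis using integrable_lborel_prod[OF i] by simp
qed

lemma hPsi_sq_le:
  assumes e: "e \<in> Basis" and r: "r > 0" and s: "s \<ge> 0"
  shows "(hPsi e r 1 \<xi>)\<^sup>2 \<le> (1 + (norm \<xi>)\<^sup>2) powr s *
    (\<Prod>b\<in>Basis. if b = e then (1 + (\<xi> \<bullet> b)\<^sup>2) powr (5 - s) else exp (- (\<xi> \<bullet> b)\<^sup>2))"
proof -
  let ?w = "\<xi> \<bullet> e" and ?P = "\<Prod>b\<in>Basis - {e}. exp (- (\<xi> \<bullet> b)\<^sup>2)"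
  have P0: "?P > 0" by (intro prod_pos) auto
  have P1: "?P \<le> 1" by (intro prod_le_1) auto
  have h: "hPsi e r 1 \<xi> = ?w ^ 5 * exp (- r * ?w\<^sup>2) * ?P"
    unfolding hPsi_def by (subst prod.remove[OF _ e]) (auto intro!: prod.cong)
  have E: "(\<Prod>b\<in>Basis. if b = e then (1 + (\<xi> \<bullet> b)\<^sup>2) powr (5 - s) else exp (- (\<xi> \<bullet> b)\<^sup>2)) = (1 + ?w\<^sup>2) powr (5 - s) * ?P"
    by (subst prod.remove[OF _ e]) (auto intro!: prod.cong)
  have "(exp (- r * ?w\<^sup>2))\<^sup>2 \<le> 1\<^sup>2" using r by (intro power_mono) auto
  then have e1: "(exp (- r * ?w\<^sup>2))\<^sup>2 \<le> 1" by simp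
  have P2: "?P\<^sup>2 \<le> ?P" using P0 P1 by (simp add: power2_eq_square)
  have "(?w ^ 5)\<^sup>2 = (?w\<^sup>2) ^ 5" by (simp flip: power_mult)
  also have "\<dots> \<le> (1 + ?w\<^sup>2) ^ 5" by (intro power_mono) auto
  also have "\<dots> = (1 + ?w\<^sup>2) powr 5" by (subst powr_realpow[symmetric]) (auto simp: add_pos_nonneg)
  also have "\<dots> = (1 + ?w\<^sup>2) powr s * (1 + ?w\<^sup>2) powr (5 - s)" by (simp flip: powr_add)
  also have "\<dots> \<le> (1 + (norm \<xi>)\<^sup>2) powr s * (1 + ?w\<^sup>2) powr (5 - s)"
  proof (intro mult_right_mono powr_mono2)
    show "1 + ?w\<^sup>2 \<le> 1 + (norm \<xi>)\<^sup>2"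
      using Basis_le_norm[OF e, of \<xi>] by (simp add: abs_le_square_iff[symmetric])
  qed (use s in auto)
  finally have "(?w ^ 5)\<^sup>2 * (exp (- r * ?w\<^sup>2))\<^sup>2 * ?P\<^sup>2 \<le> ((1 + (norm \<xi>)\<^sup>2) powr s * (1 + ?w\<^sup>2) powr (5 - s)) * 1 * ?P"
    using P0 by (intro mult_mono e1 P2) auto
  then show ?thesis unfolding h E by (simp add: power_mult_distrib mult.assoc)
qed

lemma truncated_fourier_hPsi:
  fixes u :: "'a::euclidean_space \<Rightarrow> complex"
  assumes e: "e \<in> Basis" and r: "r > 0" and u: "u \<in> borel_measurable borel" and ub: "\<And>x. cmod (u x) \<le> M"
  shows "(LINT \<xi>|lborel. (LINT x:cball 0 R|lborel. cis (- (x \<bullet> \<xi>)) * u x) * of_real (hPsi e r 1 \<xi>)) =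
    (LINT x|lborel. indicator (cball 0 R) x *\<^sub>R (u x * (- \<i> * of_real (Psi e r 1 x))))"
proof -
  note [measurable] = u
  have [measurable]: "cball (0::'a) R \<in> sets borel" by simp
  let ?f = "\<lambda>x. indicator (cball 0 R) x *\<^sub>R u x"
  let ?h = "\<lambda>\<xi>. complex_of_real (hPsi e r 1 \<xi>)"
  have f: "integrable lborel ?f"
  proof (rule Bochner_Integration.integrable_bound[where f="\<lambda>x::'a. M * indicator (cball 0 R) x"])
    show "integrable lborel (\<lambda>x::'a. M * indicator (cball 0 R) x)"
      by (intro integrable_mult_right integrable_real_indicator) (auto simp: emeasure_lborel_cball_finite[unfolded infinity_ennreal_def])
    have "norm (?f x) \<le> norm (M * indicator (cball 0 R) x)" for x
      using ub[of x] by (auto simp: indicator_def)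
    then show "AE x in lborel. norm (?f x) \<le> norm (M * indicator (cball 0 R) x)" by simp
  qed measurable
  have h: "integrable lborel ?h" using hPsi_integrable[OF r, of 1 e] by simp
  have k: "integrable (lborel \<Otimes>\<^sub>M lborel) (\<lambda>(x, \<xi>). cis (- (x \<bullet> \<xi>)) * (?f x * ?h \<xi>))"
    by (rule Bochner_Integration.integrable_bound[OF integrable_pair_mult[OF f h]]) (auto simp: norm_mult)
  have "(LINT \<xi>|lborel. (LINT x:cball 0 R|lborel. cis (- (x \<bullet> \<xi>)) * u x) * ?h \<xi>) =
      (LINT \<xi>|lborel. LINT x|lborel. cis (- (x \<bullet> \<xi>)) * (?f x * ?h \<xi>))"
  proof (intro Bochner_Integration.integral_cong refl)
    fix \<xi>
    have "(LINT x:cball 0 R|lborel. cis (- (x \<bullet> \<xi>)) * u x) * ?h \<xi> = (LINT x|lborel. indicator (cball 0 R) x *\<^sub>R (cis (- (x \<bullet> \<xi>)) * u x) * ?h \<xi>)"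
      unfolding set_lebesgue_integral_def by (rule integral_mult_left_zero[symmetric])
    then show "(LINT x:cball 0 R|lborel. cis (- (x \<bullet> \<xi>)) * u x) * ?h \<xi> = (LINT x|lborel. cis (- (x \<bullet> \<xi>)) * (?f x * ?h \<xi>))"
      by (simp add: mult.assoc)
  qed
  also have "\<dots> = (LINT x|lborel. LINT \<xi>|lborel. cis (- (x \<bullet> \<xi>)) * (?f x * ?h \<xi>))"
    by (rule lborel_pair.Fubini_integral[OF k])
  also have "\<dots> = (LINT x|lborel. indicator (cball 0 R) x *\<^sub>R (u x * (- \<i> * of_real (Psi e r 1 x))))"
  proof (intro Bochner_Integration.integral_cong refl)
    fix x
    have "(LINT \<xi>|lborel. cis (- (x \<bullet> \<xi>)) * (?f x * ?h \<xi>)) = (LINT \<xi>|lborel. ?f x * (cis (- (x \<bullet> \<xi>)) * ?h \<xi>))"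
      by (simp only: mult_ac)
    also have "\<dots> = ?f x * (- \<i> * of_real (Psi e r 1 x))"
      unfolding integral_mult_right_zero Psi_fourier[OF e r zero_less_one] ..
    finally show "(LINT \<xi>|lborel. cis (- (x \<bullet> \<xi>)) * (?f x * ?h \<xi>)) = indicator (cball 0 R) x *\<^sub>R (u x * (- \<i> * of_real (Psi e r 1 x)))"
      by simp
  qed
  finally show ?thesis .
qed

lemma Hs_Psi_pairing_bounded:
  fixes u :: "(real^'n) \<Rightarrow> complex"
  assumes u: "u \<in> Hs s" and s: "s > 11 / 2" and ub: "\<And>x. cmod (u x) \<le> M" and e: "e \<in> Basis"
  shows "\<exists>B. \<forall>r>0. cmod (LINT x|lborel. u x * of_real (Psi e r 1 x)) \<le> B"
proof -
  obtain uh where F: "is_fourier u uh"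
    and W: "(\<lambda>\<xi>. complex_of_real ((1 + (norm \<xi>)\<^sup>2) powr (s / 2)) * uh \<xi>) \<in> L2"
    using u unfolding Hs_def bessel_potential_def is_inverse_fourier_def by blast
  let ?W = "\<lambda>\<xi>. complex_of_real ((1 + (norm \<xi>)\<^sup>2) powr (s / 2)) * uh \<xi>"
  have um [measurable]: "u \<in> borel_measurable borel" and [measurable]: "uh \<in> borel_measurable borel"
    using F by (auto simp: is_fourier_def L2_def)
  have [measurable]: "cball (0::real^'n) R \<in> sets borel" for R by simp
  define D where "D R \<xi> = (LINT x:cball 0 R|lborel. cis (- (x \<bullet> \<xi>)) * u x) - uh \<xi>" for R \<xi>
  have D_meas [measurable]: "D R \<in> borel_measurable borel" for R
    unfolding D_def[abs_def] set_lebesgue_integral_def by measurable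
  have lim: "((\<lambda>R. \<integral>\<^sup>+\<xi>. ennreal ((cmod (D R \<xi>))\<^sup>2) \<partial>lborel) \<longlongrightarrow> 0) at_top"
    using F by (simp add: is_fourier_def L2_lim_def D_def)
  let ?E = "\<lambda>\<xi>. \<Prod>b\<in>Basis. if b = e then (1 + (\<xi> \<bullet> b)\<^sup>2) powr (5 - s) else exp (- (\<xi> \<bullet> b)\<^sup>2)"
  have Ei: "integrable lborel (?E :: real^'n \<Rightarrow> real)"
  proof -
    have "integrable lborel (\<lambda>w. if b = e then (1 + w\<^sup>2) powr (5 - s) else exp (- w\<^sup>2))" for b
      using one_plus_sq_powr_integrable[of "5 - s"] gauss_integrable[of 1] s by (cases "b = e") auto
    then show ?thesis by (rule integrable_lborel_prod)
  qed
  have E0: "?E \<xi> \<ge> 0" for \<xi> by (intro prod_nonneg) auto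
  have Wi: "integrable lborel (\<lambda>\<xi>. (cmod (?W \<xi>))\<^sup>2)" using W by (simp only: L2_def mem_Collect_eq)
  define B0 where "B0 = (LINT \<xi>|lborel. (cmod (?W \<xi>))\<^sup>2 + ?E \<xi>)"
  have B0: "B0 \<ge> 0" unfolding B0_def using E0 by (intro integral_nonneg_AE) auto
  have "cmod (LINT x|lborel. u x * of_real (Psi e r 1 x)) \<le> B0 + 2" if r: "r > 0" for r
  proof -
    let ?h = "hPsi e r 1"
    let ?I = "\<lambda>R. LINT x|lborel. indicator (cball 0 R) x *\<^sub>R (u x * (- \<i> * of_real (Psi e r 1 x)))"
    define H where "H = (LINT \<xi>|lborel. (?h \<xi>)\<^sup>2)"
    have H0: "H \<ge> 0" unfolding H_def by (intro integral_nonneg_AE) auto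
    have Hi: "integrable lborel (\<lambda>\<xi>. (?h \<xi>)\<^sup>2)" using r by (intro hPsi_sq_integrable) auto
    have pt: "cmod ((D R \<xi> + uh \<xi>) * of_real (?h \<xi>)) \<le>
      ((cmod (?W \<xi>))\<^sup>2 + ?E \<xi>) + ((H + 1) * (cmod (D R \<xi>))\<^sup>2 + 1 / (H + 1) * (?h \<xi>)\<^sup>2)" for R \<xi>
    proof -
      have amgm: "a * b \<le> k * a\<^sup>2 + 1 / k * b\<^sup>2" if "k > 0" "a \<ge> 0" "b \<ge> 0" for a b k :: real
      proof -
        have "2 * (a * b) \<le> k * a\<^sup>2 + 1 / k * b\<^sup>2"
          using that zero_le_power2[of "k * a - b"] by (simp add: field_simps power2_eq_square)
        moreover have "a * b \<ge> 0" using that by simp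
        ultimately show ?thesis by linarith
      qed
      have d: "cmod (D R \<xi>) * \<bar>?h \<xi>\<bar> \<le> (H + 1) * (cmod (D R \<xi>))\<^sup>2 + 1 / (H + 1) * (?h \<xi>)\<^sup>2"
        using amgm[of "H + 1" "cmod (D R \<xi>)" "\<bar>?h \<xi>\<bar>"] H0 by simp
      have n: "1 + (norm \<xi>)\<^sup>2 > 0" by (simp add: add_pos_nonneg)
      let ?p = "(1 + (norm \<xi>)\<^sup>2) powr (s / 2)"
      have p: "?p > 0" using n by simp
      have p2: "?p\<^sup>2 = (1 + (norm \<xi>)\<^sup>2) powr s" by (simp add: power2_eq_square flip: powr_add)
      have "cmod (uh \<xi>) * \<bar>?h \<xi>\<bar> = cmod (?W \<xi>) * (\<bar>?h \<xi>\<bar> / ?p)"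
        using p by (simp add: norm_mult)
      also have "\<dots> \<le> (cmod (?W \<xi>))\<^sup>2 + (\<bar>?h \<xi>\<bar> / ?p)\<^sup>2"
        using amgm[of 1 "cmod (?W \<xi>)" "\<bar>?h \<xi>\<bar> / ?p"] p by simp
      also have "(\<bar>?h \<xi>\<bar> / ?p)\<^sup>2 \<le> ?E \<xi>"
      proof -
        have "(?h \<xi>)\<^sup>2 \<le> ?p\<^sup>2 * ?E \<xi>" unfolding p2 by (rule hPsi_sq_le[OF e r]) (use s in simp)
        then show ?thesis using p by (simp add: power_divide pos_divide_le_eq mult.commute)
      qed
      finally have w: "cmod (uh \<xi>) * \<bar>?h \<xi>\<bar> \<le> (cmod (?W \<xi>))\<^sup>2 + ?E \<xi>" by simp
      have "cmod ((D R \<xi> + uh \<xi>) * of_real (?h \<xi>)) \<le> (cmod (D R \<xi>) + cmod (uh \<xi>)) * \<bar>?h \<xi>\<bar>"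
        unfolding norm_mult norm_of_real by (intro mult_right_mono norm_triangle_ineq) auto
      then show ?thesis using d w by (simp add: algebra_simps)
    qed
    have IR: "cmod (?I R) \<le> B0 + 2" if small: "(\<integral>\<^sup>+\<xi>. ennreal ((cmod (D R \<xi>))\<^sup>2) \<partial>lborel) < ennreal (1 / (H + 1))" for R
    proof -
      have Dm: "(\<lambda>\<xi>. (cmod (D R \<xi>))\<^sup>2) \<in> borel_measurable lborel" by measurable
      have fin: "(\<integral>\<^sup>+\<xi>. ennreal ((cmod (D R \<xi>))\<^sup>2) \<partial>lborel) < \<infinity>" using small by (rule order_less_trans) simp
      have Di: "integrable lborel (\<lambda>\<xi>. (cmod (D R \<xi>))\<^sup>2)"
        by (rule integrableI_nonneg[OF Dm _ fin]) simp
      have "ennreal (LINT \<xi>|lborel. (cmod (D R \<xi>))\<^sup>2) < ennreal (1 / (H + 1))"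
        using small by (subst (asm) nn_integral_eq_integral[OF Di]) auto
      then have "(LINT \<xi>|lborel. (cmod (D R \<xi>))\<^sup>2) \<le> 1 / (H + 1)"
        by (subst (asm) ennreal_less_iff) auto
      then have "(H + 1) * (LINT \<xi>|lborel. (cmod (D R \<xi>))\<^sup>2) \<le> (H + 1) * (1 / (H + 1))"
        using H0 by (intro mult_left_mono) auto
      also have "\<dots> = 1" using H0 by simp
      finally have DH: "(H + 1) * (LINT \<xi>|lborel. (cmod (D R \<xi>))\<^sup>2) \<le> 1" .
      have HH: "1 / (H + 1) * H \<le> 1" using H0 by (simp add: field_simps)
      note i1 = Bochner_Integration.integrable_add[OF Wi Ei]
        and i2 = integrable_mult_right[OF Di, of "H + 1"]
        and i3 = integrable_mult_right[OF Hi, of "1 / (H + 1)"]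
      have "?I R = (LINT \<xi>|lborel. (D R \<xi> + uh \<xi>) * of_real (?h \<xi>))"
        using truncated_fourier_hPsi[OF e r um ub, of R] by (simp add: D_def)
      then have "ennreal (cmod (?I R)) \<le> (\<integral>\<^sup>+\<xi>. ennreal (cmod ((D R \<xi> + uh \<xi>) * of_real (?h \<xi>))) \<partial>lborel)"
        by (simp only: ennreal_norm_integral_le)
      also have "\<dots> \<le> (\<integral>\<^sup>+\<xi>. ennreal (((cmod (?W \<xi>))\<^sup>2 + ?E \<xi>) + ((H + 1) * (cmod (D R \<xi>))\<^sup>2 + 1 / (H + 1) * (?h \<xi>)\<^sup>2)) \<partial>lborel)"
        by (intro nn_integral_mono ennreal_leI pt)
      also have "\<dots> = ennreal (LINT \<xi>|lborel. ((cmod (?W \<xi>))\<^sup>2 + ?E \<xi>) + ((H + 1) * (cmod (D R \<xi>))\<^sup>2 + 1 / (H + 1) * (?h \<xi>)\<^sup>2))"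
        by (intro nn_integral_eq_integral Bochner_Integration.integrable_add[OF i1 Bochner_Integration.integrable_add[OF i2 i3]] AE_I2 order_trans[OF norm_ge_zero pt])
      also have "(LINT \<xi>|lborel. ((cmod (?W \<xi>))\<^sup>2 + ?E \<xi>) + ((H + 1) * (cmod (D R \<xi>))\<^sup>2 + 1 / (H + 1) * (?h \<xi>)\<^sup>2)) =
          B0 + ((H + 1) * (LINT \<xi>|lborel. (cmod (D R \<xi>))\<^sup>2) + 1 / (H + 1) * H)"
        unfolding Bochner_Integration.integral_add[OF i1 Bochner_Integration.integrable_add[OF i2 i3]]
          Bochner_Integration.integral_add[OF i2 i3] integral_mult_right_zero
        unfolding B0_def H_def ..
      also have "ennreal \<dots> \<le> ennreal (B0 + 2)" using DH HH by (intro ennreal_leI) linarith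
      finally show ?thesis using B0 by (subst (asm) ennreal_le_iff) auto
    qed
    have "\<forall>\<^sub>F R in at_top. (\<integral>\<^sup>+\<xi>. ennreal ((cmod (D R \<xi>))\<^sup>2) \<partial>lborel) < ennreal (1 / (H + 1))"
      using H0 by (intro order_tendstoD(2)[OF lim]) simp
    then have ev: "\<forall>\<^sub>F R in at_top. cmod (?I R) \<le> B0 + 2"
      by eventually_elim (rule IR)
    let ?g = "\<lambda>x. u x * (- \<i> * of_real (Psi e r 1 x))"
    have gi: "integrable lborel (\<lambda>x. M * \<bar>Psi e r 1 x\<bar>)"
      using r by (intro integrable_mult_right integrable_abs Psi_integrable e) auto
    have gb: "norm (?g x) \<le> M * \<bar>Psi e r 1 x\<bar>" for x
      by (simp add: norm_mult mult_right_mono ub)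
    have "(?I \<longlongrightarrow> (LINT x|lborel. ?g x)) at_top"
    proof (rule integral_dominated_convergence_at_top[OF _ _ gi])
      have "((\<lambda>R. indicator (cball 0 R) x *\<^sub>R ?g x) \<longlongrightarrow> ?g x) at_top" for x
      proof (rule tendsto_eventually)
        show "\<forall>\<^sub>F R in at_top. indicator (cball 0 R) x *\<^sub>R ?g x = ?g x"
          using eventually_ge_at_top[of "norm x"] by eventually_elim (simp add: indicator_def)
      qed
      then show "AE x in lborel. ((\<lambda>R. indicator (cball 0 R) x *\<^sub>R ?g x) \<longlongrightarrow> ?g x) at_top" by simp
      have "norm (indicator (cball 0 R) x *\<^sub>R ?g x) \<le> M * \<bar>Psi e r 1 x\<bar>" for R x
      proof -
        have "norm (indicator (cball 0 R) x *\<^sub>R ?g x) \<le> 1 * norm (?g x)"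
          unfolding norm_scaleR by (intro mult_right_mono) (auto simp: indicator_def)
        then show ?thesis using gb[of x] by linarith
      qed
      then show "\<forall>\<^sub>F R in at_top. AE x in lborel. norm (indicator (cball 0 R) x *\<^sub>R ?g x) \<le> M * \<bar>Psi e r 1 x\<bar>" by simp
    qed measurable
    then have "((\<lambda>R. cmod (?I R)) \<longlongrightarrow> cmod (LINT x|lborel. ?g x)) at_top" by (rule tendsto_norm)
    then have "cmod (LINT x|lborel. ?g x) \<le> B0 + 2" by (rule tendsto_upperbound[OF _ ev]) simp
    moreover have "(LINT x|lborel. ?g x) = - \<i> * (LINT x|lborel. u x * of_real (Psi e r 1 x))"
      unfolding integral_mult_right_zero[symmetric] by (simp only: mult_ac)
    ultimately show ?thesis by (simp add: norm_mult)
  qed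
  then show ?thesis by blast
qed

lemma not_well_posed_regular:
  fixes \<alpha> lam s :: real
  assumes al: "0 < \<alpha>" and al2: "\<alpha> < 2" and lam: "lam > 0" and s: "s > 11 / 2"
  shows "\<not> locally_well_posed_small_data TYPE('n::finite) \<alpha> lam s"
proof
  assume "locally_well_posed_small_data TYPE('n) \<alpha> lam s"
  from well_posedD[OF this] obtain \<delta> T where d: "\<delta> > 0" and T: "T > 0"
    and wp: "\<forall>u0 :: (real^'n) \<Rightarrow> complex. u0 \<in> Cc_infty \<longrightarrow> Hs_norm s u0 \<le> \<delta> \<longrightarrow>
      (\<exists>Tmax u. is_solution \<alpha> lam u0 Tmax u \<and> ereal T \<le> Tmax \<and>
        (\<forall>t. 0 \<le> t \<and> t \<le> T \<and> ereal t < Tmax \<longrightarrow> u t \<in> Hs s))"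
    by (elim exE conjE)
  obtain e :: "real^'n" where e: "e \<in> Basis" by (rule that[OF SOME_Basis])
  have s0: "s \<ge> 0" using s by simp
  obtain C where "C \<ge> 0 \<and> (\<forall>A \<mu>. \<mu> \<ge> 1 \<longrightarrow> Hs_norm s (\<lambda>x::real^'n. complex_of_real (A * bump e (\<mu> *\<^sub>R x))) \<le> C * \<bar>A\<bar> * \<mu> powr (s - CARD('n) / 2))"
    using bump_Hs_norm[OF s0, of e] by (rule exE)
  then have C: "C \<ge> 0" "\<And>A. Hs_norm s (\<lambda>x::real^'n. complex_of_real (A * bump e (1 *\<^sub>R x))) \<le> C * \<bar>A\<bar> * 1 powr (s - CARD('n) / 2)"
    by blast+
  define A where "A = \<delta> / (C + 1)"
  have A0: "A > 0" using d C(1) by (simp add: A_def)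
  have CA: "C * A \<le> \<delta>" using d C(1) by (simp add: A_def field_simps)
  define U0 where "U0 x = A * bump e x" for x
  define t where "t = T / 2"
  have t0: "0 < t" and tT: "t < T" using T by (auto simp: t_def)
  have "Hs_norm s (\<lambda>x. complex_of_real (U0 x)) \<le> \<delta>"
    using C(2)[of A] CA A0 by (simp add: U0_def)
  moreover have "(\<lambda>x. complex_of_real (U0 x)) \<in> Cc_infty"
    using bump_Cc_infty[of 1 A e] by (simp add: U0_def)
  ultimately obtain Tmax u where sol: "is_solution \<alpha> lam (\<lambda>x. complex_of_real (U0 x)) Tmax u" and Tm: "ereal T \<le> Tmax"
    and reg: "\<And>t. 0 \<le> t \<Longrightarrow> t \<le> T \<Longrightarrow> ereal t < Tmax \<Longrightarrow> u t \<in> Hs s"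
    using wp by blast
  have tTm: "ereal t < Tmax" using tT Tm by (metis ereal_less_eq(3) less_le_trans less_ereal.simps(1))
  have U0_odd: "U0 (reflect e x) = - U0 x" for x by (simp add: U0_def bump_reflect[OF e])
  have U0_nonneg: "U0 x \<ge> 0" if "x \<bullet> e \<ge> 0" for x
    unfolding U0_def using A0 that by (intro mult_nonneg_nonneg bump_nonneg e) auto
  obtain M where M: "odd_solution \<alpha> lam t M e U0 (\<lambda>s x. indicator {0..t} s * Re (u s x))"
    and ure: "\<And>s x. s \<in> {0..t} \<Longrightarrow> u s x = of_real (Re (u s x))"
    using solution_imp_odd_solution[OF sol t0 tTm al lam e U0_odd U0_nonneg] by blast
  interpret odd_solution \<alpha> lam t M e U0 "\<lambda>s x. indicator {0..t} s * Re (u s x)" by (rule M)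
  have ut: "u t x = of_real (Re (u t x))" for x using ure[of t x] t0 by simp
  have "\<bar>Re (u t x)\<bar> \<le> M" for x using U_bound[of t x] t0 by simp
  then have uM: "cmod (u t x) \<le> M" for x by (subst ut) simp
  obtain B where B: "\<And>r. r > 0 \<Longrightarrow> cmod (LINT x|lborel. u t x * of_real (Psi e r 1 x)) \<le> B"
    using Hs_Psi_pairing_bounded[OF reg[OF less_imp_le[OF t0] less_imp_le[OF tT] tTm] s uM e] by blast
  show False
  proof (rule Psi_pairing_unbounded)
    show "U0 y > 0" if y: "y \<in> box 0 One" for y
    proof -
      have "0 < y \<bullet> b \<and> \<bar>y \<bullet> b\<bar> < 1" if "b \<in> Basis" for b using y that by (auto simp: mem_box)
      then show ?thesis unfolding U0_def using A0 e by (intro mult_pos_pos bump_pos) auto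
    qed
    show "\<bar>LINT y|lborel. Psi e \<epsilon> 1 y * (indicator {0..t} t * Re (u t y))\<bar> \<le> B" if "0 < \<epsilon>" for \<epsilon>
    proof -
      have "(LINT x|lborel. u t x * of_real (Psi e \<epsilon> 1 x)) = (LINT x|lborel. complex_of_real (Psi e \<epsilon> 1 x * (indicator {0..t} t * Re (u t x))))"
        using t0 by (intro Bochner_Integration.integral_cong refl, subst ut) simp
      also have "\<dots> = complex_of_real (LINT x|lborel. Psi e \<epsilon> 1 x * (indicator {0..t} t * Re (u t x)))"
        by (rule integral_complex_of_real)
      finally show ?thesis using B[OF that] by (simp only: norm_of_real)
    qed
  qed (rule al2)
qed

theorem theorem1p10:
  fixes \<alpha> lam s :: real
  assumes "0 < \<alpha>" and "\<alpha> < 2" and "lam > 0"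
    and "real CARD('n::finite) > 11 + 4 / \<alpha>"
    and "s \<ge> 0"
  shows "\<not> locally_well_posed_small_data TYPE('n) \<alpha> lam s"
proof (cases "s > 11 / 2")
  case True
  then show ?thesis using assms by (intro not_well_posed_regular)
next
  case False
  then have "s < real CARD('n) / 2 - 2 / \<alpha>" using assms(4) by simp
  then show ?thesis using assms by (intro not_well_posed_supercritical)
qed

end
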